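(* Let $G$ be a finitely generated group. Then $\mathrm{WP}_G\in \mathrm{DTIME}_1(n\log n)$ if and only if $G$ is virtually nilpotent.
   Context: For a finitely generated group $G$ and a finite generating set $S$ closed under inversion, the word problem is the language $\mathrm{WP}(G,S)=\{w\in S^{*}: w=_G e\}$ over the alphabet $S$, where $e$ is the identity of $G$. $\mathrm{DTIME}_1(t(n))$ denotes the class of languages decided in time $O(t(n))$ by a deterministic Turing machine with a single tape (which initially holds the input); $\mathrm{DTIME}_*(t(n))$ the class of languages decided in time $O(t(n))$ by a deterministic multi-tape Turing machine. Writing $\mathrm{WP}_G\in C$ means $\mathrm{WP}(G,S)\in C$ for a (equivalently, for every) finite symmetric generating set $S$; for the classes here this is independent of $S$. *)

theory Defs
  imports "HOL-Algebra.Algebra" Complex_Main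
begin

definition fin_gen_group :: "('g, 'b) monoid_scheme \<Rightarrow> bool" where
  "fin_gen_group G \<longleftrightarrow> group G \<and>
     (\<exists>S. finite S \<and> S \<subseteq> carrier G \<and> generate G S = carrier G)"

definition sym_gen_set :: "('g, 'b) monoid_scheme \<Rightarrow> 'g set \<Rightarrow> bool" where
  "sym_gen_set G S \<longleftrightarrow> finite S \<and> S \<subseteq> carrier G \<and> generate G S = carrier G
     \<and> (\<forall>s\<in>S. inv\<^bsub>G\<^esub> s \<in> S)"

definition eval_word :: "('g, 'b) monoid_scheme \<Rightarrow> 'g list \<Rightarrow> 'g" where
  "eval_word G w = foldr (\<lambda>x y. x \<otimes>\<^bsub>G\<^esub> y) w \<one>\<^bsub>G\<^esub>"

definition word_problem :: "('g, 'b) monoid_scheme \<Rightarrow> 'g set \<Rightarrow> 'g list set" where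
  "word_problem G S = {w \<in> lists S. eval_word G w = \<one>\<^bsub>G\<^esub>}"

definition comm_subgroup :: "('g, 'b) monoid_scheme \<Rightarrow> 'g set \<Rightarrow> 'g set \<Rightarrow> 'g set" where
  "comm_subgroup G A B = generate G
     {a \<otimes>\<^bsub>G\<^esub> b \<otimes>\<^bsub>G\<^esub> inv\<^bsub>G\<^esub> a \<otimes>\<^bsub>G\<^esub> inv\<^bsub>G\<^esub> b | a b. a \<in> A \<and> b \<in> B}"

fun lower_central :: "('g, 'b) monoid_scheme \<Rightarrow> nat \<Rightarrow> 'g set" where
  "lower_central G 0 = carrier G"
| "lower_central G (Suc n) = comm_subgroup G (lower_central G n) (carrier G)"

definition nilpotent_group :: "('g, 'b) monoid_scheme \<Rightarrow> bool" where
  "nilpotent_group G \<longleftrightarrow> group G \<and> (\<exists>n. lower_central G n = {\<one>\<^bsub>G\<^esub>})"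

definition virtually_nilpotent :: "('g, 'b) monoid_scheme \<Rightarrow> bool" where
  "virtually_nilpotent G \<longleftrightarrow> group G \<and>
     (\<exists>H. subgroup H G \<and> finite (rcosets\<^bsub>G\<^esub> H) \<and> nilpotent_group (G\<lparr>carrier := H\<rparr>))"

datatype 'a cell = Blank | Inp 'a | Aux nat

datatype dir = MoveL | MoveR | Stay

text \<open>States are 0..<nstates, start state 0; auxiliary symbols are Aux k with k < naux.\<close>
record 'a tm =
  nstates :: nat
  naux :: nat
  delta :: "nat \<Rightarrow> 'a cell \<Rightarrow> nat \<times> 'a cell \<times> dir"
  q_acc :: nat
  q_rej :: nat

definition valid_cell :: "'a set \<Rightarrow> 'a tm \<Rightarrow> 'a cell \<Rightarrow> bool" where
  "valid_cell \<Sigma> M c \<longleftrightarrow> c = Blank \<or> (\<exists>a\<in>\<Sigma>. c = Inp a) \<or> (\<exists>k<naux M. c = Aux k)"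

definition wf_tm :: "'a set \<Rightarrow> 'a tm \<Rightarrow> bool" where
  "wf_tm \<Sigma> M \<longleftrightarrow> finite \<Sigma> \<and> q_acc M < nstates M \<and> q_rej M < nstates M \<and> q_acc M \<noteq> q_rej M
     \<and> (\<forall>q<nstates M. \<forall>c. valid_cell \<Sigma> M c \<longrightarrow>
          (case delta M q c of (q', c', d) \<Rightarrow> q' < nstates M \<and> valid_cell \<Sigma> M c'))"

type_synonym 'a config = "nat \<times> (int \<Rightarrow> 'a cell) \<times> int"

definition init_config :: "'a list \<Rightarrow> 'a config" where
  "init_config w = (0, (\<lambda>i. if 0 \<le> i \<and> i < int (length w) then Inp (w ! nat i) else Blank), 0)"

definition shift :: "dir \<Rightarrow> int" where
  "shift d = (case d of MoveL \<Rightarrow> -1 | MoveR \<Rightarrow> 1 | Stay \<Rightarrow> 0)"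

definition halted :: "'a tm \<Rightarrow> 'a config \<Rightarrow> bool" where
  "halted M cf \<longleftrightarrow> fst cf = q_acc M \<or> fst cf = q_rej M"

definition tm_step :: "'a tm \<Rightarrow> 'a config \<Rightarrow> 'a config" where
  "tm_step M cf = (case cf of (q, tp, h) \<Rightarrow>
     if halted M cf then cf
     else (case delta M q (tp h) of (q', c, d) \<Rightarrow> (q', tp(h := c), h + shift d)))"

definition run :: "'a tm \<Rightarrow> nat \<Rightarrow> 'a list \<Rightarrow> 'a config" where
  "run M t w = (tm_step M ^^ t) (init_config w)"

definition decides_in_time :: "'a set \<Rightarrow> 'a tm \<Rightarrow> 'a list set \<Rightarrow> (nat \<Rightarrow> real) \<Rightarrow> bool" where
  "decides_in_time \<Sigma> M L T \<longleftrightarrow> (\<forall>w\<in>lists \<Sigma>. \<exists>t. real t \<le> T (length w) \<and>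
      halted M (run M t w) \<and> (fst (run M t w) = q_acc M \<longleftrightarrow> w \<in> L))"

definition DTIME1 :: "'a set \<Rightarrow> (nat \<Rightarrow> real) \<Rightarrow> 'a list set set" where
  "DTIME1 \<Sigma> T = {L. L \<subseteq> lists \<Sigma> \<and>
     (\<exists>M c. wf_tm \<Sigma> M \<and> decides_in_time \<Sigma> M L (\<lambda>n. c * T n + c))}"

definition nlogn :: "nat \<Rightarrow> real" where
  "nlogn n = real n * log 2 (real n)"

definition WP_in_DTIME1 :: "('g, 'b) monoid_scheme \<Rightarrow> (nat \<Rightarrow> real) \<Rightarrow> bool" where
  "WP_in_DTIME1 G T \<longleftrightarrow> (\<exists>S. sym_gen_set G S \<and> word_problem G S \<in> DTIME1 S T)"

end

theory Submission
  imports Defs "HOL-Analysis.Analysis"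
begin

text \<open>
Suppose the word problem is decided in time \<open>O(n log n)\<close>. Choose for every \<open>g\<close> in the ball of radius \<open>n\<close> a word
\<open>w g\<close> and run the machine on \<open>w g\<close>, a trivial padding \<open>(s s\<inverse>)\<close> repeated \<open>n\<close> times, and \<open>(w g)\<inverse>\<close>. At some
boundary inside the padding the crossing sequence has length \<open>O(log n)\<close>. Two elements with the same boundary and
crossing sequence are equal, since the runs can be spliced; so the group has polynomial growth, and Gromov's
theorem applies. Its proof follows Kleiner, Shalom and Tao: the lazy random walk yields a nonconstant Lipschitz
harmonic function; bounded systems of such functions are finite by the Poincare and Caccioppoli inequalities; in the
resulting bounded isometric action commutators of near-identity elements contract, which together with
polynomial growth forces them to be nilpotent. What remains is an infinite cyclic quotient of a subgroup of finite
index, whose kernel is finitely generated (Milnor) and has growth of smaller degree.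

Conversely, a finitely generated nilpotent group has a subgroup of finite index whose elements are separated by
finitely many integer-valued polynomials. The values of their iterated differences along the prefixes of a word grow
polynomially and change by a fixed affine map at each letter, so a machine can drag these \<open>O(log n)\<close> digits
along with its head.
\<close>

section \<open>Subgroups, generation and finite index\<close>

text \<open>After Milnor's step one obstacle remains: an extension of a virtually nilpotent group by
  an infinite cyclic one need not be virtually nilpotent, so growth has to be used once more.
  Eigenvalues of the action are not studied. Instead the extension acts on a kernel separated by
  polynomials, and the elements acting trivially on polynomials of bounded degree modulo powers of a
  prime \<open>p\<close> form a congruence filtration, that is, a p-adic norm. Commutators contract
  for this norm just as they do for the displacement of Lipschitz harmonic functions, so the
  counting lemma \<open>left_normed_null\<close> serves both the archimedean and the p-adic setting.
  Separating polynomials therefore enter twice, in Gromov's theorem and in the Turing machine.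
  Vector spaces are avoided: linear independence becomes a system of functions dual to a system of
  points, and the dimension bound becomes an entropy count of integer combinations of such
  functions. With respect to a maximal dual system group elements have bounded matrices, and
  rounding these matrices yields finitely many cosets.\<close>

text \<open>All group theory is done with subsets of a type-class group; a group with a carrier enters through
  its Cayley embedding into the type of permutations.\<close>

class grp = monoid_mult + inverse +
  assumes grp_left_inv: "inverse a * a = 1"
    and grp_divide: "a / b = a * inverse b"

lemma grp_left_cancel: "(a::'a::grp) * b = a * c \<longleftrightarrow> b = c"
proof
  assume "a * b = a * c"
  hence "inverse a * a * b = inverse a * a * c" by (simp add: mult.assoc)
  thus "b = c" by (simp add: grp_left_inv)
qed simp

lemma grp_right_inv: "(a::'a::grp) * inverse a = 1"
proof -
  have "inverse a * (a * inverse a) = inverse a * 1"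
    by (simp add: mult.assoc [symmetric] grp_left_inv)
  thus ?thesis by (simp only: grp_left_cancel)
qed

lemma grp_right_cancel: "(b::'a::grp) * a = c * a \<longleftrightarrow> b = c"
proof
  assume "b * a = c * a"
  hence "b * a * inverse a = c * a * inverse a" by simp
  thus "b = c" by (simp add: mult.assoc grp_right_inv)
qed simp

lemma grp_inv_unique: "(a::'a::grp) * b = 1 \<Longrightarrow> inverse a = b"
  by (metis grp_left_cancel grp_right_inv)

lemma grp_inv_inv: "inverse (inverse (a::'a::grp)) = a"
  by (simp add: grp_inv_unique grp_left_inv)

lemma grp_inv_one: "inverse (1::'a::grp) = 1"
  by (simp add: grp_inv_unique)

lemma grp_inv_left: "inverse (a::'a::grp) * (a * b) = b"
  by (simp add: mult.assoc [symmetric] grp_left_inv)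

lemma grp_inv_right: "(a::'a::grp) * (inverse a * b) = b"
  by (simp add: mult.assoc [symmetric] grp_right_inv)

lemma grp_inv_mult: "inverse ((a::'a::grp) * b) = inverse b * inverse a"
  by (rule grp_inv_unique) (simp add: mult.assoc grp_inv_right grp_right_inv)

lemmas grp_simps = mult.assoc grp_left_inv grp_right_inv grp_inv_inv grp_inv_one
  grp_inv_left grp_inv_right grp_inv_mult grp_left_cancel grp_right_cancel

lemma grp_eq_iff: "(x::'a::grp) = y \<longleftrightarrow> x * inverse y = 1"
  by (metis grp_right_cancel grp_right_inv)

section \<open>Subgroups and the words that generate them\<close>

definition subgrp :: "'a::grp set \<Rightarrow> bool" where
  "subgrp H \<longleftrightarrow> 1 \<in> H \<and> (\<forall>x\<in>H. \<forall>y\<in>H. x * y \<in> H) \<and> (\<forall>x\<in>H. inverse x \<in> H)"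

lemma subgrpI:
  "1 \<in> H \<Longrightarrow> (\<And>x y. x \<in> H \<Longrightarrow> y \<in> H \<Longrightarrow> x * y \<in> H) \<Longrightarrow> (\<And>x. x \<in> H \<Longrightarrow> inverse x \<in> H) \<Longrightarrow> subgrp H"
  by (simp add: subgrp_def)

lemma subgrp_one: "subgrp H \<Longrightarrow> 1 \<in> H"
  and subgrp_mult: "subgrp H \<Longrightarrow> x \<in> H \<Longrightarrow> y \<in> H \<Longrightarrow> x * y \<in> H"
  and subgrp_inv: "subgrp H \<Longrightarrow> x \<in> H \<Longrightarrow> inverse x \<in> H"
  by (auto simp: subgrp_def)

lemmas subgrp_mem = subgrp_one subgrp_mult subgrp_inv

lemma subgrp_Inter: "(\<And>A. A \<in> \<A> \<Longrightarrow> subgrp A) \<Longrightarrow> subgrp (\<Inter>\<A>)"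
  by (auto simp: subgrp_def)

lemma subgrp_Int: "subgrp A \<Longrightarrow> subgrp B \<Longrightarrow> subgrp (A \<inter> B)"
  by (auto simp: subgrp_def)

lemma subgrp_prod_list: "subgrp H \<Longrightarrow> w \<in> lists H \<Longrightarrow> prod_list w \<in> H"
  by (induction w) (auto simp: subgrp_mem)

lemma subgrp_power: "subgrp H \<Longrightarrow> x \<in> H \<Longrightarrow> x ^ n \<in> H"
  by (induction n) (auto simp: subgrp_mem)

definition gen :: "'a::grp set \<Rightarrow> 'a set" where
  "gen S = \<Inter>{H. subgrp H \<and> S \<subseteq> H}"

lemma subgrp_gen: "subgrp (gen S)"
  unfolding gen_def by (rule subgrp_Inter) auto

lemma gen_superset: "S \<subseteq> gen S"
  by (auto simp: gen_def)

lemma gen_least: "subgrp H \<Longrightarrow> S \<subseteq> H \<Longrightarrow> gen S \<subseteq> H"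
  by (auto simp: gen_def)

lemma gen_mono: "S \<subseteq> T \<Longrightarrow> gen S \<subseteq> gen T"
  by (meson gen_least gen_superset order_trans subgrp_gen)

lemma gen_subgrp: "subgrp H \<Longrightarrow> gen H = H"
  by (simp add: gen_least gen_superset subset_antisym)

definition sym_set :: "'a::grp set \<Rightarrow> bool" where
  "sym_set S \<longleftrightarrow> (\<forall>s\<in>S. inverse s \<in> S)"

lemma sym_set_Un: "sym_set A \<Longrightarrow> sym_set B \<Longrightarrow> sym_set (A \<union> B)"
  by (auto simp: sym_set_def)

lemma sym_set_closure: "sym_set (S \<union> inverse ` S)"
  by (auto simp: sym_set_def grp_inv_inv)

lemma gen_words:
  assumes "sym_set S"
  shows "gen S = prod_list ` lists S"
proof
  have inv: "inverse (prod_list w) \<in> prod_list ` lists S" if "w \<in> lists S" for w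
    using that
  proof (induction w)
    case Nil
    show ?case by (rule image_eqI[of _ _ "[]"]) (auto simp: grp_inv_one)
  next
    case (Cons s w)
    then obtain v where v: "v \<in> lists S" "inverse (prod_list w) = prod_list v" by auto
    have "inverse (prod_list (s # w)) = prod_list (v @ [inverse s])"
      using v by (simp add: grp_inv_mult)
    moreover have "v @ [inverse s] \<in> lists S"
      using v assms Cons.hyps by (simp add: sym_set_def)
    ultimately show ?case by (metis image_eqI)
  qed
  have "subgrp (prod_list ` lists S)"
  proof (rule subgrpI)
    show "1 \<in> prod_list ` lists S" by (rule image_eqI[of _ _ "[]"]) auto
    show "x * y \<in> prod_list ` lists S" if "x \<in> prod_list ` lists S" "y \<in> prod_list ` lists S" for x y
    proof -
      obtain u v where "u \<in> lists S" "x = prod_list u" "v \<in> lists S" "y = prod_list v" using \<open>x \<in> _\<close> \<open>y \<in> _\<close> by auto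
      hence "x * y = prod_list (u @ v)" "u @ v \<in> lists S" by auto
      thus ?thesis by blast
    qed
    show "inverse x \<in> prod_list ` lists S" if "x \<in> prod_list ` lists S" for x
      using that inv by auto
  qed
  moreover have "S \<subseteq> prod_list ` lists S"
  proof
    fix s assume "s \<in> S"
    thus "s \<in> prod_list ` lists S" by (intro image_eqI[of _ _ "[s]"]) auto
  qed
  ultimately show "gen S \<subseteq> prod_list ` lists S" by (rule gen_least)
  show "prod_list ` lists S \<subseteq> gen S"
    using subgrp_prod_list[OF subgrp_gen] lists_mono[OF gen_superset, of S] by blast
qed

definition fin_gen :: "'a::grp set \<Rightarrow> bool" where
  "fin_gen H \<longleftrightarrow> (\<exists>S. finite S \<and> S \<subseteq> H \<and> gen S = H)"

lemma fin_gen_subgrp: "fin_gen H \<Longrightarrow> subgrp H"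
  using subgrp_gen by (auto simp: fin_gen_def)

lemma fin_gen_sym:
  assumes "fin_gen H"
  obtains S where "finite S" "S \<subseteq> H" "gen S = H" "sym_set S" "1 \<in> S"
proof -
  obtain S where S: "finite S" "S \<subseteq> H" "gen S = H" using assms by (auto simp: fin_gen_def)
  let ?T = "(S \<union> inverse ` S) \<union> {1}"
  have H: "subgrp H" using assms by (rule fin_gen_subgrp)
  have T: "?T \<subseteq> H" using S H by (auto simp: subgrp_mem)
  have "gen ?T = H"
    using gen_least[OF H T] gen_mono[of S ?T] S by auto
  moreover have "sym_set ?T"
    by (intro sym_set_Un sym_set_closure) (simp add: sym_set_def grp_inv_one)
  ultimately show ?thesis using T S that[of ?T] by auto
qed

section \<open>Subgroups of finite index\<close>

definition fin_index :: "'a::grp set \<Rightarrow> 'a set \<Rightarrow> bool" where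
  "fin_index A H \<longleftrightarrow> A \<subseteq> H \<and> (\<exists>F. finite F \<and> F \<subseteq> H \<and> (\<forall>h\<in>H. \<exists>a\<in>A. \<exists>x\<in>F. h = a * x))"

lemma fin_index_subset: "fin_index A H \<Longrightarrow> A \<subseteq> H"
  by (simp add: fin_index_def)

lemma fin_index_refl: "subgrp H \<Longrightarrow> fin_index H H"
  unfolding fin_index_def by (intro conjI exI[of _ "{1}"]) (auto simp: subgrp_mem)

lemma fin_index_trans:
  assumes "fin_index A B" "fin_index B C" "subgrp C"
  shows "fin_index A C"
proof -
  obtain F where F: "finite F" "F \<subseteq> B" "\<And>h. h \<in> B \<Longrightarrow> \<exists>a\<in>A. \<exists>x\<in>F. h = a * x"
    using assms(1) unfolding fin_index_def by blast
  obtain E where E: "finite E" "E \<subseteq> C" "\<And>h. h \<in> C \<Longrightarrow> \<exists>a\<in>B. \<exists>x\<in>E. h = a * x"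
    using assms(2) unfolding fin_index_def by blast
  have "\<exists>a\<in>A. \<exists>x\<in>(\<lambda>(x,y). x * y) ` (F \<times> E). h = a * x" if "h \<in> C" for h
  proof -
    obtain b y where "b \<in> B" "y \<in> E" "h = b * y" using E(3)[OF \<open>h \<in> C\<close>] by blast
    moreover obtain a x where "a \<in> A" "x \<in> F" "b = a * x" using F(3)[OF \<open>b \<in> B\<close>] by blast
    ultimately have "h = a * (x * y)" "x * y \<in> (\<lambda>(x,y). x * y) ` (F \<times> E)" by (auto simp: mult.assoc)
    thus ?thesis using \<open>a \<in> A\<close> by blast
  qed
  moreover have "finite ((\<lambda>(x,y). x * y) ` (F \<times> E))" using F E by auto
  moreover have "(\<lambda>(x,y). x * y) ` (F \<times> E) \<subseteq> C"
    using F E assms by (auto simp: fin_index_def intro!: subgrp_mult[OF assms(3)])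
  moreover have "A \<subseteq> C" using assms by (auto simp: fin_index_def)
  ultimately show ?thesis unfolding fin_index_def by blast
qed

text \<open>One representative per colour serves as the finite set of translates. Later applications
  colour by rounded matrices for the action on harmonic functions and by the action on polynomials
  modulo a prime for the congruence subgroups.\<close>

lemma fin_index_colouring:
  assumes "finite (c ` H)" "A \<subseteq> H" "\<And>x y. x \<in> H \<Longrightarrow> y \<in> H \<Longrightarrow> c x = c y \<Longrightarrow> x * inverse y \<in> A"
  shows "fin_index A H"
proof -
  define r where "r = (\<lambda>v. SOME y. y \<in> H \<and> c y = v)"
  have r: "r (c h) \<in> H \<and> c (r (c h)) = c h" if "h \<in> H" for h
    unfolding r_def by (rule someI[of _ h]) (simp add: that)
  have "\<exists>a\<in>A. \<exists>x\<in>r ` c ` H. h = a * x" if "h \<in> H" for h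
  proof (intro bexI)
    show "h = h * inverse (r (c h)) * r (c h)" by (simp add: grp_simps)
    show "h * inverse (r (c h)) \<in> A" using assms(3)[of h "r (c h)"] r[OF that] that by auto
    show "r (c h) \<in> r ` c ` H" using that by auto
  qed
  moreover have "r ` c ` H \<subseteq> H" using r by auto
  ultimately show ?thesis using assms unfolding fin_index_def by blast
qed

lemma fin_index_obtain_colouring:
  assumes "fin_index A H" "subgrp A"
  shows "\<exists>c :: 'a::grp \<Rightarrow> 'a. finite (c ` H) \<and> (\<forall>x\<in>H. \<forall>y\<in>H. c x = c y \<longrightarrow> x * inverse y \<in> A)"
proof -
  obtain F where F: "finite F" "\<And>h. h \<in> H \<Longrightarrow> \<exists>x. x \<in> F \<and> (\<exists>a\<in>A. h = a * x)"
    using assms(1) unfolding fin_index_def by (meson)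
  then obtain c where c: "\<And>h. h \<in> H \<Longrightarrow> c h \<in> F \<and> (\<exists>a\<in>A. h = a * c h)"
    by metis
  show ?thesis
  proof (intro exI[of _ c] conjI ballI impI)
    show "finite (c ` H)" using c by (intro finite_subset[OF _ F(1)]) auto
    show "x * inverse y \<in> A" if xy: "x \<in> H" "y \<in> H" "c x = c y" for x y
    proof -
      obtain a b where "a \<in> A" "x = a * c x" "b \<in> A" "y = b * c y" using c xy by blast
      hence "x * inverse y = a * inverse b" using xy by (metis grp_inv_mult grp_inv_right mult.assoc)
      thus ?thesis using \<open>a \<in> A\<close> \<open>b \<in> A\<close> assms by (simp add: subgrp_mem)
    qed
  qed
qed

lemma fin_index_Int:
  assumes "fin_index (A :: 'a::grp set) H" "subgrp A" "B \<subseteq> H" "subgrp B"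
  shows "fin_index (A \<inter> B) B"
proof -
  obtain c :: "'a \<Rightarrow> 'a" where c: "finite (c ` H)" "\<And>x y. x \<in> H \<Longrightarrow> y \<in> H \<Longrightarrow> c x = c y \<Longrightarrow> x * inverse y \<in> A"
    using fin_index_obtain_colouring[OF assms(1,2)] by blast
  show ?thesis
  proof (rule fin_index_colouring[of c])
    show "finite (c ` B)" using c(1) assms(3) by (meson finite_subset image_mono)
    show "x * inverse y \<in> A \<inter> B" if "x \<in> B" "y \<in> B" "c x = c y" for x y
      using that c(2)[of x y] assms by (auto simp: subgrp_mem)
  qed auto
qed

lemma fin_index_INT:
  assumes "finite \<A>" "\<And>A. A \<in> \<A> \<Longrightarrow> subgrp A \<and> fin_index A H" "subgrp H"
  shows "fin_index (H \<inter> \<Inter>\<A>) H"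
  using assms(1,2)
proof (induction)
  case empty
  thus ?case using fin_index_refl[OF assms(3)] by simp
next
  case (insert A \<A>)
  have sub: "subgrp (H \<inter> \<Inter>\<A>)" using insert assms(3) by (intro subgrp_Int subgrp_Inter) auto
  have "fin_index (A \<inter> (H \<inter> \<Inter>\<A>)) (H \<inter> \<Inter>\<A>)"
    using insert sub by (intro fin_index_Int[of A H]) auto
  hence "fin_index (A \<inter> (H \<inter> \<Inter>\<A>)) H" by (rule fin_index_trans) (use insert assms in auto)
  thus ?case by (simp add: Int_left_commute Int_assoc)
qed

lemma fin_index_finite: "finite H \<Longrightarrow> subgrp H \<Longrightarrow> fin_index {1} H"
  unfolding fin_index_def by (auto simp: subgrp_mem)

text \<open>Schreier's lemma. Reading a word from left to right, the prefix is kept in the form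
  \<open>t * f\<close> with \<open>f\<close> in the finite set of representatives; each letter
  contributes one factor \<open>f * s * inverse f'\<close> that lies in \<open>A\<close>.\<close>

lemma fin_gen_fin_index:
  assumes "fin_gen H" "fin_index A H" "subgrp A"
  shows "fin_gen A"
proof -
  obtain S where S: "finite S" "S \<subseteq> H" "gen S = H" "sym_set S" "1 \<in> S"
    using fin_gen_sym[OF assms(1)] .
  have H: "subgrp H" using assms(1) by (rule fin_gen_subgrp)
  obtain F0 where F0: "finite F0" "F0 \<subseteq> H" "\<And>h. h \<in> H \<Longrightarrow> \<exists>a\<in>A. \<exists>x\<in>F0. h = a * x"
    using assms(2) unfolding fin_index_def by blast
  define F where "F = insert 1 F0"
  have F: "finite F" "F \<subseteq> H" "1 \<in> F" "\<And>h. h \<in> H \<Longrightarrow> \<exists>a\<in>A. \<exists>x\<in>F. h = a * x"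
    using F0 subgrp_one[OF H] by (simp_all add: F_def) blast
  \<comment> \<open>\<open>F\<close> is added because the representative left over at the end of a
    word for an element of \<open>A\<close> lies in \<open>A\<close> without having to be 1.\<close>
  define T where "T = A \<inter> ((\<lambda>(f,s,f'). f * s * inverse f') ` (F \<times> S \<times> F) \<union> F)"
  have AH: "A \<subseteq> H" using assms(2) by (rule fin_index_subset)
  have T: "finite T" "T \<subseteq> A" using F S by (auto simp: T_def)
  have gT: "gen T \<subseteq> A" using gen_least[OF assms(3) T(2)] .
  have key: "w \<in> lists S \<Longrightarrow> \<exists>t\<in>gen T. \<exists>f\<in>F. prod_list w = t * f" for w
  proof (induction w rule: rev_induct)
    case Nil
    show ?case using F(3) subgrp_one[OF subgrp_gen] by force
  next
    case (snoc s w)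
    then obtain t f where tf: "t \<in> gen T" "f \<in> F" "prod_list w = t * f" and s: "s \<in> S" by auto
    have "f * s \<in> H" using tf F S s H by (auto intro: subgrp_mult)
    then obtain a f' where a: "a \<in> A" "f' \<in> F" "f * s = a * f'" using F(4) by blast
    hence "a = f * s * inverse f'" by (simp add: grp_simps)
    hence "a \<in> T" using a tf s unfolding T_def by force
    hence "t * a \<in> gen T" using tf gen_superset[of T] subgrp_mult[OF subgrp_gen] by blast
    moreover have "prod_list (w @ [s]) = (t * a) * f'" using tf a by (simp add: mult.assoc)
    ultimately show ?case using a by blast
  qed
  have "A \<subseteq> gen T"
  proof
    fix x assume x: "x \<in> A"
    hence "x \<in> gen S" using S AH by auto
    then obtain w where "w \<in> lists S" "x = prod_list w" using gen_words[OF S(4)] by auto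
    then obtain t f where tf: "t \<in> gen T" "f \<in> F" "x = t * f" using key by blast
    hence f: "f = inverse t * x" by (simp add: grp_simps)
    have "f \<in> A" unfolding f using tf(1) x gT assms(3) by (blast intro: subgrp_mult subgrp_inv)
    hence "f \<in> T" using tf by (auto simp: T_def)
    thus "x \<in> gen T" using tf gen_superset[of T] subgrp_mult[OF subgrp_gen] by blast
  qed
  thus ?thesis using T gT unfolding fin_gen_def by blast
qed

text \<open>A subgroup with at most \<open>n\<close> cosets is determined by the action of the generators on the cosets.\<close>

lemma finite_subgrps_of_bounded_index:
  assumes "fin_gen (H :: 'a::grp set)"
  shows "finite {A. subgrp A \<and> A \<subseteq> H \<and> (\<exists>F. finite F \<and> F \<subseteq> H \<and> card F \<le> n \<and> (\<forall>h\<in>H. \<exists>a\<in>A. \<exists>x\<in>F. h = a * x))}"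
    (is "finite ?Y")
proof -
  obtain S where S: "finite S" "S \<subseteq> H" "gen S = H" "sym_set S" "1 \<in> S"
    using fin_gen_sym[OF assms] .
  have H: "subgrp H" using assms by (rule fin_gen_subgrp)
  \<comment> \<open>A subgroup is decoded from a transition table \<open>d\<close> on coset numbers
    and the number \<open>q\<close> of the coset of 1: it consists of the values of the words
    leading from \<open>q\<close> back to \<open>q\<close>.\<close>
  define D where "D = (\<lambda>(d :: nat \<times> 'a \<Rightarrow> nat, q). {prod_list w | w. w \<in> lists S \<and> foldl (\<lambda>q s. d (q, s)) q w = q})"
  define P where "P = PiE ({..<n} \<times> S) (\<lambda>_. {..<n}) \<times> {..<n}"
  have "?Y \<subseteq> D ` P"
  proof
    fix A assume "A \<in> ?Y"
    then obtain F where A: "subgrp A" "A \<subseteq> H" and F: "finite F" "F \<subseteq> H" "card F \<le> n"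
      "\<And>h. h \<in> H \<Longrightarrow> \<exists>a\<in>A. \<exists>x\<in>F. h = a * x" by auto
    obtain e where e: "inj_on e F" "e ` F \<subseteq> {..<n}"
      by (metis F(1,3) atLeast0LessThan card_lessThan finite_lessThan inj_on_iff_card_le)
    define cos where "cos = (\<lambda>h. (\<lambda>a. a * h) ` A)"
    have cosmem: "cos x = cos y \<longleftrightarrow> x * inverse y \<in> A" for x y
    proof
      assume "cos x = cos y"
      moreover have "x \<in> cos x" using subgrp_one[OF A(1)] unfolding cos_def by force
      ultimately obtain a where "a \<in> A" "x = a * y" by (auto simp: cos_def)
      thus "x * inverse y \<in> A" by (simp add: grp_simps)
    next
      assume *: "x * inverse y \<in> A"
      hence **: "y * inverse x \<in> A" using subgrp_inv[OF A(1), of "x * inverse y"] by (simp add: grp_simps)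
      have "a * x \<in> cos y" if "a \<in> A" for a
        unfolding cos_def using subgrp_mult[OF A(1) that *] by (intro image_eqI[of _ _ "a * (x * inverse y)"]) (auto simp: grp_simps)
      moreover have "a * y \<in> cos x" if "a \<in> A" for a
        unfolding cos_def using subgrp_mult[OF A(1) that **] by (intro image_eqI[of _ _ "a * (y * inverse x)"]) (auto simp: grp_simps)
      ultimately show "cos x = cos y" by (auto simp: cos_def)
    qed
    define r where "r = (\<lambda>C. SOME x. x \<in> F \<and> cos x = C)"
    have r: "r (cos h) \<in> F \<and> cos (r (cos h)) = cos h" if "h \<in> H" for h
    proof -
      obtain a x where "a \<in> A" "x \<in> F" "h = a * x" using F(4)[OF \<open>h \<in> H\<close>] by blast
      hence "x \<in> F \<and> cos x = cos h" using cosmem[of h x] by (auto simp: grp_simps)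
      thus ?thesis unfolding r_def by (rule someI)
    qed
    define c where "c = (\<lambda>h. e (r (cos h)))"
    have c: "c x = c y \<longleftrightarrow> x * inverse y \<in> A" if "x \<in> H" "y \<in> H" for x y
      using r[OF that(1)] r[OF that(2)] inj_onD[OF e(1)] cosmem unfolding c_def by metis
    have cn: "c h \<in> {..<n}" if "h \<in> H" for h using r[OF that] e(2) by (auto simp: c_def)
    \<comment> \<open>The second disjunct lets the choice land in \<open>H\<close> even at a number
      that belongs to no coset, so the table stays within \<open>{..<n}\<close> everywhere.\<close>
    define d where "d = restrict (\<lambda>(q,s). c ((SOME h. h \<in> H \<and> (c h = q \<or> (\<forall>g\<in>H. c g \<noteq> q))) * s)) ({..<n} \<times> S)"
    have dn: "d \<in> PiE ({..<n} \<times> S) (\<lambda>_. {..<n})"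
    proof -
      have "(SOME h. h \<in> H \<and> (c h = q \<or> (\<forall>g\<in>H. c g \<noteq> q))) \<in> H" for q
        by (rule someI2_ex) (use subgrp_one[OF H] in auto)
      thus ?thesis unfolding d_def using S(2) cn subgrp_mult[OF H] by (auto simp: subset_iff)
    qed
    have dstep: "d (c h, s) = c (h * s)" if "h \<in> H" "s \<in> S" for h s
    proof -
      define g where "g = (SOME g. g \<in> H \<and> (c g = c h \<or> (\<forall>k\<in>H. c k \<noteq> c h)))"
      have "g \<in> H \<and> (c g = c h \<or> (\<forall>k\<in>H. c k \<noteq> c h))"
        unfolding g_def by (rule someI[of _ h]) (simp add: that)
      hence g: "g \<in> H" "c g = c h" using that by auto
      have "d (c h, s) = c (g * s)" using that cn[of h] by (simp add: d_def g_def)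
      also have "\<dots> = c (h * s)" using c[of g h] c[of "g * s" "h * s"] g that S(2) subgrp_mult[OF H]
        by (auto simp: grp_simps)
      finally show ?thesis .
    qed
    have fold: "w \<in> lists S \<Longrightarrow> foldl (\<lambda>q s. d (q, s)) (c 1) w = c (prod_list w)" for w
    proof (induction w rule: rev_induct)
      case (snoc s w)
      have "prod_list w \<in> H" using snoc S(2) subgrp_prod_list[OF H, of w] by auto
      thus ?case using snoc dstep by simp
    qed simp
    have "D (d, c 1) = A"
    proof (intro subset_antisym subsetI)
      fix x assume "x \<in> D (d, c 1)"
      then obtain w where w: "w \<in> lists S" "x = prod_list w" "foldl (\<lambda>q s. d (q, s)) (c 1) w = c 1"
        by (auto simp: D_def simp del: in_lists_conv_set)
      hence "c (prod_list w) = c 1" using fold by metis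
      note w = w this
      have "prod_list w \<in> H" using w S(2) subgrp_prod_list[OF H, of w] by auto
      thus "x \<in> A" using w c[of "prod_list w" 1] subgrp_one[OF H] by (auto simp: grp_simps)
    next
      fix x assume x: "x \<in> A"
      then obtain w where w: "w \<in> lists S" "x = prod_list w" using A S gen_words[OF S(4)] by auto
      have "c x = c 1" using x A c[of x 1] subgrp_one[OF H] by (auto simp: grp_simps)
      thus "x \<in> D (d, c 1)" unfolding D_def prod.case using w fold[OF w(1)]
        by (intro CollectI exI[of _ w]) simp
    qed
    moreover have "(d, c 1) \<in> P" using dn cn subgrp_one[OF H] by (auto simp: P_def)
    ultimately show "A \<in> D ` P" by (metis image_eqI)
  qed
  moreover have "finite P" using S by (auto simp: P_def intro!: finite_PiE)
  ultimately show ?thesis by (meson finite_imageI finite_subset)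
qed

text \<open>Only finitely many subgroups of \<open>H\<close> have at most \<open>card F\<close>
  cosets, and conjugation by any \<open>t\<close> normalizing \<open>H\<close> permutes them, so
  their intersection is invariant. The conjugating element may lie outside \<open>H\<close>; in
  cyclic extensions it does.\<close>

lemma invariant_fin_index_subgrp:
  assumes "fin_gen H" "subgrp A" "fin_index A H"
  obtains A' where "subgrp A'" "A' \<subseteq> A" "fin_index A' H"
    "\<And>t x. (\<And>h. h \<in> H \<Longrightarrow> t * h * inverse t \<in> H) \<Longrightarrow> (\<And>h. h \<in> H \<Longrightarrow> inverse t * h * t \<in> H)
        \<Longrightarrow> x \<in> A' \<Longrightarrow> t * x * inverse t \<in> A'"
proof -
  have H: "subgrp H" using assms(1) by (rule fin_gen_subgrp)
  obtain F where F: "finite F" "F \<subseteq> H" "\<forall>h\<in>H. \<exists>a\<in>A. \<exists>x\<in>F. h = a * x"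
    using assms(3) unfolding fin_index_def by blast
  define Y where "Y = {A. subgrp A \<and> A \<subseteq> H \<and> (\<exists>E. finite E \<and> E \<subseteq> H \<and> card E \<le> card F \<and> (\<forall>h\<in>H. \<exists>a\<in>A. \<exists>x\<in>E. h = a * x))}"
  have Y: "finite Y" unfolding Y_def by (rule finite_subgrps_of_bounded_index[OF assms(1)])
  have AX: "A \<in> Y" using F assms by (auto simp: Y_def fin_index_def)
  show ?thesis
  proof (rule that[of "H \<inter> \<Inter>Y"])
    show "subgrp (H \<inter> \<Inter>Y)" by (intro subgrp_Int H subgrp_Inter) (auto simp: Y_def)
    show "H \<inter> \<Inter>Y \<subseteq> A" using AX by auto
    show "fin_index (H \<inter> \<Inter>Y) H"
      by (rule fin_index_INT[OF Y _ H]) (auto simp: Y_def fin_index_def)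
    fix t x assume t: "\<And>h. h \<in> H \<Longrightarrow> t * h * inverse t \<in> H" "\<And>h. h \<in> H \<Longrightarrow> inverse t * h * t \<in> H"
      and x: "x \<in> H \<inter> \<Inter>Y"
    have "t * x * inverse t \<in> B" if B: "B \<in> Y" for B
    proof -
      define B' where "B' = {h \<in> H. t * h * inverse t \<in> B}"
      obtain E where E: "finite E" "E \<subseteq> H" "card E \<le> card F" "\<And>h. h \<in> H \<Longrightarrow> \<exists>a\<in>B. \<exists>x\<in>E. h = a * x"
        and B1: "subgrp B" "B \<subseteq> H" using B by (auto simp: Y_def)
      define E' where "E' = (\<lambda>y. inverse t * y * t) ` E"
      have "subgrp B'"
      proof (rule subgrpI)
        show "1 \<in> B'" using subgrp_one[OF H] subgrp_one[OF B1(1)] by (simp add: B'_def grp_simps)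
        show "u * v \<in> B'" if "u \<in> B'" "v \<in> B'" for u v
          using that subgrp_mult[OF H, of u v] subgrp_mult[OF B1(1), of "t * u * inverse t" "t * v * inverse t"]
          by (simp add: B'_def grp_simps)
        show "inverse u \<in> B'" if "u \<in> B'" for u
          using that subgrp_inv[OF H, of u] subgrp_inv[OF B1(1), of "t * u * inverse t"] by (simp add: B'_def grp_simps)
      qed
      moreover have "finite E'" "E' \<subseteq> H" using E t by (auto simp: E'_def)
      moreover have "card E' \<le> card F" using card_image_le[OF E(1)] E(3) by (force simp: E'_def intro: order_trans)
      moreover have "\<exists>a\<in>B'. \<exists>x\<in>E'. h = a * x" if h: "h \<in> H" for h
      proof -
        obtain a y where a: "a \<in> B" "y \<in> E" "t * h * inverse t = a * y" using E(4)[OF t(1)[OF h]] by blast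
        have "h = (inverse t * a * t) * (inverse t * y * t)"
        proof -
          have "inverse t * (t * h * inverse t) * t = inverse t * (a * y) * t" using a by simp
          thus ?thesis by (simp add: grp_simps)
        qed
        moreover have "inverse t * a * t \<in> B'" using a(1) B1 t by (auto simp: B'_def grp_simps subset_iff)
        ultimately show ?thesis using a by (auto simp: E'_def)
      qed
      ultimately have "B' \<in> Y" unfolding Y_def B'_def by blast
      thus ?thesis using x by (auto simp: B'_def)
    qed
    thus "t * x * inverse t \<in> H \<inter> \<Inter>Y" using x t by auto
  qed
qed

section \<open>Commutators and nilpotency\<close>

definition commu :: "'a::grp \<Rightarrow> 'a \<Rightarrow> 'a" where
  "commu x y = x * y * inverse x * inverse y"

definition nrml :: "'a::grp set \<Rightarrow> 'a set \<Rightarrow> bool" where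
  "nrml N H \<longleftrightarrow> subgrp N \<and> N \<subseteq> H \<and> (\<forall>h\<in>H. \<forall>x\<in>N. h * x * inverse h \<in> N)"

lemma nrmlD: "nrml N H \<Longrightarrow> h \<in> H \<Longrightarrow> x \<in> N \<Longrightarrow> h * x * inverse h \<in> N"
  by (simp add: nrml_def)

lemma nrmlD': "nrml N H \<Longrightarrow> subgrp H \<Longrightarrow> h \<in> H \<Longrightarrow> x \<in> N \<Longrightarrow> inverse h * x * h \<in> N"
  using nrmlD[of N H "inverse h" x] by (simp add: subgrp_inv grp_inv_inv)

lemma nrml_subgrp: "nrml N H \<Longrightarrow> subgrp N" "nrml N H \<Longrightarrow> N \<subseteq> H"
  by (auto simp: nrml_def)

lemma commu_mem: "subgrp H \<Longrightarrow> x \<in> H \<Longrightarrow> y \<in> H \<Longrightarrow> commu x y \<in> H"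
  by (simp add: commu_def subgrp_mem)

text \<open>From [x, gh] = [x, g] g [x, h] g^-1. Thus commutation with \<open>x\<close> modulo a
  normal subgroup can be tested on generators.\<close>

lemma subgrp_commu_right:
  assumes "nrml N H" "subgrp H"
  shows "subgrp {h \<in> H. commu x h \<in> N}"
proof (rule subgrpI)
  show "1 \<in> {h \<in> H. commu x h \<in> N}"
    using assms subgrp_one[of H] subgrp_one[of N] by (auto simp: commu_def grp_simps nrml_def)
  show "g * h \<in> {h \<in> H. commu x h \<in> N}" if "g \<in> {h \<in> H. commu x h \<in> N}" "h \<in> {h \<in> H. commu x h \<in> N}" for g h
  proof -
    have "commu x (g * h) = commu x g * (g * commu x h * inverse g)" by (simp add: commu_def grp_simps)
    thus ?thesis using that assms nrmlD[OF assms(1), of g "commu x h"] by (auto simp: subgrp_mem nrml_def)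
  qed
  show "inverse g \<in> {h \<in> H. commu x h \<in> N}" if "g \<in> {h \<in> H. commu x h \<in> N}" for g
  proof -
    have "commu x (inverse g) = inverse g * inverse (commu x g) * g" by (simp add: commu_def grp_simps)
    thus ?thesis using that assms nrmlD'[OF assms(1,2), of g "inverse (commu x g)"] by (auto simp: subgrp_mem nrml_def)
  qed
qed

text \<open>The preimage in \<open>H\<close> of the upper central series of \<open>H / N\<close>. It
  is relative to \<open>N\<close> because commutators of near-identity elements are first shown to
  land in the kernel of a norm rather than to be trivial.\<close>

primrec upper_chain :: "'a::grp set \<Rightarrow> 'a set \<Rightarrow> nat \<Rightarrow> 'a set" where
  "upper_chain N H 0 = N"
| "upper_chain N H (Suc i) = {x \<in> H. \<forall>h\<in>H. commu x h \<in> upper_chain N H i}"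

lemma nrml_upper_chain:
  assumes "nrml N H" "subgrp H"
  shows "nrml (upper_chain N H i) H"
proof (induction i)
  case (Suc i)
  let ?M = "upper_chain N H i"
  note M = Suc nrml_subgrp[OF Suc]
  have sub: "subgrp (upper_chain N H (Suc i))"
  proof (rule subgrpI)
    show "1 \<in> upper_chain N H (Suc i)" using assms M by (auto simp: commu_def grp_simps subgrp_mem)
    show "x * y \<in> upper_chain N H (Suc i)" if "x \<in> upper_chain N H (Suc i)" "y \<in> upper_chain N H (Suc i)" for x y
    proof -
      have "commu (x * y) h = (x * commu y h * inverse x) * commu x h" for h by (simp add: commu_def grp_simps)
      thus ?thesis using that assms M nrmlD[OF M(1), of x] by (auto simp: subgrp_mem)
    qed
    show "inverse x \<in> upper_chain N H (Suc i)" if "x \<in> upper_chain N H (Suc i)" for x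
    proof -
      have "commu (inverse x) h = inverse x * inverse (commu x h) * x" for h by (simp add: commu_def grp_simps)
      thus ?thesis using that assms M nrmlD'[OF M(1) assms(2), of x] by (auto simp: subgrp_mem)
    qed
  qed
  moreover have "g * x * inverse g \<in> upper_chain N H (Suc i)" if g: "g \<in> H" and x: "x \<in> upper_chain N H (Suc i)" for g x
  proof -
    have "commu (g * x * inverse g) h = g * commu x (inverse g * h * g) * inverse g" for h by (simp add: commu_def grp_simps)
    moreover have "commu x (inverse g * h * g) \<in> ?M" if "h \<in> H" for h using that g x assms by (auto simp: subgrp_mem)
    ultimately have "commu (g * x * inverse g) h \<in> ?M" if "h \<in> H" for h using that g nrmlD[OF M(1)] by metis
    thus ?thesis using g x assms by (auto simp: subgrp_mem)
  qed
  ultimately show ?case by (auto simp: nrml_def)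
qed (use assms in auto)

lemma upper_chain_subset: "nrml N H \<Longrightarrow> subgrp H \<Longrightarrow> upper_chain N H i \<subseteq> upper_chain N H (Suc i)"
proof
  fix x assume N: "nrml N H" "subgrp H" and x: "x \<in> upper_chain N H i"
  note M = nrml_upper_chain[OF N, of i]
  have "commu x h \<in> upper_chain N H i" if "h \<in> H" for h
  proof -
    have "commu x h = x * (h * inverse x * inverse h)" by (simp add: commu_def grp_simps)
    thus ?thesis using nrmlD[OF M that, of "inverse x"] nrml_subgrp[OF M] x by (auto simp: subgrp_mem)
  qed
  thus "x \<in> upper_chain N H (Suc i)" using x nrml_subgrp[OF M] by auto
qed

text \<open>No subgroup is generated at any stage, so over a finite generating set only finitely
  many commutators of each weight have to be controlled.\<close>

primrec left_normed :: "'a::grp set \<Rightarrow> nat \<Rightarrow> 'a set" where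
  "left_normed T 0 = T"
| "left_normed T (Suc k) = {commu x t | x t. x \<in> left_normed T k \<and> t \<in> T}"

lemma finite_left_normed: "finite T \<Longrightarrow> finite (left_normed T k)"
proof (induction k)
  case (Suc k)
  have "left_normed T (Suc k) = (\<lambda>(x,t). commu x t) ` (left_normed T k \<times> T)" by auto
  thus ?case using Suc by simp
qed simp

lemma left_normed_mono: "S \<subseteq> T \<Longrightarrow> left_normed S k \<subseteq> left_normed T k"
  by (induction k) (simp_all, blast)

lemma left_normed_subset: "subgrp H \<Longrightarrow> T \<subseteq> H \<Longrightarrow> left_normed T k \<subseteq> H"
  by (induction k) (auto intro!: commu_mem)

definition nilp :: "'a::grp set \<Rightarrow> bool" where
  "nilp H \<longleftrightarrow> (\<exists>k. left_normed H k \<subseteq> {1})"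

lemma nilp_mono: "nilp H \<Longrightarrow> A \<subseteq> H \<Longrightarrow> nilp A"
  unfolding nilp_def using left_normed_mono by blast

text \<open>If all commutators of one weight lie in a term of the chain, those of the weight below
  commute with the generators modulo this term, hence with all of \<open>H\<close> by
  \<open>subgrp_commu_right\<close>, and so lie in the next term. Descending to weight one puts the
  generators themselves into the chain.\<close>

lemma upper_chain_eq:
  assumes "nrml N H" "gen T = H" "left_normed T k \<subseteq> N"
  shows "upper_chain N H k = H"
proof -
  have H: "subgrp H" using assms subgrp_gen by auto
  have T: "T \<subseteq> H" using assms gen_superset by auto
  have "i \<le> k \<Longrightarrow> left_normed T (k - i) \<subseteq> upper_chain N H i" for i
  proof (induction i)
    case (Suc i)
    show ?case
    proof
      fix x assume x: "x \<in> left_normed T (k - Suc i)"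
      have kk: "k - i = Suc (k - Suc i)" using Suc by simp
      have "commu x t \<in> upper_chain N H i" if "t \<in> T" for t
        using Suc that x unfolding kk by auto
      hence "T \<subseteq> {h \<in> H. commu x h \<in> upper_chain N H i}" using T by auto
      from gen_least[OF subgrp_commu_right[OF nrml_upper_chain[OF assms(1) H] H] this]
      show "x \<in> upper_chain N H (Suc i)" using x left_normed_subset[OF H T] assms by auto
    qed
  qed (use assms in simp)
  from this[of k] have "T \<subseteq> upper_chain N H k" by simp
  from gen_least[OF _ this] show ?thesis
    using nrml_upper_chain[OF assms(1) H, of k] assms(2) by (auto simp: nrml_def)
qed

lemma left_normed_upper_chain:
  assumes "upper_chain N H k = H"
  shows "left_normed H k \<subseteq> N"
proof -
  have "i \<le> k \<Longrightarrow> left_normed H i \<subseteq> upper_chain N H (k - i)" for i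
  proof (induction i)
    case (Suc i)
    have kk: "k - i = Suc (k - Suc i)" using Suc by simp
    show ?case using Suc unfolding kk by auto
  qed (use assms in simp)
  from this[of k] show ?thesis by simp
qed

lemma nrml_trivial: "subgrp H \<Longrightarrow> nrml {1} H"
  by (auto simp: nrml_def subgrp_def grp_simps)

lemma nilp_generators:
  assumes "gen T = H" "left_normed T k \<subseteq> {1}"
  shows "nilp H"
  using left_normed_upper_chain[OF upper_chain_eq[OF nrml_trivial assms]] subgrp_gen[of T] assms(1)
  unfolding nilp_def by auto

lemma nrml_gen_if_commu:
  assumes "subgrp H" "Y \<subseteq> H" "\<And>x h. x \<in> Y \<Longrightarrow> h \<in> H \<Longrightarrow> commu x h \<in> gen Y"
  shows "nrml (gen Y) H"
proof -
  have "h * x * inverse h \<in> gen Y" if h: "h \<in> H" and x: "x \<in> gen Y" for h x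
  proof -
    have sub: "subgrp {x. h * x * inverse h \<in> gen Y}"
    proof (rule subgrpI; clarify?)
      show "h * 1 * inverse h \<in> gen Y" using subgrp_one[OF subgrp_gen] by (simp add: grp_simps)
      show "h * (x * y) * inverse h \<in> gen Y" if "h * x * inverse h \<in> gen Y" "h * y * inverse h \<in> gen Y" for x y
        using subgrp_mult[OF subgrp_gen that] by (simp add: grp_simps)
      show "h * inverse x * inverse h \<in> gen Y" if "h * x * inverse h \<in> gen Y" for x
        using subgrp_inv[OF subgrp_gen that] by (simp add: grp_simps)
    qed
    have "Y \<subseteq> {x. h * x * inverse h \<in> gen Y}"
    proof clarify
      fix y assume y: "y \<in> Y"
      have "h * y * inverse h = inverse (commu y h) * y" by (simp add: commu_def grp_simps)
      thus "h * y * inverse h \<in> gen Y" using assms(3)[OF y h] gen_superset[of Y] y by (auto simp: subgrp_mem[OF subgrp_gen])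
    qed
    from gen_least[OF sub this] x show ?thesis by auto
  qed
  thus ?thesis using gen_least[OF assms(1,2)] by (auto simp: nrml_def subgrp_gen)
qed

text \<open>The list consists of the left-normed commutators in a finite generating set, heaviest
  weight first. The commutators of an entry with the generators come earlier in the list, so each
  entry is central modulo the subgroup generated by its predecessors.\<close>

lemma polycyclic_sequence:
  assumes "fin_gen H" "nilp H"
  obtains xs where "gen (set xs) = H"
    "\<And>j h. j < length xs \<Longrightarrow> h \<in> H \<Longrightarrow> commu (xs ! j) h \<in> gen (set (take j xs))"
proof -
  obtain T where T: "finite T" "T \<subseteq> H" "gen T = H" "sym_set T" "1 \<in> T"
    using fin_gen_sym[OF assms(1)] .
  have H: "subgrp H" using assms(1) by (rule fin_gen_subgrp)
  obtain k where k: "left_normed H k \<subseteq> {1}" using assms(2) by (auto simp: nilp_def)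
  have kT: "left_normed T k \<subseteq> {1}" using k left_normed_mono[OF T(2)] by blast
  have "i \<le> k \<Longrightarrow> \<exists>xs. set xs \<subseteq> H \<and> left_normed T (k - i) \<subseteq> gen (set xs) \<and>
    (\<forall>j<length xs. \<forall>h\<in>H. commu (xs ! j) h \<in> gen (set (take j xs)))" for i
  proof (induction i)
    case 0
    show ?case using kT subgrp_one[OF subgrp_gen[of "{}"]] by (intro exI[of _ "[]"]) auto
  next
    case (Suc i)
    then obtain xs where xs: "set xs \<subseteq> H" "left_normed T (k - i) \<subseteq> gen (set xs)"
      "\<And>j h. j < length xs \<Longrightarrow> h \<in> H \<Longrightarrow> commu (xs ! j) h \<in> gen (set (take j xs))" by auto
    have kk: "k - i = Suc (k - Suc i)" using Suc by simp
    have W: "nrml (gen (set xs)) H"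
    proof (rule nrml_gen_if_commu[OF H xs(1)])
      fix x h assume "x \<in> set xs" "h \<in> H"
      then obtain j where "j < length xs" "x = xs ! j" by (auto simp: in_set_conv_nth)
      thus "commu x h \<in> gen (set xs)" using xs(3)[of j h] \<open>h \<in> H\<close> gen_mono[OF set_take_subset[of j xs]] by auto
    qed
    obtain ys where ys: "set ys = left_normed T (k - Suc i)"
      using finite_list[OF finite_left_normed[OF T(1)]] by blast
    have ysW: "commu y h \<in> gen (set xs)" if "y \<in> set ys" "h \<in> H" for y h
    proof -
      have "T \<subseteq> {h \<in> H. commu y h \<in> gen (set xs)}" using T(2) xs(2) that(1) ys unfolding kk by auto
      from gen_least[OF subgrp_commu_right[OF W H] this] show ?thesis using that T(3) by auto
    qed
    show ?case
    proof (intro exI[of _ "xs @ ys"] conjI allI impI ballI)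
      show "set (xs @ ys) \<subseteq> H" using xs(1) ys left_normed_subset[OF H T(2)] by auto
      show "left_normed T (k - Suc i) \<subseteq> gen (set (xs @ ys))" using ys gen_superset[of "set (xs @ ys)"] by auto
      fix j h assume j: "j < length (xs @ ys)" and h: "h \<in> H"
      show "commu ((xs @ ys) ! j) h \<in> gen (set (take j (xs @ ys)))"
      proof (cases "j < length xs")
        case True thus ?thesis using xs(3)[OF True h] by (simp add: nth_append)
      next
        case False
        hence "commu ((xs @ ys) ! j) h \<in> gen (set xs)" using j h ysW by (simp add: nth_append)
        thus ?thesis using False gen_mono[of "set xs" "set (take j (xs @ ys))"] by auto
      qed
    qed
  qed
  from this[of k] obtain xs where xs: "set xs \<subseteq> H" "T \<subseteq> gen (set xs)"
    "\<And>j h. j < length xs \<Longrightarrow> h \<in> H \<Longrightarrow> commu (xs ! j) h \<in> gen (set (take j xs))" by auto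
  have "gen (set xs) = H" using gen_least[OF H xs(1)] gen_least[OF subgrp_gen xs(2)] T(3) by auto
  thus ?thesis using that xs(3) by blast
qed

section \<open>Cyclic extensions\<close>

lemma powi_Suc: "power_int (x::'a::grp) (n + 1) = power_int x n * x"
proof (cases "0 \<le> n")
  case True
  hence "nat (n + 1) = Suc (nat n)" by simp
  thus ?thesis using True by (simp add: power_int_def power_Suc2 del: power_Suc)
next
  case False
  hence e: "nat (- n) = Suc (nat (- (n + 1)))" by simp
  have "power_int x n * x = inverse x ^ nat (- (n + 1))"
    using False by (simp add: power_int_def e power_Suc2 mult.assoc grp_simps del: power_Suc)
  also have "\<dots> = power_int x (n + 1)" using False by (auto simp: power_int_def)
  finally show ?thesis by simp
qed

lemma powi_diff_one: "power_int (x::'a::grp) (n - 1) = power_int x n * inverse x"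
  using powi_Suc[of x "n - 1"] by (simp add: grp_simps)

lemma powi_zero: "power_int (x::'a::grp) 0 = 1"
  and powi_one: "power_int (x::'a::grp) 1 = x"
  by (simp_all add: power_int_def)

lemma powi_nat: "power_int (x::'a::grp) (int n) = x ^ n"
  by (simp add: power_int_def)

lemma powi_add: "power_int (x::'a::grp) (m + n) = power_int x m * power_int x n"
proof (induction n rule: int_induct[where k = 0])
  case base
  show ?case by (simp add: powi_zero)
next
  case (step1 n)
  have "power_int x (m + (n + 1)) = power_int x (m + n + 1)" by (simp add: add.assoc)
  thus ?case using step1 by (simp add: powi_Suc mult.assoc del: add.assoc)
next
  case (step2 n)
  have "power_int x (m + (n - 1)) = power_int x (m + n - 1)" by (simp add: algebra_simps)
  thus ?case using step2 by (simp add: powi_diff_one mult.assoc)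
qed

lemma powi_minus: "power_int (x::'a::grp) (- n) = inverse (power_int x n)"
  using powi_add[of x n "- n"] by (simp add: powi_zero grp_inv_unique)

lemma subgrp_powi: "subgrp H \<Longrightarrow> x \<in> H \<Longrightarrow> power_int x n \<in> H"
  by (auto simp: power_int_def intro!: subgrp_power subgrp_inv)

definition normalizes :: "'a::grp \<Rightarrow> 'a set \<Rightarrow> bool" where
  "normalizes x N \<longleftrightarrow> (\<forall>n\<in>N. x * n * inverse x \<in> N \<and> inverse x * n * x \<in> N)"

lemma normalizes_powi:
  assumes "normalizes x N" "n \<in> N"
  shows "power_int x k * n * power_int x (- k) \<in> N"
  using assms(2)
proof (induction k arbitrary: n rule: int_induct[where k = 0])
  case base
  thus ?case by (simp add: powi_zero)
next
  case (step1 k)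
  have "power_int x (k + 1) * n * power_int x (- (k + 1)) = power_int x k * (x * n * inverse x) * power_int x (- k)"
    unfolding powi_minus powi_Suc by (simp add: grp_simps)
  thus ?case using step1 assms by (simp add: normalizes_def)
next
  case (step2 k)
  have "power_int x (k - 1) * n * power_int x (- (k - 1)) = power_int x k * (inverse x * n * x) * power_int x (- k)"
    unfolding powi_minus powi_diff_one by (simp add: grp_simps)
  thus ?case using step2 assms by (simp add: normalizes_def)
qed

definition cyc :: "'a::grp set \<Rightarrow> 'a \<Rightarrow> 'a set" where
  "cyc N x = {n * power_int x k | n k. n \<in> N}"

lemma cyc_superset: "N \<subseteq> cyc N x"
proof
  fix n assume "n \<in> N"
  thus "n \<in> cyc N x" unfolding cyc_def by (intro CollectI exI[of _ n] exI[of _ 0]) (simp add: powi_zero)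
qed

lemma powi_in_cyc: "subgrp N \<Longrightarrow> power_int x k \<in> cyc N x"
  unfolding cyc_def by (intro CollectI exI[of _ 1] exI[of _ k]) (simp add: subgrp_one)

lemma gen_in_cyc: "subgrp N \<Longrightarrow> x \<in> cyc N x"
  using powi_in_cyc[of N x 1] by (simp add: powi_one)

lemma subgrp_cyc:
  assumes "subgrp N" "normalizes x N"
  shows "subgrp (cyc N x)"
proof (rule subgrpI)
  show "1 \<in> cyc N x" using cyc_superset subgrp_one[OF assms(1)] by blast
  show "u * v \<in> cyc N x" if uv: "u \<in> cyc N x" "v \<in> cyc N x" for u v
  proof -
    obtain m k n l where u: "u = m * power_int x k" "m \<in> N" and v: "v = n * power_int x l" "n \<in> N"
      using uv by (auto simp: cyc_def)
    have "u * v = m * (power_int x k * n * power_int x (- k)) * power_int x (k + l)"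
      by (simp add: u v powi_add powi_minus grp_simps)
    moreover have "m * (power_int x k * n * power_int x (- k)) \<in> N"
      using u v normalizes_powi[OF assms(2)] subgrp_mult[OF assms(1)] by blast
    ultimately show ?thesis unfolding cyc_def by blast
  qed
  show "inverse u \<in> cyc N x" if u: "u \<in> cyc N x" for u
  proof -
    obtain m k where u: "u = m * power_int x k" "m \<in> N" using u by (auto simp: cyc_def)
    have "inverse u = (power_int x (- k) * inverse m * power_int x (- (- k))) * power_int x (- k)"
      by (simp add: u powi_minus grp_simps)
    moreover have "power_int x (- k) * inverse m * power_int x (- (- k)) \<in> N"
      using u normalizes_powi[OF assms(2)] subgrp_inv[OF assms(1)] by blast
    ultimately show ?thesis unfolding cyc_def by blast
  qed
qed

lemma gen_insert_cyc:
  assumes "subgrp N" "normalizes x N"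
  shows "gen (insert x N) = cyc N x"
proof
  show "gen (insert x N) \<subseteq> cyc N x"
    using gen_least[OF subgrp_cyc[OF assms]] cyc_superset[of N x] gen_in_cyc[OF assms(1)] by simp
  show "cyc N x \<subseteq> gen (insert x N)"
    using gen_superset[of "insert x N"] subgrp_powi[OF subgrp_gen, of x "insert x N"]
    by (auto simp: cyc_def intro!: subgrp_mult[OF subgrp_gen])
qed

lemma fin_index_cyc:
  assumes "subgrp N" "normalizes x N" "0 < k" "x ^ k \<in> N"
  shows "fin_index N (cyc N x)"
proof -
  have cov: "\<exists>a\<in>N. \<exists>y\<in>(\<lambda>i. x ^ i) ` {..<k}. h = a * y" if h: "h \<in> cyc N x" for h
  proof -
    obtain n i where h: "h = n * power_int x i" "n \<in> N" using h by (auto simp: cyc_def)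
    define q where "q = i div int k"
    define r where "r = nat (i mod int k)"
    have i: "i = int k * q + int r" "r < k" using assms(3) by (auto simp: q_def r_def nat_less_iff)
    have "power_int x (int k * q) \<in> N"
    proof -
      have "power_int x (int k * q) = power_int (x ^ k) q"
      proof (induction q rule: int_induct[where k = 0])
        case base
        show ?case by (simp add: powi_zero)
      next
        case (step1 q)
        have "power_int x (int k * (q + 1)) = power_int x (int k * q) * power_int x (int k)"
          unfolding powi_add [symmetric] by (simp add: algebra_simps)
        thus ?case using step1 by (simp add: powi_Suc powi_nat)
      next
        case (step2 q)
        have "power_int x (int k * (q - 1)) = power_int x (int k * q) * inverse (power_int x (int k))"
          unfolding powi_minus [symmetric] powi_add [symmetric] by (simp add: algebra_simps)
        thus ?case using step2 by (simp add: powi_diff_one powi_nat)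
      qed
      thus ?thesis using subgrp_powi[OF assms(1,4)] by simp
    qed
    hence "n * power_int x (int k * q) \<in> N" using h assms(1) by (simp add: subgrp_mult)
    moreover have "h = (n * power_int x (int k * q)) * x ^ r" by (simp add: h i(1) powi_add powi_nat mult.assoc)
    ultimately show ?thesis using i(2) by blast
  qed
  moreover have "(\<lambda>i. x ^ i) ` {..<k} \<subseteq> cyc N x"
    using powi_in_cyc[OF assms(1), of x "int i" for i] by auto
  ultimately show ?thesis unfolding fin_index_def
    by (intro conjI exI[of _ "(\<lambda>i. x ^ i) ` {..<k}"] ballI cyc_superset cov) simp_all
qed

lemma fin_index_cyc_mono:
  assumes "subgrp N" "normalizes x N" "fin_index L N" "subgrp L" "normalizes x L"
  shows "fin_index (cyc L x) (cyc N x)"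
proof -
  obtain F where F: "finite F" "F \<subseteq> N" "\<And>h. h \<in> N \<Longrightarrow> \<exists>a\<in>L. \<exists>y\<in>F. h = a * y"
    using assms(3) unfolding fin_index_def by metis
  have "\<exists>a\<in>cyc L x. \<exists>y\<in>F. h = a * y" if h: "h \<in> cyc N x" for h
  proof -
    obtain n k where n: "h = n * power_int x k" "n \<in> N" using h by (auto simp: cyc_def)
    have "h = power_int x k * (power_int x (- k) * n * power_int x (- (- k)))" by (simp add: n powi_minus grp_simps)
    moreover obtain a y where a: "a \<in> L" "y \<in> F" "power_int x (- k) * n * power_int x (- (- k)) = a * y"
      using F(3)[OF normalizes_powi[OF assms(2) n(2)]] by metis
    ultimately have "h = (power_int x k * a) * y" by (simp add: mult.assoc)
    moreover have "power_int x k * a \<in> cyc L x"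
      using a powi_in_cyc[OF assms(4)] cyc_superset[of L x] subgrp_mult[OF subgrp_cyc[OF assms(4,5)]] by blast
    ultimately show ?thesis using a by blast
  qed
  moreover have "cyc L x \<subseteq> cyc N x" using fin_index_subset[OF assms(3)] by (auto simp: cyc_def)
  moreover have "F \<subseteq> cyc N x" using F(2) cyc_superset[of N x] by (rule subset_trans)
  ultimately show ?thesis unfolding fin_index_def using F(1) by (intro conjI exI[of _ F] ballI) simp_all
qed

text \<open>A split extension: \<open>H\<close> is the semidirect product of the kernel
  \<open>L\<close> of \<open>j\<close> with the infinite cyclic group generated by
  \<open>t\<close>.\<close>

locale cyclic_ext =
  fixes H L :: "'a::grp set" and t :: 'a and j :: "'a \<Rightarrow> int"
  assumes H: "subgrp H" and t: "t \<in> H" and jt: "j t = 1"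
    and j_mult: "\<And>x y. x \<in> H \<Longrightarrow> y \<in> H \<Longrightarrow> j (x * y) = j x + j y"
    and L_eq: "L = {x \<in> H. j x = 0}"
begin

lemma j_one: "j 1 = 0"
  using j_mult[of 1 1] subgrp_one[OF H] by simp

lemma j_inv: "x \<in> H \<Longrightarrow> j (inverse x) = - j x"
  using j_mult[of x "inverse x"] subgrp_inv[OF H, of x] j_one by (simp add: grp_simps)

lemma powi_mem: "power_int t n \<in> H"
  by (rule subgrp_powi[OF H t])

lemma j_powi: "j (power_int t n) = n"
proof (induction n rule: int_induct[where k = 0])
  case (step2 n)
  thus ?case using j_mult[OF powi_mem[of n] subgrp_inv[OF H t]] j_inv[OF t] jt by (simp add: powi_diff_one)
qed (use j_mult[OF powi_mem t] jt j_one in \<open>simp_all add: powi_Suc powi_zero\<close>)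

lemma L_subset: "L \<subseteq> H"
  by (auto simp: L_eq)

lemma subgrp_L: "subgrp L"
  by (rule subgrpI) (auto simp: L_eq j_one j_mult j_inv subgrp_mem[OF H])

lemma nrml_L: "nrml L H"
  using subgrp_L by (auto simp: nrml_def L_eq j_mult j_inv subgrp_mem[OF H])

lemma commu_in_L: "x \<in> H \<Longrightarrow> y \<in> H \<Longrightarrow> commu x y \<in> L"
  by (auto simp: commu_def L_eq j_mult j_inv subgrp_mem[OF H])

text \<open>\<open>L\<close> is a set of representatives for the cosets of the group generated by
  \<open>t\<close> on the left, and \<open>act\<close> is right multiplication by \<open>H\<close>
  on these cosets. Elements of \<open>L\<close> act by translation, \<open>t\<close> by conjugation;
  \<open>act_split\<close> writes a general \<open>h\<close> as a conjugation followed by a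
  translation, which is why polynomials on \<open>L\<close> are preserved.\<close>

definition act :: "'a \<Rightarrow> 'a \<Rightarrow> 'a" where
  "act x h = power_int t (- j h) * x * h"

lemma act_mem: "x \<in> L \<Longrightarrow> h \<in> H \<Longrightarrow> act x h \<in> L"
  by (auto simp: act_def L_eq j_mult subgrp_mem[OF H] powi_mem j_powi)

lemma act_mult: "x \<in> L \<Longrightarrow> g \<in> H \<Longrightarrow> h \<in> H \<Longrightarrow> act x (g * h) = act (act x g) h"
  using powi_add[of t "- j h" "- j g"] by (simp add: act_def j_mult mult.assoc add.commute)

lemma act_one: "act x 1 = x"
  by (simp add: act_def j_one powi_zero)

lemma act_L: "h \<in> L \<Longrightarrow> act x h = x * h"
  by (simp add: act_def L_eq powi_zero)

lemma act_split: "act x h = (power_int t (- j h) * x * inverse (power_int t (- j h))) * act 1 h"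
  by (simp add: act_def grp_simps)

end

text \<open>If no positive power of \<open>x\<close> lies in \<open>N\<close>, the exponent in
  \<open>n * power_int x k\<close> is determined by the product, and \<open>j\<close> reads it
  off.\<close>

lemma cyclic_ext_or_finite:
  assumes "subgrp N" "normalizes x N"
  obtains "fin_index N (cyc N x)" | j where "cyclic_ext (cyc N x) N x j"
proof (cases "\<exists>k>0. x ^ k \<in> N")
  case True
  thus ?thesis using fin_index_cyc[OF assms] that by blast
next
  case False
  have zero: "k = 0" if "power_int x k \<in> N" for k
  proof (rule ccontr)
    assume "k \<noteq> 0"
    hence "x ^ nat \<bar>k\<bar> \<in> N"
      using that subgrp_inv[OF assms(1), of "power_int x k"]
      by (cases "0 \<le> k") (auto simp: powi_nat [symmetric] powi_minus [symmetric])
    thus False using False \<open>k \<noteq> 0\<close> by (metis zero_less_abs_iff zero_less_nat_eq)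
  qed
  have uniq: "k = l" if "m \<in> N" "n \<in> N" "m * power_int x k = n * power_int x l" for m n k l
  proof -
    have "power_int x k = inverse m * (m * power_int x k)" by (simp add: grp_simps)
    also have "\<dots> = inverse m * n * power_int x l" using that by (simp add: mult.assoc)
    finally have "power_int x (k - l) = inverse m * n"
      using powi_add[of x k "- l"] by (simp add: powi_minus grp_simps)
    hence "power_int x (k - l) \<in> N" using that assms(1) by (simp add: subgrp_mem)
    thus ?thesis using zero by fastforce
  qed
  define j where "j = (\<lambda>h. THE k. \<exists>n\<in>N. h = n * power_int x k)"
  have j: "j (n * power_int x k) = k" if "n \<in> N" for n k
    unfolding j_def by (rule the_equality) (use that uniq in blast)+
  have "cyclic_ext (cyc N x) N x j"
  proof
    show "subgrp (cyc N x)" by (rule subgrp_cyc[OF assms])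
    show "x \<in> cyc N x" by (rule gen_in_cyc[OF assms(1)])
    show "j x = 1" using j[OF subgrp_one[OF assms(1)], of 1] by (simp add: powi_one)
    show "j (u * v) = j u + j v" if uv: "u \<in> cyc N x" "v \<in> cyc N x" for u v
    proof -
      obtain m k n l where u: "u = m * power_int x k" "m \<in> N" and v: "v = n * power_int x l" "n \<in> N"
        using uv by (auto simp: cyc_def)
      have "u * v = m * (power_int x k * n * power_int x (- k)) * power_int x (k + l)"
        by (simp add: u v powi_add powi_minus grp_simps)
      moreover have "m * (power_int x k * n * power_int x (- k)) \<in> N"
        using u v normalizes_powi[OF assms(2)] subgrp_mult[OF assms(1)] by blast
      ultimately have "j (u * v) = k + l" using j by simp
      thus ?thesis using u v j by simp
    qed
    show "N = {h \<in> cyc N x. j h = 0}"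
    proof (intro subset_antisym subsetI)
      fix n assume "n \<in> N"
      thus "n \<in> {h \<in> cyc N x. j h = 0}" using cyc_superset[of N x] j[of n 0] by (auto simp: powi_zero)
    next
      fix h assume h: "h \<in> {h \<in> cyc N x. j h = 0}"
      then obtain m k where "h = m * power_int x k" "m \<in> N" by (auto simp: cyc_def)
      thus "h \<in> N" using h j by (auto simp: powi_zero)
    qed
  qed
  thus ?thesis by (rule that(2))
qed

section \<open>Polynomial functions on groups\<close>

text \<open>\<open>pol k H f\<close> says that \<open>f\<close> has degree less than \<open>k\<close> on \<open>H\<close>.\<close>

primrec pol :: "nat \<Rightarrow> 'a::grp set \<Rightarrow> ('a \<Rightarrow> int) \<Rightarrow> bool" where
  "pol 0 H f = (\<forall>x\<in>H. f x = 0)"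
| "pol (Suc k) H f = (\<forall>g\<in>H. pol k H (\<lambda>x. f (x * g) - f x))"

lemma pol_cong: "subgrp H \<Longrightarrow> pol k H f \<Longrightarrow> (\<And>x. x \<in> H \<Longrightarrow> f x = g x) \<Longrightarrow> pol k H g"
proof (induction k arbitrary: f g)
  case (Suc k)
  have "pol k H (\<lambda>x. g (x * h) - g x)" if "h \<in> H" for h
    by (rule Suc.IH[of "\<lambda>x. f (x * h) - f x"]) (use Suc.prems that in \<open>auto simp: subgrp_mult\<close>)
  thus ?case by simp
qed simp

lemma pol_add: "pol k H f \<Longrightarrow> pol k H g \<Longrightarrow> pol k H (\<lambda>x. f x + g x)"
proof (induction k arbitrary: f g)
  case (Suc k)
  have "pol k H (\<lambda>x. (f (x * h) - f x) + (g (x * h) - g x))" if "h \<in> H" for h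
    using Suc that by auto
  thus ?case by (simp add: algebra_simps)
qed simp

lemma pol_smult: "pol k H f \<Longrightarrow> pol k H (\<lambda>x. c * f x)"
proof (induction k arbitrary: f)
  case (Suc k)
  have "pol k H (\<lambda>x. c * (f (x * h) - f x))" if "h \<in> H" for h using Suc that by auto
  thus ?case by (simp add: algebra_simps)
qed simp

lemma pol_diff: "pol k H f \<Longrightarrow> pol k H g \<Longrightarrow> pol k H (\<lambda>x. f x - g x)"
  using pol_add[OF _ pol_smult[of k H g "-1"], of f] by simp

text \<open>Integers are torsion-free. This is what allows a difference divisible by a prime power
  to be divided by it without leaving the polynomials.\<close>

lemma pol_cancel: "pol k H (\<lambda>x. c * f x) \<Longrightarrow> c \<noteq> 0 \<Longrightarrow> pol k H f"
proof (induction k arbitrary: f)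
  case (Suc k)
  have "pol k H (\<lambda>x. f (x * h) - f x)" if "h \<in> H" for h
    using Suc.IH[of "\<lambda>x. f (x * h) - f x"] Suc.prems that by (simp add: right_diff_distrib)
  thus ?case by simp
qed simp

lemma pol_Suc: "subgrp H \<Longrightarrow> pol k H f \<Longrightarrow> pol (Suc k) H f"
proof (induction k arbitrary: f)
  case (Suc k)
  have "pol (Suc k) H (\<lambda>x. f (x * h) - f x)" if "h \<in> H" for h
    using Suc.IH[OF Suc.prems(1), of "\<lambda>x. f (x * h) - f x"] Suc.prems(2) that by simp
  thus ?case by (subst pol.simps) blast
qed (simp add: subgrp_mult)

lemma pol_mono:
  assumes "subgrp H" "pol k H f" "k \<le> l"
  shows "pol l H f"
  using assms(3) by (induction l rule: dec_induct) (use assms pol_Suc in blast)+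

lemma pol_subset: "pol k H f \<Longrightarrow> A \<subseteq> H \<Longrightarrow> pol k A f"
  by (induction k arbitrary: f) auto

lemma pol_hom:
  assumes "\<And>x. x \<in> H \<Longrightarrow> \<alpha> x \<in> H" "\<And>x y. x \<in> H \<Longrightarrow> y \<in> H \<Longrightarrow> \<alpha> (x * y) = \<alpha> x * \<alpha> y" "subgrp H"
  shows "pol k H f \<Longrightarrow> pol k H (\<lambda>x. f (\<alpha> x))"
proof (induction k arbitrary: f)
  case (Suc k)
  have "pol k H (\<lambda>x. f (\<alpha> (x * h)) - f (\<alpha> x))" if "h \<in> H" for h
    by (rule pol_cong[OF assms(3) Suc.IH[of "\<lambda>x. f (x * \<alpha> h) - f x"]]) (use Suc.prems assms that in auto)
  thus ?case by simp
qed (use assms in simp)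

lemma pol_translate:
  assumes "subgrp H" "pol k H f" "g \<in> H"
  shows "pol k H (\<lambda>x. f (x * g))"
proof (cases k)
  case 0
  thus ?thesis using assms by (simp add: subgrp_mult)
next
  case (Suc l)
  hence "pol l H (\<lambda>x. f (x * g) - f x)" using assms by simp
  hence "pol k H (\<lambda>x. f (x * g) - f x)" using pol_Suc[OF assms(1)] Suc by blast
  from pol_add[OF this assms(2)] show ?thesis by simp
qed

text \<open>Only 1 has to be told apart from the other elements. The machine tests no more than
  this, and in \<open>fin_index_nilp\<close> it shows that an element of the kernel acting trivially
  modulo all powers of a prime is 1.\<close>

definition separated :: "'a::grp set \<Rightarrow> bool" where
  "separated H \<longleftrightarrow> (\<exists>k F. finite F \<and> (\<forall>f\<in>F. pol k H f) \<and> (\<forall>x\<in>H. x \<noteq> 1 \<longrightarrow> (\<exists>f\<in>F. f x \<noteq> f 1)))"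

lemma separated_subset: "separated H \<Longrightarrow> A \<subseteq> H \<Longrightarrow> separated A"
  unfolding separated_def using pol_subset by (metis subsetD)

text \<open>Polynomials weighted along a descending chain: a difference along \<open>Ls i\<close> lowers the weighted degree by \<open>i + 1\<close>.\<close>

function wpol :: "(nat \<Rightarrow> 'a::grp set) \<Rightarrow> nat \<Rightarrow> ('a \<Rightarrow> int) \<Rightarrow> bool" where
  "wpol Ls 0 f = (\<forall>x\<in>Ls 0. f x = 0)"
| "wpol Ls (Suc n) f = (\<forall>i. \<forall>g\<in>Ls i. wpol Ls (n - i) (\<lambda>x. f (x * g) - f x))"
  by pat_completeness auto
termination by (relation "Wellfounded.measure (\<lambda>(Ls, n, f). n)") auto

declare wpol.simps(2) [simp del]

lemma wpol_SucI: "(\<And>i g. g \<in> Ls i \<Longrightarrow> wpol Ls (n - i) (\<lambda>x. f (x * g) - f x)) \<Longrightarrow> wpol Ls (Suc n) f"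
  by (simp add: wpol.simps)

lemma wpol_SucD: "wpol Ls (Suc n) f \<Longrightarrow> g \<in> Ls i \<Longrightarrow> wpol Ls (n - i) (\<lambda>x. f (x * g) - f x)"
  by (simp add: wpol.simps)

text \<open>Modelled on the upper central series of \<open>H\<close> cut down to a normal subgroup
  \<open>Ls 0\<close>. Conjugation by \<open>H\<close> changes an element of \<open>Ls i\<close>
  only by a factor in \<open>Ls (Suc i)\<close>, so it acts unipotently with respect to the weighted
  degree.\<close>

locale weight_chain =
  fixes Ls :: "nat \<Rightarrow> 'a::grp set" and H :: "'a set" and c :: nat
  assumes H: "subgrp H" and L: "subgrp (Ls 0)" and Ls_sub: "\<And>i. Ls i \<subseteq> Ls 0"
    and conj: "\<And>i g h. g \<in> Ls i \<Longrightarrow> h \<in> H \<Longrightarrow> inverse h * g * h \<in> Ls i"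
    and commu: "\<And>i g h. g \<in> Ls i \<Longrightarrow> h \<in> H \<Longrightarrow> inverse g * inverse h * g * h \<in> Ls (Suc i)"
    and c: "0 < c" "\<And>i. c \<le> i \<Longrightarrow> Ls i \<subseteq> {1}"
begin

lemma mult_mem: "x \<in> Ls 0 \<Longrightarrow> g \<in> Ls i \<Longrightarrow> x * g \<in> Ls 0"
  using Ls_sub L by (auto intro: subgrp_mult)

lemma wpol_add: "wpol Ls n f \<Longrightarrow> wpol Ls n g \<Longrightarrow> wpol Ls n (\<lambda>x. f x + g x)"
proof (induction n arbitrary: f g rule: less_induct)
  case (less n)
  show ?case
  proof (cases n)
    case (Suc m)
    show ?thesis unfolding Suc
    proof (rule wpol_SucI)
      fix i h assume h: "h \<in> Ls i"
      have "wpol Ls (m - i) (\<lambda>x. (f (x * h) - f x) + (g (x * h) - g x))"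
        by (rule less.IH[OF _ wpol_SucD[OF less.prems(1)[unfolded Suc] h] wpol_SucD[OF less.prems(2)[unfolded Suc] h]])
          (use Suc in auto)
      thus "wpol Ls (m - i) (\<lambda>x. f (x * h) + g (x * h) - (f x + g x))" by (simp add: algebra_simps)
    qed
  qed (use less.prems in auto)
qed

lemma wpol_Suc: "wpol Ls n f \<Longrightarrow> wpol Ls (Suc n) f"
proof (induction n arbitrary: f rule: less_induct)
  case (less n)
  show ?case
  proof (rule wpol_SucI)
    fix i h assume h: "h \<in> Ls i"
    show "wpol Ls (n - i) (\<lambda>x. f (x * h) - f x)"
    proof (cases n)
      case 0
      thus ?thesis using less.prems mult_mem[OF _ h] by simp
    next
      case (Suc m)
      have *: "wpol Ls (m - i) (\<lambda>x. f (x * h) - f x)" by (rule wpol_SucD[OF less.prems[unfolded Suc] h])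
      show ?thesis
      proof (cases "i \<le> m")
        case True
        hence "n - i = Suc (m - i)" using Suc by simp
        thus ?thesis using less.IH[OF _ *] Suc by simp
      next
        case False
        hence "n - i = m - i" using Suc by simp
        thus ?thesis using * by simp
      qed
    qed
  qed
qed

lemma wpol_mono:
  assumes "wpol Ls n f" "n \<le> m"
  shows "wpol Ls m f"
  using assms(2) by (induction m rule: dec_induct) (use assms wpol_Suc in blast)+

lemma wpol_diff_step:
  assumes "wpol Ls (Suc n) f" "g \<in> Ls 0"
  shows "wpol Ls n (\<lambda>x. f (x * g) - f x)"
  using wpol_SucD[OF assms] by simp

lemma wpol_translate:
  assumes "wpol Ls n f" "g \<in> Ls 0"
  shows "wpol Ls n (\<lambda>x. f (x * g))"
proof (cases n)
  case 0
  thus ?thesis using assms mult_mem by simp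
next
  case (Suc m)
  have "wpol Ls n (\<lambda>x. f (x * g) - f x)"
    using wpol_Suc[OF wpol_diff_step] assms Suc by simp
  from wpol_add[OF this assms(1)] show ?thesis by simp
qed

lemma wpol_conj: "wpol Ls n f \<Longrightarrow> h \<in> H \<Longrightarrow> wpol Ls n (\<lambda>x. f (inverse h * x * h))"
proof (induction n arbitrary: f rule: less_induct)
  case (less n)
  show ?case
  proof (cases n)
    case 0
    thus ?thesis using less.prems conj by auto
  next
    case (Suc m)
    show ?thesis unfolding Suc
    proof (rule wpol_SucI)
      fix i g assume g: "g \<in> Ls i"
      have "wpol Ls (m - i) (\<lambda>x. f ((inverse h * x * h) * (inverse h * g * h)) - f (inverse h * x * h))"
        by (rule less.IH[OF _ wpol_SucD[OF less.prems(1)[unfolded Suc] conj[OF g less.prems(2)]] less.prems(2)]) (use Suc in auto)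
      thus "wpol Ls (m - i) (\<lambda>x. f (inverse h * (x * g) * h) - f (inverse h * x * h))"
        by (simp add: grp_simps)
    qed
  qed
qed

text \<open>For \<open>g\<close> in \<open>Ls i\<close> and
  \<open>u = inverse g * inverse h * g * h\<close>, the conjugate of \<open>x * g\<close> is the
  conjugate of \<open>x\<close> times \<open>g * u\<close>. Hence the difference along
  \<open>g\<close> splits into the same expression for the difference of \<open>f\<close> along
  \<open>g\<close>, covered by induction, and a difference along \<open>u\<close>, which lies one
  step further down the chain.\<close>

lemma wpol_conj_diff:
  "wpol Ls (Suc n) f \<Longrightarrow> h \<in> H \<Longrightarrow> wpol Ls n (\<lambda>x. f (inverse h * x * h) - f x)"
proof (induction n arbitrary: f rule: less_induct)
  case (less n)
  show ?case
  proof (cases n)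
    case 0
    have "f x = f 1" if "x \<in> Ls 0" for x
      using wpol_diff_step[OF less.prems(1) that] subgrp_one[OF L] by (simp add: 0) (metis mult_1)
    thus ?thesis using 0 conj[OF _ less.prems(2)] by simp
  next
    case (Suc m)
    show ?thesis unfolding Suc
    proof (rule wpol_SucI)
      fix i g assume g: "g \<in> Ls i"
      define u where "u = inverse g * inverse h * g * h"
      have u: "u \<in> Ls (Suc i)" unfolding u_def by (rule commu[OF g less.prems(2)])
      have dg: "wpol Ls (Suc m - i) (\<lambda>x. f (x * g) - f x)"
        using wpol_SucD[OF less.prems(1) g] Suc by simp
      have "wpol Ls (m - i) (\<lambda>x. (f ((inverse h * x * h) * g) - f (inverse h * x * h)) - (f (x * g) - f x))"
      proof (cases "i \<le> m")
        case True
        hence "Suc m - i = Suc (m - i)" by simp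
        thus ?thesis using less.IH[of "m - i" "\<lambda>x. f (x * g) - f x"] dg less.prems(2) Suc by simp
      next
        case False
        thus ?thesis using dg conj[OF _ less.prems(2)] by simp
      qed
      moreover have "wpol Ls (m - i) (\<lambda>x. f (inverse h * x * h * g * u) - f (inverse h * x * h * g))"
      proof -
        have "wpol Ls (m - i) (\<lambda>x. f (x * u) - f x)"
          using wpol_SucD[OF less.prems(1) u] Suc by simp
        from wpol_conj[OF wpol_translate[OF this] less.prems(2)] show ?thesis using g Ls_sub by blast
      qed
      ultimately have "wpol Ls (m - i) (\<lambda>x. ((f ((inverse h * x * h) * g) - f (inverse h * x * h)) - (f (x * g) - f x))
          + (f (inverse h * x * h * g * u) - f (inverse h * x * h * g)))" by (rule wpol_add)
      moreover have "inverse h * x * h * g * u = inverse h * (x * g) * h" for x by (simp add: u_def grp_simps)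
      ultimately show "wpol Ls (m - i) (\<lambda>x. f (inverse h * (x * g) * h) - f (x * g) - (f (inverse h * x * h) - f x))"
        by (simp add: algebra_simps)
    qed
  qed
qed

text \<open>A difference along \<open>Ls i\<close> costs \<open>i + 1\<close> units of weight, and
  for \<open>i \<ge> c\<close> only the difference along 1 is left, which is zero. So one unit of
  ordinary degree is worth at most \<open>c\<close> units of weight.\<close>

lemma pol_wpol: "pol k (Ls 0) f \<Longrightarrow> wpol Ls (k * c) f"
proof (induction k arbitrary: f)
  case (Suc k)
  obtain b where b: "c = Suc b" using c(1) by (cases c) auto
  have "wpol Ls (Suc (k * c + b)) f"
  proof (rule wpol_SucI)
    fix i g assume g: "g \<in> Ls i"
    show "wpol Ls (k * c + b - i) (\<lambda>x. f (x * g) - f x)"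
    proof (cases "i < c")
      case True
      have "wpol Ls (k * c) (\<lambda>x. f (x * g) - f x)" using Suc g Ls_sub by auto
      thus ?thesis by (rule wpol_mono) (use True b in auto)
    next
      case False
      hence "g = 1" using c(2) g by (metis not_less singletonD subsetD)
      hence "wpol Ls 0 (\<lambda>x. f (x * g) - f x)" by simp
      thus ?thesis by (rule wpol_mono) simp
    qed
  qed
  thus ?case by (simp add: b algebra_simps)
qed simp

end

lemma (in cyclic_ext) pol_act:
  assumes "pol k L f" "h \<in> H"
  shows "pol k L (\<lambda>x. f (act x h))"
proof -
  let ?y = "power_int t (- j h)"
  have "pol k L (\<lambda>x. f (x * act 1 h))"
    by (rule pol_translate[OF subgrp_L assms(1) act_mem[OF subgrp_one[OF subgrp_L] assms(2)]])
  from pol_hom[OF _ _ subgrp_L this, of "\<lambda>x. ?y * x * inverse ?y"]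
  have "pol k L (\<lambda>x. f ((?y * x * inverse ?y) * act 1 h))"
    using nrmlD[OF nrml_L powi_mem] by (simp add: grp_simps)
  thus ?thesis by (subst act_split)
qed

text \<open>A difference along \<open>g\<close> of the pulled-back function is the pullback of
  \<open>\<lambda>x. f (act x g) - f x\<close>. By \<open>act_split\<close> this is a difference
  along a translation plus a difference along a conjugation, and both lower the weighted
  degree.\<close>

lemma (in cyclic_ext) wpol_extend:
  assumes "weight_chain Ls H c" "Ls 0 = L"
  shows "wpol Ls n f \<Longrightarrow> pol n H (\<lambda>h. f (act 1 h))"
proof (induction n arbitrary: f)
  case 0
  thus ?case using act_mem[OF subgrp_one[OF subgrp_L]] assms(2) by simp
next
  case (Suc n)
  interpret weight_chain Ls H c by fact
  have "pol n H (\<lambda>h. f (act 1 (h * g)) - f (act 1 h))" if g: "g \<in> H" for g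
  proof -
    let ?y = "power_int t (j g)" and ?z = "act 1 g"
    have z: "?z \<in> Ls 0" using act_mem[OF subgrp_one[OF subgrp_L] g] assms(2) by simp
    have "wpol Ls n (\<lambda>x. (f (inverse ?y * x * ?y * ?z) - f (inverse ?y * x * ?y)) + (f (inverse ?y * x * ?y) - f x))"
      by (intro wpol_add wpol_conj_diff Suc.prems powi_mem
          wpol_conj[of n "\<lambda>x. f (x * ?z) - f x", OF wpol_diff_step[OF Suc.prems z]])
    hence "wpol Ls n (\<lambda>x. f (act x g) - f x)"
      by (subst act_split) (simp add: powi_minus grp_simps)
    from Suc.IH[OF this] show ?thesis
      by (rule pol_cong[OF H]) (use act_mult[OF subgrp_one[OF subgrp_L] _ g] in simp)
  qed
  thus ?case by simp
qed

text \<open>The polynomials on \<open>L\<close>, pulled back by \<open>\<lambda>h. act 1 h\<close>,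
  separate the elements of \<open>L\<close> from 1, and \<open>j\<close> separates all others.
  Nilpotency of \<open>H\<close> provides the weight chain that makes the pullbacks
  polynomial.\<close>

lemma (in cyclic_ext) separated_extend:
  assumes "nilp H" "separated L"
  shows "separated H"
proof -
  obtain b where b: "left_normed H b \<subseteq> {1}" using assms(1) by (auto simp: nilp_def)
  \<comment> \<open>One more than \<open>b\<close>, so that \<open>c\<close> is positive even when
    \<open>H\<close> is trivial and \<open>b\<close> is 0.\<close>
  define c where "c = Suc b"
  have tr: "nrml {1} H" by (rule nrml_trivial[OF H])
  have uc: "upper_chain {1} H b = H" by (rule upper_chain_eq[OF tr gen_subgrp[OF H] b])
  have ucc: "upper_chain {1} H c = H"
    using upper_chain_subset[OF tr H, of b] nrml_upper_chain[OF tr H, of c] uc by (auto simp: c_def nrml_def simp del: upper_chain.simps)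
  define Ls where "Ls = (\<lambda>i. L \<inter> upper_chain {1} H (c - i))"
  note nu = nrml_upper_chain[OF tr H]
  have Ls0: "Ls 0 = L" using L_subset ucc by (auto simp: Ls_def)
  have W: "weight_chain Ls H c"
  proof
    show "subgrp H" by (rule H)
    show "subgrp (Ls 0)" using subgrp_L Ls0 by simp
    show "Ls i \<subseteq> Ls 0" for i unfolding Ls0 by (simp add: Ls_def)
    show cj: "inverse h * g * h \<in> Ls i" if "g \<in> Ls i" "h \<in> H" for i g h
      using that nrmlD'[OF nrml_L H] nrmlD'[OF nu H] by (auto simp: Ls_def)
    show "inverse g * inverse h * g * h \<in> Ls (Suc i)" if g: "g \<in> Ls i" and h: "h \<in> H" for i g h
    proof -
      have gh: "g \<in> H" using g L_subset by (auto simp: Ls_def)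
      have e: "inverse g * inverse h * g * h = commu (inverse g) (inverse h)"
        by (simp add: commu_def grp_simps)
      have ig: "inverse g \<in> upper_chain {1} H (c - i)"
        using g subgrp_inv[OF nrml_subgrp(1)[OF nu]] by (simp add: Ls_def)
      have "commu (inverse g) (inverse h) \<in> upper_chain {1} H (c - Suc i)"
      proof (cases "i < c")
        case True
        hence "c - i = Suc (c - Suc i)" by simp
        thus ?thesis using ig h subgrp_inv[OF H] by simp
      next
        case False
        hence "inverse g = 1" using ig by simp
        hence "commu (inverse g) (inverse h) = 1" by (simp add: commu_def grp_simps)
        thus ?thesis using subgrp_one[OF nrml_subgrp(1)[OF nu]] by simp
      qed
      thus ?thesis unfolding e using commu_in_L subgrp_inv[OF H] gh h by (auto simp: Ls_def)
    qed
    show "0 < c" by (simp add: c_def)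
    show "Ls i \<subseteq> {1}" if "c \<le> i" for i using that by (auto simp: Ls_def)
  qed
  obtain k F where F: "finite F" "\<And>f. f \<in> F \<Longrightarrow> pol k L f" "\<And>x. x \<in> L \<Longrightarrow> x \<noteq> 1 \<Longrightarrow> \<exists>f\<in>F. f x \<noteq> f 1"
    using assms(2) unfolding separated_def by metis
  define F' where "F' = insert j ((\<lambda>f h. f (act 1 h)) ` F)"
  have P: "pol (Suc (Suc (k * c))) H f" if f: "f \<in> F'" for f
  proof -
    consider "f = j" | g where "g \<in> F" "f = (\<lambda>h. g (act 1 h))" using f by (auto simp: F'_def)
    thus ?thesis
    proof cases
      case 1
      have "pol (Suc (Suc 0)) H j" using j_mult H by (simp add: subgrp_mult)
      thus ?thesis unfolding 1 by (rule pol_mono[OF H]) simp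
    next
      case 2
      have "pol (k * c) H f" unfolding 2
        by (rule wpol_extend[OF W Ls0 weight_chain.pol_wpol[OF W]]) (use F(2)[OF 2(1)] Ls0 in simp)
      thus ?thesis by (rule pol_mono[OF H]) simp
    qed
  qed
  have D: "\<exists>f\<in>F'. f x \<noteq> f 1" if x: "x \<in> H" "x \<noteq> 1" for x
  proof (cases "j x = 0")
    case True
    hence "x \<in> L" using x L_eq by simp
    then obtain f where "f \<in> F" "f x \<noteq> f 1" using F(3) x(2) by metis
    hence "(\<lambda>h. f (act 1 h)) x \<noteq> (\<lambda>h. f (act 1 h)) 1" using \<open>x \<in> L\<close> by (simp add: act_L act_one)
    thus ?thesis using \<open>f \<in> F\<close> by (auto simp: F'_def)
  next
    case False
    thus ?thesis using j_one by (auto simp: F'_def)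
  qed
  have "finite F'" using F(1) by (simp add: F'_def)
  thus ?thesis unfolding separated_def
    by (intro exI[of _ "Suc (Suc (k * c))"] exI[of _ F'] conjI ballI impI P D)
qed

lemma invariant_separated_extension:
  assumes "fin_gen N" "normalizes x N" "subgrp L" "fin_index L N" "separated L"
  obtains L' where "subgrp L'" "normalizes x L'" "fin_index L' N" "separated L'"
proof -
  obtain L' where L': "subgrp L'" "L' \<subseteq> L" "fin_index L' N"
    "\<And>t y. (\<And>h. h \<in> N \<Longrightarrow> t * h * inverse t \<in> N) \<Longrightarrow> (\<And>h. h \<in> N \<Longrightarrow> inverse t * h * t \<in> N)
        \<Longrightarrow> y \<in> L' \<Longrightarrow> t * y * inverse t \<in> L'"
    using invariant_fin_index_subgrp[OF assms(1,3,4)] by metis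
  have "normalizes x L'"
    using L'(4)[of x] L'(4)[of "inverse x"] assms(2) by (auto simp: normalizes_def grp_inv_inv)
  thus ?thesis using that L' separated_subset[OF assms(5)] by blast
qed

lemma cyclic_ext_sub:
  assumes "cyclic_ext (cyc N x) N x j" "subgrp L" "L \<subseteq> N" "normalizes x L"
  shows "cyclic_ext (cyc L x) L x j"
proof -
  interpret E: cyclic_ext "cyc N x" N x j by fact
  have sub: "cyc L x \<subseteq> cyc N x" using assms(3) by (auto simp: cyc_def)
  have jl: "j (l * power_int x k) = k" if "l \<in> L" for l k
  proof -
    have "l \<in> cyc N x" "j l = 0" using that assms(3) E.L_eq by auto
    thus ?thesis using E.j_mult[OF _ E.powi_mem, of l k] E.j_powi by simp
  qed
  show ?thesis
  proof
    show "subgrp (cyc L x)" by (rule subgrp_cyc[OF assms(2,4)])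
    show "x \<in> cyc L x" by (rule gen_in_cyc[OF assms(2)])
    show "j x = 1" by (rule E.jt)
    show "j (u * v) = j u + j v" if "u \<in> cyc L x" "v \<in> cyc L x" for u v
      using that sub E.j_mult by blast
    show "L = {h \<in> cyc L x. j h = 0}"
      using cyc_superset[of L x] assms(3) E.L_eq jl by (auto simp: cyc_def powi_zero)
  qed
qed

text \<open>Climb along a polycyclic sequence. A finite cyclic step keeps the subgroup found so far;
  at an infinite cyclic step it is first shrunk to a subgroup invariant under the new element, over
  which \<open>separated_extend\<close> applies. The shrinking is the reason why only a subgroup of
  finite index is obtained.\<close>

theorem nilp_fin_index_separated:
  assumes "fin_gen H" "nilp H"
  obtains L where "subgrp L" "fin_index L H" "separated L"
proof -
  have H: "subgrp H" using assms(1) by (rule fin_gen_subgrp)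
  obtain xs where xs: "gen (set xs) = H"
    "\<And>j h. j < length xs \<Longrightarrow> h \<in> H \<Longrightarrow> commu (xs ! j) h \<in> gen (set (take j xs))"
    using polycyclic_sequence[OF assms] by metis
  define N where "N = (\<lambda>m. gen (set (take m xs)))"
  have subN: "subgrp (N m)" and NH: "N m \<subseteq> H" for m
    unfolding N_def using subgrp_gen gen_mono[OF set_take_subset[of m xs]] xs(1) by auto
  have mono: "N i \<subseteq> N m" if "i \<le> m" for i m
    unfolding N_def by (rule gen_mono) (rule set_take_subset_set_take[OF that])
  have nrm: "nrml (N m) H" for m unfolding N_def
  proof (rule nrml_gen_if_commu[OF H])
    show "set (take m xs) \<subseteq> H" using NH[of m] gen_superset[of "set (take m xs)"] by (auto simp: N_def)
    fix x h assume x: "x \<in> set (take m xs)" and h: "h \<in> H"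
    then obtain i where "i < length xs" "i < m" "x = xs ! i" by (auto simp: in_set_conv_nth)
    thus "commu x h \<in> gen (set (take m xs))" using xs(2)[of i h] h mono[of i m] by (auto simp: N_def)
  qed
  have "m \<le> length xs \<Longrightarrow> \<exists>L. subgrp L \<and> fin_index L (N m) \<and> separated L" for m
  proof (induction m)
    case 0
    have "N 0 = {1}" unfolding N_def using gen_least[of "{1::'a}" "{}"] subgrp_one[OF subgrp_gen[of "{}"]]
      by (auto simp: subgrp_def grp_inv_one)
    moreover have "separated {1::'a}" unfolding separated_def by (intro exI[of _ 0] exI[of _ "{}"]) auto
    ultimately show ?case using subN[of 0] fin_index_refl by metis
  next
    case (Suc m)
    then obtain L where L: "subgrp L" "fin_index L (N m)" "separated L" by auto
    define x where "x = xs ! m"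
    have xH: "x \<in> H" using Suc.prems xs(1) gen_superset[of "set xs"] by (auto simp: x_def)
    have nx: "normalizes x (N m)" using nrmlD[OF nrm xH] nrmlD'[OF nrm H xH] by (auto simp: normalizes_def)
    have NS: "N (Suc m) = cyc (N m) x"
    proof -
      have "set (take (Suc m) xs) = insert x (set (take m xs))"
        using Suc.prems by (simp add: x_def take_Suc_conv_app_nth)
      hence "N (Suc m) = gen (insert x (set (take m xs)))" by (simp add: N_def)
      also have "\<dots> = gen (insert x (N m))"
      proof
        show "gen (insert x (set (take m xs))) \<subseteq> gen (insert x (N m))"
          unfolding N_def using gen_superset[of "set (take m xs)"] by (intro gen_mono) auto
        have "N m \<subseteq> gen (insert x (set (take m xs)))" unfolding N_def by (intro gen_mono) auto
        thus "gen (insert x (N m)) \<subseteq> gen (insert x (set (take m xs)))"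
          using gen_superset[of "insert x (set (take m xs))"] by (intro gen_least[OF subgrp_gen]) auto
      qed
      finally show ?thesis by (simp add: gen_insert_cyc[OF subN nx])
    qed
    have fgN: "fin_gen (N m)" unfolding fin_gen_def N_def
      by (intro exI[of _ "set (take m xs)"]) (simp add: gen_superset)
    show ?case
    proof (rule cyclic_ext_or_finite[OF subN nx])
      assume "fin_index (N m) (cyc (N m) x)"
      hence "fin_index L (N (Suc m))" using fin_index_trans[OF L(2)] NS subN[of "Suc m"] by metis
      thus ?thesis using L by blast
    next
      fix j assume "cyclic_ext (cyc (N m) x) (N m) x j"
      then interpret E: cyclic_ext "cyc (N m) x" "N m" x j .
      obtain L' where L': "subgrp L'" "normalizes x L'" "fin_index L' (N m)" "separated L'"
        using invariant_separated_extension[OF fgN nx L] .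
      have sub: "subgrp (cyc L' x)" by (rule subgrp_cyc[OF L'(1,2)])
      have fi: "fin_index (cyc L' x) (cyc (N m) x)" by (rule fin_index_cyc_mono[OF subN nx L'(3,1,2)])
      interpret F: cyclic_ext "cyc L' x" L' x j
        by (rule cyclic_ext_sub[OF \<open>cyclic_ext (cyc (N m) x) (N m) x j\<close> L'(1) fin_index_subset[OF L'(3)] L'(2)])
      have "nilp (cyc L' x)" using nilp_mono[OF assms(2)] fin_index_subset[OF fi] NS NH[of "Suc m"] by auto
      hence "separated (cyc L' x)" using F.separated_extend L'(4) by blast
      thus ?thesis using fi NS sub by metis
    qed
  qed
  from this[of "length xs"] show ?thesis using that xs(1) by (auto simp: N_def)
qed

section \<open>Growth and iterated commutators\<close>

definition wball :: "'a::grp set \<Rightarrow> nat \<Rightarrow> 'a set" where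
  "wball S n = prod_list ` {w \<in> lists S. length w \<le> n}"

lemma wballI: "w \<in> lists S \<Longrightarrow> length w \<le> n \<Longrightarrow> prod_list w \<in> wball S n"
  by (auto simp: wball_def)

lemma wballE:
  assumes "x \<in> wball S n"
  obtains w where "w \<in> lists S" "length w \<le> n" "x = prod_list w"
  using assms by (auto simp: wball_def)

lemma wball_one: "1 \<in> wball S n"
  using wballI[of "[]" S n] by simp

lemma wball_gen: "s \<in> S \<Longrightarrow> 0 < n \<Longrightarrow> s \<in> wball S n"
  using wballI[of "[s]" S n] by simp

lemma wball_mono: "m \<le> n \<Longrightarrow> wball S m \<subseteq> wball S n"
  by (auto simp: wball_def)

lemma wball_mult: "x \<in> wball S m \<Longrightarrow> y \<in> wball S n \<Longrightarrow> x * y \<in> wball S (m + n)"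
proof (elim wballE)
  fix v w assume "v \<in> lists S" "length v \<le> m" "x = prod_list v" "w \<in> lists S" "length w \<le> n" "y = prod_list w"
  thus ?thesis using wballI[of "v @ w" S "m + n"] by simp
qed

lemma wball_inv: "sym_set S \<Longrightarrow> x \<in> wball S n \<Longrightarrow> inverse x \<in> wball S n"
proof (elim wballE)
  fix w assume S: "sym_set S" and w: "w \<in> lists S" "length w \<le> n" "x = prod_list w"
  have "inverse (prod_list w) = prod_list (rev (map inverse w))"
    by (induction w) (simp_all add: grp_inv_one grp_inv_mult)
  moreover have "rev (map inverse w) \<in> lists S" using S w by (auto simp: sym_set_def)
  ultimately show ?thesis using w wballI[of "rev (map inverse w)" S n] by simp
qed

lemma wball_power: "x \<in> wball S m \<Longrightarrow> x ^ k \<in> wball S (k * m)"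
  by (induction k) (auto simp: wball_one intro: wball_mult)

lemma wball_commu:
  assumes "sym_set S" "x \<in> wball S m" "y \<in> wball S n"
  shows "commu x y \<in> wball S (2 * m + 2 * n)"
proof -
  have "commu x y \<in> wball S (m + n + m + n)"
    unfolding commu_def using assms by (intro wball_mult wball_inv)
  thus ?thesis by (simp add: mult_2 add_ac)
qed

lemma finite_wball: "finite S \<Longrightarrow> finite (wball S n)"
proof -
  assume "finite S"
  hence "finite {w. set w \<subseteq> S \<and> length w \<le> n}" by (rule finite_lists_length_le)
  moreover have "{w \<in> lists S. length w \<le> n} = {w. set w \<subseteq> S \<and> length w \<le> n}" by auto
  ultimately show ?thesis by (simp add: wball_def)
qed

lemma wball_subset: "subgrp H \<Longrightarrow> S \<subseteq> H \<Longrightarrow> wball S n \<subseteq> H"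
  by (auto simp: wball_def intro!: subgrp_prod_list)

lemma gen_wball: "sym_set S \<Longrightarrow> x \<in> gen S \<Longrightarrow> \<exists>n. x \<in> wball S n"
  by (auto simp: gen_words wball_def)

text \<open>Quantifying over all finite subsets makes the bound pass to arbitrary subgroups and
  removes any reference to a generating set.\<close>

definition growth :: "nat \<Rightarrow> 'a::grp set \<Rightarrow> bool" where
  "growth d H \<longleftrightarrow> (\<forall>S. finite S \<longrightarrow> S \<subseteq> H \<longrightarrow> (\<exists>C. \<forall>n. card (wball S n) \<le> C * (n + 1) ^ d))"

lemma growth_subset: "growth d H \<Longrightarrow> A \<subseteq> H \<Longrightarrow> growth d A"
  unfolding growth_def by (meson subset_trans)

lemma growthE:
  assumes "growth d H" "finite S" "S \<subseteq> H"
  obtains C where "\<And>n. card (wball S n) \<le> C * (n + 1) ^ d"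
  using assms unfolding growth_def by metis

lemma left_normed_sequence:
  "x \<in> left_normed T m \<Longrightarrow> \<exists>h. h m = x \<and> h 0 \<in> T \<and> (\<forall>i<m. \<exists>t\<in>T. h (Suc i) = commu (h i) t)"
proof (induction m arbitrary: x)
  case (Suc m)
  then obtain y t where y: "y \<in> left_normed T m" "t \<in> T" "x = commu y t" by auto
  then obtain h where h: "h m = y" "h 0 \<in> T" "\<forall>i<m. \<exists>t\<in>T. h (Suc i) = commu (h i) t" using Suc.IH by blast
  show ?case
    by (intro exI[of _ "h(Suc m := x)"]) (use y h in \<open>auto simp: less_Suc_eq\<close>)
qed auto

text \<open>If \<open>h i\<close> is an iterated commutator of weight \<open>i + 1\<close>, the products \<open>h 0 ^ e 0 * \<dots> * h m ^ e m\<close> with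
  exponents below \<open>N\<close> are pairwise distinct because \<open>\<nu> (h i)\<close> decays geometrically,
  while \<open>h i\<close> has length only \<open>O(2 ^ i)\<close>.\<close>

theorem left_normed_null:
  fixes \<nu> :: "'a::grp \<Rightarrow> real"
  assumes T: "finite T" "sym_set T" "T \<subseteq> H" and H: "subgrp H" "growth d H"
    and one: "\<nu> 1 = 0" and nonneg: "\<And>x. x \<in> H \<Longrightarrow> 0 \<le> \<nu> x"
    and mult: "\<And>x y. x \<in> H \<Longrightarrow> y \<in> H \<Longrightarrow> \<nu> (x * y) \<le> \<nu> x + \<nu> y"
    and inv: "\<And>x. x \<in> H \<Longrightarrow> \<nu> (inverse x) = \<nu> x"
    and comm: "\<And>x t. x \<in> H \<Longrightarrow> t \<in> T \<Longrightarrow> \<nu> (commu x t) \<le> \<epsilon> * \<nu> x"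
    and small: "\<And>t. t \<in> T \<Longrightarrow> \<nu> t \<le> \<epsilon>"
    and pow: "\<And>x a. x \<in> H \<Longrightarrow> \<nu> x \<le> \<epsilon> \<Longrightarrow> 0 < a \<Longrightarrow> a < N \<Longrightarrow> \<nu> x / 2 \<le> \<nu> (x ^ a)"
    and N: "N = 2 ^ (d + 1)" and eps: "0 < \<epsilon>" "8 * real N * \<epsilon> < 1"
  shows "\<exists>k. \<forall>x\<in>left_normed T k. \<nu> x = 0"
proof (rule ccontr)
  assume contra: "\<not> ?thesis"
  have "1 \<le> N" unfolding N by (rule one_le_power) simp
  hence N1: "1 \<le> real N" by simp
  have eps2: "\<epsilon> \<le> 1/2"
  proof -
    have "1 * \<epsilon> \<le> real N * \<epsilon>" using N1 eps by (intro mult_right_mono) auto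
    thus ?thesis using eps by linarith
  qed
  obtain C where C: "\<And>n. card (wball T n) \<le> C * (n + 1) ^ d" using growthE[OF H(2) T(1,3)] by blast
  \<comment> \<open>The products with exponents below \<open>N\<close> are \<open>N ^ m\<close>
    distinct elements of a ball of radius \<open>3 * N * 2 ^ m\<close>.\<close>
  have key: "N ^ m \<le> C * (4 * N * 2 ^ m) ^ d" for m
  proof -
    obtain z where z: "z \<in> left_normed T m" "\<nu> z \<noteq> 0" using contra by blast
    obtain h where h: "h m = z" "h 0 \<in> T" "\<And>i. i < m \<Longrightarrow> \<exists>t\<in>T. h (Suc i) = commu (h i) t"
      using left_normed_sequence[OF z(1)] by blast
    have hH: "h i \<in> H" if "i \<le> m" for i
      using that
    proof (induction i)
      case (Suc i)
      thus ?case using h(3)[of i] T(3) by (auto intro!: commu_mem[OF H(1)])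
    qed (use h T in auto)
    have dec: "\<nu> (h (Suc i)) \<le> \<epsilon> * \<nu> (h i)" if "i < m" for i
      using h(3)[OF that] comm[OF hH] that by auto
    have pos: "0 < \<nu> (h i)" if "i \<le> m" for i
      using that
    proof (induction i rule: inc_induct)
      case base
      show ?case using z h nonneg[OF hH[of m]] by simp
    next
      case (step i)
      hence "0 < \<epsilon> * \<nu> (h i)" using dec[of i] by simp
      thus ?case using eps by (simp add: zero_less_mult_iff)
    qed
    have le: "\<nu> (h i) \<le> \<epsilon>" if "i \<le> m" for i
      using that
    proof (induction i)
      case (Suc i)
      have "\<epsilon> * \<nu> (h i) \<le> 1 * \<nu> (h i)" using eps2 pos[of i] Suc by (intro mult_right_mono) auto
      thus ?case using dec[of i] Suc by simp
    qed (use small h in simp)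
    \<comment> \<open>A commutator with a generator turns length \<open>l\<close> into at most
      \<open>2 * l + 2\<close>; starting from 1 this recursion gives
      \<open>3 * 2 ^ i - 2\<close>.\<close>
    have len: "h i \<in> wball T (3 * 2 ^ i - 2)" if "i \<le> m" for i
      using that
    proof (induction i)
      case (Suc i)
      obtain t where t: "t \<in> T" "h (Suc i) = commu (h i) t" using h(3)[of i] Suc by auto
      have "commu (h i) t \<in> wball T (2 * (3 * 2 ^ i - 2) + 2 * 1)"
        by (rule wball_commu[OF T(2) _ wball_gen[OF t(1)]]) (use Suc in auto)
      moreover have "2 * (3 * 2 ^ i - 2) + 2 * 1 \<le> 3 * 2 ^ Suc i - (2::nat)"
      proof -
        have "(1::nat) \<le> 2 ^ i" by simp
        thus ?thesis unfolding power_Suc by arith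
      qed
      ultimately show ?case unfolding t(2) using wball_mono by (meson subsetD)
    qed (use wball_gen[of "h 0" T "Suc 0"] h in simp)
    define Q where "Q = (\<lambda>e k. prod_list (map (\<lambda>i. h i ^ e i) [k..<m]))"
    have Qm: "Q e m = 1" for e by (simp add: Q_def)
    have QS: "Q e k = h k ^ e k * Q e (Suc k)" if "k < m" for e k
      using that by (simp add: Q_def upt_conv_Cons)
    have QH: "k \<le> m \<Longrightarrow> Q e k \<in> H" for e k
      by (induction k rule: inc_induct) (auto simp: Qm QS subgrp_one[OF H(1)] intro!: subgrp_mult[OF H(1)] subgrp_power[OF H(1)] hH)
    have npow: "x \<in> H \<Longrightarrow> \<nu> (x ^ a) \<le> real a * \<nu> x" for x a
    proof (induction a)
      case (Suc a)
      have "\<nu> (x * x ^ a) \<le> \<nu> x + \<nu> (x ^ a)" by (rule mult) (use Suc subgrp_power[OF H(1)] in auto)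
      thus ?case using Suc by (simp add: algebra_simps)
    qed (simp add: one)
    have Qb: "\<nu> (Q e k) \<le> 2 * real N * \<nu> (h k)" if e: "\<And>i. i < m \<Longrightarrow> e i < N" and k: "k \<le> m" for e k
      using k
    proof (induction k rule: inc_induct)
      case base
      show ?case using pos[of m] by (simp add: Qm one)
    next
      case (step k)
      have "\<nu> (Q e k) \<le> \<nu> (h k ^ e k) + \<nu> (Q e (Suc k))"
        using step by (simp add: QS) (intro mult subgrp_power[OF H(1)] hH QH, auto)
      also have "\<dots> \<le> real N * \<nu> (h k) + 2 * real N * \<nu> (h (Suc k))"
      proof (intro add_mono)
        have "\<nu> (h k ^ e k) \<le> real (e k) * \<nu> (h k)" using step hH npow by simp
        also have "\<dots> \<le> real N * \<nu> (h k)" using e[of k] step pos[of k] by (intro mult_right_mono) auto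
        finally show "\<nu> (h k ^ e k) \<le> real N * \<nu> (h k)" .
      qed (use step in simp)
      also have "\<dots> \<le> real N * \<nu> (h k) + 2 * real N * (1/2 * \<nu> (h k))"
      proof -
        have "\<nu> (h (Suc k)) \<le> 1/2 * \<nu> (h k)"
        proof -
          have "\<epsilon> * \<nu> (h k) \<le> 1/2 * \<nu> (h k)" using eps2 pos[of k] step by (intro mult_right_mono) auto
          thus ?thesis using dec[of k] step by linarith
        qed
        thus ?thesis using N1 by (intro add_mono mult_left_mono) auto
      qed
      finally show ?case by (simp add: algebra_simps)
    qed
    \<comment> \<open>At the first exponent that differs, \<open>h k ^ a\<close> is a quotient of
      two tails. Their norms are controlled by \<open>\<nu> (h (Suc k))\<close>, hence by
      \<open>\<epsilon> * \<nu> (h k)\<close>, so the power would have norm below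
      \<open>\<nu> (h k) / 2\<close>, against \<open>pow\<close>.\<close>
    have ne: False if e: "\<And>i. i < m \<Longrightarrow> e i < N" "\<And>i. i < m \<Longrightarrow> e' i < N" and k: "k < m" "e k < e' k" "Q e k = Q e' k" for e e' k
    proof -
      define a where "a = e' k - e k"
      have "h k ^ e k * Q e (Suc k) = h k ^ e k * (h k ^ a * Q e' (Suc k))"
        using k QS by (simp add: a_def power_add [symmetric] mult.assoc [symmetric])
      hence "h k ^ a = Q e (Suc k) * inverse (Q e' (Suc k))" by (simp add: grp_simps)
      hence "\<nu> (h k ^ a) \<le> \<nu> (Q e (Suc k)) + \<nu> (Q e' (Suc k))"
        using mult[OF QH[of "Suc k" e] subgrp_inv[OF H(1) QH[of "Suc k" e']]] inv[OF QH[of "Suc k" e']] k by simp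
      also have "\<dots> \<le> 4 * real N * \<nu> (h (Suc k))" using Qb[of e "Suc k"] Qb[of e' "Suc k"] e k by simp
      also have "\<dots> \<le> 4 * real N * (\<epsilon> * \<nu> (h k))" using dec[OF k(1)] N1 by (intro mult_left_mono) auto
      also have "\<dots> = (8 * real N * \<epsilon>) * \<nu> (h k) / 2" by simp
      also have "\<dots> < 1 * \<nu> (h k) / 2" using eps(2) pos[of k] k by (intro divide_strict_right_mono mult_strict_right_mono) auto
      finally have "\<nu> (h k ^ a) < \<nu> (h k) / 2" by simp
      moreover have "\<nu> (h k) / 2 \<le> \<nu> (h k ^ a)"
      proof (rule pow[OF hH le])
        show "a < N" using e(2)[OF k(1)] by (simp add: a_def)
      qed (use k in \<open>simp_all add: a_def\<close>)
      ultimately show False by simp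
    qed
    have inj: "k \<le> m \<Longrightarrow> Q e k = Q e' k \<Longrightarrow> \<forall>i. k \<le> i \<and> i < m \<longrightarrow> e i = e' i"
      if e: "\<And>i. i < m \<Longrightarrow> e i < N" "\<And>i. i < m \<Longrightarrow> e' i < N" for e e' k
    proof (induction k rule: inc_induct)
      case (step k)
      have ek: "e k = e' k" using ne[of e e' k] ne[of e' e k] e step by (metis nat_neq_iff)
      hence "Q e (Suc k) = Q e' (Suc k)" using step QS by (simp add: grp_simps)
      thus ?case using step.IH ek by (metis Suc_leI le_neq_implies_less)
    qed simp
    have Ql: "Q e k \<in> wball T (3 * N * (2 ^ m - 2 ^ k))" if e: "\<And>i. i < m \<Longrightarrow> e i < N" and k: "k \<le> m" for e k
      using k
    proof (induction k rule: inc_induct)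
      case base
      show ?case by (simp add: Qm wball_one)
    next
      case (step k)
      have "h k ^ e k \<in> wball T (e k * (3 * 2 ^ k - 2))" using len step by (intro wball_power) auto
      hence "Q e k \<in> wball T (e k * (3 * 2 ^ k - 2) + 3 * N * (2 ^ m - 2 ^ Suc k))"
        using step QS wball_mult by metis
      moreover have "e k * (3 * 2 ^ k - 2) + 3 * N * (2 ^ m - 2 ^ Suc k) \<le> 3 * N * (2 ^ m - 2 ^ k)"
      proof -
        have "e k * (3 * 2 ^ k - 2) \<le> N * (3 * 2 ^ k)" using e[of k] step by (intro mult_le_mono) auto
        moreover have "(2::nat) ^ Suc k \<le> 2 ^ m" using step by (intro power_increasing) auto
        hence "(2::nat) ^ m - 2 ^ k = (2 ^ m - 2 ^ Suc k) + 2 ^ k" by simp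
        hence "3 * N * (2 ^ m - 2 ^ k) = 3 * N * (2 ^ m - 2 ^ Suc k) + N * (3 * 2 ^ k)"
          by (simp only: distrib_left)
        ultimately show ?thesis by linarith
      qed
      ultimately show ?case using wball_mono by (meson subsetD)
    qed
    define E where "E = PiE {..<m} (\<lambda>_. {..<N})"
    have EN: "e i < N" if "e \<in> E" "i < m" for e i using that by (auto simp: E_def PiE_def)
    have "card E = N ^ m" by (simp add: E_def card_PiE)
    moreover have "card E \<le> card (wball T (3 * N * 2 ^ m))"
    proof (rule card_inj_on_le)
      show "inj_on (\<lambda>e. Q e 0) E"
      proof (rule inj_onI)
        fix e e' assume ee: "e \<in> E" "e' \<in> E" "Q e 0 = Q e' 0"
        hence "\<forall>i. 0 \<le> i \<and> i < m \<longrightarrow> e i = e' i" using inj[of e e' 0] EN by blast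
        thus "e = e'" using ee by (intro PiE_ext[of e "{..<m}" "\<lambda>_. {..<N}" e']) (auto simp: E_def)
      qed
      have "Q e 0 \<in> wball T (3 * N * 2 ^ m)" if "e \<in> E" for e
        using Ql[of e 0] EN[OF that] wball_mono[of "3 * N * (2 ^ m - 2 ^ 0)" "3 * N * 2 ^ m" T] by auto
      thus "(\<lambda>e. Q e 0) ` E \<subseteq> wball T (3 * N * 2 ^ m)" by auto
      show "finite (wball T (3 * N * 2 ^ m))" by (rule finite_wball[OF T(1)])
    qed
    moreover have "card (wball T (3 * N * 2 ^ m)) \<le> C * (3 * N * 2 ^ m + 1) ^ d" by (rule C)
    moreover have "C * (3 * N * 2 ^ m + 1) ^ d \<le> C * (4 * N * 2 ^ m) ^ d"
    proof -
      have "1 \<le> N * 2 ^ m" by (simp add: N)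
      thus ?thesis by (intro mult_le_mono2 power_mono) auto
    qed
    ultimately show ?thesis by linarith
  qed
  \<comment> \<open>This is where \<open>N = 2 ^ (d + 1)\<close> enters: the factor
    \<open>(2 ^ d) ^ m\<close> coming from the radius cancels, and a bounded power of 2
    remains.\<close>
  have "2 ^ m \<le> C * (4 * N) ^ d" for m
  proof -
    have "(2 ^ d) ^ m * 2 ^ m \<le> (2 ^ d) ^ m * (C * (4 * N) ^ d)"
      using key[of m] by (simp add: N power_mult_distrib power_mult [symmetric] power_add algebra_simps)
    thus ?thesis by simp
  qed
  from this[of "C * (4 * N) ^ d"] show False using less_exp[of "C * (4 * N) ^ d"] by linarith
qed

section \<open>Cyclic extensions of separated groups with polynomial growth\<close>

text \<open>By induction on the degree the differences along generators are divisible by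
  \<open>p\<close> everywhere, so divisibility spreads from 1 along words. In consequence a
  polynomial modulo \<open>p\<close> is determined by its values on a finite ball.\<close>

lemma pol_dvd_wball:
  assumes "sym_set S" "gen S = L"
  shows "pol k L f \<Longrightarrow> (\<And>w. w \<in> wball S k \<Longrightarrow> p dvd f w) \<Longrightarrow> x \<in> L \<Longrightarrow> p dvd f x"
proof (induction k arbitrary: f x)
  case (Suc k)
  have L: "subgrp L" using assms(2) subgrp_gen by auto
  have SL: "S \<subseteq> L" using assms(2) gen_superset by auto
  have step: "p dvd f (y * s) - f y" if s: "s \<in> S" "y \<in> L" for y s
  proof (rule Suc.IH[of "\<lambda>y. f (y * s) - f y"])
    show "pol k L (\<lambda>y. f (y * s) - f y)" using Suc.prems(1) s SL by auto
    fix w assume "w \<in> wball S k"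
    thus "p dvd f (w * s) - f w"
      using Suc.prems(2) wball_mult[OF _ wball_gen[OF s(1), of 1], of w k] wball_mono[of k "Suc k" S] by (auto intro!: dvd_diff)
  qed (rule s(2))
  have "w \<in> lists S \<Longrightarrow> p dvd f (prod_list w)" for w
  proof (induction w rule: rev_induct)
    case Nil
    show ?case using Suc.prems(2)[OF wball_one] by simp
  next
    case (snoc s w)
    have "p dvd f (prod_list w * s) - f (prod_list w)" using snoc SL subgrp_prod_list[OF L, of w] by (intro step) auto
    from dvd_add[OF this snoc.IH] snoc.prems show ?case by simp
  qed
  thus ?case using Suc.prems(3) assms gen_words[OF assms(1)] by auto
qed simp

text \<open>\<open>D i\<close> consists of the elements whose action on \<open>L\<close> changes no
  polynomial of degree less than \<open>k\<close> modulo \<open>p ^ i\<close>. Mixed differences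
  gain the product of the moduli, so a commutator of \<open>D i\<close> with \<open>D 1\<close>
  falls into \<open>D (Suc i)\<close>, and exponents below \<open>p\<close> do not raise the level.
  These are the hypotheses of \<open>left_normed_null\<close> for the p-adic norm; it makes long
  commutators act trivially modulo every power of \<open>p\<close>, and separation on
  \<open>L\<close> turns this into triviality.\<close>

theorem (in cyclic_ext) fin_index_nilp:
  assumes "growth d H" "fin_gen H" "fin_gen L" "separated L"
  obtains D where "subgrp D" "fin_index D H" "nilp D"
proof -
  obtain k F where F: "\<And>f. f \<in> F \<Longrightarrow> pol k L f" "\<And>x. x \<in> L \<Longrightarrow> x \<noteq> 1 \<Longrightarrow> \<exists>f\<in>F. f x \<noteq> f 1"
    using assms(4) unfolding separated_def by metis
  obtain S where S: "finite S" "S \<subseteq> L" "gen S = L" "sym_set S" using fin_gen_sym[OF assms(3)] by metis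
  define N :: nat where "N = 2 ^ (d + 1)"
  \<comment> \<open>The contraction factor will be \<open>1 / p\<close>, so \<open>8 * N < p\<close>
    is the smallness condition of \<open>left_normed_null\<close>; it also keeps exponents below
    \<open>N\<close> prime to \<open>p\<close>.\<close>
  obtain p :: nat where p: "Factorial_Ring.prime p" "8 * N < p" using bigger_prime by blast
  have p1: "1 < p" using p prime_gt_1_nat by blast
  define D where "D = (\<lambda>i. {h \<in> H. \<forall>f. pol k L f \<longrightarrow> (\<forall>x\<in>L. int p ^ i dvd f (act x h) - f x)})"
  have D0: "D 0 = H" by (simp add: D_def)
  have DH: "D i \<subseteq> H" for i by (auto simp: D_def)
  have DI: "h \<in> D i" if "h \<in> H" "\<And>f x. pol k L f \<Longrightarrow> x \<in> L \<Longrightarrow> int p ^ i dvd f (act x h) - f x" for h i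
    using that by (auto simp: D_def)
  have DD: "int p ^ i dvd f (act x h) - f x" if "h \<in> D i" "pol k L f" "x \<in> L" for h i f x
    using that by (auto simp: D_def)
  have dec: "D j \<subseteq> D i" if "i \<le> j" for i j
    using that unfolding D_def by (auto intro: power_le_dvd)
  have sub: "subgrp (D i)" for i
  proof (rule subgrpI)
    show "1 \<in> D i" by (rule DI) (auto simp: act_one subgrp_one[OF H])
    show "g * h \<in> D i" if "g \<in> D i" "h \<in> D i" for g h
    proof (rule DI)
      show "g * h \<in> H" using that DH subgrp_mult[OF H] by blast
      fix f x assume f: "pol k L f" and x: "x \<in> L"
      have gH: "g \<in> H" "h \<in> H" using that DH by auto
      have "int p ^ i dvd (f (act (act x g) h) - f (act x g)) + (f (act x g) - f x)"
        by (intro dvd_add DD[OF that(1) f x] DD[OF that(2) f act_mem[OF x gH(1)]])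
      thus "int p ^ i dvd f (act x (g * h)) - f x" by (simp add: act_mult[OF x gH])
    qed
    show "inverse h \<in> D i" if "h \<in> D i" for h
    proof (rule DI)
      have hH: "h \<in> H" "inverse h \<in> H" using that DH subgrp_inv[OF H] by auto
      thus "inverse h \<in> H" by simp
      fix f x assume f: "pol k L f" and x: "x \<in> L"
      have "int p ^ i dvd f (act (act x (inverse h)) h) - f (act x (inverse h))"
        by (rule DD[OF that f act_mem[OF x hH(2)]])
      hence "int p ^ i dvd f x - f (act x (inverse h))"
        by (simp add: act_mult[OF x hH(2,1), symmetric] grp_simps act_one)
      thus "int p ^ i dvd f (act x (inverse h)) - f x" by (simp add: dvd_diff_commute)
    qed
  qed
  have quot: "pol k L (\<lambda>x. (f (act x h) - f x) div int p ^ i)" if "h \<in> D i" "pol k L f" for h i f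
  proof -
    have "h \<in> H" using that DH by blast
    hence "pol k L (\<lambda>x. f (act x h) - f x)" using pol_diff[OF pol_act[OF that(2)] that(2)] by blast
    hence "pol k L (\<lambda>x. int p ^ i * ((f (act x h) - f x) div int p ^ i))"
      by (rule pol_cong[OF subgrp_L]) (simp add: DD[OF that])
    thus ?thesis by (rule pol_cancel) (use p1 in simp)
  qed
  \<comment> \<open>The difference along \<open>h\<close>, divided by \<open>p ^ i\<close>, is again
    a polynomial of degree less than \<open>k\<close>, so \<open>g\<close> changes it by a multiple
    of \<open>p ^ i'\<close>.\<close>
  have mixed: "int p ^ (i + i') dvd (f (act x (g * h)) - f (act x g)) - (f (act x h) - f x)"
    if g: "g \<in> D i'" and h: "h \<in> D i" and f: "pol k L f" and x: "x \<in> L" for g h f x i i'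
  proof -
    have gH: "g \<in> H" "h \<in> H" using g h DH by auto
    define f1 where "f1 = (\<lambda>x. (f (act x h) - f x) div int p ^ i)"
    have f1: "int p ^ i * f1 y = f (act y h) - f y" if "y \<in> L" for y
      using DD[OF h f that] by (simp add: f1_def)
    have "int p ^ i * int p ^ i' dvd int p ^ i * (f1 (act x g) - f1 x)"
      by (intro mult_dvd_mono dvd_refl DD[OF g _ x]) (use quot[OF h f] f1_def in simp)
    thus ?thesis by (simp add: right_diff_distrib f1[OF act_mem[OF x gH(1)]] f1[OF x] act_mult[OF x gH] power_add)
  qed
  have comm: "commu h g \<in> D (Suc i)" if h: "h \<in> D i" and g: "g \<in> D 1" for h g i
  proof (rule DI)
    have gH: "g \<in> H" "h \<in> H" using g h DH by auto
    thus "commu h g \<in> H" by (simp add: commu_mem[OF H])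
    fix f x assume f: "pol k L f" and x: "x \<in> L"
    \<comment> \<open>Multiplied by \<open>u\<close>, the product \<open>g * h\<close> becomes 1 and
      \<open>h * g\<close> becomes the commutator. Subtracting the two mixed differences for
      \<open>\<lambda>x. f (act x u)\<close> leaves exactly the wanted difference.\<close>
    define u where "u = inverse h * inverse g"
    have uH: "u \<in> H" using gH by (simp add: u_def subgrp_mem[OF H])
    have "pol k L (\<lambda>x. f (act x u))" by (rule pol_act[OF f uH])
    from dvd_diff[OF mixed[OF g h this x] mixed[OF h g this x, unfolded add.commute[of 1 i]]]
    have "int p ^ Suc i dvd f (act (act x (g * h)) u) - f (act (act x (h * g)) u)"
      by (simp add: algebra_simps)
    moreover have "act (act x (h * g)) u = act x (commu h g)"
      using act_mult[OF x _ uH, of "h * g"] gH by (simp add: subgrp_mem[OF H] commu_def u_def mult.assoc)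
    moreover have "act (act x (g * h)) u = x"
      using act_mult[OF x _ uH, of "g * h"] gH by (simp add: subgrp_mem[OF H] u_def grp_simps act_one)
    ultimately show "int p ^ Suc i dvd f (act x (commu h g)) - f x" by (simp add: dvd_diff_commute)
  qed
  \<comment> \<open>Modulo \<open>p ^ Suc i\<close> the displacement by \<open>h ^ b\<close> is
    \<open>b\<close> times the displacement by \<open>h\<close>; the induction uses that
    \<open>h ^ b\<close> lies in \<open>D 1\<close>, hence the condition
    \<open>1 \<le> i\<close>.\<close>
  have pow: "h ^ a \<notin> D (Suc i)" if h: "h \<in> D i" "h \<notin> D (Suc i)" and i: "1 \<le> i" and a: "0 < a" "a < p" for h a i
  proof
    assume ha: "h ^ a \<in> D (Suc i)"
    have hH: "h \<in> H" using h DH by auto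
    obtain f x where f: "pol k L f" and x: "x \<in> L" and nd: "\<not> int p ^ Suc i dvd f (act x h) - f x"
      using h DI[OF hH, of "Suc i"] by blast
    have "int p ^ Suc i dvd (f (act x (h ^ b)) - f x) - int b * (f (act x h) - f x)" for b
    proof (induction b)
      case (Suc b)
      have hb: "h ^ b \<in> D 1" using subgrp_power[OF sub] h(1) dec[OF i] by blast
      have "int p ^ (i + 1) dvd (f (act x (h ^ b * h)) - f (act x (h ^ b))) - (f (act x h) - f x)"
        by (rule mixed[OF hb h(1) f x])
      from dvd_add[OF this[simplified] Suc[simplified]] show ?case by (simp add: power_commutes algebra_simps)
    qed (simp add: act_one)
    from dvd_diff[OF DD[OF ha f x] this[of a]] have "int p ^ Suc i dvd int a * (f (act x h) - f x)" by simp
    moreover have "coprime (int p ^ Suc i) (int a)"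
    proof -
      have "coprime p a" using p(1) a by (metis nat_dvd_not_less prime_imp_coprime)
      thus ?thesis by (simp add: coprime_int_iff del: power_Suc)
    qed
    ultimately show False using nd by (simp add: coprime_dvd_mult_right_iff del: power_Suc)
  qed
  have fin: "fin_index (D 1) H"
  proof -
    \<comment> \<open>The polynomials reduced modulo \<open>p\<close>: a finite set by
      \<open>pol_dvd_wball\<close>. An element of \<open>H\<close> is coloured by the map it induces
      on this set.\<close>
    define \<Phi> where "\<Phi> = {restrict (\<lambda>x. f x mod int p) L | f. pol k L f}"
    have "finite \<Phi>"
    proof (rule inj_on_finite)
      show "inj_on (\<lambda>\<phi>. restrict \<phi> (wball S k)) \<Phi>"
      proof (rule inj_onI)
        fix \<phi> \<psi> assume "\<phi> \<in> \<Phi>" "\<psi> \<in> \<Phi>" and e: "restrict \<phi> (wball S k) = restrict \<psi> (wball S k)"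
        then obtain f g where f: "pol k L f" "\<phi> = restrict (\<lambda>x. f x mod int p) L"
          and g: "pol k L g" "\<psi> = restrict (\<lambda>x. g x mod int p) L" by (auto simp: \<Phi>_def)
        have "f w mod int p = g w mod int p" if "w \<in> wball S k" for w
          using fun_cong[OF e, of w] that f g wball_subset[OF subgrp_L S(2), of k] by (auto simp: subset_iff)
        hence "int p dvd f x - g x" if "x \<in> L" for x
          using pol_dvd_wball[OF S(4,3) pol_diff[OF f(1) g(1)] _ that] by (simp add: mod_eq_dvd_iff)
        thus "\<phi> = \<psi>" using f g by (auto simp: fun_eq_iff restrict_def mod_eq_dvd_iff)
      qed
      show "(\<lambda>\<phi>. restrict \<phi> (wball S k)) ` \<Phi> \<subseteq> PiE (wball S k) (\<lambda>_. {0..<int p})"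
        using wball_subset[OF subgrp_L S(2), of k] p1 by (auto simp: \<Phi>_def subset_iff)
      show "finite (PiE (wball S k) (\<lambda>_. {0..<int p}))" by (intro finite_PiE finite_wball S(1)) auto
    qed
    define c where "c = (\<lambda>h. restrict (\<lambda>\<phi>. restrict (\<lambda>x. \<phi> (act x h)) L) \<Phi>)"
    have "c h \<in> PiE \<Phi> (\<lambda>_. \<Phi>)" if h: "h \<in> H" for h
    proof -
      have "restrict (\<lambda>x. \<phi> (act x h)) L \<in> \<Phi>" if \<phi>: "\<phi> \<in> \<Phi>" for \<phi>
      proof -
        obtain f where f: "pol k L f" "\<phi> = restrict (\<lambda>x. f x mod int p) L" using \<phi> by (auto simp: \<Phi>_def)
        have "restrict (\<lambda>x. \<phi> (act x h)) L = restrict (\<lambda>x. f (act x h) mod int p) L"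
          using f act_mem[OF _ h] by (auto simp: fun_eq_iff restrict_def)
        thus ?thesis unfolding \<Phi>_def
          by (intro CollectI exI[of _ "\<lambda>x. f (act x h)"] conjI pol_act[OF f(1) h])
      qed
      thus ?thesis by (simp add: c_def)
    qed
    hence "c ` H \<subseteq> PiE \<Phi> (\<lambda>_. \<Phi>)" by (rule image_subsetI)
    hence "finite (c ` H)" by (rule finite_subset) (intro finite_PiE \<open>finite \<Phi>\<close>)
    thus ?thesis
    proof (rule fin_index_colouring[OF _ DH])
      fix g h assume gh: "g \<in> H" "h \<in> H" "c g = c h"
      note ih = subgrp_inv[OF H gh(2)]
      show "g * inverse h \<in> D 1"
      proof (rule DI)
        show "g * inverse h \<in> H" using gh ih by (simp add: subgrp_mult[OF H])
        fix f x assume f: "pol k L f" and x: "x \<in> L"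
        have f': "pol k L (\<lambda>x. f (act x (inverse h)))" by (rule pol_act[OF f ih])
        define \<phi> where "\<phi> = restrict (\<lambda>x. f (act x (inverse h)) mod int p) L"
        have "\<phi> \<in> \<Phi>" unfolding \<Phi>_def \<phi>_def
          by (intro CollectI exI[of _ "\<lambda>x. f (act x (inverse h))"] conjI refl f')
        hence "\<phi> (act x g) = \<phi> (act x h)" using fun_cong[OF fun_cong[OF gh(3), of \<phi>], of x] x by (simp add: c_def)
        hence "f (act (act x g) (inverse h)) mod int p = f (act (act x h) (inverse h)) mod int p"
          using x act_mem gh by (simp add: \<phi>_def)
        hence "f (act x (g * inverse h)) mod int p = f x mod int p"
          using act_mult[OF x gh(1) ih] act_mult[OF x gh(2) ih] by (simp add: grp_simps act_one)
        thus "int p ^ 1 dvd f (act x (g * inverse h)) - f x" by (simp add: mod_eq_dvd_iff)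
      qed
    qed
  qed
  obtain T where T: "finite T" "T \<subseteq> D 1" "gen T = D 1" "sym_set T"
    using fin_gen_sym[OF fin_gen_fin_index[OF assms(2) fin sub]] by metis
  define \<nu> :: "'a \<Rightarrow> real" where "\<nu> = (\<lambda>h. if \<forall>i. h \<in> D i then 0 else (1 / real p) ^ (LEAST i. h \<notin> D i))"
  have nu_ge: "(1 / real p) ^ i \<le> \<nu> h" if "h \<notin> D i" for h i
    unfolding \<nu>_def using that p1 Least_le[of "\<lambda>i. h \<notin> D i", OF that] by (auto intro!: power_decreasing)
  have nu_le: "\<nu> h \<le> (1 / real p) ^ i" if "\<And>i'. i' < i \<Longrightarrow> h \<in> D i'" for h i
  proof (cases "\<forall>i. h \<in> D i")
    case False
    hence "h \<notin> D (LEAST i. h \<notin> D i)" by (metis (mono_tags, lifting) LeastI)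
    hence "i \<le> (LEAST i. h \<notin> D i)" using that not_le by blast
    thus ?thesis using p1 False by (auto simp: \<nu>_def intro!: power_decreasing)
  qed (simp add: \<nu>_def)
  have nu_nonneg: "0 \<le> \<nu> h" for h by (simp add: \<nu>_def)
  have nu_cases: "\<nu> h = 0 \<and> (\<forall>i. h \<in> D i) \<or> (\<exists>i. h \<notin> D i \<and> \<nu> h = (1 / real p) ^ i \<and> (\<forall>i'<i. h \<in> D i'))" for h
  proof (cases "\<forall>i. h \<in> D i")
    case False
    hence "h \<notin> D (LEAST i. h \<notin> D i)" by (metis (mono_tags, lifting) LeastI)
    moreover have "\<forall>i'<LEAST i. h \<notin> D i. h \<in> D i'" using not_less_Least by blast
    moreover have "\<nu> h = (1 / real p) ^ (LEAST i. h \<notin> D i)" unfolding \<nu>_def using False by (rule if_not_P)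
    ultimately show ?thesis by (intro disjI2 exI[of _ "LEAST i. h \<notin> D i"] conjI)
  qed (simp add: \<nu>_def)
  have nu_mult: "\<nu> (x * y) \<le> \<nu> x + \<nu> y" for x y
    using nu_cases[of "x * y"]
  proof (elim disjE exE)
    fix i assume i: "x * y \<notin> D i \<and> \<nu> (x * y) = (1 / real p) ^ i \<and> (\<forall>i'<i. x * y \<in> D i')"
    hence "x \<notin> D i \<or> y \<notin> D i" using subgrp_mult[OF sub] by blast
    thus ?thesis using nu_ge[of x i] nu_ge[of y i] nu_nonneg[of x] nu_nonneg[of y] i by auto
  qed (use nu_nonneg[of x] nu_nonneg[of y] in auto)
  have nu_inv: "\<nu> (inverse x) = \<nu> x" for x
  proof -
    have "inverse x \<in> D i \<longleftrightarrow> x \<in> D i" for i using subgrp_inv[OF sub] by (metis grp_inv_inv)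
    thus ?thesis by (simp add: \<nu>_def)
  qed
  have nu_comm: "\<nu> (commu x t) \<le> (1 / real p) * \<nu> x" if x: "x \<in> D 1" and t: "t \<in> T" for x t
  proof -
    have tD: "t \<in> D 1" using t T(2) by blast
    have c0: "commu x t \<in> D 0" using commu_mem[OF sub x tD] dec[of 0 1] by auto
    from nu_cases[of x] show ?thesis
    proof (elim disjE exE)
      assume "\<nu> x = 0 \<and> (\<forall>i. x \<in> D i)"
      hence "commu x t \<in> D i" for i using comm[OF _ tD] c0 by (cases i) auto
      thus ?thesis using nu_nonneg[of x] by (simp add: \<nu>_def)
    next
      fix i assume i: "x \<notin> D i \<and> \<nu> x = (1 / real p) ^ i \<and> (\<forall>i'<i. x \<in> D i')"
      have "\<nu> (commu x t) \<le> (1 / real p) ^ Suc i"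
      proof (rule nu_le)
        fix i' assume "i' < Suc i"
        thus "commu x t \<in> D i'" using comm[OF _ tD] c0 i by (cases i') auto
      qed
      thus ?thesis using i by simp
    qed
  qed
  have "\<exists>k. \<forall>x\<in>left_normed T k. \<nu> x = 0"
  proof (rule left_normed_null[OF T(1,4,2) sub growth_subset[OF assms(1) DH], where N = N and \<epsilon> = "1 / real p"])
    show "\<nu> 1 = 0" using subgrp_one[OF sub] by (simp add: \<nu>_def)
    show "\<nu> t \<le> 1 / real p" if "t \<in> T" for t
      using nu_le[of 1 t] that T(2) dec[of 0 1] by auto
    show "\<nu> x / 2 \<le> \<nu> (x ^ a)" if x: "x \<in> D 1" and a: "0 < a" "a < N" for x a
      using nu_cases[of x]
    proof (elim disjE exE)
      fix i assume i: "x \<notin> D i \<and> \<nu> x = (1 / real p) ^ i \<and> (\<forall>i'<i. x \<in> D i')"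
      \<comment> \<open>\<open>x\<close> lies in \<open>D 0\<close> and in \<open>D 1\<close>, so
        the first level it misses is at least 2 and the preceding one is at least 1, as
        \<open>pow\<close> demands.\<close>
      have "i \<noteq> 0" using i x dec[of 0 1] by (metis subsetD zero_le)
      moreover have "i \<noteq> 1" using i x by metis
      ultimately have "2 \<le> i" by simp
      then obtain i' where i': "i = Suc i'" "1 \<le> i'" by (cases i) auto
      have "x ^ a \<notin> D i" using pow[of x i' a] i i' a p(2) by auto
      from nu_ge[OF this] i nu_nonneg[of x] show ?thesis by linarith
    qed (use nu_nonneg in auto)
    show "8 * real N * (1 / real p) < 1" using p by (simp add: divide_simps)
    show "0 < 1 / real p" using p1 by simp
  qed (use nu_nonneg nu_mult nu_inv nu_comm N_def in auto)
  then obtain K where K: "\<And>x. x \<in> left_normed T K \<Longrightarrow> \<nu> x = 0" by blast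
  \<comment> \<open>One further commutator guarantees that the element lies in \<open>L\<close>,
    where the polynomials separate it from 1.\<close>
  have "left_normed T (Suc K) \<subseteq> {1}"
  proof
    fix y assume "y \<in> left_normed T (Suc K)"
    then obtain x t where xt: "x \<in> left_normed T K" "t \<in> T" "y = commu x t" by auto
    have x1: "x \<in> D 1" using xt left_normed_subset[OF sub T(2)] by blast
    have "\<nu> y \<le> (1 / real p) * \<nu> x" using nu_comm[OF x1 xt(2)] xt(3) by simp
    hence "\<nu> y = 0" using K[OF xt(1)] nu_nonneg[of y] by simp
    hence yD: "y \<in> D i" for i using nu_cases[of y] p1 by auto
    have yL: "y \<in> L" unfolding xt(3) by (rule commu_in_L) (use x1 xt T(2) DH in blast)+
    show "y \<in> {1}"
    proof (rule ccontr)
      assume "y \<notin> {1}"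
      then obtain f where f: "f \<in> F" "f y \<noteq> f 1" using F(2)[OF yL] by blast
      have "int p ^ i dvd f y - f 1" for i
        using DD[OF yD F(1)[OF f(1)] subgrp_one[OF subgrp_L], of i] yL by (simp add: act_L)
      \<comment> \<open>The exponent is the absolute value of the number itself, because
        \<open>n < p ^ n\<close> then excludes divisibility of a nonzero number.\<close>
      hence *: "int p ^ nat \<bar>f y - f 1\<bar> dvd f y - f 1" by blast
      have "\<bar>f y - f 1\<bar> < int p ^ nat \<bar>f y - f 1\<bar>"
      proof -
        have "nat \<bar>f y - f 1\<bar> < 2 ^ nat \<bar>f y - f 1\<bar>" by (rule less_exp)
        also have "\<dots> \<le> p ^ nat \<bar>f y - f 1\<bar>" using p1 by (intro power_mono) auto
        finally show ?thesis by (simp add: nat_less_iff)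
      qed
      thus False using * f(2) by (metis abs_of_nat dvd_imp_le_int linorder_not_less of_nat_power right_minus_eq)
    qed
  qed
  hence "nilp (D 1)" by (rule nilp_generators[OF T(3)])
  thus ?thesis using that[of "D 1"] sub fin by blast
qed

section \<open>Finitely supported functions and the lazy averaging operator\<close>

text \<open>The l2 argument only ever involves finitely supported functions, so sums over the whole
  type, with their invariance under translations, replace infinite series.\<close>

definition finsupp :: "('a \<Rightarrow> real) \<Rightarrow> bool" where
  "finsupp f \<longleftrightarrow> finite {x. f x \<noteq> 0}"

definition tot :: "('a \<Rightarrow> real) \<Rightarrow> real" where
  "tot f = (\<Sum>x\<in>{x. f x \<noteq> 0}. f x)"

lemma tot_superset: "finite A \<Longrightarrow> {x. f x \<noteq> 0} \<subseteq> A \<Longrightarrow> tot f = sum f A"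
  unfolding tot_def by (rule sum.mono_neutral_left) auto

lemma tot_eq:
  assumes "finite A" "\<And>x. x \<notin> A \<Longrightarrow> f x = 0"
  shows "tot f = sum f A"
proof (rule tot_superset[OF assms(1)])
  show "{x. f x \<noteq> 0} \<subseteq> A"
  proof
    fix x assume "x \<in> {x. f x \<noteq> 0}"
    thus "x \<in> A" using assms(2)[of x] by auto
  qed
qed

lemma finsuppI:
  assumes "finite A" "\<And>x. x \<notin> A \<Longrightarrow> f x = 0"
  shows "finsupp f"
  unfolding finsupp_def
proof (rule finite_subset[OF _ assms(1)])
  show "{x. f x \<noteq> 0} \<subseteq> A"
  proof
    fix x assume "x \<in> {x. f x \<noteq> 0}"
    thus "x \<in> A" using assms(2)[of x] by auto
  qed
qed

lemma support_add: "{x. f x + g x \<noteq> (0::real)} \<subseteq> {x. f x \<noteq> 0} \<union> {x. g x \<noteq> 0}"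
  and support_diff: "{x. f x - g x \<noteq> (0::real)} \<subseteq> {x. f x \<noteq> 0} \<union> {x. g x \<noteq> 0}"
proof safe
  fix x assume "f x + g x \<noteq> 0" "g x = 0" thus "f x = 0 \<Longrightarrow> False" by simp
next
  fix x assume "f x - g x \<noteq> 0" "g x = 0" thus "f x = 0 \<Longrightarrow> False" by simp
qed

lemma finsupp_add: "finsupp f \<Longrightarrow> finsupp g \<Longrightarrow> finsupp (\<lambda>x. f x + g x)"
  unfolding finsupp_def by (rule finite_subset[OF support_add]) simp

lemma finsupp_diff: "finsupp f \<Longrightarrow> finsupp g \<Longrightarrow> finsupp (\<lambda>x. f x - g x)"
  unfolding finsupp_def by (rule finite_subset[OF support_diff]) simp

lemma finsupp_mult1: "finsupp f \<Longrightarrow> finsupp (\<lambda>x. f x * g x)"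
  unfolding finsupp_def by (rule finite_subset[of _ "{x. f x \<noteq> 0}"]) auto

lemma finsupp_mult2: "finsupp g \<Longrightarrow> finsupp (\<lambda>x. f x * g x)"
  unfolding finsupp_def by (rule finite_subset[of _ "{x. g x \<noteq> 0}"]) auto

lemma finsupp_divide: "finsupp f \<Longrightarrow> finsupp (\<lambda>x. f x / c)"
  unfolding finsupp_def by (rule finite_subset[of _ "{x. f x \<noteq> 0}"]) auto

lemma finsupp_power: "finsupp f \<Longrightarrow> finsupp (\<lambda>x. (f x)\<^sup>2)"
  unfolding finsupp_def by auto

lemma finsupp_sum: "finite I \<Longrightarrow> (\<And>i. i \<in> I \<Longrightarrow> finsupp (f i)) \<Longrightarrow> finsupp (\<lambda>x. \<Sum>i\<in>I. f i x)"
  by (induction I rule: finite_induct) (auto intro: finsupp_add finsuppI[of "{}"])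

lemma finsupp_inj: "finsupp f \<Longrightarrow> inj h \<Longrightarrow> finsupp (\<lambda>x. f (h x))"
  unfolding finsupp_def using finite_vimageI[of "{x. f x \<noteq> 0}" h] by (simp add: vimage_def)

lemma inj_lmult: "inj (\<lambda>x::'a::grp. g * x)" and inj_rmult: "inj (\<lambda>x::'a::grp. x * g)"
  by (auto simp: inj_def grp_left_cancel grp_right_cancel)

lemmas finsupp_shift = finsupp_inj[OF _ inj_lmult] finsupp_inj[OF _ inj_rmult]

lemmas finsupp_intros = finsupp_add finsupp_diff finsupp_mult1 finsupp_divide finsupp_power finsupp_sum

lemma tot_add:
  assumes "finsupp f" "finsupp g"
  shows "tot (\<lambda>x. f x + g x) = tot f + tot g"
proof -
  let ?A = "{x. f x \<noteq> 0} \<union> {x. g x \<noteq> 0}"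
  have "finite ?A" using assms by (simp add: finsupp_def)
  moreover have "{x. f x \<noteq> 0} \<subseteq> ?A" "{x. g x \<noteq> 0} \<subseteq> ?A" by auto
  moreover note support_add[of f g]
  ultimately show ?thesis by (simp only: tot_superset sum.distrib)
qed

lemma tot_cmult: "tot (\<lambda>x. c * f x) = c * tot f"
proof (cases "c = 0")
  case True thus ?thesis by (simp add: tot_def)
next
  case False thus ?thesis by (simp add: tot_def sum_distrib_left)
qed

lemma tot_divide: "tot (\<lambda>x. f x / c) = tot f / c"
  using tot_cmult[of "1 / c" f] by simp

lemma tot_diff:
  assumes "finsupp f" "finsupp g"
  shows "tot (\<lambda>x. f x - g x) = tot f - tot g"
  using tot_add[of f "\<lambda>x. -1 * g x"] tot_cmult[of "-1" g] assms finsupp_mult2[OF assms(2), of "\<lambda>_. -1"] by simp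

lemma tot_sum:
  "finite I \<Longrightarrow> (\<And>i. i \<in> I \<Longrightarrow> finsupp (f i)) \<Longrightarrow> tot (\<lambda>x. \<Sum>i\<in>I. f i x) = (\<Sum>i\<in>I. tot (f i))"
proof (induction I rule: finite_induct)
  case (insert i I)
  thus ?case by (simp add: tot_add finsupp_sum)
qed (simp add: tot_def)

lemma tot_bij:
  assumes "bij h"
  shows "tot (\<lambda>x. f (h x)) = tot f"
proof -
  have "{x. f x \<noteq> 0} = h ` {x. f (h x) \<noteq> 0}" using bij_is_surj[OF assms] by auto
  thus ?thesis unfolding tot_def
    using sum.reindex[OF inj_on_subset[OF bij_is_inj[OF assms] subset_UNIV], of f "{x. f (h x) \<noteq> 0}"] by simp
qed

lemma bij_lmult: "bij (\<lambda>x::'a::grp. g * x)"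
  by (rule o_bij[of "\<lambda>x. inverse g * x"]) (auto simp: fun_eq_iff grp_simps)

lemma bij_rmult: "bij (\<lambda>x::'a::grp. x * g)"
  by (rule o_bij[of "\<lambda>x. x * inverse g"]) (auto simp: fun_eq_iff grp_simps)

lemma tot_lshift: "tot (\<lambda>x::'a::grp. f (g * x)) = tot f"
  and tot_rshift: "tot (\<lambda>x::'a::grp. f (x * g)) = tot f"
  by (rule tot_bij[OF bij_lmult], rule tot_bij[OF bij_rmult])

lemma tot_nonneg: "(\<And>x. 0 \<le> f x) \<Longrightarrow> 0 \<le> tot f"
  by (simp add: tot_def sum_nonneg)

lemma tot_mono:
  assumes "finsupp f" "finsupp g" "\<And>x. f x \<le> g x"
  shows "tot f \<le> tot g"
  using tot_nonneg[of "\<lambda>x. g x - f x"] assms by (simp add: tot_diff)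

lemma tot_ge_sum:
  assumes "finsupp f" "\<And>x. 0 \<le> f x" "finite A"
  shows "sum f A \<le> tot f"
proof -
  have "tot f = sum f (A \<union> {x. f x \<noteq> 0})" using assms by (intro tot_eq) (auto simp: finsupp_def)
  thus ?thesis using assms by (auto simp: finsupp_def intro: sum_mono2)
qed

lemma tot_ge: "finsupp f \<Longrightarrow> (\<And>x. 0 \<le> f x) \<Longrightarrow> f x \<le> tot f"
  using tot_ge_sum[of f "{x}"] by simp

lemma tot_Cauchy_Schwarz:
  assumes "finsupp f" "finsupp g"
  shows "(tot (\<lambda>x. f x * g x))\<^sup>2 \<le> tot (\<lambda>x. (f x)\<^sup>2) * tot (\<lambda>x. (g x)\<^sup>2)"
proof -
  let ?A = "{x. f x \<noteq> 0} \<union> {x. g x \<noteq> 0}"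
  have A: "finite ?A" using assms by (simp add: finsupp_def)
  have "{x. f x * g x \<noteq> 0} \<subseteq> ?A" "{x. (f x)\<^sup>2 \<noteq> 0} \<subseteq> ?A" "{x. (g x)\<^sup>2 \<noteq> 0} \<subseteq> ?A" by auto
  thus ?thesis using Cauchy_Schwarz_ineq_sum[of f g ?A] A by (simp only: tot_superset)
qed

section \<open>The lazy random walk on a group of polynomial growth\<close>

locale cayley =
  fixes \<Gamma> S :: "'a::grp set" and d :: nat
  assumes fin_S: "finite S" and sym_S: "sym_set S" and one_S: "1 \<in> S" and gen_S: "gen S = \<Gamma>"
    and growth_G: "growth d \<Gamma>"
begin

lemma subgrp_G: "subgrp \<Gamma>"
  using gen_S subgrp_gen by auto

lemma S_sub: "S \<subseteq> \<Gamma>"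
  using gen_S gen_superset by auto

lemma S_mem: "s \<in> S \<Longrightarrow> s \<in> \<Gamma>"
  using S_sub by auto

lemma S_inv: "s \<in> S \<Longrightarrow> inverse s \<in> S"
  using sym_S by (auto simp: sym_set_def)

lemma card_S: "0 < card S"
  using fin_S one_S by (auto simp: card_gt_0_iff)

lemma sum_S_inv: "(\<Sum>s\<in>S. f (inverse s)) = (\<Sum>s\<in>S. f s)"
  by (rule sum.reindex_bij_witness[of _ inverse inverse]) (auto simp: grp_inv_inv S_inv)

definition B :: "nat \<Rightarrow> 'a set" where "B n = wball S n"

lemma fin_B: "finite (B n)"
  by (simp add: B_def finite_wball fin_S)

lemma B_sub: "B n \<subseteq> \<Gamma>"
  unfolding B_def by (rule wball_subset[OF subgrp_G S_sub])

lemma B_one: "1 \<in> B n"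
  by (simp add: B_def wball_one)

lemma B_mono: "m \<le> n \<Longrightarrow> B m \<subseteq> B n"
  unfolding B_def by (rule wball_mono)

lemma B_mult: "x \<in> B m \<Longrightarrow> y \<in> B n \<Longrightarrow> x * y \<in> B (m + n)"
  unfolding B_def by (rule wball_mult)

lemma B_inv: "x \<in> B n \<Longrightarrow> inverse x \<in> B n"
  unfolding B_def by (rule wball_inv[OF sym_S])

lemma S_B: "s \<in> S \<Longrightarrow> s \<in> B (Suc 0)"
  unfolding B_def by (rule wball_gen) auto

lemma B_exhaust: "x \<in> \<Gamma> \<Longrightarrow> \<exists>n. x \<in> B n"
  unfolding B_def using gen_wball[OF sym_S] gen_S by auto

lemma card_B_pos: "0 < card (B n)"
  using fin_B B_one by (auto simp: card_gt_0_iff)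

lemma growth_B: obtains C where "0 < C" "\<And>n. real (card (B n)) \<le> C * (real n + 1) ^ d"
proof -
  obtain C where C: "\<And>n. card (wball S n) \<le> C * (n + 1) ^ d"
    using growthE[OF growth_G fin_S S_sub] by blast
  have "real (card (B n)) \<le> real (C + 1) * (real n + 1) ^ d" for n
  proof -
    have "card (B n) \<le> (C + 1) * (n + 1) ^ d" using C[of n] by (simp add: B_def)
    hence "real (card (B n)) \<le> real ((C + 1) * (n + 1) ^ d)" by (simp only: of_nat_le_iff)
    thus ?thesis by (simp add: algebra_simps)
  qed
  thus ?thesis using that[of "real (C + 1)"] by simp
qed

lemma infinite_card_B:
  assumes "infinite \<Gamma>"
  shows "\<exists>n. k \<le> card (B n)"
proof -
  obtain F where F: "finite F" "card F = k" "F \<subseteq> \<Gamma>" using infinite_arbitrarily_large[OF assms] by blast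
  have "\<exists>n. F \<subseteq> B n" using F(1,3)
  proof (induction F)
    case (insert x F)
    then obtain m n where "x \<in> B m" "F \<subseteq> B n" using B_exhaust[of x] by auto
    thus ?case using B_mono[of m "max m n"] B_mono[of n "max m n"] by (intro exI[of _ "max m n"]) auto
  qed auto
  thus ?thesis using card_mono[OF fin_B] F by metis
qed

text \<open>The lazy half makes this operator positive semidefinite (\<open>ip_T_nonneg\<close>),
  without which the energy of the heat kernel could not be shown to decay step by step.\<close>

definition T :: "('a \<Rightarrow> real) \<Rightarrow> 'a \<Rightarrow> real" where
  "T f = (\<lambda>z. f z / 2 + (\<Sum>s\<in>S. f (s * z)) / (2 * card S))"

definition Q :: "('a \<Rightarrow> real) \<Rightarrow> 'a \<Rightarrow> real" where
  "Q f = (\<lambda>z. f z - T f z)"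

definition ip :: "('a \<Rightarrow> real) \<Rightarrow> ('a \<Rightarrow> real) \<Rightarrow> real" where
  "ip f g = tot (\<lambda>x. f x * g x)"

lemma ip_commute: "ip f g = ip g f"
  by (simp add: ip_def mult.commute)

lemma ip_self: "ip f f = tot (\<lambda>x. (f x)\<^sup>2)"
  by (simp add: ip_def power2_eq_square)

lemma ip_nonneg: "0 \<le> ip f f"
  unfolding ip_self by (rule tot_nonneg) simp

lemma ip_diff_left: "finsupp f \<Longrightarrow> finsupp g \<Longrightarrow> ip (\<lambda>x. f x - g x) h = ip f h - ip g h"
  by (simp add: ip_def left_diff_distrib tot_diff finsupp_intros)

lemma ip_diff_right: "finsupp f \<Longrightarrow> finsupp g \<Longrightarrow> ip h (\<lambda>x. f x - g x) = ip h f - ip h g"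
  using ip_diff_left[of f g h] by (simp add: ip_commute)

lemma finsupp_T:
  assumes "finsupp f"
  shows "finsupp (T f)"
  unfolding T_def by (intro finsupp_intros fin_S assms finsupp_shift[OF assms])

lemma finsupp_Q:
  assumes "finsupp f"
  shows "finsupp (Q f)"
  unfolding Q_def by (intro finsupp_intros finsupp_T assms)

lemma ip_T:
  assumes "finsupp f"
  shows "ip (T f) g = ip f g / 2 + (\<Sum>s\<in>S. tot (\<lambda>z. f (s * z) * g z)) / (2 * card S)"
proof -
  have "ip (T f) g = tot (\<lambda>z. f z * g z / 2 + (\<Sum>s\<in>S. f (s * z) * g z) / (2 * card S))"
    by (simp add: ip_def T_def distrib_right sum_distrib_right)
  also have "\<dots> = tot (\<lambda>z. f z * g z / 2) + tot (\<lambda>z. (\<Sum>s\<in>S. f (s * z) * g z) / (2 * card S))"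
    by (intro tot_add finsupp_intros fin_S assms finsupp_shift[OF assms])
  also have "tot (\<lambda>z. (\<Sum>s\<in>S. f (s * z) * g z) / (2 * card S)) = (\<Sum>s\<in>S. tot (\<lambda>z. f (s * z) * g z)) / (2 * card S)"
    by (subst tot_divide, subst tot_sum) (intro finsupp_intros fin_S assms finsupp_shift[OF assms] | simp)+
  finally show ?thesis by (simp add: tot_divide ip_def)
qed

lemma T_self_adjoint:
  assumes "finsupp f" "finsupp g"
  shows "ip (T f) g = ip f (T g)"
proof -
  have "tot (\<lambda>z. f (s * z) * g z) = tot (\<lambda>z. g (inverse s * z) * f z)" for s
    using tot_lshift[of "\<lambda>z. g (inverse s * z) * f z" s] by (simp add: grp_simps mult.commute)
  hence "(\<Sum>s\<in>S. tot (\<lambda>z. f (s * z) * g z)) = (\<Sum>s\<in>S. tot (\<lambda>z. g (s * z) * f z))"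
    using sum_S_inv[of "\<lambda>s. tot (\<lambda>z. g (s * z) * f z)"] by simp
  thus ?thesis by (simp add: ip_T assms ip_commute[of f])
qed

text \<open>Used with \<open>c = -1\<close> to express the energy through the operator and with
  \<open>c = 1\<close> to see that the lazy operator is positive.\<close>

lemma tot_square_shift:
  assumes "finsupp f"
  shows "tot (\<lambda>z. (f (s * z) + c * f z)\<^sup>2) = (1 + c\<^sup>2) * ip f f + 2 * c * tot (\<lambda>z. f (s * z) * f z)"
proof -
  have "tot (\<lambda>z. (f (s * z) + c * f z)\<^sup>2) = tot (\<lambda>z. ((f (s * z))\<^sup>2 + c\<^sup>2 * (f z)\<^sup>2) + 2 * c * (f (s * z) * f z))"
    by (simp add: power2_sum power_mult_distrib algebra_simps)
  also have "\<dots> = (tot (\<lambda>z. (f (s * z))\<^sup>2) + tot (\<lambda>z. c\<^sup>2 * (f z)\<^sup>2)) + tot (\<lambda>z. 2 * c * (f (s * z) * f z))"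
  proof -
    have "finsupp (\<lambda>z. (f (s * z))\<^sup>2)" "finsupp (\<lambda>z. c\<^sup>2 * (f z)\<^sup>2)" "finsupp (\<lambda>z. 2 * c * (f (s * z) * f z))"
      by (intro finsupp_intros assms finsupp_shift[OF assms], rule finsupp_mult2, intro finsupp_intros assms,
          rule finsupp_mult2, intro finsupp_intros assms finsupp_shift[OF assms])
    thus ?thesis by (simp only: tot_add finsupp_add)
  qed
  finally show ?thesis
    unfolding tot_cmult tot_lshift[of "\<lambda>z. (f z)\<^sup>2" s] ip_self by (simp add: distrib_right)
qed

definition energy :: "('a \<Rightarrow> real) \<Rightarrow> real" where
  "energy f = (\<Sum>s\<in>S. tot (\<lambda>z. (f (s * z) - f z)\<^sup>2))"

lemma ip_Q:
  assumes "finsupp f"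
  shows "ip (Q f) f = energy f / (4 * card S)"
proof -
  have "energy f = (\<Sum>s\<in>S. 2 * ip f f - 2 * tot (\<lambda>z. f (s * z) * f z))"
    using tot_square_shift[OF assms, of _ "-1"] by (simp add: energy_def)
  also have "\<dots> = 2 * card S * ip f f - 2 * (\<Sum>s\<in>S. tot (\<lambda>z. f (s * z) * f z))"
    by (simp add: sum_subtractf sum_distrib_left)
  finally have e: "energy f = 2 * card S * ip f f - 2 * (\<Sum>s\<in>S. tot (\<lambda>z. f (s * z) * f z))" .
  show ?thesis
    unfolding Q_def ip_diff_left[OF assms finsupp_T[OF assms]] ip_T[OF assms] e using card_S by (simp add: field_simps)
qed

lemma energy_nonneg: "0 \<le> energy f"
  unfolding energy_def by (intro sum_nonneg tot_nonneg) simp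

lemma ip_T_nonneg:
  assumes "finsupp f"
  shows "0 \<le> ip (T f) f"
proof -
  have "(\<Sum>s\<in>S. tot (\<lambda>z. (f (s * z) + 1 * f z)\<^sup>2)) = (\<Sum>s\<in>S. 2 * ip f f + 2 * tot (\<lambda>z. f (s * z) * f z))"
    by (simp only: tot_square_shift[OF assms]) simp
  also have "\<dots> = 2 * card S * ip f f + 2 * (\<Sum>s\<in>S. tot (\<lambda>z. f (s * z) * f z))"
    by (simp add: sum.distrib sum_distrib_left)
  finally have "(\<Sum>s\<in>S. tot (\<lambda>z. (f (s * z) + 1 * f z)\<^sup>2)) / (4 * card S) = ip (T f) f"
    using card_S by (simp add: ip_T assms field_simps)
  thus ?thesis by (metis (no_types, lifting) divide_nonneg_nonneg of_nat_0_le_iff sum_nonneg tot_nonneg zero_le_power2)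
qed

lemma T_diff: "T (\<lambda>z. f z - g z) = (\<lambda>z. T f z - T g z)"
  by (simp add: T_def fun_eq_iff sum_subtractf diff_divide_distrib)

text \<open>The distribution of the lazy walk after \<open>k\<close> steps from 1.\<close>

definition heat :: "nat \<Rightarrow> 'a \<Rightarrow> real" where
  "heat k = (T ^^ k) (\<lambda>x. if x = 1 then 1 else 0)"

lemma heat_Suc: "heat (Suc k) = T (heat k)"
  by (simp add: heat_def)

lemma finsupp_heat: "finsupp (heat k)"
  by (induction k) (auto simp: heat_Suc finsupp_T, simp add: heat_def finsupp_def)

lemma heat_nonneg: "0 \<le> heat k x"
proof (induction k arbitrary: x)
  case (Suc k)
  thus ?case by (simp add: heat_Suc T_def sum_nonneg)
qed (simp add: heat_def)

lemma tot_T: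
  assumes "finsupp f"
  shows "tot (T f) = tot f"
proof -
  have "tot (T f) = tot (\<lambda>z. f z / 2) + tot (\<lambda>z. (\<Sum>s\<in>S. f (s * z)) / (2 * card S))"
    unfolding T_def by (intro tot_add finsupp_intros assms fin_S finsupp_shift[OF assms])
  also have "tot (\<lambda>z. (\<Sum>s\<in>S. f (s * z)) / (2 * card S)) = (\<Sum>s\<in>S. tot (\<lambda>z. f (s * z))) / (2 * card S)"
    by (subst tot_divide, subst tot_sum) (intro finsupp_intros fin_S assms finsupp_shift[OF assms] | simp)+
  finally show ?thesis using card_S by (simp add: tot_divide tot_lshift)
qed

lemma tot_heat: "tot (heat k) = 1"
proof (induction k)
  case 0
  show ?case using tot_eq[of "{1}" "heat 0"] by (simp add: heat_def)
qed (simp add: heat_Suc tot_T finsupp_heat)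

lemma heat_support: "heat k x \<noteq> 0 \<Longrightarrow> x \<in> B k"
proof (induction k arbitrary: x)
  case 0
  thus ?case using B_one by (auto simp: heat_def split: if_splits)
next
  case (Suc k)
  hence "heat k x \<noteq> 0 \<or> (\<exists>s\<in>S. heat k (s * x) \<noteq> 0)"
    by (intro ccontr[of "_ \<or> _"]) (auto simp: heat_Suc T_def)
  thus ?case
  proof
    assume "heat k x \<noteq> 0"
    thus ?case using Suc.IH B_mono[of k "Suc k"] by auto
  next
    assume "\<exists>s\<in>S. heat k (s * x) \<noteq> 0"
    then obtain s where s: "s \<in> S" "s * x \<in> B k" using Suc.IH by blast
    from B_mult[OF S_B[OF S_inv[OF s(1)]] s(2)] show ?case by (simp add: grp_simps)
  qed
qed

lemma heat_norm_ge: "1 \<le> card (B k) * ip (heat k) (heat k)"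
proof -
  have "tot (heat k) = (\<Sum>x\<in>B k. 1 * heat k x)"
    using tot_superset[OF fin_B[of k], of "heat k"] heat_support by (simp add: subset_iff)
  hence "1 = (\<Sum>x\<in>B k. 1 * heat k x)\<^sup>2" by (simp add: tot_heat)
  also have "\<dots> \<le> (\<Sum>x\<in>B k. 1\<^sup>2) * (\<Sum>x\<in>B k. (heat k x)\<^sup>2)" by (rule Cauchy_Schwarz_ineq_sum)
  also have "(\<Sum>x\<in>B k. (heat k x)\<^sup>2) = ip (heat k) (heat k)"
    unfolding ip_self using heat_support by (intro tot_superset[symmetric] fin_B) auto
  finally show ?thesis by simp
qed

text \<open>A single step changes \<open>f\<close> by at most the square root of the energy, since
  each squared difference is one of the terms summed in the energy.\<close>

lemma walk_difference:
  assumes "finsupp f"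
  shows "x \<in> B r \<Longrightarrow> \<bar>f (x * z) - f z\<bar> \<le> r * sqrt (energy f)"
proof (induction r arbitrary: x)
  case 0
  thus ?case by (auto simp: B_def wball_def)
next
  case (Suc r)
  then obtain w where w: "w \<in> lists S" "length w \<le> Suc r" "x = prod_list w" by (auto simp: B_def elim: wballE)
  show ?case
  proof (cases w)
    case Nil
    thus ?thesis using w energy_nonneg by simp
  next
    case (Cons s v)
    have s: "s \<in> S" and v: "prod_list v \<in> B r" using w Cons by (auto simp: B_def intro!: wballI)
    have "(f (s * (prod_list v * z)) - f (prod_list v * z))\<^sup>2 \<le> tot (\<lambda>z. (f (s * z) - f z)\<^sup>2)"
      by (rule tot_ge[of "\<lambda>z. (f (s * z) - f z)\<^sup>2"]) (intro finsupp_intros assms finsupp_shift[OF assms], simp)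
    also have "\<dots> \<le> energy f" unfolding energy_def
      by (rule member_le_sum[OF s _ fin_S]) (intro tot_nonneg, simp)
    finally have "\<bar>f (s * (prod_list v * z)) - f (prod_list v * z)\<bar> \<le> sqrt (energy f)"
      by (metis real_sqrt_abs real_sqrt_le_iff)
    thus ?thesis using Suc.IH[OF v] w Cons by (simp add: mult.assoc algebra_simps)
  qed
qed

text \<open>A probability vector of large norm has a large atom; if its energy is tiny, the mass near that atom
  is almost constant, so on an infinite group the total mass would exceed 1.\<close>

lemma norm_small_if_energy_small:
  assumes "infinite \<Gamma>" "0 < c"
  obtains \<eta> where "0 < \<eta>" "\<And>f. finsupp f \<Longrightarrow> (\<And>x. 0 \<le> f x) \<Longrightarrow> tot f = 1 \<Longrightarrow> ip (Q f) f < \<eta> \<Longrightarrow> ip f f < c"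
proof -
  obtain r where r: "nat \<lceil>4 / c\<rceil> + 1 \<le> card (B r)" using infinite_card_B[OF assms(1)] by blast
  have rc: "4 / c < card (B r)"
  proof -
    have "4 / c \<le> real (nat \<lceil>4 / c\<rceil>)" by (simp add: real_nat_ceiling_ge)
    also have "\<dots> < real (nat \<lceil>4 / c\<rceil> + 1)" by simp
    also have "\<dots> \<le> card (B r)" using r of_nat_le_iff by blast
    finally show ?thesis .
  qed
  define \<eta> where "\<eta> = (c / (4 * (real r + 1)))\<^sup>2 / (4 * card S)"
  have "ip f f < c" if f: "finsupp f" "\<And>x. 0 \<le> f x" "tot f = 1" "ip (Q f) f < \<eta>" for f
  proof (rule ccontr)
    assume ge: "\<not> ip f f < c"
    have "\<exists>x0. c / 2 \<le> f x0"
    proof (rule ccontr)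
      assume "\<not> ?thesis"
      hence lt: "f x \<le> c / 2" for x by (metis less_imp_le not_le)
      have "ip f f \<le> tot (\<lambda>x. c / 2 * f x)" unfolding ip_def
        by (rule tot_mono) (intro finsupp_mult1 finsupp_mult2 f(1) mult_right_mono lt f(2))+
      also have "\<dots> = c / 2" by (simp only: tot_cmult f)
      finally show False using ge assms by simp
    qed
    then obtain x0 where x0: "c / 2 \<le> f x0" by blast
    have "energy f < (c / (4 * (real r + 1)))\<^sup>2"
      using f(4) card_S by (simp add: ip_Q[OF f(1)] \<eta>_def divide_strict_right_mono field_simps)
    hence "sqrt (energy f) < c / (4 * (real r + 1))"
      using assms(2) by (intro real_less_lsqrt) auto
    hence "r * sqrt (energy f) \<le> real r * (c / (4 * (real r + 1)))"
      by (intro mult_left_mono) auto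
    also have "\<dots> \<le> c / 4" using assms(2) by (simp add: field_simps)
    finally have rs: "r * sqrt (energy f) \<le> c / 4" .
    have "c / 4 \<le> f (x * x0)" if "x \<in> B r" for x
      using walk_difference[OF f(1) that, of x0] rs x0 by linarith
    hence "(\<Sum>x\<in>B r. c / 4) \<le> (\<Sum>x\<in>B r. f (x * x0))" by (intro sum_mono) auto
    also have "\<dots> \<le> tot (\<lambda>x. f (x * x0))" by (intro tot_ge_sum finsupp_shift[OF f(1)] f(2) fin_B)
    also have "\<dots> = 1" by (simp add: tot_rshift f)
    finally have "card (B r) * (c / 4) \<le> 1" by simp
    moreover have "1 < card (B r) * (c / 4)" using rc assms(2) by (simp add: field_simps)
    ultimately show False by simp
  qed
  moreover have "0 < \<eta>" using assms card_S by (simp add: \<eta>_def)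
  ultimately show ?thesis using that by blast
qed

text \<open>Otherwise the energy, hence the norm, of the heat kernel would decay exponentially,
  contradicting the Cauchy-Schwarz lower bound from polynomial growth.\<close>

lemma almost_harmonic:
  assumes "infinite \<Gamma>" "2 \<le> A"
  obtains f where "finsupp f" "A * ip (Q f) (Q f) < ip (Q f) f"
proof (rule ccontr)
  assume "\<not> thesis"
  hence gap: "ip (Q f) f \<le> A * ip (Q f) (Q f)" if "finsupp f" for f
    using that \<open>\<And>f. finsupp f \<Longrightarrow> A * ip (Q f) (Q f) < ip (Q f) f \<Longrightarrow> thesis\<close> by force
  define \<theta> where "\<theta> = 1 - 1 / A"
  have th: "0 < \<theta>" "\<theta> < 1" using assms by (auto simp: \<theta>_def field_simps)
  define e where "e = (\<lambda>k. ip (Q (heat k)) (heat k))"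
  define a where "a = (\<lambda>k. ip (heat k) (heat k))"
  note fs = finsupp_heat finsupp_T finsupp_Q
  have QQ: "ip (Q g) (Q g) = ip g g - 2 * ip (T g) g + ip (T g) (T g)" if "finsupp g" for g
    using that by (simp add: Q_def ip_diff_left ip_diff_right fs ip_commute[of g "T g"])
  \<comment> \<open>With \<open>Q = 1 - T\<close>, the energy form at \<open>T g\<close> is that at
    \<open>g\<close> minus the squared norm of \<open>Q g\<close> minus
    \<open>ip (T (Q g)) (Q g)\<close>; the last term is nonnegative by laziness.\<close>
  have e_dec: "e (Suc k) \<le> e k - ip (Q (heat k)) (Q (heat k))" for k
  proof -
    let ?g = "heat k"
    have "0 \<le> ip (T (Q ?g)) (Q ?g)" by (intro ip_T_nonneg fs)
    also have "ip (T (Q ?g)) (Q ?g) = ip (T ?g) (Q ?g) - ip (T (T ?g)) (Q ?g)"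
      by (simp add: Q_def T_diff ip_diff_left fs)
    also have "ip (T ?g) (Q ?g) = ip (T ?g) ?g - ip (T ?g) (T ?g)"
      by (simp add: Q_def ip_diff_right fs)
    also have "ip (T (T ?g)) (Q ?g) = ip (T ?g) (T ?g) - ip (T (T ?g)) (T ?g)"
      using T_self_adjoint[of "T ?g" ?g] by (simp add: Q_def ip_diff_right fs)
    finally have *: "0 \<le> ip (T ?g) ?g - 2 * ip (T ?g) (T ?g) + ip (T (T ?g)) (T ?g)" by simp
    have "e (Suc k) = ip (T ?g) (T ?g) - ip (T (T ?g)) (T ?g)"
      by (simp add: e_def heat_Suc Q_def ip_diff_left fs)
    moreover have "e k = ip ?g ?g - ip (T ?g) ?g" by (simp add: e_def Q_def ip_diff_left fs)
    ultimately show ?thesis using * QQ[of ?g] fs by simp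
  qed
  have e_nonneg: "0 \<le> e k" for k
    unfolding e_def ip_Q[OF finsupp_heat] using energy_nonneg by simp
  have e_step: "e (Suc k) \<le> \<theta> * e k" for k
  proof -
    have "e k / A \<le> ip (Q (heat k)) (Q (heat k))"
      using gap[OF finsupp_heat[of k]] assms(2) by (simp add: e_def divide_le_eq mult.commute)
    thus ?thesis using e_dec[of k] by (simp add: \<theta>_def left_diff_distrib)
  qed
  have e_exp: "e k \<le> \<theta> ^ k * e 0" for k
  proof (induction k)
    case (Suc k)
    have "\<theta> * e k \<le> \<theta> * (\<theta> ^ k * e 0)" using Suc th by (intro mult_left_mono) auto
    thus ?case using e_step[of k] by simp
  qed simp
  have a_step: "a k \<le> a (Suc k) + 2 * e k" for k
  proof -
    let ?g = "heat k"
    have "0 \<le> ip (Q ?g) (Q ?g)" by (rule ip_nonneg)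
    moreover have "e k = ip ?g ?g - ip (T ?g) ?g" by (simp add: e_def Q_def ip_diff_left fs)
    ultimately show ?thesis using QQ[of ?g] fs by (simp add: a_def heat_Suc)
  qed
  \<comment> \<open>\<open>D * \<theta> ^ k\<close> is the tail from \<open>k\<close> on of the
    geometric series with terms \<open>2 * (\<theta> ^ i * e 0)\<close>, which bounds the total
    further loss of norm.\<close>
  define D where "D = 2 * e 0 / (1 - \<theta>)"
  have D: "D * \<theta> ^ k = D * \<theta> ^ Suc k + 2 * (\<theta> ^ k * e 0)" for k
  proof -
    have "D * (1 - \<theta>) = 2 * e 0" using th by (simp add: D_def)
    hence "D * (1 - \<theta>) * \<theta> ^ k = 2 * e 0 * \<theta> ^ k" by simp
    thus ?thesis by (simp add: algebra_simps)
  qed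
  have D0: "0 \<le> D" using th e_nonneg by (simp add: D_def)
  have a_le: "a k \<le> a (k + m) + D * \<theta> ^ k" for k m
  proof (induction m arbitrary: k)
    case 0
    show ?case using D0 th by simp
  next
    case (Suc m)
    show ?case using a_step[of k] Suc[of "Suc k"] e_exp[of k] D[of k] by simp
  qed
  \<comment> \<open>The norm itself tends to 0 because the energy does and the group is infinite; so
    \<open>a k\<close> is bounded by the total loss of norm from \<open>k\<close> on.\<close>
  have a_exp: "a k \<le> D * \<theta> ^ k" for k
  proof (rule field_le_epsilon)
    fix c :: real assume c: "0 < c"
    obtain \<eta> where eta: "0 < \<eta>" "\<And>f. finsupp f \<Longrightarrow> (\<And>x. 0 \<le> f x) \<Longrightarrow> tot f = 1 \<Longrightarrow> ip (Q f) f < \<eta> \<Longrightarrow> ip f f < c"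
      using norm_small_if_energy_small[OF assms(1) c] by blast
    have "(\<lambda>m. \<theta> ^ m * e 0) \<longlonglongrightarrow> 0" using th by (intro tendsto_eq_intros LIMSEQ_power_zero) auto
    hence "\<forall>\<^sub>F m in sequentially. \<theta> ^ m * e 0 < \<eta>" using eta(1) by (rule order_tendstoD)
    then obtain m0 where m0: "\<And>m. m0 \<le> m \<Longrightarrow> \<theta> ^ m * e 0 < \<eta>" unfolding eventually_sequentially by blast
    have "e (k + m0) < \<eta>" using e_exp[of "k + m0"] m0[of "k + m0"] by linarith
    hence "a (k + m0) < c" using eta(2)[OF finsupp_heat heat_nonneg tot_heat] by (simp add: a_def e_def)
    thus "a k \<le> D * \<theta> ^ k + c" using a_le[of k m0] by simp
  qed
  obtain C where C: "0 < C" "\<And>n. real (card (B n)) \<le> C * (real n + 1) ^ d" using growth_B by blast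
  have ge: "1 \<le> C * (real k + 1) ^ d * (D * \<theta> ^ k)" for k
  proof -
    have "1 \<le> card (B k) * a k" using heat_norm_ge by (simp add: a_def)
    also have "\<dots> \<le> C * (real k + 1) ^ d * (D * \<theta> ^ k)"
      using C a_exp ip_nonneg by (intro mult_mono) (auto simp: a_def)
    finally show ?thesis .
  qed
  have "(\<lambda>k::nat. C * (real k + 1) ^ d * (D * \<theta> ^ k)) \<longlonglongrightarrow> 0"
    using th by real_asymp
  hence "\<forall>\<^sub>F k in sequentially. C * (real k + 1) ^ d * (D * \<theta> ^ k) < 1" by (rule order_tendstoD) simp
  then obtain k0 where "\<forall>k\<ge>k0. C * (real k + 1) ^ d * (D * \<theta> ^ k) < 1"
    unfolding eventually_sequentially by (rule exE)
  hence "C * (real k0 + 1) ^ d * (D * \<theta> ^ k0) < 1" by simp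
  thus False using ge[of k0] by linarith
qed

section \<open>Lipschitz harmonic functions\<close>

text \<open>Differences are taken along right multiplication, so that left translations by the group
  preserve harmonicity and Lipschitz constants. The averaging operator multiplies on the left; the
  inverse in the matrix coefficients below exchanges the sides.\<close>

definition harmonic :: "('a \<Rightarrow> real) \<Rightarrow> bool" where
  "harmonic u \<longleftrightarrow> (\<forall>x\<in>\<Gamma>. (\<Sum>s\<in>S. u (x * s) - u x) = 0)"

definition lip :: "real \<Rightarrow> ('a \<Rightarrow> real) \<Rightarrow> bool" where
  "lip L u \<longleftrightarrow> (\<forall>x\<in>\<Gamma>. \<forall>s\<in>S. \<bar>u (x * s) - u x\<bar> \<le> L)"

text \<open>\<open>u\<close> is a matrix coefficient. Among the differences of an almost harmonic
  \<open>f\<close> let \<open>v\<close> be one of largest norm; \<open>u x\<close> pairs the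
  translate of \<open>f\<close> by \<open>x\<close> with \<open>v\<close>, normalized by the squared
  norm of \<open>v\<close>. Cauchy-Schwarz bounds all differences of \<open>u\<close> by 1, pairing
  \<open>v\<close> with itself gives the value 1, and the Laplacian of \<open>u\<close> pairs a
  translate of \<open>Q f\<close> with \<open>v\<close>, which is small.\<close>

lemma almost_harmonic_lip:
  assumes "infinite \<Gamma>" "0 < \<epsilon>"
  obtains u where "lip 1 u" "\<exists>s\<in>S. u s - u 1 = 1" "\<forall>x\<in>\<Gamma>. \<bar>\<Sum>s\<in>S. u (x * s) - u x\<bar> \<le> \<epsilon>"
proof -
  \<comment> \<open>The square makes the Cauchy-Schwarz bound for the Laplacian at most
    \<open>\<epsilon>\<close> at the end of the proof; 2 is the lower bound demanded by
    \<open>almost_harmonic\<close>.\<close>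
  define A where "A = max 2 ((card S / \<epsilon>)\<^sup>2)"
  obtain f where f: "finsupp f" "A * ip (Q f) (Q f) < ip (Q f) f"
    using almost_harmonic[OF assms(1), of A] by (auto simp: A_def)
  define N where "N = (\<lambda>s. tot (\<lambda>z. (f (s * z) - f z)\<^sup>2))"
  obtain s0 where s0: "s0 \<in> S" "\<And>s. s \<in> S \<Longrightarrow> N s \<le> N s0"
    using obtains_MAX[OF fin_S, of N] one_S Max_ge[of "N ` S"] fin_S
    by (metis empty_iff finite_imageI image_eqI)
  have "4 * card S * ip (Q f) f = (\<Sum>s\<in>S. N s)" using card_S by (simp add: ip_Q f energy_def N_def)
  also have "\<dots> \<le> (\<Sum>s\<in>S. N s0)" by (intro sum_mono s0)
  finally have "4 * card S * ip (Q f) f \<le> card S * N s0" by simp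
  hence M: "4 * ip (Q f) f \<le> N s0" using card_S by simp
  have A2: "0 \<le> A" by (simp add: A_def)
  have M0: "0 < N s0" and MQ: "4 * A * ip (Q f) (Q f) \<le> N s0"
    using M f(2) A2 ip_nonneg[of "Q f"] mult_nonneg_nonneg[OF A2 ip_nonneg[of "Q f"]] by linarith+
  define v where "v = (\<lambda>z. f (s0 * z) - f z)"
  have fv: "finsupp v" unfolding v_def by (intro finsupp_intros f finsupp_shift[OF f(1)])
  have v2: "tot (\<lambda>z. (v z)\<^sup>2) = N s0" by (simp add: v_def N_def)
  define u where "u = (\<lambda>x. tot (\<lambda>y. f (inverse x * y) * v y) / N s0)"
  have fsf: "finsupp (\<lambda>y. f (g * y) * v y)" for g by (intro finsupp_intros finsupp_shift[OF f(1)])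
  have udiff: "u (x * s) - u x = tot (\<lambda>y. (f (inverse s * (inverse x * y)) - f (inverse x * y)) * v y) / N s0" for x s
  proof -
    have "u (x * s) - u x = (tot (\<lambda>y. f (inverse s * inverse x * y) * v y) - tot (\<lambda>y. f (inverse x * y) * v y)) / N s0"
      by (simp add: u_def grp_inv_mult diff_divide_distrib)
    also have "\<dots> = tot (\<lambda>y. f (inverse s * inverse x * y) * v y - f (inverse x * y) * v y) / N s0"
      using fsf by (simp add: tot_diff)
    finally show ?thesis by (simp add: left_diff_distrib mult.assoc)
  qed
  have bound: "\<bar>tot (\<lambda>y. h (inverse x * y) * v y)\<bar> \<le> sqrt (tot (\<lambda>y. (h y)\<^sup>2)) * sqrt (N s0)" if "finsupp h" for h x
  proof -
    have "(tot (\<lambda>y. h (inverse x * y) * v y))\<^sup>2 \<le> tot (\<lambda>y. (h (inverse x * y))\<^sup>2) * tot (\<lambda>z. (v z)\<^sup>2)"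
      by (intro tot_Cauchy_Schwarz finsupp_shift[OF that] fv)
    also have "\<dots> = tot (\<lambda>y. (h y)\<^sup>2) * N s0" using tot_lshift[of "\<lambda>y. (h y)\<^sup>2" "inverse x"] v2 by simp
    finally have "sqrt ((tot (\<lambda>y. h (inverse x * y) * v y))\<^sup>2) \<le> sqrt (tot (\<lambda>y. (h y)\<^sup>2) * N s0)"
      by (rule real_sqrt_le_mono)
    thus ?thesis by (simp add: real_sqrt_mult)
  qed
  have "lip 1 u" unfolding lip_def
  proof (intro ballI)
    fix x s assume "x \<in> \<Gamma>" "s \<in> S"
    have "finsupp (\<lambda>z. f (inverse s * z) - f z)" by (intro finsupp_diff f finsupp_shift[OF f(1)])
    from bound[OF this, of x]
    have "\<bar>tot (\<lambda>y. (f (inverse s * (inverse x * y)) - f (inverse x * y)) * v y)\<bar> \<le> sqrt (N (inverse s)) * sqrt (N s0)"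
      by (simp add: N_def)
    also have "\<dots> \<le> sqrt (N s0) * sqrt (N s0)"
      using s0(2)[OF S_inv[OF \<open>s \<in> S\<close>]] M0 by (intro mult_right_mono) auto
    finally have "\<bar>tot (\<lambda>y. (f (inverse s * (inverse x * y)) - f (inverse x * y)) * v y)\<bar> \<le> N s0" using M0 by simp
    thus "\<bar>u (x * s) - u x\<bar> \<le> 1" unfolding udiff using M0 by (simp add: abs_divide)
  qed
  moreover have "\<exists>s\<in>S. u s - u 1 = 1"
  proof
    show "inverse s0 \<in> S" by (rule S_inv[OF s0(1)])
    have "u (1 * inverse s0) - u 1 = tot (\<lambda>y. v y * v y) / N s0" unfolding udiff by (simp add: grp_inv_inv grp_inv_one v_def)
    thus "u (inverse s0) - u 1 = 1" using v2 M0 by (simp add: power2_eq_square)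
  qed
  moreover have "\<bar>\<Sum>s\<in>S. u (x * s) - u x\<bar> \<le> \<epsilon>" if "x \<in> \<Gamma>" for x
  proof -
    have "(\<Sum>s\<in>S. u (x * s) - u x) = (\<Sum>s\<in>S. tot (\<lambda>y. (f (inverse s * (inverse x * y)) - f (inverse x * y)) * v y)) / N s0"
      by (simp add: udiff sum_divide_distrib)
    also have "(\<Sum>s\<in>S. tot (\<lambda>y. (f (inverse s * (inverse x * y)) - f (inverse x * y)) * v y))
        = tot (\<lambda>y. \<Sum>s\<in>S. (f (inverse s * (inverse x * y)) - f (inverse x * y)) * v y)"
      by (rule tot_sum[symmetric]) (intro fin_S finsupp_mult2[OF fv])+
    also have "(\<lambda>y. \<Sum>s\<in>S. (f (inverse s * (inverse x * y)) - f (inverse x * y)) * v y)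
        = (\<lambda>y. (-2 * card S) * (Q f (inverse x * y) * v y))"
    proof
      fix y
      have "(\<Sum>s\<in>S. f (inverse s * z) - f z) = -2 * card S * Q f z" for z
        using sum_S_inv[of "\<lambda>s. f (s * z)"] card_S by (simp add: sum_subtractf Q_def T_def field_simps)
      thus "(\<Sum>s\<in>S. (f (inverse s * (inverse x * y)) - f (inverse x * y)) * v y) = (-2 * card S) * (Q f (inverse x * y) * v y)"
        by (simp add: sum_distrib_right [symmetric])
    qed
    also have "tot \<dots> = (-2 * card S) * tot (\<lambda>y. Q f (inverse x * y) * v y)" by (rule tot_cmult)
    finally have "\<bar>\<Sum>s\<in>S. u (x * s) - u x\<bar> = 2 * card S * \<bar>tot (\<lambda>y. Q f (inverse x * y) * v y)\<bar> / N s0"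
      using M0 by (simp add: abs_mult)
    also have "\<dots> \<le> 2 * card S * (sqrt (ip (Q f) (Q f)) * sqrt (N s0)) / N s0"
      unfolding ip_self using M0 by (intro divide_right_mono mult_left_mono bound finsupp_Q f) auto
    also have "\<dots> \<le> \<epsilon>"
    proof -
      have "card S / \<epsilon> \<le> sqrt A"
        using assms(2) by (intro real_le_rsqrt) (simp add: A_def)
      hence "card S / \<epsilon> * (2 * sqrt (ip (Q f) (Q f))) \<le> sqrt A * (2 * sqrt (ip (Q f) (Q f)))"
        using ip_nonneg[of "Q f"] by (intro mult_right_mono) auto
      also have "\<dots> = sqrt (4 * A * ip (Q f) (Q f))" by (simp add: real_sqrt_mult)
      also have "\<dots> \<le> sqrt (N s0)" using MQ by simp
      finally have "2 * card S * sqrt (ip (Q f) (Q f)) \<le> \<epsilon> * sqrt (N s0)"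
        using assms(2) by (simp add: field_simps)
      hence "2 * card S * sqrt (ip (Q f) (Q f)) * sqrt (N s0) \<le> \<epsilon> * sqrt (N s0) * sqrt (N s0)"
        using M0 by (intro mult_right_mono) auto
      thus ?thesis using M0 by (simp add: divide_le_eq mult.assoc)
    qed
    finally show ?thesis .
  qed
  ultimately show ?thesis using that by blast
qed

lemma lip_ball:
  assumes "lip L u" "y \<in> \<Gamma>" "x \<in> B n"
  shows "\<bar>u (y * x) - u y\<bar> \<le> L * n"
  using assms(3)
proof (induction n arbitrary: x)
  case 0
  thus ?case by (auto simp: B_def wball_def)
next
  case (Suc n)
  have L0: "0 \<le> L" using assms(1,2) one_S unfolding lip_def by (metis abs_ge_zero order_trans)
  from Suc.prems obtain w where w: "w \<in> lists S" "length w \<le> Suc n" "x = prod_list w" by (auto simp: B_def elim: wballE)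
  show ?case
  proof (cases w rule: rev_cases)
    case Nil
    thus ?thesis using w L0 by simp
  next
    case (snoc v s)
    have s: "s \<in> S" and v: "prod_list v \<in> B n" using w snoc by (auto simp: B_def intro!: wballI)
    have "y * prod_list v \<in> \<Gamma>" using assms(2) v B_sub subgrp_mult[OF subgrp_G] by blast
    hence "\<bar>u (y * prod_list v * s) - u (y * prod_list v)\<bar> \<le> L" using assms(1) s by (auto simp: lip_def)
    thus ?thesis using Suc.IH[OF v] w snoc by (simp add: mult.assoc algebra_simps)
  qed
qed

text \<open>Normalized to vanish at 1, Lipschitz functions form a subset of a product of compact
  intervals. The conditions on almost harmonic ones are closed, the requirement of a difference
  equal to 1 included because it is a finite union over \<open>S\<close>, and they are nested, so
  they have a common point.\<close>

theorem nonconstant_harmonic: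
  assumes "infinite \<Gamma>"
  obtains u s where "harmonic u" "lip 1 u" "s \<in> S" "u s - u 1 = 1"
proof -
  define r where "r = (\<lambda>x. if x \<in> \<Gamma> then real (LEAST n. x \<in> B n) else 0)"
  define K where "K = PiE UNIV (\<lambda>x. {- r x..r x})"
  have K: "compact K"
  proof -
    have "compactin (product_topology (\<lambda>_. euclidean) UNIV) K"
      unfolding K_def by (subst compactin_PiE) (auto simp: compactin_euclidean_iff)
    thus ?thesis by (simp add: euclidean_product_topology)
  qed
  have ev: "continuous_on UNIV (\<lambda>u::'a\<Rightarrow>real. u x)" for x by (rule continuous_on_product_coordinates)
  define C :: "nat \<Rightarrow> ('a \<Rightarrow> real) set" where "C = (\<lambda>n. (\<Inter>x\<in>\<Gamma>. \<Inter>s\<in>S. {u. \<bar>u (x * s) - u x\<bar> \<le> 1})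
     \<inter> (\<Union>s\<in>S. {u. u s - u 1 = 1}) \<inter> (\<Inter>x\<in>\<Gamma>. {u. \<bar>\<Sum>s\<in>S. u (x * s) - u x\<bar> \<le> 1 / real (Suc n)}))"
  have clC: "closed (C n)" for n unfolding C_def
    by (intro closed_Int closed_INT closed_UN fin_S ballI closed_Collect_le closed_Collect_eq continuous_intros ev)
  have decC: "C n \<subseteq> C m" if "m \<le> n" for m n
  proof -
    have "1 / real (Suc n) \<le> 1 / real (Suc m)" using that by (simp add: field_simps)
    thus ?thesis unfolding C_def by (auto intro: order_trans)
  qed
  have neC: "K \<inter> C n \<noteq> {}" for n
  proof -
    obtain u where u: "lip 1 u" "\<exists>s\<in>S. u s - u 1 = 1" "\<forall>x\<in>\<Gamma>. \<bar>\<Sum>s\<in>S. u (x * s) - u x\<bar> \<le> 1 / real (Suc n)"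
      using almost_harmonic_lip[OF assms, of "1 / real (Suc n)"] by auto
    define v where "v = (\<lambda>x. if x \<in> \<Gamma> then u x - u 1 else 0)"
    have "v x \<in> {- r x..r x}" for x
    proof (cases "x \<in> \<Gamma>")
      case True
      have "x \<in> B (LEAST n. x \<in> B n)" using B_exhaust[OF True] by (rule LeastI_ex)
      from lip_ball[OF u(1) subgrp_one[OF subgrp_G] this] True show ?thesis by (auto simp: v_def r_def)
    qed (simp add: v_def r_def)
    moreover have "v \<in> C n"
      using u subgrp_mult[OF subgrp_G] S_mem subgrp_one[OF subgrp_G] unfolding C_def lip_def
      by (auto simp: v_def sum_subtractf right_diff_distrib)
    ultimately have "v \<in> K \<inter> C n" by (simp add: K_def PiE_def extensional_def)
    thus ?thesis by blast
  qed
  have "K \<inter> (\<Inter>n\<in>UNIV. C n) \<noteq> {}"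
  proof (rule compact_imp_fip_image[OF K])
    fix I :: "nat set" assume I: "finite I"
    have "C (Max (insert 0 I)) \<subseteq> (\<Inter>n\<in>I. C n)" using I by (intro INT_greatest decC) simp
    thus "K \<inter> (\<Inter>n\<in>I. C n) \<noteq> {}" using neC by blast
  qed (rule clC)
  then obtain u where u: "u \<in> C n" for n by blast
  have "lip 1 u" using u[of 0] by (auto simp: C_def lip_def)
  moreover have "\<exists>s\<in>S. u s - u 1 = 1" using u[of 0] by (auto simp: C_def)
  moreover have "harmonic u" unfolding harmonic_def
  proof
    fix x assume x: "x \<in> \<Gamma>"
    have le: "\<bar>\<Sum>s\<in>S. u (x * s) - u x\<bar> \<le> 1 / real (Suc n)" for n using u[of n] x by (auto simp: C_def)
    have "\<bar>\<Sum>s\<in>S. u (x * s) - u x\<bar> \<le> 0"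
    proof (rule field_le_epsilon)
      fix e :: real assume "0 < e"
      then obtain n where "1 / real (Suc n) < e" using nat_approx_posE by blast
      thus "\<bar>\<Sum>s\<in>S. u (x * s) - u x\<bar> \<le> 0 + e" using le[of n] by simp
    qed
    thus "(\<Sum>s\<in>S. u (x * s) - u x) = 0" by simp
  qed
  ultimately show ?thesis using that by blast
qed

end

section \<open>Lipschitz harmonic functions span a finite-dimensional space\<close>

lemma sum_sq_pairs:
  fixes u :: "'b \<Rightarrow> real"
  assumes "finite D"
  shows "(\<Sum>x\<in>D. \<Sum>y\<in>D. (u y - u x)\<^sup>2) = 2 * card D * (\<Sum>x\<in>D. (u x)\<^sup>2) - 2 * (\<Sum>x\<in>D. u x)\<^sup>2"
proof -
  have "(\<Sum>x\<in>D. \<Sum>y\<in>D. (u y - u x)\<^sup>2) = (\<Sum>x\<in>D. \<Sum>y\<in>D. (u y)\<^sup>2 + (u x)\<^sup>2 - 2 * (u x * u y))"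
    by (simp add: power2_diff algebra_simps)
  also have "\<dots> = (\<Sum>x\<in>D. (\<Sum>y\<in>D. (u y)\<^sup>2) + card D * (u x)\<^sup>2 - 2 * (u x * (\<Sum>y\<in>D. u y)))"
    by (simp add: sum.distrib sum_subtractf sum_distrib_left)
  also have "\<dots> = card D * (\<Sum>y\<in>D. (u y)\<^sup>2) + card D * (\<Sum>x\<in>D. (u x)\<^sup>2) - 2 * ((\<Sum>x\<in>D. u x) * (\<Sum>y\<in>D. u y))"
    by (simp add: sum.distrib sum_subtractf sum_distrib_left [symmetric] sum_distrib_right [symmetric])
  finally show ?thesis by (simp add: power2_eq_square)
qed

lemma sum_sq_mean:
  fixes u :: "'b \<Rightarrow> real"
  assumes "finite D" "D \<noteq> {}"
  shows "(\<Sum>x\<in>D. (u x)\<^sup>2) = (\<Sum>x\<in>D. \<Sum>y\<in>D. (u y - u x)\<^sup>2) / (2 * card D) + (\<Sum>x\<in>D. u x)\<^sup>2 / card D"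
  using assms by (simp add: sum_sq_pairs card_gt_0_iff field_simps)

lemma sum_sq_le: "(\<Sum>i<n. a i)\<^sup>2 \<le> real n * (\<Sum>i<n. (a i :: real)\<^sup>2)"
  using Cauchy_Schwarz_ineq_sum[of "\<lambda>_. 1" a "{..<n}"] by simp

lemma sum_UN_le:
  fixes f :: "'b \<Rightarrow> real"
  assumes "finite I" "\<And>i. i \<in> I \<Longrightarrow> finite (A i)" "\<And>x. 0 \<le> f x"
  shows "sum f (\<Union>i\<in>I. A i) \<le> (\<Sum>i\<in>I. sum f (A i))"
  using assms(1,2)
proof (induction I)
  case (insert i I)
  have "sum f (A i \<union> (\<Union>i\<in>I. A i)) \<le> sum f (A i) + sum f (\<Union>i\<in>I. A i)"
    using sum.union_inter[of "A i" "\<Union>i\<in>I. A i" f] sum_nonneg[of "A i \<inter> (\<Union>i\<in>I. A i)" f] insert assms(3) by simp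
  thus ?case using insert by simp
qed simp

text \<open>Each counted \<open>k\<close> contributes a factor of at least \<open>q\<close> to the
  product of the ratios \<open>b (k + l) / b k\<close>, while this product telescopes to at most
  \<open>b (n + l) ^ l\<close>. With \<open>b\<close> the volume at the k-th scale, polynomial
  growth bounds the number of scales of large growth.\<close>

lemma shifted_growth_count:
  fixes b :: "nat \<Rightarrow> real"
  assumes b: "\<And>k. 1 \<le> b k" "\<And>k. b k \<le> b (Suc k)" and q: "1 \<le> q"
  shows "q ^ card {k. k < n \<and> q * b k < b (k + l)} \<le> b (n + l) ^ l"
proof -
  have mono: "b i \<le> b j" if "i \<le> j" for i j using that b(2) by (rule lift_Suc_mono_le[rotated])
  have pos: "0 < b k" for k using b(1)[of k] by linarith
  have "q ^ card {k. k < n \<and> q * b k < b (k + l)} = (\<Prod>k<n. if q * b k < b (k + l) then q else 1)"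
  proof (induction n)
    case (Suc n)
    have "{k. k < Suc n \<and> q * b k < b (k + l)} =
      (if q * b n < b (n + l) then insert n {k. k < n \<and> q * b k < b (k + l)} else {k. k < n \<and> q * b k < b (k + l)})"
      by (auto simp: less_Suc_eq)
    thus ?case using Suc by simp
  qed simp
  also have "\<dots> \<le> (\<Prod>k<n. b (k + l) / b k)"
    using q pos mono by (intro prod_mono) (auto simp: le_divide_eq less_imp_le)
  also have "\<dots> \<le> b (n + l) ^ l"
  proof (induction l)
    case 0
    show ?case using pos by (simp add: less_imp_neq[THEN not_sym])
  next
    case (Suc l)
    have "(\<Prod>k<n. b (k + Suc l) / b k) = (\<Prod>k<n. b (k + l) / b k) * (\<Prod>k<n. b (Suc k + l) / b (k + l))"
      using pos by (simp add: prod.distrib [symmetric] less_imp_neq[THEN not_sym])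
    also have "(\<Prod>k<n. b (Suc k + l) / b (k + l)) = b (n + l) / b l"
      by (induction n) (use pos in \<open>auto simp: less_imp_neq[THEN not_sym]\<close>)
    also have "(\<Prod>k<n. b (k + l) / b k) * (b (n + l) / b l) \<le> b (n + l) ^ l * b (n + l)"
      using Suc pos b(1)[of l] mult_left_mono[OF b(1)[of l], of "b (n + l)"]
      by (intro mult_mono) (auto simp: divide_le_eq less_imp_le intro!: prod_nonneg)
    also have "\<dots> \<le> b (n + Suc l) ^ Suc l"
      using power_mono[OF b(2)[of "n + l"], of "Suc l"] pos by (simp add: mult.commute less_imp_le)
    finally show ?case .
  qed
  finally show ?thesis .
qed

context cayley
begin

section \<open>Poincare and Caccioppoli inequalities on balls\<close>

definition nrm2 :: "('a \<Rightarrow> real) \<Rightarrow> nat \<Rightarrow> real" where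
  "nrm2 u n = (\<Sum>x\<in>B n. (u x)\<^sup>2)"

definition grad2 :: "('a \<Rightarrow> real) \<Rightarrow> 'a \<Rightarrow> real" where
  "grad2 u z = (\<Sum>s\<in>S. (u (z * s) - u z)\<^sup>2)"

definition yball :: "'a \<Rightarrow> nat \<Rightarrow> 'a set" where
  "yball y r = (\<lambda>b. y * b) ` B r"

lemma nrm2_nonneg: "0 \<le> nrm2 u n"
  by (simp add: nrm2_def sum_nonneg)

lemma nrm2_mono: "m \<le> n \<Longrightarrow> nrm2 u m \<le> nrm2 u n"
  unfolding nrm2_def using B_mono fin_B by (intro sum_mono2) auto

lemma grad2_nonneg: "0 \<le> grad2 u z"
  by (simp add: grad2_def sum_nonneg)

lemma fin_yball: "finite (yball y r)"
  by (simp add: yball_def fin_B)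

lemma card_yball: "card (yball y r) = card (B r)"
  unfolding yball_def by (rule card_image) (simp add: inj_on_def grp_left_cancel)

lemma yball_iff: "x \<in> yball y r \<longleftrightarrow> inverse y * x \<in> B r"
  by (auto simp: yball_def grp_simps image_iff intro!: bexI[of _ "inverse y * x"])

lemma yball_mult: "x \<in> yball y r \<Longrightarrow> h \<in> B m \<Longrightarrow> x * h \<in> yball y (r + m)"
  using B_mult[of "inverse y * x" r h m] by (simp add: yball_iff mult.assoc)

lemma yball_subset_B: "y \<in> B m \<Longrightarrow> yball y r \<subseteq> B (m + r)"
  using B_mult by (auto simp: yball_def)

text \<open>Follow a word for \<open>h\<close> of length at most \<open>m\<close>. Cauchy-Schwarz
  along the path costs one factor \<open>m\<close>, summing the \<open>m\<close> translated
  gradients the other; the path never leaves the enlarged ball.\<close>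

lemma displacement_le_gradient:
  assumes h: "h \<in> B m"
  shows "(\<Sum>x\<in>yball y r. (u (x * h) - u x)\<^sup>2) \<le> (real m)\<^sup>2 * (\<Sum>z\<in>yball y (r + m). grad2 u z)"
proof -
  obtain w where w: "w \<in> lists S" "length w \<le> m" "h = prod_list w" using h by (auto simp: B_def elim: wballE)
  define n where "n = length w"
  define g where "g = (\<lambda>i. prod_list (take i w))"
  have gB: "i \<le> n \<Longrightarrow> g i \<in> B m" for i
    using w set_take_subset[of i w] unfolding g_def B_def n_def by (intro wballI) auto
  have gS: "g (Suc i) = g i * w ! i" if "i < n" for i using that by (simp add: g_def n_def take_Suc_conv_app_nth)
  have wS: "w ! i \<in> S" if "i < n" for i using that w by (auto simp: n_def)
  have pt: "(u (x * h) - u x)\<^sup>2 \<le> real n * (\<Sum>i<n. grad2 u (x * g i))" for x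
  proof -
    have "u (x * h) - u x = (\<Sum>i<n. u (x * g (Suc i)) - u (x * g i))"
      by (subst sum_lessThan_telescope) (simp add: g_def n_def w(3))
    hence "(u (x * h) - u x)\<^sup>2 \<le> real n * (\<Sum>i<n. (u (x * g (Suc i)) - u (x * g i))\<^sup>2)"
      by (simp only: sum_sq_le)
    also have "\<dots> \<le> real n * (\<Sum>i<n. grad2 u (x * g i))"
    proof (intro mult_left_mono sum_mono)
      fix i assume "i \<in> {..<n}"
      hence i: "i < n" by simp
      have "(u (x * g i * w ! i) - u (x * g i))\<^sup>2 \<le> grad2 u (x * g i)" unfolding grad2_def
        by (rule member_le_sum[OF wS[OF i] _ fin_S]) simp
      thus "(u (x * g (Suc i)) - u (x * g i))\<^sup>2 \<le> grad2 u (x * g i)" using gS[OF i] by (simp add: mult.assoc)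
    qed simp
    finally show ?thesis .
  qed
  have "(\<Sum>x\<in>yball y r. (u (x * h) - u x)\<^sup>2) \<le> (\<Sum>x\<in>yball y r. real n * (\<Sum>i<n. grad2 u (x * g i)))"
    by (intro sum_mono pt)
  also have "\<dots> = real n * (\<Sum>i<n. \<Sum>x\<in>yball y r. grad2 u (x * g i))"
    by (simp add: sum_distrib_left [symmetric] sum.swap[of _ "yball y r"])
  also have "\<dots> \<le> real n * (\<Sum>i<n. \<Sum>z\<in>yball y (r + m). grad2 u z)"
  proof (intro mult_left_mono sum_mono)
    fix i assume "i \<in> {..<n}"
    have "(\<Sum>x\<in>yball y r. grad2 u (x * g i)) = (\<Sum>z\<in>(\<lambda>x. x * g i) ` yball y r. grad2 u z)"
      by (subst sum.reindex) (auto simp: inj_on_def grp_right_cancel)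
    also have "\<dots> \<le> (\<Sum>z\<in>yball y (r + m). grad2 u z)"
      using gB[of i] \<open>i \<in> _\<close> yball_mult grad2_nonneg by (intro sum_mono2 fin_yball) auto
    finally show "(\<Sum>x\<in>yball y r. grad2 u (x * g i)) \<le> (\<Sum>z\<in>yball y (r + m). grad2 u z)" .
  qed simp
  also have "\<dots> = (real n)\<^sup>2 * (\<Sum>z\<in>yball y (r + m). grad2 u z)" by (simp add: power2_eq_square)
  also have "\<dots> \<le> (real m)\<^sup>2 * (\<Sum>z\<in>yball y (r + m). grad2 u z)"
    using w(2) grad2_nonneg by (intro mult_right_mono power_mono sum_nonneg) (auto simp: n_def)
  finally show ?thesis .
qed

text \<open>The sum of squares is a mean term plus the averaged squared differences of pairs. Two
  points of the ball differ by an element of length at most \<open>2 * r\<close>, so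
  \<open>displacement_le_gradient\<close> applies, and the connecting paths stay in the ball of
  radius \<open>3 * r\<close>.\<close>

lemma poincare:
  "(\<Sum>x\<in>yball y r. (u x)\<^sup>2) \<le> 2 * (real r)\<^sup>2 * (card (B (2 * r)) / card (B r)) * (\<Sum>z\<in>yball y (3 * r). grad2 u z)
     + (\<Sum>x\<in>yball y r. u x)\<^sup>2 / card (B r)"
proof -
  let ?D = "yball y r" and ?G = "\<Sum>z\<in>yball y (3 * r). grad2 u z"
  have ne: "?D \<noteq> {}" using B_one by (auto simp: yball_def)
  have "(\<Sum>x\<in>?D. \<Sum>x'\<in>?D. (u x' - u x)\<^sup>2) \<le> (\<Sum>x\<in>?D. \<Sum>h\<in>B (2 * r). (u (x * h) - u x)\<^sup>2)"
  proof (rule sum_mono)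
    fix x assume x: "x \<in> ?D"
    have sub: "(\<lambda>x'. inverse x * x') ` ?D \<subseteq> B (2 * r)"
    proof
      fix h assume "h \<in> (\<lambda>x'. inverse x * x') ` ?D"
      then obtain x' where x': "x' \<in> ?D" "h = inverse x * x'" by blast
      have "inverse (inverse y * x) * (inverse y * x') \<in> B (r + r)"
        by (intro B_mult B_inv) (use x x' yball_iff in auto)
      thus "h \<in> B (2 * r)" using x'(2) by (simp add: grp_simps mult_2)
    qed
    have "(\<Sum>x'\<in>?D. (u x' - u x)\<^sup>2) = (\<Sum>h\<in>(\<lambda>x'. inverse x * x') ` ?D. (u (x * h) - u x)\<^sup>2)"
      by (subst sum.reindex) (auto simp: inj_on_def grp_simps)
    also have "\<dots> \<le> (\<Sum>h\<in>B (2 * r). (u (x * h) - u x)\<^sup>2)" by (intro sum_mono2 fin_B sub) auto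
    finally show "(\<Sum>x'\<in>?D. (u x' - u x)\<^sup>2) \<le> (\<Sum>h\<in>B (2 * r). (u (x * h) - u x)\<^sup>2)" .
  qed
  also have "\<dots> = (\<Sum>h\<in>B (2 * r). \<Sum>x\<in>?D. (u (x * h) - u x)\<^sup>2)" by (rule sum.swap)
  also have "\<dots> \<le> (\<Sum>h\<in>B (2 * r). (real (2 * r))\<^sup>2 * ?G)"
  proof (rule sum_mono)
    fix h assume h: "h \<in> B (2 * r)"
    have "r + 2 * r = 3 * r" by simp
    thus "(\<Sum>x\<in>?D. (u (x * h) - u x)\<^sup>2) \<le> (real (2 * r))\<^sup>2 * ?G"
      using displacement_le_gradient[OF h, of u y r] by simp
  qed
  also have "\<dots> = card (B (2 * r)) * (4 * (real r)\<^sup>2 * ?G)" by (simp add: power_mult_distrib)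
  finally have "(\<Sum>x\<in>?D. \<Sum>x'\<in>?D. (u x' - u x)\<^sup>2) / (2 * card ?D) \<le> card (B (2 * r)) * (4 * (real r)\<^sup>2 * ?G) / (2 * card ?D)"
    by (rule divide_right_mono) simp
  also have "\<dots> = 2 * (real r)\<^sup>2 * (card (B (2 * r)) / card (B r)) * ?G" by (simp add: card_yball)
  finally show ?thesis using sum_sq_mean[OF fin_yball ne, of u] by (simp add: card_yball)
qed

text \<open>A cut-off function equal to 1 on \<open>B R\<close> and 0 outside
  \<open>B (2 * R)\<close>, linear in the word length in between; counting radii avoids introducing
  the word length itself.\<close>

definition cut :: "nat \<Rightarrow> 'a \<Rightarrow> real" where
  "cut R x = card {k \<in> {R..<2 * R}. x \<in> B k} / R"

lemma cut_one: "0 < R \<Longrightarrow> x \<in> B R \<Longrightarrow> cut R x = 1"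
proof -
  assume "0 < R" "x \<in> B R"
  hence "{k \<in> {R..<2 * R}. x \<in> B k} = {R..<2 * R}" using subsetD[OF B_mono] by auto
  thus ?thesis using \<open>0 < R\<close> by (simp add: cut_def)
qed

lemma cut_zero: "x \<notin> B (2 * R) \<Longrightarrow> cut R x = 0"
proof -
  assume "x \<notin> B (2 * R)"
  hence "x \<notin> B k" if "k < 2 * R" for k using B_mono[of k "2 * R"] that by auto
  hence "{k \<in> {R..<2 * R}. x \<in> B k} = {}" by auto
  thus ?thesis by (simp add: cut_def)
qed

lemma cut_lip:
  assumes "0 < R" "s \<in> S"
  shows "\<bar>cut R (x * s) - cut R x\<bar> \<le> 1 / R"
proof -
  have le: "card {k \<in> {R..<2 * R}. x \<in> B k} \<le> card {k \<in> {R..<2 * R}. x * s \<in> B k} + 1" if s: "s \<in> S" for x s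
  proof -
    have "{k \<in> {R..<2 * R}. x \<in> B k} \<subseteq> insert (2 * R - 1) ((\<lambda>k. k - 1) ` {k \<in> {R..<2 * R}. x * s \<in> B k})"
    proof
      fix k assume k: "k \<in> {k \<in> {R..<2 * R}. x \<in> B k}"
      hence "x * s \<in> B (Suc k)" using B_mult[OF _ S_B[OF s], of x k] by simp
      thus "k \<in> insert (2 * R - 1) ((\<lambda>k. k - 1) ` {k \<in> {R..<2 * R}. x * s \<in> B k})"
        using k by (cases "k = 2 * R - 1") (auto intro!: image_eqI[of _ _ "Suc k"])
    qed
    hence "card {k \<in> {R..<2 * R}. x \<in> B k} \<le> card (insert (2 * R - 1) ((\<lambda>k. k - 1) ` {k \<in> {R..<2 * R}. x * s \<in> B k}))"
      by (intro card_mono) auto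
    also have "\<dots> \<le> Suc (card ((\<lambda>k. k - 1) ` {k \<in> {R..<2 * R}. x * s \<in> B k}))" by (simp add: card_insert_if)
    also have "\<dots> \<le> Suc (card {k \<in> {R..<2 * R}. x * s \<in> B k})" using card_image_le[of "{k \<in> {R..<2 * R}. x * s \<in> B k}" "\<lambda>k. k - 1"] by simp
    finally show ?thesis by simp
  qed
  have "\<bar>real (card {k \<in> {R..<2 * R}. x * s \<in> B k}) - real (card {k \<in> {R..<2 * R}. x \<in> B k})\<bar> \<le> 1"
    using le[OF assms(2), of x] le[OF S_inv[OF assms(2)], of "x * s"] by (simp add: grp_simps)
  hence "\<bar>real (card {k \<in> {R..<2 * R}. x * s \<in> B k}) - real (card {k \<in> {R..<2 * R}. x \<in> B k})\<bar> / R \<le> 1 / R"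
    by (rule divide_right_mono) simp
  thus ?thesis by (simp add: cut_def diff_divide_distrib [symmetric] abs_divide)
qed

text \<open>The difference of the two sides is a sum of squares. The product on the right is the
  term that harmonicity makes vanish after summation.\<close>

lemma cutoff_ineq:
  fixes a b u v :: real
  shows "(a\<^sup>2 + b\<^sup>2) * (u - v)\<^sup>2 / 4 \<le> (a\<^sup>2 * u - b\<^sup>2 * v) * (u - v) + (a - b)\<^sup>2 * (u + v)\<^sup>2 / 2"
proof -
  have "(a\<^sup>2 * u - b\<^sup>2 * v) * (u - v) + (a - b)\<^sup>2 * (u + v)\<^sup>2 / 2 - (a\<^sup>2 + b\<^sup>2) * (u - v)\<^sup>2 / 4
    = ((a + b) * (u - v) / 2 + (a - b) * (u + v))\<^sup>2 / 2 + (a - b)\<^sup>2 * (u - v)\<^sup>2 / 8"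
    by (simp add: power2_eq_square field_simps)
  also have "\<dots> \<ge> 0" by simp
  finally show ?thesis by simp
qed

text \<open>Test harmonicity against the function times the squared cut-off. The resulting terms
  \<open>F\<close> sum to zero in both orientations of the edges, and \<open>cutoff_ineq\<close>
  leaves an error that lives where the cut-off varies. There it is at most \<open>1 / R\<close> per
  edge, and both endpoints lie in \<open>B (3 * R)\<close>.\<close>

lemma caccioppoli:
  assumes u: "harmonic u" and R: "0 < R"
  shows "(\<Sum>z\<in>B R. grad2 u z) \<le> 8 * card S / (real R)\<^sup>2 * nrm2 u (3 * R)"
proof -
  let ?a = "cut R"
  define F where "F = (\<lambda>x y. (?a x)\<^sup>2 * u x * (u x - u y))"
  define U where "U = (\<lambda>x. if x \<in> B (3 * R) then (u x)\<^sup>2 else 0)"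
  define P where "P = (\<lambda>s x. ((?a x)\<^sup>2 + (?a (x * s))\<^sup>2) * (u x - u (x * s))\<^sup>2 / 4)"
  have fa: "finsupp ?a" by (rule finsuppI[OF fin_B[of "2 * R"] cut_zero])
  have fa2: "finsupp (\<lambda>x. (?a x)\<^sup>2)" by (rule finsupp_power[OF fa])
  have fas: "finsupp (\<lambda>x. (?a (x * s))\<^sup>2)" for s by (rule finsupp_shift(2)[OF fa2])
  have fF: "finsupp (\<lambda>x. F x (h x))" for h unfolding F_def by (intro finsupp_mult1 fa2)
  have fF': "finsupp (\<lambda>x. F (x * s) x)" for s unfolding F_def by (intro finsupp_mult1 fas)
  have fU: "finsupp U" by (rule finsuppI[OF fin_B[of "3 * R"]]) (simp add: U_def)
  have totU: "tot U = nrm2 u (3 * R)"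
  proof -
    have "{x. U x \<noteq> 0} \<subseteq> B (3 * R)" by (auto simp: U_def)
    from tot_superset[OF fin_B this] show ?thesis by (simp add: U_def nrm2_def)
  qed
  have fP: "finsupp (P s)" for s
    unfolding P_def by (intro finsupp_divide finsupp_mult1 finsupp_add fa2 fas)
  have zero: "(\<Sum>s\<in>S. tot (\<lambda>x. F x (x * s))) = 0"
  proof -
    have "(\<Sum>s\<in>S. tot (\<lambda>x. F x (x * s))) = tot (\<lambda>x. \<Sum>s\<in>S. F x (x * s))"
      by (rule tot_sum[symmetric, OF fin_S fF])
    also have "(\<lambda>x. \<Sum>s\<in>S. F x (x * s)) = (\<lambda>x. 0)"
    proof
      fix x
      have "(\<Sum>s\<in>S. F x (x * s)) = - (?a x)\<^sup>2 * u x * (\<Sum>s\<in>S. u (x * s) - u x)"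
        unfolding sum_distrib_left by (rule sum.cong) (simp_all add: F_def algebra_simps)
      also have "\<dots> = 0"
      proof (cases "x \<in> B (2 * R)")
        case True
        thus ?thesis using u B_sub by (auto simp: harmonic_def)
      qed (simp add: cut_zero)
      finally show "(\<Sum>s\<in>S. F x (x * s)) = 0" .
    qed
    finally show ?thesis by (simp add: tot_def)
  qed
  have "(\<Sum>s\<in>S. tot (\<lambda>x. F (x * s) x)) = (\<Sum>s\<in>S. tot (\<lambda>z. F z (z * inverse s)))"
  proof (rule sum.cong[OF refl])
    fix s
    show "tot (\<lambda>x. F (x * s) x) = tot (\<lambda>z. F z (z * inverse s))"
      using tot_rshift[of "\<lambda>z. F z (z * inverse s)" s] by (simp add: grp_simps)
  qed
  also have "\<dots> = 0" using sum_S_inv[of "\<lambda>s. tot (\<lambda>z. F z (z * s))"] zero by simp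
  finally have zero': "(\<Sum>s\<in>S. tot (\<lambda>x. F (x * s) x)) = 0" .
  have bound: "tot (P s) \<le> tot (\<lambda>x. F x (x * s)) + tot (\<lambda>x. F (x * s) x) + 2 / (real R)\<^sup>2 * nrm2 u (3 * R)" if s: "s \<in> S" for s
  proof -
    have pt: "P s x \<le> (F x (x * s) + F (x * s) x) + (1 / (real R)\<^sup>2 * U x + 1 / (real R)\<^sup>2 * U (x * s))" for x
    proof -
      have "P s x \<le> ((?a x)\<^sup>2 * u x - (?a (x * s))\<^sup>2 * u (x * s)) * (u x - u (x * s)) + (?a x - ?a (x * s))\<^sup>2 * (u x + u (x * s))\<^sup>2 / 2"
        unfolding P_def by (rule cutoff_ineq)
      also have "((?a x)\<^sup>2 * u x - (?a (x * s))\<^sup>2 * u (x * s)) * (u x - u (x * s)) = F x (x * s) + F (x * s) x"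
        by (simp add: F_def algebra_simps)
      also have "(?a x - ?a (x * s))\<^sup>2 * (u x + u (x * s))\<^sup>2 / 2 \<le> 1 / (real R)\<^sup>2 * U x + 1 / (real R)\<^sup>2 * U (x * s)"
      proof (cases "?a x = ?a (x * s)")
        case False
        have "x \<in> B (2 * R) \<or> x * s \<in> B (2 * R)" using False cut_zero by metis
        hence "x \<in> B (Suc (2 * R)) \<and> x * s \<in> B (Suc (2 * R))"
          using B_mult[OF _ S_B[OF s], of x "2 * R"] B_mult[OF _ S_B[OF S_inv[OF s]], of "x * s" "2 * R"]
            B_mono[of "2 * R" "Suc (2 * R)"] by (auto simp: grp_simps)
        hence xB: "x \<in> B (3 * R)" "x * s \<in> B (3 * R)" using B_mono[of "Suc (2 * R)" "3 * R"] R by auto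
        have "(?a x - ?a (x * s))\<^sup>2 \<le> (1 / R)\<^sup>2"
          using cut_lip[OF R s, of x] by (metis abs_le_square_iff abs_minus_commute abs_of_nonneg divide_nonneg_nonneg of_nat_0_le_iff zero_le_one)
        hence "(?a x - ?a (x * s))\<^sup>2 * (u x + u (x * s))\<^sup>2 / 2 \<le> (1 / R)\<^sup>2 * (u x + u (x * s))\<^sup>2 / 2"
          by (intro divide_right_mono mult_right_mono) auto
        also have "\<dots> \<le> (1 / R)\<^sup>2 * (2 * ((u x)\<^sup>2 + (u (x * s))\<^sup>2)) / 2"
          using sum_squares_bound[of "u x" "u (x * s)"] by (intro divide_right_mono mult_left_mono) (auto simp: power2_sum)
        finally show ?thesis using xB by (simp add: U_def power_divide algebra_simps add_divide_distrib)
      qed (simp add: U_def)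
      finally show ?thesis by simp
    qed
    have f1: "finsupp (\<lambda>x. F x (x * s) + F (x * s) x)" by (rule finsupp_add[OF fF fF'])
    have f2: "finsupp (\<lambda>x. 1 / (real R)\<^sup>2 * U x)" "finsupp (\<lambda>x. 1 / (real R)\<^sup>2 * U (x * s))"
      by (rule finsupp_mult2[OF fU], rule finsupp_mult2[OF finsupp_shift(2)[OF fU]])
    have "tot (P s) \<le> tot (\<lambda>x. (F x (x * s) + F (x * s) x) + (1 / (real R)\<^sup>2 * U x + 1 / (real R)\<^sup>2 * U (x * s)))"
      by (rule tot_mono[OF fP finsupp_add[OF f1 finsupp_add[OF f2]] pt])
    also have "\<dots> = (tot (\<lambda>x. F x (x * s)) + tot (\<lambda>x. F (x * s) x)) + (1 / (real R)\<^sup>2 * tot U + 1 / (real R)\<^sup>2 * tot (\<lambda>x. U (x * s)))"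
      by (simp only: tot_add[OF f1 finsupp_add[OF f2]] tot_add[OF fF fF'] tot_add[OF f2] tot_cmult)
    finally show ?thesis by (simp add: tot_rshift totU)
  qed
  have "(\<Sum>z\<in>B R. grad2 u z) / 4 = (\<Sum>s\<in>S. \<Sum>x\<in>B R. (u x - u (x * s))\<^sup>2 / 4)"
    by (simp add: grad2_def sum.swap[of _ S] sum_divide_distrib power2_commute)
  also have "\<dots> \<le> (\<Sum>s\<in>S. \<Sum>x\<in>B R. P s x)"
  proof (intro sum_mono)
    fix s x assume "x \<in> B R"
    hence "1 * (u x - u (x * s))\<^sup>2 \<le> ((?a x)\<^sup>2 + (?a (x * s))\<^sup>2) * (u x - u (x * s))\<^sup>2"
      by (intro mult_right_mono) (simp_all add: cut_one[OF R])
    thus "(u x - u (x * s))\<^sup>2 / 4 \<le> P s x" by (simp add: P_def)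
  qed
  also have "\<dots> \<le> (\<Sum>s\<in>S. tot (P s))"
    by (intro sum_mono tot_ge_sum fP fin_B) (simp add: P_def)
  also have "\<dots> \<le> (\<Sum>s\<in>S. tot (\<lambda>x. F x (x * s)) + tot (\<lambda>x. F (x * s) x) + 2 / (real R)\<^sup>2 * nrm2 u (3 * R))"
    by (intro sum_mono bound)
  also have "\<dots> = card S * (2 / (real R)\<^sup>2 * nrm2 u (3 * R))" using zero zero' by (simp add: sum.distrib)
  finally show ?thesis by (simp add: field_simps)
qed

text \<open>\<open>Y\<close> is a maximal set of centres with disjoint balls of radius
  \<open>\<rho>\<close>. Maximality makes the balls of twice the radius cover; disjointness bounds
  the number of centres in a region by a ratio of volumes. Multiplicity is counted at radius
  \<open>6 * \<rho>\<close> because the Poincare inequality at radius \<open>2 * \<rho>\<close>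
  looks that far.\<close>

lemma ball_cover:
  obtains Y where "Y \<subseteq> B R" "finite Y" "B R \<subseteq> (\<Union>y\<in>Y. yball y (2 * \<rho>))"
    "card Y * card (B \<rho>) \<le> card (B (R + \<rho>))"
    "\<forall>z. card {y \<in> Y. z \<in> yball y (6 * \<rho>)} * card (B \<rho>) \<le> card (B (7 * \<rho>))"
proof -
  define sep where "sep = (\<lambda>Y. Y \<subseteq> B R \<and> (\<forall>y\<in>Y. \<forall>y'\<in>Y. y \<noteq> y' \<longrightarrow> yball y \<rho> \<inter> yball y' \<rho> = {}))"
  have bnd: "card Y \<le> card (B R)" if "sep Y" for Y using that card_mono[OF fin_B] by (auto simp: sep_def)
  have "sep {}" by (simp add: sep_def)
  then obtain Y where Y: "sep Y" "\<And>Z. sep Z \<Longrightarrow> card Z \<le> card Y"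
    using ex_has_greatest_nat[of sep "{}" card "Suc (card (B R))"] bnd by (metis less_Suc_eq_le)
  have YB: "Y \<subseteq> B R" "finite Y" using Y(1) fin_B finite_subset by (auto simp: sep_def)
  have packing: "card Z * card (B \<rho>) \<le> card W" if "Z \<subseteq> Y" "\<And>y. y \<in> Z \<Longrightarrow> yball y \<rho> \<subseteq> W" "finite W" for Z W
  proof -
    have fZ: "finite Z" using that(1) YB(2) finite_subset by blast
    have "\<forall>i\<in>Z. \<forall>j\<in>Z. i \<noteq> j \<longrightarrow> yball i \<rho> \<inter> yball j \<rho> = {}"
      using Y(1) that(1) unfolding sep_def by blast
    hence "card (\<Union>y\<in>Z. yball y \<rho>) = (\<Sum>y\<in>Z. card (yball y \<rho>))"
      using fZ fin_yball by (intro card_UN_disjoint) auto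
    hence "card Z * card (B \<rho>) = card (\<Union>y\<in>Z. yball y \<rho>)" by (simp add: card_yball)
    also have "\<dots> \<le> card W" using that(2,3) by (intro card_mono) auto
    finally show ?thesis .
  qed
  have cover: "B R \<subseteq> (\<Union>y\<in>Y. yball y (2 * \<rho>))"
  proof
    fix x assume x: "x \<in> B R"
    show "x \<in> (\<Union>y\<in>Y. yball y (2 * \<rho>))"
    proof (cases "x \<in> Y")
      case True
      thus ?thesis using B_one by (intro UN_I[of x]) (simp_all add: yball_iff grp_simps)
    next
      case False
      have "\<exists>y\<in>Y. yball x \<rho> \<inter> yball y \<rho> \<noteq> {}"
      proof (rule ccontr)
        assume "\<not> ?thesis"
        hence "\<forall>y\<in>Y. yball x \<rho> \<inter> yball y \<rho> = {}" by blast
        hence "sep (insert x Y)" using Y(1) x unfolding sep_def by (simp add: Int_commute)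
        from Y(2)[OF this] show False using False YB(2) by simp
      qed
      then obtain y where y: "y \<in> Y" "yball x \<rho> \<inter> yball y \<rho> \<noteq> {}" by blast
      then obtain z where z: "inverse x * z \<in> B \<rho>" "inverse y * z \<in> B \<rho>" by (auto simp: yball_iff)
      have "inverse y * z * inverse (inverse x * z) \<in> B (\<rho> + \<rho>)" by (intro B_mult B_inv z)
      hence "x \<in> yball y (2 * \<rho>)" by (simp add: yball_iff grp_simps mult_2)
      thus ?thesis using y(1) by blast
    qed
  qed
  have "card Y * card (B \<rho>) \<le> card (B (R + \<rho>))"
  proof (rule packing[OF order_refl _ fin_B])
    fix y assume "y \<in> Y"
    thus "yball y \<rho> \<subseteq> B (R + \<rho>)" using YB(1) by (intro yball_subset_B) auto
  qed
  moreover have "card {y \<in> Y. z \<in> yball y (6 * \<rho>)} * card (B \<rho>) \<le> card (B (7 * \<rho>))" for z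
  proof -
    have "card {y \<in> Y. z \<in> yball y (6 * \<rho>)} * card (B \<rho>) \<le> card (yball z (7 * \<rho>))"
    proof (rule packing[OF _ _ fin_yball])
      fix y assume "y \<in> {y \<in> Y. z \<in> yball y (6 * \<rho>)}"
      hence y: "inverse y * z \<in> B (6 * \<rho>)" by (simp add: yball_iff)
      show "yball y \<rho> \<subseteq> yball z (7 * \<rho>)"
      proof
        fix w assume "w \<in> yball y \<rho>"
        hence "inverse (inverse y * z) * (inverse y * w) \<in> B (6 * \<rho> + \<rho>)" by (intro B_mult B_inv y) (simp add: yball_iff)
        thus "w \<in> yball z (7 * \<rho>)" by (simp add: yball_iff grp_simps)
      qed
    qed auto
    thus ?thesis by (simp add: card_yball)
  qed
  ultimately show ?thesis using that YB cover by blast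
qed

text \<open>At a scale where the volume of balls is doubling, a harmonic function whose means over the
  small balls of a cover vanish is much smaller on the ball than on a larger concentric ball.\<close>

lemma contraction:
  assumes rho: "0 < \<rho>" and K: "6 \<le> K"
    and M: "card (B (8 * \<rho>)) \<le> M * card (B \<rho>)"
    and N: "card (B (2 * K * \<rho>)) \<le> N * card (B \<rho>)"
  obtains Y where "finite Y" "card Y \<le> N"
    "\<And>u y. y \<in> Y \<Longrightarrow> (\<Sum>x\<in>yball y (2 * \<rho>). u x)\<^sup>2 / card (B (2 * \<rho>)) \<le> nrm2 u (6 * (K * \<rho>))"
    "\<And>u. harmonic u \<Longrightarrow> nrm2 u (K * \<rho>) \<le> 16 * card S * (real M)\<^sup>2 / (real K)\<^sup>2 * nrm2 u (6 * (K * \<rho>))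
        + (\<Sum>y\<in>Y. (\<Sum>x\<in>yball y (2 * \<rho>). u x)\<^sup>2 / card (B (2 * \<rho>)))"
proof -
  define R where "R = K * \<rho>"
  obtain Y where Y: "Y \<subseteq> B R" "finite Y" "B R \<subseteq> (\<Union>y\<in>Y. yball y (2 * \<rho>))"
    "card Y * card (B \<rho>) \<le> card (B (R + \<rho>))"
    "\<forall>z. card {y \<in> Y. z \<in> yball y (6 * \<rho>)} * card (B \<rho>) \<le> card (B (7 * \<rho>))"
    by (rule ball_cover[of R \<rho>])
  have R6: "6 * \<rho> \<le> R" using K by (simp add: R_def)
  have "card Y * card (B \<rho>) \<le> card (B (2 * K * \<rho>))"
    using Y(4) card_mono[OF fin_B B_mono[of "R + \<rho>" "2 * K * \<rho>"]] K by (force simp: R_def)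
  hence "card Y * card (B \<rho>) \<le> N * card (B \<rho>)" using N by linarith
  hence YN: "card Y \<le> N" using card_B_pos[of \<rho>] by simp
  \<comment> \<open>The single ratio of the volumes at \<open>8 * \<rho>\<close> and
    \<open>\<rho>\<close> controls both the multiplicity of the cover (radius
    \<open>7 * \<rho>\<close>) and the doubling constant in the Poincare inequality (radius
    \<open>4 * \<rho>\<close>).\<close>
  have mult: "card {y \<in> Y. z \<in> yball y (6 * \<rho>)} \<le> M" for z
  proof -
    have "card {y \<in> Y. z \<in> yball y (6 * \<rho>)} * card (B \<rho>) \<le> M * card (B \<rho>)"
    proof -
      have "card (B (7 * \<rho>)) \<le> card (B (8 * \<rho>))" by (intro card_mono fin_B B_mono) simp
      thus ?thesis using Y(5)[rule_format, of z] M by linarith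
    qed
    thus ?thesis using card_B_pos[of \<rho>] by simp
  qed
  have ratio: "card (B (2 * (2 * \<rho>))) / card (B (2 * \<rho>)) \<le> M"
  proof -
    have "card (B (2 * (2 * \<rho>))) \<le> M * card (B (2 * \<rho>))"
      using card_mono[OF fin_B B_mono[of "2 * (2 * \<rho>)" "8 * \<rho>"]] M
        mult_le_mono2[OF card_mono[OF fin_B B_mono[of \<rho> "2 * \<rho>"]], of M] by linarith
    hence "real (card (B (2 * (2 * \<rho>)))) \<le> real M * card (B (2 * \<rho>))" by (metis of_nat_le_iff of_nat_mult)
    thus ?thesis using card_B_pos[of "2 * \<rho>"] by (simp add: divide_le_eq)
  qed
  show ?thesis
  proof (rule that[OF Y(2) YN])
    fix u :: "'a \<Rightarrow> real" and y assume y: "y \<in> Y"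
    have "(\<Sum>x\<in>yball y (2 * \<rho>). 1 * u x)\<^sup>2 \<le> (\<Sum>x\<in>yball y (2 * \<rho>). 1\<^sup>2) * (\<Sum>x\<in>yball y (2 * \<rho>). (u x)\<^sup>2)"
      by (rule Cauchy_Schwarz_ineq_sum)
    hence "(\<Sum>x\<in>yball y (2 * \<rho>). u x)\<^sup>2 / card (B (2 * \<rho>)) \<le> (\<Sum>x\<in>yball y (2 * \<rho>). (u x)\<^sup>2)"
      using card_B_pos[of "2 * \<rho>"] by (simp add: card_yball divide_le_eq mult.commute)
    also have "\<dots> \<le> nrm2 u (6 * (K * \<rho>))" unfolding nrm2_def
    proof (rule sum_mono2[OF fin_B])
      have "yball y (2 * \<rho>) \<subseteq> B (R + 2 * \<rho>)" using y Y(1) by (intro yball_subset_B) auto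
      also have "\<dots> \<subseteq> B (6 * (K * \<rho>))" using R6 by (intro B_mono) (unfold R_def [symmetric], linarith)
      finally show "yball y (2 * \<rho>) \<subseteq> B (6 * (K * \<rho>))" .
    qed simp
    finally show "(\<Sum>x\<in>yball y (2 * \<rho>). u x)\<^sup>2 / card (B (2 * \<rho>)) \<le> nrm2 u (6 * (K * \<rho>))" .
  next
    fix u assume u: "harmonic u"
    let ?m = "\<lambda>y. (\<Sum>x\<in>yball y (2 * \<rho>). u x)\<^sup>2 / card (B (2 * \<rho>))"
    have "nrm2 u R \<le> (\<Sum>x\<in>(\<Union>y\<in>Y. yball y (2 * \<rho>)). (u x)\<^sup>2)"
      unfolding nrm2_def using Y fin_yball by (intro sum_mono2) auto
    also have "\<dots> \<le> (\<Sum>y\<in>Y. \<Sum>x\<in>yball y (2 * \<rho>). (u x)\<^sup>2)"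
      by (rule sum_UN_le) (use Y(2) fin_yball in auto)
    also have "\<dots> \<le> (\<Sum>y\<in>Y. 2 * (real (2 * \<rho>))\<^sup>2 * M * (\<Sum>z\<in>yball y (6 * \<rho>). grad2 u z) + ?m y)"
    proof (rule sum_mono)
      fix y assume "y \<in> Y"
      have "(\<Sum>x\<in>yball y (2 * \<rho>). (u x)\<^sup>2) \<le> 2 * (real (2 * \<rho>))\<^sup>2 * (card (B (2 * (2 * \<rho>))) / card (B (2 * \<rho>))) * (\<Sum>z\<in>yball y (6 * \<rho>). grad2 u z) + ?m y"
        using poincare[of u y "2 * \<rho>"] by simp
      also have "\<dots> \<le> 2 * (real (2 * \<rho>))\<^sup>2 * M * (\<Sum>z\<in>yball y (6 * \<rho>). grad2 u z) + ?m y"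
        using grad2_nonneg by (intro add_right_mono mult_right_mono mult_left_mono ratio sum_nonneg) auto
      finally show "(\<Sum>x\<in>yball y (2 * \<rho>). (u x)\<^sup>2) \<le> 2 * (real (2 * \<rho>))\<^sup>2 * M * (\<Sum>z\<in>yball y (6 * \<rho>). grad2 u z) + ?m y" .
    qed
    also have "\<dots> = 8 * (real \<rho>)\<^sup>2 * M * (\<Sum>y\<in>Y. \<Sum>z\<in>yball y (6 * \<rho>). grad2 u z) + (\<Sum>y\<in>Y. ?m y)"
      by (simp add: sum.distrib sum_distrib_left power_mult_distrib mult.assoc)
    also have "(\<Sum>y\<in>Y. \<Sum>z\<in>yball y (6 * \<rho>). grad2 u z) \<le> M * (\<Sum>z\<in>B (2 * R). grad2 u z)"
    proof -
      have sub: "yball y (6 * \<rho>) \<subseteq> B (2 * R)" if "y \<in> Y" for y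
        using yball_subset_B[of y R "6 * \<rho>"] that Y(1) B_mono[of "R + 6 * \<rho>" "2 * R"] R6 by auto
      have "(\<Sum>y\<in>Y. \<Sum>z\<in>yball y (6 * \<rho>). grad2 u z) = (\<Sum>y\<in>Y. \<Sum>z\<in>B (2 * R). if z \<in> yball y (6 * \<rho>) then grad2 u z else 0)"
      proof (rule sum.cong[OF refl])
        fix y assume "y \<in> Y"
        have "B (2 * R) \<inter> yball y (6 * \<rho>) = yball y (6 * \<rho>)" using sub[OF \<open>y \<in> Y\<close>] by auto
        thus "(\<Sum>z\<in>yball y (6 * \<rho>). grad2 u z) = (\<Sum>z\<in>B (2 * R). if z \<in> yball y (6 * \<rho>) then grad2 u z else 0)"
          by (simp add: sum.inter_restrict[OF fin_B, symmetric])
      qed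
      also have "\<dots> = (\<Sum>z\<in>B (2 * R). card {y \<in> Y. z \<in> yball y (6 * \<rho>)} * grad2 u z)"
        using Y(2) by (subst sum.swap) (simp add: sum.inter_filter [symmetric])
      also have "\<dots> \<le> (\<Sum>z\<in>B (2 * R). M * grad2 u z)"
        using mult grad2_nonneg by (intro sum_mono mult_right_mono) auto
      finally show ?thesis by (simp add: sum_distrib_left)
    qed
    also have "(\<Sum>z\<in>B (2 * R). grad2 u z) \<le> 8 * card S / (real (2 * R))\<^sup>2 * nrm2 u (6 * R)"
      using caccioppoli[OF u, of "2 * R"] R6 rho by simp
    finally have "nrm2 u R \<le> 8 * (real \<rho>)\<^sup>2 * M * (M * (8 * card S / (real (2 * R))\<^sup>2 * nrm2 u (6 * R))) + (\<Sum>y\<in>Y. ?m y)"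
      by (simp add: mult_left_mono)
    \<comment> \<open>With \<open>R = K * \<rho>\<close> the radius cancels: 8 from the Poincare
      inequality at \<open>2 * \<rho>\<close>, 8 from the Caccioppoli inequality and a quarter from
      its radius \<open>2 * R\<close> make 16.\<close>
    also have "8 * (real \<rho>)\<^sup>2 * M * (M * (8 * card S / (real (2 * R))\<^sup>2 * nrm2 u (6 * R)))
        = 16 * card S * (real M)\<^sup>2 / (real K)\<^sup>2 * nrm2 u (6 * R)"
      using rho K by (simp add: R_def power_mult_distrib power2_eq_square field_simps)
    finally show "nrm2 u (K * \<rho>) \<le> 16 * card S * (real M)\<^sup>2 / (real K)\<^sup>2 * nrm2 u (6 * (K * \<rho>)) + (\<Sum>y\<in>Y. ?m y)"
      by (simp add: R_def)
  qed
qed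

end

context cayley
begin

section \<open>Entropy of combinations of Lipschitz harmonic functions\<close>

lemma harmonic_add: "harmonic u \<Longrightarrow> harmonic v \<Longrightarrow> harmonic (\<lambda>x. u x + v x)"
  unfolding harmonic_def by (simp add: sum.distrib sum_subtractf algebra_simps)

lemma harmonic_cmult: "harmonic u \<Longrightarrow> harmonic (\<lambda>x. c * u x)"
  unfolding harmonic_def by (simp add: right_diff_distrib [symmetric] sum_distrib_left [symmetric])

lemma harmonic_diff: "harmonic u \<Longrightarrow> harmonic v \<Longrightarrow> harmonic (\<lambda>x. u x - v x)"
  using harmonic_add[OF _ harmonic_cmult[of v "-1"], of u] by simp

lemma harmonic_const: "harmonic (\<lambda>x. c)"
  by (simp add: harmonic_def)

lemma harmonic_sum: "finite I \<Longrightarrow> (\<And>i. i \<in> I \<Longrightarrow> harmonic (u i)) \<Longrightarrow> harmonic (\<lambda>x. \<Sum>i\<in>I. c i * u i x)"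
proof (induction I rule: finite_induct)
  case (insert i I)
  have "harmonic (\<lambda>x. c i * u i x + (\<Sum>i\<in>I. c i * u i x))"
    by (intro harmonic_add harmonic_cmult insert) (use insert in auto)
  thus ?case using insert by simp
qed (simp add: harmonic_const)

text \<open>Pigeonhole replaces restriction to the common kernel of the functionals. Each
  functional, measured from \<open>u0\<close> in units of \<open>sqrt r / z\<close>, has at most
  \<open>2 * z + 1\<close> integer parts. Functions with equal integer parts differ by at most one
  unit under every functional, and the condition on \<open>z\<close> keeps the sum of the squares at
  most \<open>\<delta> * r\<close>.\<close>

lemma pigeonhole_step:
  assumes A: "finite A" "A \<noteq> {}" "\<And>u. u \<in> A \<Longrightarrow> harmonic u"
    and diam: "\<And>u v. u \<in> A \<Longrightarrow> v \<in> A \<Longrightarrow> nrm2 (\<lambda>x. u x - v x) R' \<le> r"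
    and r: "0 < r" and delta: "0 < \<delta>" and z: "real N \<le> \<delta> * (real z)\<^sup>2" "0 < z"
    and Y: "finite Y" "card Y \<le> N"
    and lin: "\<And>y u v. y \<in> Y \<Longrightarrow> \<phi> y (\<lambda>x. u x - v x) = \<phi> y u - \<phi> y v"
    and le: "\<And>y u. y \<in> Y \<Longrightarrow> (\<phi> y u)\<^sup>2 \<le> nrm2 u R'"
    and con: "\<And>u. harmonic u \<Longrightarrow> nrm2 u R \<le> \<delta> * nrm2 u R' + (\<Sum>y\<in>Y. (\<phi> y u)\<^sup>2)"
  obtains A' where "A' \<subseteq> A" "A' \<noteq> {}" "card A \<le> (2 * z + 1) ^ N * card A'"
    "\<And>u v. u \<in> A' \<Longrightarrow> v \<in> A' \<Longrightarrow> nrm2 (\<lambda>x. u x - v x) R \<le> 2 * \<delta> * r"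
proof -
  obtain u0 where u0: "u0 \<in> A" using A(2) by blast
  define c where "c = (\<lambda>u. restrict (\<lambda>y. \<lfloor>\<phi> y (\<lambda>x. u x - u0 x) * z / sqrt r\<rfloor>) Y)"
  define E where "E = PiE Y (\<lambda>_. {- int z..int z})"
  have absle: "\<bar>\<phi> y (\<lambda>x. u x - v x)\<bar> \<le> sqrt r" if "y \<in> Y" "u \<in> A" "v \<in> A" for y u v
  proof -
    have "(\<phi> y (\<lambda>x. u x - v x))\<^sup>2 \<le> r" using le[OF that(1), of "\<lambda>x. u x - v x"] diam[OF that(2,3)] by linarith
    thus ?thesis by (metis real_sqrt_abs real_sqrt_le_iff)
  qed
  have cE: "c u \<in> E" if "u \<in> A" for u
  proof -
    have "\<lfloor>\<phi> y (\<lambda>x. u x - u0 x) * z / sqrt r\<rfloor> \<in> {- int z..int z}" if y: "y \<in> Y" for y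
    proof -
      have "\<bar>\<phi> y (\<lambda>x. u x - u0 x) * z / sqrt r\<bar> \<le> sqrt r * z / sqrt r"
      proof -
        have "\<bar>\<phi> y (\<lambda>x. u x - u0 x)\<bar> * real z \<le> sqrt r * real z"
          by (rule mult_right_mono[OF absle[OF y \<open>u \<in> A\<close> u0]]) simp
        hence "\<bar>\<phi> y (\<lambda>x. u x - u0 x)\<bar> * real z / sqrt r \<le> sqrt r * real z / sqrt r"
          using r by (intro divide_right_mono) auto
        thus ?thesis using r by (simp add: abs_mult abs_divide)
      qed
      also have "\<dots> = real z" using r by simp
      finally have "- real z \<le> \<phi> y (\<lambda>x. u x - u0 x) * z / sqrt r" "\<phi> y (\<lambda>x. u x - u0 x) * z / sqrt r < real z + 1"
        by linarith+
      thus ?thesis by (simp add: le_floor_iff floor_le_iff)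
    qed
    thus ?thesis by (auto simp: c_def E_def)
  qed
  have finE: "finite E" unfolding E_def by (intro finite_PiE Y) auto
  have cardE: "card E \<le> (2 * z + 1) ^ N"
  proof -
    have "card E = (2 * z + 1) ^ card Y" using Y(1) by (simp add: E_def card_PiE nat_add_distrib nat_mult_distrib)
    thus ?thesis using Y(2) by (simp add: power_increasing)
  qed
  have "E \<noteq> {}" using cE u0 by blast
  then obtain e where e: "card (c -` {e} \<inter> A) * card E \<ge> card A"
    using pigeonhole_card[of c A E] cE A(1) finE by blast
  define A' where "A' = c -` {e} \<inter> A"
  show ?thesis
  proof (rule that)
    show "A' \<subseteq> A" by (simp add: A'_def)
    have "card A \<le> card A' * card E" using e by (simp add: A'_def)
    also have "\<dots> \<le> (2 * z + 1) ^ N * card A'" using cardE by (simp add: mult.commute)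
    finally show cA: "card A \<le> (2 * z + 1) ^ N * card A'" .
    have "0 < card A" using A by (simp add: card_gt_0_iff)
    thus "A' \<noteq> {}" using cA by auto
    fix u v assume u: "u \<in> A'" and v: "v \<in> A'"
    have uA: "u \<in> A" "v \<in> A" "c u = c v" using u v by (auto simp: A'_def)
    have small: "(\<phi> y (\<lambda>x. u x - v x))\<^sup>2 \<le> r / (real z)\<^sup>2" if y: "y \<in> Y" for y
    proof -
      have "\<lfloor>\<phi> y (\<lambda>x. u x - u0 x) * z / sqrt r\<rfloor> = \<lfloor>\<phi> y (\<lambda>x. v x - u0 x) * z / sqrt r\<rfloor>"
        using fun_cong[OF uA(3), of y] y by (simp add: c_def)
      hence "\<bar>\<phi> y (\<lambda>x. u x - u0 x) * z / sqrt r - \<phi> y (\<lambda>x. v x - u0 x) * z / sqrt r\<bar> \<le> 1"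
        by linarith
      moreover have "\<phi> y (\<lambda>x. u x - u0 x) * z / sqrt r - \<phi> y (\<lambda>x. v x - u0 x) * z / sqrt r = \<phi> y (\<lambda>x. u x - v x) * (z / sqrt r)"
        by (simp add: lin[OF y] left_diff_distrib diff_divide_distrib)
      ultimately have "(\<phi> y (\<lambda>x. u x - v x) * (z / sqrt r))\<^sup>2 \<le> 1" by (simp add: abs_square_le_1)
      thus ?thesis using r z(2) by (simp add: power_mult_distrib power_divide field_simps)
    qed
    have "nrm2 (\<lambda>x. u x - v x) R \<le> \<delta> * nrm2 (\<lambda>x. u x - v x) R' + (\<Sum>y\<in>Y. (\<phi> y (\<lambda>x. u x - v x))\<^sup>2)"
      by (intro con harmonic_diff A uA)
    also have "\<dots> \<le> \<delta> * r + (\<Sum>y\<in>Y. r / (real z)\<^sup>2)"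
      using delta by (intro add_mono mult_left_mono diam uA sum_mono small) auto
    also have "\<dots> = \<delta> * r + card Y * (r / (real z)\<^sup>2)" by simp
    also have "\<dots> \<le> \<delta> * r + real N * (r / (real z)\<^sup>2)"
      using Y(2) r by (intro add_left_mono mult_right_mono) auto
    also have "\<dots> \<le> \<delta> * r + (\<delta> * (real z)\<^sup>2) * (r / (real z)\<^sup>2)"
      using z r by (intro add_left_mono mult_right_mono) auto
    also have "\<dots> = 2 * \<delta> * r" using z(2) by simp
    finally show "nrm2 (\<lambda>x. u x - v x) R \<le> 2 * \<delta> * r" .
  qed
qed

text \<open>Iterating over the good scales below \<open>n\<close>: a finite set of harmonic functions has a large subset
  whose members are exponentially close to one another on the smallest ball.\<close>

lemma entropy_iteration:
  fixes good :: "nat \<Rightarrow> bool" and R :: "nat \<Rightarrow> nat"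
  assumes delta: "0 < \<delta>" and z: "real N \<le> \<delta> * (real z)\<^sup>2" "0 < z"
    and R: "\<And>k. R k \<le> R (Suc k)"
    and good: "\<And>k. good k \<Longrightarrow> \<exists>Y \<phi> R'. finite Y \<and> card Y \<le> N \<and> R' \<le> R (Suc k)
      \<and> (\<forall>y\<in>Y. \<forall>u v. \<phi> y (\<lambda>x. u x - v x) = \<phi> y u - \<phi> y v)
      \<and> (\<forall>y\<in>Y. \<forall>u. (\<phi> (y::'a) u)\<^sup>2 \<le> nrm2 u R')
      \<and> (\<forall>u. harmonic u \<longrightarrow> nrm2 u (R k) \<le> \<delta> * nrm2 u R' + (\<Sum>y\<in>Y. (\<phi> y u)\<^sup>2))"
  shows "\<lbrakk>finite A; A \<noteq> {}; \<And>u. u \<in> A \<Longrightarrow> harmonic u; 0 < r;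
      \<And>u v. u \<in> A \<Longrightarrow> v \<in> A \<Longrightarrow> nrm2 (\<lambda>x. u x - v x) (R n) \<le> r\<rbrakk> \<Longrightarrow>
    \<exists>A'. A' \<subseteq> A \<and> A' \<noteq> {} \<and> card A \<le> ((2 * z + 1) ^ N) ^ card {k. k < n \<and> good k} * card A' \<and>
      (\<forall>u\<in>A'. \<forall>v\<in>A'. nrm2 (\<lambda>x. u x - v x) (R 0) \<le> (2 * \<delta>) ^ card {k. k < n \<and> good k} * r)"
proof (induction n arbitrary: A r)
  case 0
  thus ?case by (intro exI[of _ A]) auto
next
  case (Suc n)
  show ?case
  proof (cases "good n")
    case False
    hence e: "{k. k < Suc n \<and> good k} = {k. k < n \<and> good k}" by (auto simp: less_Suc_eq)
    have "nrm2 (\<lambda>x. u x - v x) (R n) \<le> r" if "u \<in> A" "v \<in> A" for u v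
      using nrm2_mono[OF R[of n], of "\<lambda>x. u x - v x"] Suc.prems(5)[OF that] by linarith
    from Suc.IH[OF Suc.prems(1-4) this] show ?thesis unfolding e by blast
  next
    case True
    have "{k. k < Suc n \<and> good k} = insert n {k. k < n \<and> good k}" using True by (auto simp: less_Suc_eq)
    hence e: "card {k. k < Suc n \<and> good k} = Suc (card {k. k < n \<and> good k})" by simp
    obtain Y \<phi> R' where conj: "finite Y \<and> card Y \<le> N \<and> R' \<le> R (Suc n)
      \<and> (\<forall>y\<in>Y. \<forall>u v. \<phi> y (\<lambda>x. u x - v x) = \<phi> y u - \<phi> y v)
      \<and> (\<forall>y\<in>Y. \<forall>u. (\<phi> (y::'a) u)\<^sup>2 \<le> nrm2 u R')
      \<and> (\<forall>u. harmonic u \<longrightarrow> nrm2 u (R n) \<le> \<delta> * nrm2 u R' + (\<Sum>y\<in>Y. (\<phi> y u)\<^sup>2))"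
      using good[OF True] by (elim exE)
    have Y: "finite Y" "card Y \<le> N" "R' \<le> R (Suc n)"
      "\<And>y u v. y \<in> Y \<Longrightarrow> \<phi> y (\<lambda>x. u x - v x) = \<phi> y u - \<phi> y v"
      "\<And>y u. y \<in> Y \<Longrightarrow> (\<phi> y u)\<^sup>2 \<le> nrm2 u R'"
      "\<And>u. harmonic u \<Longrightarrow> nrm2 u (R n) \<le> \<delta> * nrm2 u R' + (\<Sum>y\<in>Y. (\<phi> y u)\<^sup>2)"
      using conj by simp_all
    have diam: "nrm2 (\<lambda>x. u x - v x) R' \<le> r" if "u \<in> A" "v \<in> A" for u v
      using nrm2_mono[OF Y(3), of "\<lambda>x. u x - v x"] Suc.prems(5)[OF that] by linarith
    obtain A1 where A1: "A1 \<subseteq> A" "A1 \<noteq> {}" "card A \<le> (2 * z + 1) ^ N * card A1"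
      "\<forall>u\<in>A1. \<forall>v\<in>A1. nrm2 (\<lambda>x. u x - v x) (R n) \<le> 2 * \<delta> * r"
      by (rule pigeonhole_step[OF Suc.prems(1-3) diam Suc.prems(4) delta z Y(1,2,4,5,6)]) auto
    have f1: "finite A1" using A1(1) Suc.prems(1) by (rule finite_subset)
    have h1: "harmonic u" if "u \<in> A1" for u using that A1(1) Suc.prems(3) by auto
    have r1: "0 < 2 * \<delta> * r" using delta Suc.prems(4) by simp
    have d1: "nrm2 (\<lambda>x. u x - v x) (R n) \<le> 2 * \<delta> * r" if "u \<in> A1" "v \<in> A1" for u v using A1(4) that by blast
    obtain A' where "A' \<subseteq> A1 \<and> A' \<noteq> {} \<and>
      card A1 \<le> ((2 * z + 1) ^ N) ^ card {k. k < n \<and> good k} * card A' \<and>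
      (\<forall>u\<in>A'. \<forall>v\<in>A'. nrm2 (\<lambda>x. u x - v x) (R 0) \<le> (2 * \<delta>) ^ card {k. k < n \<and> good k} * (2 * \<delta> * r))"
    proof -
      have "\<exists>A'. A' \<subseteq> A1 \<and> A' \<noteq> {} \<and>
        card A1 \<le> ((2 * z + 1) ^ N) ^ card {k. k < n \<and> good k} * card A' \<and>
        (\<forall>u\<in>A'. \<forall>v\<in>A'. nrm2 (\<lambda>x. u x - v x) (R 0) \<le> (2 * \<delta>) ^ card {k. k < n \<and> good k} * (2 * \<delta> * r))"
        by (rule Suc.IH[OF f1 A1(2) _ r1]) (erule h1, erule (1) d1)
      thus ?thesis using that by (elim exE)
    qed
    hence A': "A' \<subseteq> A1" "A' \<noteq> {}"
      "card A1 \<le> ((2 * z + 1) ^ N) ^ card {k. k < n \<and> good k} * card A'"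
      "\<And>u v. u \<in> A' \<Longrightarrow> v \<in> A' \<Longrightarrow> nrm2 (\<lambda>x. u x - v x) (R 0) \<le> (2 * \<delta>) ^ card {k. k < n \<and> good k} * (2 * \<delta> * r)"
      by simp_all
    have "card A \<le> (2 * z + 1) ^ N * (((2 * z + 1) ^ N) ^ card {k. k < n \<and> good k} * card A')"
      using A1(3) A'(3) by (meson le_trans mult_le_mono2)
    thus ?thesis using A' A1(1) unfolding e by (intro exI[of _ A']) (auto simp: mult_ac)
  qed
qed

lemma lip_bound:
  assumes "finite I" "\<And>i. i \<in> I \<Longrightarrow> \<exists>L. lip L (us i)"
  obtains \<Lambda> where "0 < \<Lambda>" "\<And>i n x. i \<in> I \<Longrightarrow> x \<in> B n \<Longrightarrow> \<bar>us i x\<bar> \<le> \<Lambda> * (real n + 1)"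
proof -
  obtain L where L: "\<And>i. i \<in> I \<Longrightarrow> lip (L i) (us i)" using assms(2) by metis
  define \<Lambda> where "\<Lambda> = 1 + (\<Sum>i\<in>I. \<bar>L i\<bar> + \<bar>us i 1\<bar>)"
  have "\<bar>us i x\<bar> \<le> \<Lambda> * (real n + 1)" if i: "i \<in> I" and x: "x \<in> B n" for i n x
  proof -
    have "\<bar>us i x\<bar> \<le> \<bar>us i 1\<bar> + L i * n" using lip_ball[OF L[OF i] subgrp_one[OF subgrp_G] x] by simp
    also have "\<dots> \<le> (\<bar>L i\<bar> + \<bar>us i 1\<bar>) * (real n + 1)"
    proof -
      have "L i * n \<le> \<bar>L i\<bar> * n" by (rule mult_right_mono) auto
      moreover have "0 \<le> \<bar>us i 1\<bar> * n" "0 \<le> \<bar>L i\<bar>" by auto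
      ultimately show ?thesis unfolding distrib_left distrib_right mult_1_right by linarith
    qed
    also have "\<dots> \<le> \<Lambda> * (real n + 1)"
    proof (rule mult_right_mono)
      have "\<bar>L i\<bar> + \<bar>us i 1\<bar> \<le> (\<Sum>i\<in>I. \<bar>L i\<bar> + \<bar>us i 1\<bar>)" by (rule member_le_sum[OF i _ assms(1)]) auto
      thus "\<bar>L i\<bar> + \<bar>us i 1\<bar> \<le> \<Lambda>" by (simp add: \<Lambda>_def)
    qed simp
    finally show ?thesis .
  qed
  moreover have "0 < \<Lambda>" unfolding \<Lambda>_def by (intro add_pos_nonneg sum_nonneg) auto
  ultimately show ?thesis using that by blast
qed

text \<open>Linear independence in a form witnessed by points: evaluation at \<open>xs\<close> is
  dual to \<open>us\<close>.\<close>

definition dual_system :: "nat \<Rightarrow> (nat \<Rightarrow> 'a \<Rightarrow> real) \<Rightarrow> (nat \<Rightarrow> 'a) \<Rightarrow> bool" where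
  "dual_system D us xs \<longleftrightarrow> (\<forall>i<D. harmonic (us i) \<and> (\<exists>L. lip L (us i)) \<and> xs i \<in> \<Gamma>)
     \<and> (\<forall>i<D. \<forall>j<D. us i (xs j) = of_bool (i = j))"

text \<open>Consider the \<open>2 ^ (n * D)\<close> combinations with natural coefficients below
  \<open>2 ^ n\<close>. Two different ones differ by at least 1 at some \<open>xs j\<close>.
  Iterating over the good scales below \<open>n\<close> leaves, up to at most \<open>q ^ n\<close>
  classes, a subset of combinations closer than 1 at all these points, hence a single one. So
  \<open>2 ^ D \<le> q\<close>, where \<open>q\<close> depends on the group only: Lipschitz
  constants and positions of the points enter just the threshold for \<open>n\<close>.\<close>

theorem dual_system_bound: "\<exists>Dmax. \<forall>D us xs. dual_system D us xs \<longrightarrow> D \<le> Dmax"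
proof -
  define e where "e = d + 1"
  \<comment> \<open>Along radii growing by the factor 8 the volume grows on average by at most about
    \<open>8 ^ e\<close> per scale, so growth by \<open>8 ^ (4 * e)\<close> happens at no more than
    about a quarter of the scales. The same holds for growth by \<open>8 ^ (4 * e * l)\<close> over
    \<open>l\<close> scales, and about half of all scales remain good.\<close>
  define M :: nat where "M = 8 ^ (4 * e)"
  \<comment> \<open>With about \<open>n / 2\<close> good scales the factor
    \<open>2 * \<delta>\<close> at each of them yields \<open>8 ^ ((e + 4) * n)\<close> in the
    denominator. This beats the initial diameter \<open>8 ^ ((e + 3) * n)\<close>, in which
    \<open>e\<close> stems from the volume and 3 from the squared values.\<close>
  define \<delta> :: real where "\<delta> = 1 / (2 * 8 ^ (2 * (e + 4)))"
  have delta: "0 < \<delta>" by (simp add: \<delta>_def)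
  obtain K0 :: nat where K0: "16 * card S * (real M)\<^sup>2 / \<delta> \<le> real K0" using real_arch_simple by blast
  define K where "K = max 6 K0"
  have K: "6 \<le> K" by (simp add: K_def)
  have coef: "16 * card S * (real M)\<^sup>2 / (real K)\<^sup>2 \<le> \<delta>"
  proof -
    have "16 * card S * (real M)\<^sup>2 / \<delta> \<le> real K" using K0 by (simp add: K_def)
    also have "\<dots> \<le> (real K)\<^sup>2" using K by (simp add: power2_eq_square)
    finally show ?thesis using delta K by (simp add: divide_le_eq mult.commute)
  qed
  define l where "l = 2 * K"
  have l8: "2 * K \<le> 8 ^ l"
  proof -
    have "2 * K \<le> 2 ^ (2 * K)" by (rule less_imp_le[OF less_exp])
    also have "\<dots> \<le> (8::nat) ^ l" unfolding l_def by (rule power_mono) auto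
    finally show ?thesis .
  qed
  define N :: nat where "N = 8 ^ (4 * e * l)"
  obtain z0 :: nat where z0: "real N / \<delta> \<le> real z0" using real_arch_simple by blast
  define z where "z = max 1 z0"
  have z: "real N \<le> \<delta> * (real z)\<^sup>2" "0 < z"
  proof -
    have "real N / \<delta> \<le> real z" using z0 by (simp add: z_def)
    also have "\<dots> \<le> (real z)\<^sup>2"
      unfolding power2_eq_square using mult_left_mono[of 1 "real z" "real z"] by (simp add: z_def del: of_nat_max)
    finally show "real N \<le> \<delta> * (real z)\<^sup>2" using delta by (simp add: divide_le_eq mult.commute)
  qed (simp add: z_def)
  define q where "q = (2 * z + 1) ^ N"
  obtain C where C: "0 < C" "\<And>n. real (card (B n)) \<le> C * (real n + 1) ^ d" using growth_B by blast
  have "D \<le> q" if dual: "dual_system D us xs" for D us xs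
  proof -
    have us: "harmonic (us i)" "\<exists>L. lip L (us i)" "xs i \<in> \<Gamma>" if "i < D" for i using dual that by (auto simp: dual_system_def)
    have dl: "us i (xs j) = of_bool (i = j)" if "i < D" "j < D" for i j using dual that by (auto simp: dual_system_def)
    obtain \<Lambda> where Lam: "0 < \<Lambda>" "\<And>i n x. i \<in> {..<D} \<Longrightarrow> x \<in> B n \<Longrightarrow> \<bar>us i x\<bar> \<le> \<Lambda> * (real n + 1)"
      using lip_bound[of "{..<D}" us] us(2) by blast
    have "\<exists>n. i < D \<longrightarrow> xs i \<in> B n" for i using us(3)[of i] B_exhaust[of "xs i"] by blast
    then obtain m where m: "\<And>i. i < D \<Longrightarrow> xs i \<in> B (m i)" by metis
    define \<rho> where "\<rho> = 1 + (\<Sum>i<D. m i)"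
    have xs\<rho>: "xs i \<in> B \<rho>" if "i < D" for i
    proof -
      have "m i \<le> (\<Sum>i<D. m i)" by (rule member_le_sum) (use that in auto)
      thus ?thesis using m[OF that] B_mono[of "m i" \<rho>] by (auto simp: \<rho>_def)
    qed
    have rho: "0 < \<rho>" by (simp add: \<rho>_def)
    define R where "R = (\<lambda>k. K * (\<rho> * 8 ^ k))"
    define b where "b = (\<lambda>k. real (card (B (\<rho> * 8 ^ k))))"
    have b1: "1 \<le> b k" "b k \<le> b (Suc k)" for k
      using card_B_pos[of "\<rho> * 8 ^ k"] card_mono[OF fin_B B_mono[of "\<rho> * 8 ^ k" "\<rho> * 8 ^ Suc k"]] by (auto simp: b_def Suc_le_eq)
    have R8: "R k = (K * \<rho>) * 8 ^ k" for k by (simp add: R_def)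
    have card8: "\<exists>c. \<forall>n. real (card (B (c0 * 8 ^ n))) \<le> 8 ^ (c + e * n)" for c0
    proof -
      obtain c where c: "C * (real c0 + 1) ^ d \<le> 8 ^ c"
        using real_arch_pow[of 8 "C * (real c0 + 1) ^ d"] by (auto intro: less_imp_le)
      have "real (card (B (c0 * 8 ^ n))) \<le> 8 ^ (c + e * n)" for n
      proof -
        have "real (c0 * 8 ^ n) + 1 \<le> (real c0 + 1) * 8 ^ n" by (simp add: algebra_simps)
        hence "C * (real (c0 * 8 ^ n) + 1) ^ d \<le> C * ((real c0 + 1) * 8 ^ n) ^ d"
          using C(1) by (intro mult_left_mono power_mono) auto
        also have "\<dots> = (C * (real c0 + 1) ^ d) * 8 ^ (d * n)"
          by (simp add: power_mult_distrib power_mult [symmetric] mult.commute)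
        also have "\<dots> \<le> 8 ^ c * 8 ^ (e * n)" using c C(1) by (intro mult_mono power_increasing) (auto simp: e_def)
        finally show ?thesis using C(2)[of "c0 * 8 ^ n"] by (simp add: power_add)
      qed
      thus ?thesis by blast
    qed
    obtain c where c: "\<And>n. b n \<le> 8 ^ (c + e * n)" using card8[of \<rho>] by (auto simp: b_def)
    obtain c' where c': "\<And>n. real (card (B (R n))) \<le> 8 ^ (c' + e * n)" using card8[of "K * \<rho>"] R8 by auto
    have bad: "4 * e * card {k. k < n \<and> 8 ^ (4 * e * h) * b k < b (k + h)} \<le> c + e * (n + h)" if h: "0 < h" for h n
    proof -
      let ?c = "card {k. k < n \<and> 8 ^ (4 * e * h) * b k < b (k + h)}"
      have "(8 ^ (4 * e * h)) ^ ?c \<le> b (n + h) ^ h" by (rule shifted_growth_count) (rule b1 | simp)+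
      also have "\<dots> \<le> (8 ^ (c + e * (n + h))) ^ h" using c b1(1) by (intro power_mono) (auto intro: order_trans[of 0 1])
      finally have "(8::real) ^ (4 * e * h * ?c) \<le> 8 ^ ((c + e * (n + h)) * h)" by (simp only: power_mult)
      hence "4 * e * h * ?c \<le> (c + e * (n + h)) * h" by (rule power_le_imp_le_exp[rotated]) simp
      hence "h * (4 * e * ?c) \<le> h * (c + e * (n + h))" by (simp add: mult_ac)
      thus ?thesis using h by simp
    qed
    define good where "good = (\<lambda>k. b (k + 1) \<le> 8 ^ (4 * e * 1) * b k \<and> b (k + l) \<le> 8 ^ (4 * e * l) * b k)"
    define G where "G = (\<lambda>n. card {k. k < n \<and> good k})"
    have G: "n \<le> 2 * G n + (2 * c + e + e * l)" for n
    proof -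
      have "{..<n} \<subseteq> {k. k < n \<and> good k} \<union> ({k. k < n \<and> 8 ^ (4 * e * 1) * b k < b (k + 1)} \<union> {k. k < n \<and> 8 ^ (4 * e * l) * b k < b (k + l)})"
        by (auto simp: good_def)
      hence "card {..<n} \<le> card ({k. k < n \<and> good k} \<union> ({k. k < n \<and> 8 ^ (4 * e * 1) * b k < b (k + 1)} \<union> {k. k < n \<and> 8 ^ (4 * e * l) * b k < b (k + l)}))"
        by (intro card_mono) auto
      also have "\<dots> \<le> G n + (card {k. k < n \<and> 8 ^ (4 * e * 1) * b k < b (k + 1)} + card {k. k < n \<and> 8 ^ (4 * e * l) * b k < b (k + l)})"
        unfolding G_def by (meson add_left_mono card_Un_le le_trans)
      finally have "4 * e * n \<le> 4 * e * (G n + (card {k. k < n \<and> 8 ^ (4 * e * 1) * b k < b (k + 1)} + card {k. k < n \<and> 8 ^ (4 * e * l) * b k < b (k + l)}))"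
        by (intro mult_le_mono2) simp
      also have "\<dots> \<le> 4 * e * G n + ((c + e * (n + 1)) + (c + e * (n + l)))"
        using bad[of 1 n] bad[of l n] K by (simp only: distrib_left) (simp add: l_def)
      finally have "2 * (e * n) \<le> 4 * (e * G n) + 2 * c + e + e * l" by (simp add: algebra_simps)
      moreover have "2 * c + e + e * l \<le> 2 * (e * (2 * c + e + e * l))" by (simp add: e_def)
      ultimately have "2 * (e * n) \<le> 2 * (e * (2 * G n + (2 * c + e + e * l)))" by (simp add: algebra_simps)
      hence "e * n \<le> e * (2 * G n + (2 * c + e + e * l))" by (simp only: nat_mult_le_cancel1[OF pos2])
      moreover have "0 < e" by (simp add: e_def)
      ultimately show ?thesis by (simp only: nat_mult_le_cancel1)
    qed
    have goodD: "\<exists>Y \<phi> R'. finite Y \<and> card Y \<le> N \<and> R' \<le> R (Suc k)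
      \<and> (\<forall>y\<in>Y. \<forall>u v. \<phi> y (\<lambda>x. u x - v x) = \<phi> y u - \<phi> y v)
      \<and> (\<forall>y\<in>Y. \<forall>u. (\<phi> (y::'a) u)\<^sup>2 \<le> nrm2 u R')
      \<and> (\<forall>u. harmonic u \<longrightarrow> nrm2 u (R k) \<le> \<delta> * nrm2 u R' + (\<Sum>y\<in>Y. (\<phi> y u)\<^sup>2))" if k: "good k" for k
    proof -
      let ?\<rho> = "\<rho> * 8 ^ k"
      have "real (card (B (8 * ?\<rho>))) \<le> real (M * card (B ?\<rho>))"
        using k by (simp add: good_def b_def M_def mult_ac)
      hence cM: "card (B (8 * ?\<rho>)) \<le> M * card (B ?\<rho>)" by (simp only: of_nat_le_iff)
      have "real (card (B (?\<rho> * 8 ^ l))) \<le> real (N * card (B ?\<rho>))"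
        using k by (simp add: good_def b_def N_def power_add mult_ac)
      hence "card (B (?\<rho> * 8 ^ l)) \<le> N * card (B ?\<rho>)" by (simp only: of_nat_le_iff)
      moreover have "card (B (2 * K * ?\<rho>)) \<le> card (B (?\<rho> * 8 ^ l))"
        using l8 by (intro card_mono fin_B B_mono) (simp add: mult.commute)
      ultimately have cN: "card (B (2 * K * ?\<rho>)) \<le> N * card (B ?\<rho>)" by linarith
      have r0: "0 < ?\<rho>" using rho by simp
      obtain Y where Y: "finite Y" "card Y \<le> N"
        "\<And>u y. y \<in> Y \<Longrightarrow> (\<Sum>x\<in>yball y (2 * ?\<rho>). u x)\<^sup>2 / card (B (2 * ?\<rho>)) \<le> nrm2 u (6 * (K * ?\<rho>))"
        "\<And>u. harmonic u \<Longrightarrow> nrm2 u (K * ?\<rho>) \<le> 16 * card S * (real M)\<^sup>2 / (real K)\<^sup>2 * nrm2 u (6 * (K * ?\<rho>))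
            + (\<Sum>y\<in>Y. (\<Sum>x\<in>yball y (2 * ?\<rho>). u x)\<^sup>2 / card (B (2 * ?\<rho>)))"
        using contraction[OF r0 K cM cN] by (smt (verit, del_insts))
      define \<phi> where "\<phi> = (\<lambda>y u. (\<Sum>x\<in>yball y (2 * ?\<rho>). (u x :: real)) / sqrt (card (B (2 * ?\<rho>))))"
      have \<phi>2: "(\<phi> y u)\<^sup>2 = (\<Sum>x\<in>yball y (2 * ?\<rho>). u x)\<^sup>2 / card (B (2 * ?\<rho>))" for y u
        by (simp add: \<phi>_def power_divide)
      show ?thesis
      proof (intro exI[of _ Y] exI[of _ \<phi>] exI[of _ "6 * (K * ?\<rho>)"] conjI ballI allI impI Y(1,2))
        show "6 * (K * ?\<rho>) \<le> R (Suc k)" by (simp add: R_def)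
        show "\<phi> y (\<lambda>x. u x - v x) = \<phi> y u - \<phi> y v" for y u v by (simp add: \<phi>_def sum_subtractf diff_divide_distrib)
        show "(\<phi> y u)\<^sup>2 \<le> nrm2 u (6 * (K * ?\<rho>))" if "y \<in> Y" for y u unfolding \<phi>2 by (rule Y(3)[OF that])
        fix u assume "harmonic u"
        from Y(4)[OF this] show "nrm2 u (R k) \<le> \<delta> * nrm2 u (6 * (K * ?\<rho>)) + (\<Sum>y\<in>Y. (\<phi> y u)\<^sup>2)"
          using mult_right_mono[OF coef nrm2_nonneg[of u "6 * (K * ?\<rho>)"]] by (simp add: \<phi>2 R_def)
      qed
    qed
    define W where "W = 8 ^ c' * (real D * \<Lambda> * (real (K * \<rho>) + 1) + 1)\<^sup>2"
    have W: "0 < W" unfolding W_def using Lam(1) by (intro mult_pos_pos zero_less_power) (auto intro: add_nonneg_pos)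
    have final: "(2 ^ n) ^ D \<le> q ^ G n" if small: "(2 * \<delta>) ^ G n * (W * (8 ^ (e + 3)) ^ n) < 1" for n
    proof -
      define E where "E = PiE {..<D} (\<lambda>_. {..<(2::nat) ^ n})"
      define f where "f = (\<lambda>a x. \<Sum>i<D. real (a i) * us i x)"
      define A where "A = f ` E"
      have fx: "f a (xs j) = real (a j)" if "j < D" for a j
      proof -
        have "f a (xs j) = (\<Sum>i<D. if i = j then real (a j) else 0)"
          unfolding f_def by (rule sum.cong) (use dl[OF _ that] in auto)
        thus ?thesis using that by simp
      qed
      have "inj_on f E"
      proof (rule inj_onI)
        fix a a' assume a: "a \<in> E" "a' \<in> E" "f a = f a'"
        have "a j = a' j" if "j < D" for j using fx[OF that, of a] fx[OF that, of a'] a(3) by simp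
        thus "a = a'" using a by (intro PiE_ext[of a "{..<D}" "\<lambda>_. {..<2 ^ n}" a']) (auto simp: E_def)
      qed
      hence cardA: "card A = (2 ^ n) ^ D" by (simp add: A_def card_image E_def card_PiE)
      have finE: "finite E" by (simp add: E_def finite_PiE)
      have "restrict (\<lambda>_. 0) {..<D} \<in> E" by (simp add: E_def)
      hence "E \<noteq> {}" by blast
      have harmA: "harmonic u" if "u \<in> A" for u
        using that us(1) by (auto simp: A_def f_def intro!: harmonic_sum)
      have diam: "nrm2 (\<lambda>x. u x - v x) (R n) \<le> W * (8 ^ (e + 3)) ^ n" if uv: "u \<in> A" "v \<in> A" for u v
      proof -
        obtain a a' where a: "a \<in> E" "a' \<in> E" "u = f a" "v = f a'" using uv by (auto simp: A_def)
        \<comment> \<open>Coefficients contribute \<open>2 ^ n\<close> and the linear growth of the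
          functions on \<open>B (R n)\<close> contributes \<open>8 ^ n\<close>; the square of
          \<open>16 ^ n\<close> is \<open>256 ^ n\<close>.\<close>
        have pt: "(u x - v x)\<^sup>2 \<le> (real D * \<Lambda> * (real (K * \<rho>) + 1) + 1)\<^sup>2 * 256 ^ n" if x: "x \<in> B (R n)" for x
        proof -
          have "\<bar>u x - v x\<bar> = \<bar>\<Sum>i<D. (real (a i) - real (a' i)) * us i x\<bar>"
            by (simp add: a f_def sum_subtractf left_diff_distrib)
          also have "\<dots> \<le> (\<Sum>i<D. 2 ^ n * (\<Lambda> * (real (R n) + 1)))"
          proof (rule order_trans[OF sum_abs sum_mono])
            fix i assume i: "i \<in> {..<D}"
            have "a i < 2 ^ n" "a' i < 2 ^ n" using a i by (auto simp: E_def PiE_def)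
            hence "real (a i) < 2 ^ n" "real (a' i) < 2 ^ n" by (simp_all add: of_nat_less_numeral_power_cancel_iff)
            hence "\<bar>real (a i) - real (a' i)\<bar> \<le> 2 ^ n" by linarith
            thus "\<bar>(real (a i) - real (a' i)) * us i x\<bar> \<le> 2 ^ n * (\<Lambda> * (real (R n) + 1))"
              unfolding abs_mult using Lam(2)[OF i x] by (intro mult_mono) auto
          qed
          also have "\<dots> = real D * \<Lambda> * (2 ^ n * (real (R n) + 1))" by simp
          also have "\<dots> \<le> real D * \<Lambda> * (2 ^ n * ((real (K * \<rho>) + 1) * 8 ^ n))"
            using Lam(1) by (intro mult_left_mono) (auto simp: R8 algebra_simps)
          also have "\<dots> = (real D * \<Lambda> * (real (K * \<rho>) + 1)) * 16 ^ n" by (simp add: power_mult_distrib [symmetric])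
          also have "\<dots> \<le> (real D * \<Lambda> * (real (K * \<rho>) + 1) + 1) * 16 ^ n" by (intro mult_right_mono) auto
          finally have "\<bar>u x - v x\<bar>\<^sup>2 \<le> ((real D * \<Lambda> * (real (K * \<rho>) + 1) + 1) * 16 ^ n)\<^sup>2" by (rule power_mono) simp
          also have "\<dots> = (real D * \<Lambda> * (real (K * \<rho>) + 1) + 1)\<^sup>2 * 256 ^ n"
            by (simp add: power_mult_distrib power2_eq_square power_mult_distrib [symmetric])
          finally show ?thesis by simp
        qed
        have "nrm2 (\<lambda>x. u x - v x) (R n) \<le> (\<Sum>x\<in>B (R n). (real D * \<Lambda> * (real (K * \<rho>) + 1) + 1)\<^sup>2 * 256 ^ n)"
          unfolding nrm2_def by (intro sum_mono pt)
        also have "\<dots> = card (B (R n)) * ((real D * \<Lambda> * (real (K * \<rho>) + 1) + 1)\<^sup>2 * 256 ^ n)" by simp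
        also have "\<dots> \<le> 8 ^ (c' + e * n) * ((real D * \<Lambda> * (real (K * \<rho>) + 1) + 1)\<^sup>2 * 512 ^ n)"
          by (intro mult_mono mult_left_mono power_mono c') auto
        also have "(512::real) ^ n = (8 ^ 3) ^ n" by simp
        also have "8 ^ (c' + e * n) * ((real D * \<Lambda> * (real (K * \<rho>) + 1) + 1)\<^sup>2 * (8 ^ 3) ^ n) = W * (8 ^ (e + 3)) ^ n"
          unfolding W_def power_add power_mult power_mult_distrib by (simp only: mult_ac)
        finally show ?thesis .
      qed
      have Apos: "0 < W * (8 ^ (e + 3)) ^ n" using W by simp
      have A_fin: "finite A" "A \<noteq> {}" using finE \<open>E \<noteq> {}\<close> by (auto simp: A_def)
      have Rmono: "R k \<le> R (Suc k)" for k by (simp add: R_def)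
      obtain A' where A': "A' \<subseteq> A" "A' \<noteq> {}" "card A \<le> ((2 * z + 1) ^ N) ^ card {k. k < n \<and> good k} * card A'"
        "\<forall>u\<in>A'. \<forall>v\<in>A'. nrm2 (\<lambda>x. u x - v x) (R 0) \<le> (2 * \<delta>) ^ card {k. k < n \<and> good k} * (W * (8 ^ (e + 3)) ^ n)"
        using entropy_iteration[where R = R and good = good and N = N and z = z, OF delta z Rmono goodD A_fin harmA Apos diam] by blast
      have "u = v" if uv: "u \<in> A'" "v \<in> A'" for u v
      proof -
        have "u \<in> f ` E" "v \<in> f ` E" using uv A'(1) unfolding A_def by (simp_all add: subsetD)
        then obtain a a' where a: "a \<in> E" "a' \<in> E" "u = f a" "v = f a'" by blast
        have "a j = a' j" if j: "j < D" for j
        proof -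
          have "xs j \<in> B (R 0)" using xs\<rho>[OF j] B_mono[of \<rho> "R 0"] K by (auto simp: R_def)
          hence "(u (xs j) - v (xs j))\<^sup>2 \<le> nrm2 (\<lambda>x. u x - v x) (R 0)" unfolding nrm2_def
            by (intro member_le_sum[OF _ _ fin_B, where f = "\<lambda>x. (u x - v x)\<^sup>2"]) auto
          also have "\<dots> < 1" using A'(4) uv small by (force simp: G_def)
          finally have "\<bar>real (a j) - real (a' j)\<bar> < 1" using fx[OF j] by (simp add: a abs_square_less_1)
          thus ?thesis by linarith
        qed
        hence "a = a'" using a by (intro PiE_ext[of a "{..<D}" "\<lambda>_. {..<2 ^ n}" a']) (auto simp: E_def)
        thus ?thesis using a by simp
      qed
      then obtain u where "A' = {u}" using A'(2) by blast
      thus ?thesis using A'(3) cardA by (simp add: q_def G_def)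
    qed
    have "(\<lambda>n::nat. W * 8 ^ ((2 * c + e + e * l) * (e + 4)) * (1/8) ^ n) \<longlonglongrightarrow> 0"
      by (intro tendsto_mult_right_zero LIMSEQ_power_zero) simp
    hence "\<forall>\<^sub>F n::nat in sequentially. W * 8 ^ ((2 * c + e + e * l) * (e + 4)) * (1/8) ^ n < 1" by (rule order_tendstoD) simp
    then obtain n0 where n0: "\<And>n. n0 \<le> n \<Longrightarrow> W * 8 ^ ((2 * c + e + e * l) * (e + 4)) * (1/8) ^ n < 1"
      unfolding eventually_sequentially by blast
    define n where "n = Suc n0"
    have "(2 * \<delta>) ^ G n * (W * (8 ^ (e + 3)) ^ n) < 1"
    proof -
      define c1 where "c1 = 2 * c + e + e * l"
      have "(e + 4) * n \<le> (e + 4) * (2 * G n + c1)" using G[of n] by (intro mult_le_mono2) (simp add: c1_def)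
      hence le: "(8::real) ^ ((e + 4) * n) \<le> 8 ^ (2 * (e + 4) * G n + c1 * (e + 4))"
        by (intro power_increasing) (auto simp: algebra_simps)
      have d2: "(2 * \<delta>) ^ G n = 1 / 8 ^ (2 * (e + 4) * G n)"
        by (simp add: \<delta>_def power_one_over power_mult [symmetric] power_divide)
      have "(2 * \<delta>) ^ G n * (W * (8 ^ (e + 3)) ^ n) * 8 ^ n = W * (8 ^ ((e + 4) * n) / 8 ^ (2 * (e + 4) * G n))"
        unfolding d2 by (simp add: power_mult [symmetric] power_add [symmetric] algebra_simps)
      also have "\<dots> \<le> W * 8 ^ (c1 * (e + 4))"
        using le W by (intro mult_left_mono) (auto simp: divide_le_eq power_add mult.commute)
      finally have "(2 * \<delta>) ^ G n * (W * (8 ^ (e + 3)) ^ n) \<le> W * 8 ^ (c1 * (e + 4)) * (1/8) ^ n"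
        by (simp add: power_one_over field_simps)
      also have "\<dots> < 1" using n0[of n] by (simp add: n_def c1_def)
      finally show ?thesis .
    qed
    from final[OF this] have "(2 ^ D) ^ n \<le> q ^ G n" by (simp add: power_mult [symmetric] mult.commute)
    also have "\<dots> \<le> q ^ n"
    proof (rule power_increasing)
      have "card {k. k < n \<and> good k} \<le> card {..<n}" by (intro card_mono) auto
      thus "G n \<le> n" by (simp add: G_def)
    qed (simp add: q_def)
    finally have "2 ^ D \<le> q" by (rule power_le_imp_le_base[of _ n0, folded n_def]) simp
    thus ?thesis using less_exp[of D] by linarith
  qed
  thus ?thesis by blast
qed

end

section \<open>The isometric action on harmonic functions\<close>

context cayley
begin

lemma lip_nonneg: "lip L u \<Longrightarrow> 0 \<le> L"
  using one_S subgrp_one[OF subgrp_G] unfolding lip_def by (metis abs_ge_zero order_trans)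

lemma lip_add: "lip L u \<Longrightarrow> lip K v \<Longrightarrow> lip (L + K) (\<lambda>x. u x + v x)"
  unfolding lip_def by (smt (verit))

lemma lip_cmult: "lip L u \<Longrightarrow> lip (\<bar>c\<bar> * L) (\<lambda>x. c * u x)"
  unfolding lip_def by (auto simp: right_diff_distrib [symmetric] abs_mult intro: mult_left_mono)

lemma lip_sum: "finite I \<Longrightarrow> (\<And>i. i \<in> I \<Longrightarrow> \<exists>L. lip L (u i)) \<Longrightarrow> \<exists>L. lip L (\<lambda>x. \<Sum>i\<in>I. c i * u i x)"
proof (induction I rule: finite_induct)
  case empty
  show ?case by (auto simp: lip_def intro: exI[of _ 0])
next
  case (insert i I)
  then obtain L K where "lip L (u i)" "lip K (\<lambda>x. \<Sum>i\<in>I. c i * u i x)" by blast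
  from lip_add[OF lip_cmult[OF this(1), of "c i"] this(2)] show ?case using insert by auto
qed

lemma harmonic_translate: "g \<in> \<Gamma> \<Longrightarrow> harmonic u \<Longrightarrow> harmonic (\<lambda>x. u (g * x))"
  using subgrp_mult[OF subgrp_G] by (auto simp: harmonic_def mult.assoc [symmetric])

lemma lip_translate: "g \<in> \<Gamma> \<Longrightarrow> lip L u \<Longrightarrow> lip L (\<lambda>x. u (g * x))"
  using subgrp_mult[OF subgrp_G] by (auto simp: lip_def mult.assoc [symmetric])

text \<open>Take a dual system of maximal size. If some \<open>u\<close> differed at
  \<open>x\<close> from its interpolation at the points \<open>xs\<close>, the error
  \<open>w\<close> would vanish at all of them but not at \<open>x\<close>; subtracting multiples of
  \<open>w\<close> from the old functions and adjoining a multiple of \<open>w\<close> with the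
  point \<open>x\<close> would give a larger system.\<close>

lemma spanning_dual_system:
  obtains D us xs where "dual_system D us xs"
    "\<And>u L x. harmonic u \<Longrightarrow> lip L u \<Longrightarrow> x \<in> \<Gamma> \<Longrightarrow> u x = (\<Sum>j<D. u (xs j) * us j x)"
proof -
  obtain Dmax where Dmax: "\<And>D us xs. dual_system D us xs \<Longrightarrow> D \<le> Dmax" using dual_system_bound by blast
  define P where "P = (\<lambda>D. \<exists>us xs. dual_system D us xs)"
  have "P 0" by (simp add: P_def dual_system_def)
  moreover have "\<forall>D. P D \<longrightarrow> D \<le> Dmax" using Dmax by (auto simp: P_def)
  ultimately have "P (Greatest P)" "\<And>D. P D \<Longrightarrow> D \<le> Greatest P"
    by (metis GreatestI_nat, metis Greatest_le_nat \<open>\<forall>D. P D \<longrightarrow> D \<le> Dmax\<close>)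
  then obtain D us xs where dual: "dual_system D us xs" and max: "\<And>E vs ys. dual_system E vs ys \<Longrightarrow> E \<le> D"
    unfolding P_def by blast
  have us: "harmonic (us i)" "\<exists>L. lip L (us i)" "xs i \<in> \<Gamma>" if "i < D" for i using dual that by (auto simp: dual_system_def)
  have dl: "us i (xs j) = of_bool (i = j)" if "i < D" "j < D" for i j using dual that by (auto simp: dual_system_def)
  have "u x = (\<Sum>j<D. u (xs j) * us j x)" if u: "harmonic u" "lip L u" and x: "x \<in> \<Gamma>" for u L x
  proof (rule ccontr)
    assume ne: "u x \<noteq> (\<Sum>j<D. u (xs j) * us j x)"
    define w where "w = (\<lambda>x. u x + -1 * (\<Sum>j<D. u (xs j) * us j x))"
    have wx: "w x \<noteq> 0" using ne by (simp add: w_def)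
    have wh: "harmonic w" unfolding w_def by (intro harmonic_add harmonic_cmult harmonic_sum u us) auto
    obtain L' where "lip L' (\<lambda>x. \<Sum>j<D. u (xs j) * us j x)" using lip_sum[of "{..<D}" us "\<lambda>j. u (xs j)"] us by auto
    hence wl: "\<exists>L. lip L w" unfolding w_def using lip_add[OF u(2) lip_cmult[of L' _ "-1"]] by blast
    have w0: "w (xs i) = 0" if "i < D" for i
    proof -
      have "(\<Sum>j<D. u (xs j) * us j (xs i)) = (\<Sum>j<D. if j = i then u (xs i) else 0)"
        by (rule sum.cong) (use dl[OF _ that] in auto)
      thus ?thesis using that by (simp add: w_def)
    qed
    define vs where "vs = (\<lambda>i. if i < D then (\<lambda>y. us i y + (- us i x / w x) * w y) else (\<lambda>y. 1 / w x * w y))"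
    define ys where "ys = (\<lambda>i. if i < D then xs i else x)"
    have "dual_system (Suc D) vs ys" unfolding dual_system_def
    proof (intro conjI allI impI)
      fix i assume "i < Suc D"
      show "harmonic (vs i)" unfolding vs_def
        by (cases "i < D") (simp_all only: if_True if_False, intro harmonic_add harmonic_cmult us wh, simp, intro harmonic_cmult wh)
      show "\<exists>L. lip L (vs i)"
      proof (cases "i < D")
        case True
        obtain L1 L2 where "lip L1 (us i)" "lip L2 w" using us(2)[OF True] wl by blast
        from lip_add[OF this(1) lip_cmult[OF this(2), of "- us i x / w x"]]
        show ?thesis using True unfolding vs_def by (simp only: if_True) (rule exI)
      next
        case False
        obtain L2 where "lip L2 w" using wl by blast
        from lip_cmult[OF this] show ?thesis using False unfolding vs_def by (simp only: if_False) blast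
      qed
      show "ys i \<in> \<Gamma>" using us(3) x by (simp add: ys_def)
    next
      fix i k assume ik: "i < Suc D" "k < Suc D"
      show "vs i (ys k) = of_bool (i = k)"
        using ik wx w0[of k] dl[of i k] by (cases "i < D"; cases "k < D") (auto simp: vs_def ys_def)
    qed
    from max[OF this] show False by simp
  qed
  thus ?thesis using that dual by blast
qed

section \<open>The displacement norm on the group\<close>

definition testf :: "(('a \<Rightarrow> real) \<times> 'a \<times> 'a) set" where
  "testf = {(u, x, s). harmonic u \<and> lip 1 u \<and> x \<in> \<Gamma> \<and> s \<in> S}"

text \<open>The operator norm of \<open>g - 1\<close> on Lipschitz harmonic functions modulo
  constants, on which left translation is isometric for the Lipschitz seminorm.\<close>

definition \<nu> :: "'a \<Rightarrow> real" where
  "\<nu> g = (SUP (u, x, s)\<in>testf. \<bar>(u (g * x * s) - u (g * x)) - (u (x * s) - u x)\<bar>)"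

lemma testf_nonempty: "testf \<noteq> {}"
proof -
  have "(\<lambda>_. 0, 1, 1) \<in> testf"
    using one_S subgrp_one[OF subgrp_G] by (simp add: testf_def harmonic_def lip_def)
  thus ?thesis by blast
qed

lemma nu_upper:
  assumes "g \<in> \<Gamma>" "harmonic u" "lip 1 u" "x \<in> \<Gamma>" "s \<in> S"
  shows "\<bar>(u (g * x * s) - u (g * x)) - (u (x * s) - u x)\<bar> \<le> \<nu> g"
proof -
  have "bdd_above ((\<lambda>(u, x, s). \<bar>(u (g * x * s) - u (g * x)) - (u (x * s) - u x)\<bar>) ` testf)"
  proof (rule bdd_aboveI2)
    fix t assume "t \<in> testf"
    then obtain u x s where t: "t = (u, x, s)" "lip 1 u" "x \<in> \<Gamma>" "s \<in> S" by (auto simp: testf_def)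
    have "\<bar>u (g * x * s) - u (g * x)\<bar> \<le> 1" "\<bar>u (x * s) - u x\<bar> \<le> 1"
      using t assms(1) subgrp_mult[OF subgrp_G] by (auto simp: lip_def)
    thus "(case t of (u, x, s) \<Rightarrow> \<bar>(u (g * x * s) - u (g * x)) - (u (x * s) - u x)\<bar>) \<le> 2" using t by simp
  qed
  moreover have "(u, x, s) \<in> testf" using assms by (simp add: testf_def)
  ultimately show ?thesis unfolding \<nu>_def using cSUP_upper by fastforce
qed

lemma nu_least:
  assumes "\<And>u x s. harmonic u \<Longrightarrow> lip 1 u \<Longrightarrow> x \<in> \<Gamma> \<Longrightarrow> s \<in> S \<Longrightarrow>
    \<bar>(u (g * x * s) - u (g * x)) - (u (x * s) - u x)\<bar> \<le> c"
  shows "\<nu> g \<le> c"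
  unfolding \<nu>_def by (rule cSUP_least[OF testf_nonempty]) (use assms in \<open>auto simp: testf_def\<close>)

lemma nu_nonneg: "g \<in> \<Gamma> \<Longrightarrow> 0 \<le> \<nu> g"
  using nu_upper[of g "\<lambda>_. 0" 1 1] one_S subgrp_one[OF subgrp_G] by (simp add: harmonic_def lip_def)

lemma nu_scaled:
  assumes g: "g \<in> \<Gamma>" and v: "harmonic v" "lip L v" and x: "x \<in> \<Gamma>" "s \<in> S"
  shows "\<bar>(v (g * x * s) - v (g * x)) - (v (x * s) - v x)\<bar> \<le> \<nu> g * L"
proof (cases "L = 0")
  case True
  have "v (g * x * s) = v (g * x)" "v (x * s) = v x"
    using v(2) x subgrp_mult[OF subgrp_G g x(1)] unfolding True lip_def by auto
  thus ?thesis using True by simp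
next
  case False
  hence L: "0 < L" using lip_nonneg[OF v(2)] by simp
  have "lip 1 (\<lambda>x. 1 / L * v x)" using lip_cmult[OF v(2), of "1 / L"] L by simp
  from nu_upper[OF g harmonic_cmult[OF v(1)] this x]
  have "\<bar>1 / L * ((v (g * x * s) - v (g * x)) - (v (x * s) - v x))\<bar> \<le> \<nu> g" by (simp add: right_diff_distrib)
  hence "1 / L * \<bar>(v (g * x * s) - v (g * x)) - (v (x * s) - v x)\<bar> \<le> \<nu> g" using L by (simp only: abs_mult) simp
  thus ?thesis using L by (simp add: divide_le_eq)
qed

lemma lip_displacement:
  assumes "g \<in> \<Gamma>" "harmonic u" "lip 1 u"
  shows "harmonic (\<lambda>x. u (g * x) - u x)" "lip (\<nu> g) (\<lambda>x. u (g * x) - u x)"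
proof -
  show "harmonic (\<lambda>x. u (g * x) - u x)" by (intro harmonic_diff harmonic_translate assms)
  show "lip (\<nu> g) (\<lambda>x. u (g * x) - u x)" unfolding lip_def
  proof (intro ballI)
    fix x s assume "x \<in> \<Gamma>" "s \<in> S"
    from nu_upper[OF assms this] show "\<bar>u (g * (x * s)) - u (x * s) - (u (g * x) - u x)\<bar> \<le> \<nu> g"
      by (simp add: mult.assoc algebra_simps)
  qed
qed

lemma nu_one: "\<nu> 1 = 0"
  using nu_least[of 1 0] nu_nonneg[OF subgrp_one[OF subgrp_G]] by simp

lemma nu_mult:
  assumes "g \<in> \<Gamma>" "h \<in> \<Gamma>"
  shows "\<nu> (g * h) \<le> \<nu> g + \<nu> h"
proof (rule nu_least)
  fix u x s assume u: "harmonic u" "lip 1 u" "x \<in> \<Gamma>" "s \<in> S"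
  have "h * x \<in> \<Gamma>" using assms u subgrp_mult[OF subgrp_G] by auto
  from nu_upper[OF assms(1) u(1,2) this u(4)] nu_upper[OF assms(2) u]
  show "\<bar>(u (g * h * x * s) - u (g * h * x)) - (u (x * s) - u x)\<bar> \<le> \<nu> g + \<nu> h"
    by (simp add: mult.assoc)
qed

lemma nu_inv:
  assumes "g \<in> \<Gamma>"
  shows "\<nu> (inverse g) = \<nu> g"
proof -
  have le: "\<nu> (inverse g) \<le> \<nu> g" if g: "g \<in> \<Gamma>" for g
  proof (rule nu_least)
    fix u x s assume u: "harmonic u" "lip 1 u" "x \<in> \<Gamma>" "s \<in> S"
    have "inverse g * x \<in> \<Gamma>" using g u subgrp_mult[OF subgrp_G] subgrp_inv[OF subgrp_G] by auto
    from nu_upper[OF g u(1,2) this u(4)]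
    show "\<bar>(u (inverse g * x * s) - u (inverse g * x)) - (u (x * s) - u x)\<bar> \<le> \<nu> g"
      by (simp add: grp_simps abs_minus_commute)
  qed
  show ?thesis using le[OF assms] le[OF subgrp_inv[OF subgrp_G assms]] by (simp add: grp_inv_inv)
qed

text \<open>The operators satisfy gt - tg = (g - 1)(t - 1) - (t - 1)(g - 1), and composing with an
  isometry does not change norms. The two products account for the factor 2.\<close>

lemma nu_commu:
  assumes g: "g \<in> \<Gamma>" and t: "t \<in> \<Gamma>"
  shows "\<nu> (commu g t) \<le> 2 * \<nu> t * \<nu> g"
proof (rule nu_least)
  fix u x s assume u: "harmonic u" "lip 1 u" "x \<in> \<Gamma>" "s \<in> S"
  note mem = subgrp_mult[OF subgrp_G] subgrp_inv[OF subgrp_G]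
  \<comment> \<open>With this base point \<open>commu g t * x\<close> is \<open>g * t * y\<close>
    and \<open>x\<close> is \<open>t * g * y\<close>, so the displacement by the commutator compares
    the two orders of \<open>g\<close> and \<open>t\<close>.\<close>
  define y where "y = inverse (t * g) * x"
  have y: "y \<in> \<Gamma>" "t * y \<in> \<Gamma>" "g * y \<in> \<Gamma>" using g t u mem by (auto simp: y_def)
  have e: "commu g t * x = g * (t * y)" "x = t * (g * y)" by (simp_all add: commu_def y_def grp_simps)
  have 1: "\<bar>(u (g * (t * y * s)) - u (t * y * s) - (u (g * (t * y)) - u (t * y)))
      - (u (g * (y * s)) - u (y * s) - (u (g * y) - u y))\<bar> \<le> \<nu> t * \<nu> g"
    by (rule nu_scaled[OF t lip_displacement[OF g u(1,2)] y(1) u(4)])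
  have 2: "\<bar>(u (t * (g * y * s)) - u (g * y * s) - (u (t * (g * y)) - u (g * y)))
      - (u (t * (y * s)) - u (y * s) - (u (t * y) - u y))\<bar> \<le> \<nu> g * \<nu> t"
    by (rule nu_scaled[OF g lip_displacement[OF t u(1,2)] y(1) u(4)])
  have "\<bar>(u (g * (t * y) * s) - u (g * (t * y))) - (u (t * (g * y) * s) - u (t * (g * y)))\<bar> \<le> 2 * \<nu> t * \<nu> g"
    using 1 2 unfolding mult.assoc by (simp only: mult.commute[of "\<nu> g"])
  thus "\<bar>(u (commu g t * x * s) - u (commu g t * x)) - (u (x * s) - u x)\<bar> \<le> 2 * \<nu> t * \<nu> g"
    using e by metis
qed

lemma nu_power_le: "g \<in> \<Gamma> \<Longrightarrow> \<nu> (g ^ a) \<le> a * \<nu> g"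
proof (induction a)
  case (Suc a)
  thus ?case using nu_mult[of g "g ^ a"] subgrp_power[OF subgrp_G, of g a] by (simp add: algebra_simps)
qed (simp add: nu_one)

text \<open>\<open>g ^ a - 1\<close> is the sum of the operators \<open>g ^ i * (g - 1)\<close>. As
  each \<open>g ^ i\<close> differs from 1 by at most \<open>a * \<nu> g \<le> 1 / 2\<close>, the
  sum differs from \<open>a\<close> copies of \<open>g - 1\<close> by at most
  \<open>a * \<nu> g / 2\<close>.\<close>

lemma nu_power_ge:
  assumes g: "g \<in> \<Gamma>" and a: "0 < a" "a * \<nu> g \<le> 1 / 2"
  shows "\<nu> g / 2 \<le> \<nu> (g ^ a)"
proof -
  note ga = subgrp_power[OF subgrp_G g]
  have "\<nu> g \<le> \<nu> (g ^ a) + \<nu> g / 2"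
  proof (rule nu_least)
    fix u x s assume u: "harmonic u" "lip 1 u" "x \<in> \<Gamma>" "s \<in> S"
    define D where "D = (\<lambda>y. (u (g * y * s) - u (g * y)) - (u (y * s) - u y))"
    have tel: "(\<Sum>i<n. D (g ^ i * x)) = (u (g ^ n * x * s) - u (g ^ n * x)) - (u (x * s) - u x)" for n
      by (induction n) (simp_all add: D_def mult.assoc)
    have near: "\<bar>D (g ^ i * x) - D x\<bar> \<le> \<nu> g / 2" if "i < a" for i
    proof -
      have "\<bar>D (g ^ i * x) - D x\<bar> \<le> \<nu> (g ^ i) * \<nu> g"
        using nu_scaled[OF ga[of i] lip_displacement[OF g u(1,2)] u(3,4)] by (simp add: D_def mult.assoc algebra_simps)
      also have "\<dots> \<le> (a * \<nu> g) * \<nu> g"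
      proof (rule mult_right_mono[OF _ nu_nonneg[OF g]])
        have "\<nu> (g ^ i) \<le> i * \<nu> g" by (rule nu_power_le[OF g])
        also have "\<dots> \<le> a * \<nu> g" using that nu_nonneg[OF g] by (intro mult_right_mono) auto
        finally show "\<nu> (g ^ i) \<le> a * \<nu> g" .
      qed
      also have "\<dots> \<le> 1 / 2 * \<nu> g" by (rule mult_right_mono[OF a(2) nu_nonneg[OF g]])
      finally show ?thesis by simp
    qed
    have "a * \<bar>D x\<bar> = \<bar>(\<Sum>i<a. D (g ^ i * x)) - (\<Sum>i<a. D (g ^ i * x) - D x)\<bar>"
      by (simp add: sum_subtractf abs_mult)
    also have "\<dots> \<le> \<bar>\<Sum>i<a. D (g ^ i * x)\<bar> + \<bar>\<Sum>i<a. D (g ^ i * x) - D x\<bar>" by (rule abs_triangle_ineq4)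
    also have "\<dots> \<le> \<nu> (g ^ a) + (\<Sum>i<a. \<nu> g / 2)"
    proof (rule add_mono)
      show "\<bar>\<Sum>i<a. D (g ^ i * x)\<bar> \<le> \<nu> (g ^ a)" unfolding tel by (rule nu_upper[OF ga u])
      show "\<bar>\<Sum>i<a. D (g ^ i * x) - D x\<bar> \<le> (\<Sum>i<a. \<nu> g / 2)"
        by (rule order_trans[OF sum_abs sum_mono]) (use near in auto)
    qed
    also have "\<dots> \<le> a * (\<nu> (g ^ a) + \<nu> g / 2)"
      using a(1) mult_right_mono[of 1 "real a" "\<nu> (g ^ a)"] nu_nonneg[OF ga] by (simp add: algebra_simps)
    finally show "\<bar>(u (g * x * s) - u (g * x)) - (u (x * s) - u x)\<bar> \<le> \<nu> (g ^ a) + \<nu> g / 2"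
      using a(1) by (simp add: D_def)
  qed
  thus ?thesis by simp
qed

text \<open>The operators attached to group elements form a bounded set of matrices, so finitely many
  cosets of near-identity elements suffice.\<close>

lemma nu_colouring:
  assumes eps: "0 < \<epsilon>"
  shows "\<exists>c :: 'a \<Rightarrow> nat \<times> nat \<Rightarrow> int. finite (c ` \<Gamma>) \<and> (\<forall>g\<in>\<Gamma>. \<forall>h\<in>\<Gamma>. c g = c h \<longrightarrow> \<nu> (g * inverse h) \<le> \<epsilon>)"
proof -
  obtain D us xs where dual: "dual_system D us xs"
    and span: "\<And>u L x. harmonic u \<Longrightarrow> lip L u \<Longrightarrow> x \<in> \<Gamma> \<Longrightarrow> u x = (\<Sum>j<D. u (xs j) * us j x)"
    using spanning_dual_system by blast
  have us: "harmonic (us i)" "\<exists>L. lip L (us i)" "xs i \<in> \<Gamma>" if "i < D" for i using dual that by (auto simp: dual_system_def)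
  have "\<exists>L. i < D \<longrightarrow> lip L (us i)" for i using us(2) by blast
  then obtain L0 where L0: "\<And>i. i < D \<Longrightarrow> lip (L0 i) (us i)" by metis
  define L where "L = 1 + (\<Sum>i<D. \<bar>L0 i\<bar>)"
  have L: "lip L (us i)" if "i < D" for i
  proof -
    have "\<bar>L0 i\<bar> \<le> (\<Sum>i<D. \<bar>L0 i\<bar>)" by (rule member_le_sum) (use that in auto)
    hence "L0 i \<le> L" by (simp add: L_def)
    thus ?thesis using L0[OF that] unfolding lip_def by (meson order_trans)
  qed
  have L1: "1 \<le> L" by (simp add: L_def sum_nonneg)
  have "\<exists>n. i < D \<longrightarrow> xs i \<in> B n" for i using us(3)[of i] B_exhaust[of "xs i"] by blast
  then obtain m where m: "\<And>i. i < D \<Longrightarrow> xs i \<in> B (m i)" by metis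
  define R where "R = (\<Sum>i<D. m i)"
  have xsR: "xs i \<in> B R" if "i < D" for i
  proof -
    have "m i \<le> R" unfolding R_def by (rule member_le_sum) (use that in auto)
    thus ?thesis using m[OF that] B_mono by blast
  qed
  \<comment> \<open>An error of \<open>\<eta>\<close> per matrix entry is summed over
    \<open>D * D\<close> entries, weighted by coefficients up to \<open>R\<close> and gradients up
    to \<open>L\<close>; the added 1 keeps the denominator positive.\<close>
  define \<eta> where "\<eta> = \<epsilon> / (real D * real D * (real R * L) + 1)"
  have den: "0 < real D * real D * (real R * L) + 1" using L1 by (intro add_nonneg_pos) auto
  have eta: "0 < \<eta>" using eps den by (simp add: \<eta>_def)
  \<comment> \<open>By the spanning property the coordinates of a translate of \<open>us i\<close>,
    made zero at 1, are its values at the points \<open>xs j\<close>.\<close>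
  define M where "M = (\<lambda>g i j. us i (g * xs j) - us i g)"
  have Mb: "\<bar>M g i j\<bar> \<le> L * R" if "g \<in> \<Gamma>" "i < D" "j < D" for g i j
    unfolding M_def by (rule lip_ball[OF L[OF that(2)] that(1) xsR[OF that(3)]])
  define c where "c = (\<lambda>g. restrict (\<lambda>(i, j). \<lfloor>M g i j / \<eta>\<rfloor>) ({..<D} \<times> {..<D}))"
  have "c g \<in> PiE ({..<D} \<times> {..<D}) (\<lambda>_. {\<lfloor>- (L * R / \<eta>)\<rfloor>..\<lfloor>L * R / \<eta>\<rfloor>})" if g: "g \<in> \<Gamma>" for g
  proof -
    have "\<lfloor>- (L * R / \<eta>)\<rfloor> \<le> \<lfloor>M g i j / \<eta>\<rfloor> \<and> \<lfloor>M g i j / \<eta>\<rfloor> \<le> \<lfloor>L * R / \<eta>\<rfloor>" if ij: "i < D" "j < D" for i j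
    proof -
      have "- (L * R) \<le> M g i j" "M g i j \<le> L * R" using Mb[OF g ij] by linarith+
      hence "- (L * R) / \<eta> \<le> M g i j / \<eta>" "M g i j / \<eta> \<le> L * R / \<eta>" using eta by (intro divide_right_mono; simp)+
      thus ?thesis by (auto intro: floor_mono)
    qed
    thus ?thesis by (auto simp: c_def)
  qed
  hence "finite (c ` \<Gamma>)"
    by (intro finite_subset[OF image_subsetI, of _ _ "PiE ({..<D} \<times> {..<D}) (\<lambda>_. {\<lfloor>- (L * R / \<eta>)\<rfloor>..\<lfloor>L * R / \<eta>\<rfloor>})"] finite_PiE) auto
  moreover have "\<nu> (g * inverse h) \<le> \<epsilon>" if g: "g \<in> \<Gamma>" and h: "h \<in> \<Gamma>" and c: "c g = c h" for g h
  proof (rule nu_least)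
    fix u x s assume u: "harmonic u" "lip 1 u" "x \<in> \<Gamma>" "s \<in> S"
    note mem = subgrp_mult[OF subgrp_G] subgrp_inv[OF subgrp_G]
    define y where "y = inverse h * x"
    have y: "y \<in> \<Gamma>" "y * s \<in> \<Gamma>" using u h S_mem mem by (auto simp: y_def)
    define k where "k = (\<lambda>i. u (xs i) - u 1)"
    have kb: "\<bar>k i\<bar> \<le> R" if "i < D" for i
      unfolding k_def using lip_ball[OF u(2) subgrp_one[OF subgrp_G] xsR[OF that]] by simp
    have uexp: "u z - u 1 = (\<Sum>i<D. k i * us i z)" if "z \<in> \<Gamma>" for z
    proof -
      have "lip 1 (\<lambda>z. u z - u 1)" using u(2) by (simp add: lip_def)
      from span[OF harmonic_diff[OF u(1) harmonic_const] this that] show ?thesis by (simp add: k_def)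
    qed
    have usexp: "us i (f * z) - us i f = (\<Sum>j<D. M f i j * us j z)" if "f \<in> \<Gamma>" "i < D" "z \<in> \<Gamma>" for f i z
    proof -
      have "lip L (\<lambda>z. us i (f * z) - us i f)" using lip_translate[OF that(1) L[OF that(2)]] by (simp add: lip_def)
      from span[OF harmonic_diff[OF harmonic_translate[OF that(1) us(1)[OF that(2)]] harmonic_const] this that(3)]
      show ?thesis by (simp add: M_def)
    qed
    have grad: "u (f * (y * s)) - u (f * y) = (\<Sum>i<D. \<Sum>j<D. k i * M f i j * (us j (y * s) - us j y))" if f: "f \<in> \<Gamma>" for f
    proof -
      have "u (f * (y * s)) - u (f * y) = (\<Sum>i<D. k i * (us i (f * (y * s)) - us i (f * y)))"
        using uexp[of "f * (y * s)"] uexp[of "f * y"] f y mem by (simp add: right_diff_distrib sum_subtractf)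
      also have "\<dots> = (\<Sum>i<D. k i * (\<Sum>j<D. M f i j * (us j (y * s) - us j y)))"
      proof (rule sum.cong[OF refl])
        fix i assume "i \<in> {..<D}"
        hence "us i (f * (y * s)) - us i (f * y) = (\<Sum>j<D. M f i j * us j (y * s)) - (\<Sum>j<D. M f i j * us j y)"
          using usexp[OF f _ y(1), of i] usexp[OF f _ y(2), of i] by simp
        thus "k i * (us i (f * (y * s)) - us i (f * y)) = k i * (\<Sum>j<D. M f i j * (us j (y * s) - us j y))"
          by (simp add: right_diff_distrib sum_subtractf)
      qed
      finally show ?thesis by (simp add: sum_distrib_left mult.assoc)
    qed
    have Mdiff: "\<bar>M g i j - M h i j\<bar> \<le> \<eta>" if "i < D" "j < D" for i j
    proof -
      have "\<lfloor>M g i j / \<eta>\<rfloor> = \<lfloor>M h i j / \<eta>\<rfloor>" using fun_cong[OF c, of "(i, j)"] that by (simp add: c_def)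
      hence "\<bar>M g i j / \<eta> - M h i j / \<eta>\<bar> \<le> 1" by linarith
      hence "\<bar>M g i j - M h i j\<bar> / \<eta> \<le> 1" using eta by (simp add: diff_divide_distrib [symmetric] abs_divide)
      thus ?thesis using eta by (simp add: divide_le_eq)
    qed
    have "\<bar>(u (g * (y * s)) - u (g * y)) - (u (h * (y * s)) - u (h * y))\<bar>
      = \<bar>\<Sum>i<D. \<Sum>j<D. k i * (M g i j - M h i j) * (us j (y * s) - us j y)\<bar>"
      unfolding grad[OF g] grad[OF h] by (simp add: sum_subtractf [symmetric] algebra_simps)
    also have "\<dots> \<le> (\<Sum>i<D. \<Sum>j<D. real R * \<eta> * L)"
    proof (rule order_trans[OF sum_abs sum_mono], rule order_trans[OF sum_abs sum_mono])
      fix i j assume "i \<in> {..<D}" "j \<in> {..<D}"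
      hence ij: "i < D" "j < D" by auto
      have "\<bar>us j (y * s) - us j y\<bar> \<le> L" using L[OF ij(2)] y u(4) by (auto simp: lip_def)
      thus "\<bar>k i * (M g i j - M h i j) * (us j (y * s) - us j y)\<bar> \<le> real R * \<eta> * L"
        unfolding abs_mult using kb[OF ij(1)] Mdiff[OF ij] eta by (intro mult_mono) auto
    qed
    also have "\<dots> = (real D * real D * (real R * L)) * \<eta>" by simp
    also have "\<dots> \<le> (real D * real D * (real R * L) + 1) * \<eta>" using eta by (intro mult_right_mono) auto
    also have "\<dots> = \<epsilon>" using den by (simp add: \<eta>_def)
    finally show "\<bar>(u (g * inverse h * x * s) - u (g * inverse h * x)) - (u (x * s) - u x)\<bar> \<le> \<epsilon>"
      by (simp add: y_def grp_simps)
  qed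
  ultimately show ?thesis by blast
qed

text \<open>The maximum principle: at a point where the maximum is attained, all differences to
  neighbours have one sign and sum to zero.\<close>

lemma harmonic_finite_range_const:
  assumes "harmonic u" "finite (u ` \<Gamma>)" "x \<in> \<Gamma>"
  shows "u x = u 1"
proof -
  have one: "1 \<in> \<Gamma>" by (rule subgrp_one[OF subgrp_G])
  define M where "M = Max (u ` \<Gamma>)"
  have le: "u x \<le> M" if "x \<in> \<Gamma>" for x using that assms(2) by (simp add: M_def)
  have "M \<in> u ` \<Gamma>" unfolding M_def using assms(2) one by (intro Max_in) auto
  then obtain y where y: "y \<in> \<Gamma>" "u y = M" by auto
  have "w \<in> lists S \<Longrightarrow> u (y * prod_list w) = M" for w
  proof (induction w rule: rev_induct)
    case (snoc s w)
    define z where "z = y * prod_list w"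
    have z: "z \<in> \<Gamma>" "u z = M" using snoc y S_sub subgrp_prod_list[OF subgrp_G, of w] subgrp_mult[OF subgrp_G] by (auto simp: z_def)
    have sz: "(\<Sum>s\<in>S. u z - u (z * s)) = 0" using assms(1) z(1) by (simp add: harmonic_def sum_subtractf)
    have nn: "0 \<le> u z - u (z * s)" if "s \<in> S" for s
      using le[OF subgrp_mult[OF subgrp_G z(1) S_mem[OF that]]] z(2) by simp
    have "\<forall>s\<in>S. u z - u (z * s) = 0" using sz by (subst (asm) sum_nonneg_eq_0_iff[OF fin_S nn])
    moreover have "s \<in> S" using snoc.prems by simp
    ultimately have "u (z * s) = M" using z(2) by auto
    thus ?case by (simp add: z_def mult.assoc)
  qed (use y in simp)
  hence "u z = M" if "z \<in> \<Gamma>" for z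
  proof -
    have "inverse y * z \<in> gen S" using that y gen_S subgrp_mult[OF subgrp_G] subgrp_inv[OF subgrp_G] by auto
    then obtain w where "w \<in> lists S" "inverse y * z = prod_list w" using gen_words[OF sym_S] by auto
    thus ?thesis using \<open>\<And>w. w \<in> lists S \<Longrightarrow> u (y * prod_list w) = M\<close>[of w] by (metis grp_inv_right)
  qed
  thus ?thesis using assms(3) one by simp
qed

text \<open>Near-identity elements generate a subgroup \<open>H\<close> of finite index, and
  \<open>H\<close> is nilpotent modulo the kernel \<open>Z\<close> of the norm. If \<open>Z\<close>
  has infinite index in \<open>H\<close>, some step of the relative upper central series has
  infinite index, and its quotient is abelian. Otherwise \<open>Z\<close> has finite index in the
  group; elements of \<open>Z\<close> displace a nonconstant harmonic function by constants, which
  gives a homomorphism to the reals, with infinite image by the maximum principle.\<close>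

theorem infinite_abelianization:
  assumes inf: "infinite \<Gamma>"
  obtains H A where "subgrp H" "fin_index H \<Gamma>" "subgrp A" "A \<subseteq> H" "\<not> fin_index A H"
    "\<And>x y. x \<in> H \<Longrightarrow> y \<in> H \<Longrightarrow> commu x y \<in> A"
proof -
  define N :: nat where "N = 2 ^ (d + 1)"
  have N1: "1 \<le> N" unfolding N_def by (rule one_le_power) simp
  define \<epsilon> :: real where "\<epsilon> = 1 / (16 * N)"
  have eps: "0 < \<epsilon>" "8 * real N * \<epsilon> < 1" "N * \<epsilon> \<le> 1 / 2" using N1 by (auto simp: \<epsilon>_def)
  \<comment> \<open>Half of \<open>\<epsilon>\<close>, to absorb the factor 2 in
    \<open>nu_commu\<close>.\<close>
  define E where "E = {g \<in> \<Gamma>. \<nu> g \<le> \<epsilon> / 2}"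
  have E_sub: "E \<subseteq> \<Gamma>" by (auto simp: E_def)
  have E_sym: "sym_set E" using nu_inv subgrp_inv[OF subgrp_G] by (auto simp: sym_set_def E_def)
  define H where "H = gen E"
  have H: "subgrp H" "H \<subseteq> \<Gamma>" unfolding H_def by (rule subgrp_gen, rule gen_least[OF subgrp_G E_sub])
  obtain c :: "'a \<Rightarrow> nat \<times> nat \<Rightarrow> int" where c: "finite (c ` \<Gamma>)"
    "\<And>g h. g \<in> \<Gamma> \<Longrightarrow> h \<in> \<Gamma> \<Longrightarrow> c g = c h \<Longrightarrow> \<nu> (g * inverse h) \<le> \<epsilon> / 2"
    using nu_colouring[of "\<epsilon> / 2"] eps by auto
  have HG: "fin_index H \<Gamma>"
  proof (rule fin_index_colouring[OF c(1) H(2)])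
    fix x y assume xy: "x \<in> \<Gamma>" "y \<in> \<Gamma>" "c x = c y"
    hence "x * inverse y \<in> E" using c(2) subgrp_mult[OF subgrp_G] subgrp_inv[OF subgrp_G] by (simp add: E_def)
    thus "x * inverse y \<in> H" using gen_superset by (auto simp: H_def)
  qed
  have "fin_gen \<Gamma>" unfolding fin_gen_def using fin_S S_sub gen_S by blast
  from fin_gen_fin_index[OF this HG H(1)] obtain T0 where T0: "finite T0" "T0 \<subseteq> H" "gen T0 = H" by (auto simp: fin_gen_def)
  \<comment> \<open>The Schreier generators in \<open>T0\<close> need not be close to the identity.
    They are replaced by the letters from \<open>E\<close> in words that spell them.\<close>
  have "\<forall>t\<in>T0. \<exists>w. w \<in> lists E \<and> t = prod_list w" using T0(2) gen_words[OF E_sym] by (auto simp: H_def)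
  then obtain w where w: "\<And>t. t \<in> T0 \<Longrightarrow> w t \<in> lists E \<and> t = prod_list (w t)" by metis
  define T1 where "T1 = (\<Union>t\<in>T0. set (w t))"
  define T where "T = T1 \<union> inverse ` T1"
  have T1E: "T1 \<subseteq> E" using w by (auto simp: T1_def)
  have TE: "T \<subseteq> E" using T1E E_sym by (auto simp: T_def sym_set_def)
  have Tfin: "finite T" using T0(1) by (simp add: T_def T1_def)
  have Tsym: "sym_set T" unfolding T_def by (rule sym_set_closure)
  have TH: "T \<subseteq> H" using TE gen_superset[of E] by (auto simp: H_def)
  have genT: "gen T = H"
  proof
    show "gen T \<subseteq> H" by (rule gen_least[OF H(1) TH])
    have "t \<in> gen T" if "t \<in> T0" for t
    proof -
      have "w t \<in> lists T" using that by (auto simp: T_def T1_def)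
      thus ?thesis using w[OF that] gen_words[OF Tsym] by auto
    qed
    thus "H \<subseteq> gen T" using gen_least[OF subgrp_gen, of T0 T] T0(3) by auto
  qed
  have HG': "g \<in> \<Gamma>" if "g \<in> H" for g using that H(2) by blast
  have "\<exists>k. \<forall>x\<in>left_normed T k. \<nu> x = 0"
  proof (rule left_normed_null[OF Tfin Tsym TH H(1) growth_subset[OF growth_G H(2)], where N = N and \<epsilon> = \<epsilon>])
    show "\<nu> (commu x t) \<le> \<epsilon> * \<nu> x" if "x \<in> H" "t \<in> T" for x t
    proof -
      have t: "t \<in> \<Gamma>" "\<nu> t \<le> \<epsilon> / 2" using that(2) TE by (auto simp: E_def)
      have "\<nu> (commu x t) \<le> 2 * \<nu> t * \<nu> x" by (rule nu_commu[OF HG'[OF that(1)] t(1)])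
      also have "\<dots> \<le> \<epsilon> * \<nu> x" using t(2) nu_nonneg[OF HG'[OF that(1)]] by (intro mult_right_mono) auto
      finally show ?thesis .
    qed
    show "\<nu> t \<le> \<epsilon>" if "t \<in> T" for t using that TE eps(1) by (force simp: E_def)
    show "\<nu> x / 2 \<le> \<nu> (x ^ a)" if "x \<in> H" "\<nu> x \<le> \<epsilon>" "0 < a" "a < N" for x a
    proof (rule nu_power_ge[OF HG'[OF that(1)] that(3)])
      have "a * \<nu> x \<le> N * \<epsilon>" using that nu_nonneg[OF HG'[OF that(1)]] by (intro mult_mono) auto
      thus "a * \<nu> x \<le> 1 / 2" using eps(3) by linarith
    qed
  qed (use nu_one nu_nonneg nu_mult nu_inv HG' N_def eps in auto)
  then obtain k where k: "\<And>x. x \<in> left_normed T k \<Longrightarrow> \<nu> x = 0" by blast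
  define Z where "Z = {g \<in> H. \<nu> g = 0}"
  have nz: "\<nu> g = 0" if "g \<in> H" "\<nu> g \<le> 0" for g using that nu_nonneg[OF HG'[OF that(1)]] by simp
  have Z: "nrml Z H" unfolding nrml_def
  proof (intro conjI ballI)
    show "subgrp Z"
    proof (rule subgrpI)
      show "1 \<in> Z" by (simp add: Z_def nu_one subgrp_one[OF H(1)])
      show "x * y \<in> Z" if "x \<in> Z" "y \<in> Z" for x y
        using that nu_mult[of x y] HG' nz[of "x * y"] subgrp_mult[OF H(1)] by (simp add: Z_def)
      show "inverse x \<in> Z" if "x \<in> Z" for x
        using that nu_inv[of x] HG' subgrp_inv[OF H(1)] by (simp add: Z_def)
    qed
    show "Z \<subseteq> H" by (auto simp: Z_def)
    fix h x assume h: "h \<in> H" and x: "x \<in> Z"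
    have "\<nu> (commu h x) \<le> 2 * \<nu> x * \<nu> h" using h x HG' by (intro nu_commu) (auto simp: Z_def)
    hence "\<nu> (commu h x) = 0" using x h nz commu_mem[OF H(1) h, of x] by (simp add: Z_def)
    moreover have "h * x * inverse h = commu h x * x" by (simp add: commu_def grp_simps)
    ultimately have "\<nu> (h * x * inverse h) \<le> 0"
      using nu_mult[of "commu h x" x] x h HG' commu_mem[OF H(1) h, of x] by (simp add: Z_def)
    thus "h * x * inverse h \<in> Z" using nz h x H(1) by (simp add: Z_def subgrp_mem)
  qed
  have "left_normed T k \<subseteq> Z" using k left_normed_subset[OF H(1) TH] by (auto simp: Z_def)
  hence uck: "upper_chain Z H k = H" by (rule upper_chain_eq[OF Z genT])
  show ?thesis
  proof (cases "fin_index Z H")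
    case False
    define P where "P = (\<lambda>i. fin_index (upper_chain Z H i) H)"
    have "P k" using uck fin_index_refl[OF H(1)] by (simp add: P_def)
    hence least: "P (LEAST i. P i)" "\<And>i. i < (LEAST i. P i) \<Longrightarrow> \<not> P i" by (rule LeastI) (rule not_less_Least)
    moreover have "\<not> P 0" using False by (simp add: P_def)
    ultimately obtain i where i: "P (Suc i)" "\<not> P i" by (metis lessI not0_implies_Suc)
    note U = nrml_upper_chain[OF Z H(1)]
    show ?thesis
    proof (rule that[of "upper_chain Z H (Suc i)" "upper_chain Z H i"])
      show "subgrp (upper_chain Z H (Suc i))" "subgrp (upper_chain Z H i)" using U nrml_subgrp(1) by blast+
      show "fin_index (upper_chain Z H (Suc i)) \<Gamma>" using i(1) fin_index_trans[OF _ HG subgrp_G] by (simp add: P_def)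
      show sub: "upper_chain Z H i \<subseteq> upper_chain Z H (Suc i)" by (rule upper_chain_subset[OF Z H(1)])
      show "\<not> fin_index (upper_chain Z H i) (upper_chain Z H (Suc i))"
        using i fin_index_trans[of "upper_chain Z H i" "upper_chain Z H (Suc i)" H] H(1) unfolding P_def by blast
      show "commu x y \<in> upper_chain Z H i" if "x \<in> upper_chain Z H (Suc i)" "y \<in> upper_chain Z H (Suc i)" for x y
        using that by simp
    qed
  next
    case True
    have ZG: "fin_index Z \<Gamma>" by (rule fin_index_trans[OF True HG subgrp_G])
    have Zs: "subgrp Z" by (rule nrml_subgrp(1)[OF Z])
    have ZG': "g \<in> \<Gamma>" if "g \<in> Z" for g using that HG' by (simp add: Z_def)
    obtain u s where u: "harmonic u" "lip 1 u" "s \<in> S" "u s - u 1 = 1" using nonconstant_harmonic[OF inf] .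
    \<comment> \<open>The displacement of \<open>u\<close> by an element of norm zero has Lipschitz
      constant 0, so it is constant on the group.\<close>
    have shift: "u (g * x) = u x + (u g - u 1)" if g: "g \<in> Z" and x: "x \<in> \<Gamma>" for g x
    proof -
      have "lip 0 (\<lambda>x. u (g * x) - u x)" using lip_displacement(2)[OF ZG'[OF g] u(1,2)] g by (simp add: Z_def)
      moreover obtain n where "x \<in> B n" using B_exhaust[OF x] by blast
      ultimately have "\<bar>(u (g * (1 * x)) - u (1 * x)) - (u (g * 1) - u 1)\<bar> \<le> 0 * real n"
        using lip_ball[of 0 "\<lambda>x. u (g * x) - u x" 1 x n] subgrp_one[OF subgrp_G] by blast
      thus ?thesis by simp
    qed
    define A where "A = {g \<in> Z. u g = u 1}"
    have one: "1 \<in> \<Gamma>" by (rule subgrp_one[OF subgrp_G])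
    have inv: "u (inverse g) - u 1 = - (u g - u 1)" if "g \<in> Z" for g
      using shift[OF that, of "inverse g"] subgrp_inv[OF subgrp_G ZG'[OF that]] by (simp add: grp_simps)
    show ?thesis
    proof (rule that[of Z A])
      show "subgrp A"
      proof (rule subgrpI)
        show "1 \<in> A" using subgrp_one[OF Zs] by (simp add: A_def)
        show "x * y \<in> A" if "x \<in> A" "y \<in> A" for x y
          using that shift[of x y] ZG' subgrp_mult[OF Zs] by (simp add: A_def)
        show "inverse x \<in> A" if "x \<in> A" for x using that inv[of x] subgrp_inv[OF Zs] by (simp add: A_def)
      qed
      show "commu x y \<in> A" if xy: "x \<in> Z" "y \<in> Z" for x y
      proof -
        note m = subgrp_mult[OF subgrp_G] subgrp_inv[OF subgrp_G] ZG'
        have "u (x * (y * (inverse x * inverse y))) = u 1"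
          using shift[of x "y * (inverse x * inverse y)"] shift[of y "inverse x * inverse y"]
            shift[of "inverse x" "inverse y"] inv[OF xy(1)] inv[OF xy(2)] xy subgrp_inv[OF Zs] m by simp
        thus ?thesis using commu_mem[OF Zs xy] by (simp add: A_def commu_def mult.assoc)
      qed
      show "\<not> fin_index A Z"
      proof
        assume "fin_index A Z"
        hence "fin_index A \<Gamma>" by (rule fin_index_trans[OF _ ZG subgrp_G])
        then obtain F where F: "finite F" "F \<subseteq> \<Gamma>" "\<And>h. h \<in> \<Gamma> \<Longrightarrow> \<exists>a\<in>A. \<exists>x\<in>F. h = a * x"
          unfolding fin_index_def by metis
        have "u ` \<Gamma> \<subseteq> u ` F"
        proof (rule image_subsetI)
          fix h assume "h \<in> \<Gamma>"
          then obtain a x where "a \<in> A" "x \<in> F" "h = a * x" using F(3) by blast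
          hence "u h = u x" using shift[of a x] F(2) by (auto simp: A_def)
          thus "u h \<in> u ` F" using \<open>x \<in> F\<close> by blast
        qed
        hence "finite (u ` \<Gamma>)" using F(1) finite_subset by blast
        from harmonic_finite_range_const[OF u(1) this S_mem[OF u(3)]] show False using u(4) by simp
      qed
    qed (use Zs ZG in \<open>auto simp: A_def\<close>)
  qed
qed

end

section \<open>Gromov's theorem\<close>

lemma normalizes_if_commu:
  assumes "subgrp A" "\<And>n. n \<in> A \<Longrightarrow> commu x n \<in> A \<and> commu (inverse x) n \<in> A"
  shows "normalizes x A"
  unfolding normalizes_def
proof (intro ballI conjI)
  fix n assume n: "n \<in> A"
  have "x * n * inverse x = commu x n * n" "inverse x * n * x = commu (inverse x) n * n"
    by (simp_all add: commu_def grp_simps)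
  thus "x * n * inverse x \<in> A" "inverse x * n * x \<in> A" using assms n by (simp_all add: subgrp_mult)
qed

text \<open>Adjoin the generators of \<open>H\<close> to \<open>A\<close> one at a time. At the
  first moment when finite index is reached, the preceding subgroup had infinite index, so the last
  generator has infinite order modulo it; it normalizes that subgroup because all commutators lie in
  \<open>A\<close>.\<close>

lemma infinite_cyclic_quotient:
  assumes "fin_gen H" "subgrp A" "A \<subseteq> H" "\<not> fin_index A H"
    and commu: "\<And>x y. x \<in> H \<Longrightarrow> y \<in> H \<Longrightarrow> commu x y \<in> A"
  obtains K x j where "subgrp K" "normalizes x K" "fin_index (cyc K x) H" "cyclic_ext (cyc K x) K x j"
proof -
  have H: "subgrp H" using assms(1) by (rule fin_gen_subgrp)
  obtain S where S: "finite S" "S \<subseteq> H" "gen S = H" using assms(1) by (auto simp: fin_gen_def)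
  obtain ss where ss: "set ss = S" using finite_list[OF S(1)] by blast
  define M where "M = (\<lambda>i. gen (A \<union> set (take i ss)))"
  have tk: "set (take i ss) \<subseteq> H" for i using S(2) ss set_take_subset[of i ss] by (metis order_trans)
  have MH: "M i \<subseteq> H" for i unfolding M_def by (rule gen_least[OF H]) (simp add: assms(3) tk)
  have AM: "A \<subseteq> M i" for i unfolding M_def by (rule order_trans[OF Un_upper1 gen_superset])
  have subM: "subgrp (M i)" for i by (simp add: M_def subgrp_gen)
  have "M 0 = A" by (simp add: M_def gen_subgrp[OF assms(2)])
  hence P0: "\<not> fin_index (M 0) H" using assms(4) by simp
  have "gen S \<subseteq> M (length ss)" unfolding M_def using ss by (intro gen_mono) auto
  hence Pn: "fin_index (M (length ss)) H" using S(3) MH[of "length ss"] fin_index_refl[OF H] by (metis subset_antisym)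
  define n where "n = (LEAST i. fin_index (M i) H)"
  have n: "fin_index (M n) H" "\<And>i. i < n \<Longrightarrow> \<not> fin_index (M i) H"
    unfolding n_def by (rule LeastI[of "\<lambda>i. fin_index (M i) H", OF Pn]) (rule not_less_Least)
  have nl: "n \<le> length ss" unfolding n_def by (rule Least_le[of "\<lambda>i. fin_index (M i) H", OF Pn])
  obtain i where i: "n = Suc i" using n(1) P0 by (cases n) auto
  define x where "x = ss ! i"
  have x: "x \<in> H" using nl i S(2) ss by (auto simp: x_def)
  have nx: "normalizes x (M i)"
  proof (rule normalizes_if_commu[OF subM])
    fix m assume "m \<in> M i"
    thus "commu x m \<in> M i \<and> commu (inverse x) m \<in> M i"
      using commu[OF x, of m] commu[OF subgrp_inv[OF H x], of m] MH[of i] AM[of i] by blast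
  qed
  have "M n = cyc (M i) x"
  proof -
    have "set (take n ss) = insert x (set (take i ss))" using nl i by (simp add: x_def take_Suc_conv_app_nth)
    hence "M n = gen (insert x (A \<union> set (take i ss)))" by (simp add: M_def insert_commute)
    also have "\<dots> = gen (insert x (M i))"
    proof
      show "gen (insert x (A \<union> set (take i ss))) \<subseteq> gen (insert x (M i))"
        unfolding M_def using gen_superset[of "A \<union> set (take i ss)"] by (intro gen_mono) auto
      have "M i \<subseteq> gen (insert x (A \<union> set (take i ss)))" unfolding M_def by (intro gen_mono) auto
      thus "gen (insert x (M i)) \<subseteq> gen (insert x (A \<union> set (take i ss)))"
        using gen_superset[of "insert x (A \<union> set (take i ss))"] by (intro gen_least[OF subgrp_gen]) auto
    qed
    finally show ?thesis by (simp add: gen_insert_cyc[OF subM nx])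
  qed
  hence fc: "fin_index (cyc (M i) x) H" using n(1) by simp
  show ?thesis
  proof (rule cyclic_ext_or_finite[OF subM nx])
    assume "fin_index (M i) (cyc (M i) x)"
    hence "fin_index (M i) H" by (rule fin_index_trans[OF _ fc H])
    thus ?thesis using n(2)[of i] i by simp
  next
    fix j assume "cyclic_ext (cyc (M i) x) (M i) x j"
    thus ?thesis using that[OF subM nx fc] by blast
  qed
qed

text \<open>The products \<open>k * t ^ i\<close> with \<open>k\<close> in the ball of radius
  \<open>n\<close> of the kernel and \<open>i \<le> n\<close> are distinct and lie in a ball of
  radius \<open>2 * n\<close> of \<open>H\<close>. So the ball in the kernel is smaller by a factor
  \<open>n + 1\<close>.\<close>

lemma (in cyclic_ext) growth_L:
  assumes "growth (Suc e) H"
  shows "growth e L"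
  unfolding growth_def
proof (intro allI impI)
  fix S assume S: "finite S" "S \<subseteq> L"
  have S': "finite (insert t S)" "insert t S \<subseteq> H" using S t L_subset by auto
  obtain C where C: "\<And>n. card (wball (insert t S) n) \<le> C * (n + 1) ^ Suc e" using growthE[OF assms S'] by blast
  have WL: "wball S n \<subseteq> L" for n by (rule wball_subset[OF subgrp_L S(2)])
  have "card (wball S n) \<le> (C * 2 ^ Suc e) * (n + 1) ^ e" for n
  proof -
    have "inj_on (\<lambda>(k, i). k * t ^ i) (wball S n \<times> {..n})"
    proof (rule inj_onI, clarify)
      fix k i k' i' assume a: "k \<in> wball S n" "k' \<in> wball S n" and e: "k * t ^ i = k' * t ^ i'"
      have "j (k * power_int t (int i)) = int i" "j (k' * power_int t (int i')) = int i'"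
        using subsetD[OF WL a(1)] subsetD[OF WL a(2)] j_mult[OF _ powi_mem, of k "int i"] j_mult[OF _ powi_mem, of k' "int i'"]
        unfolding j_powi by (simp_all add: L_eq)
      hence "i = i'" using e by (simp add: powi_nat)
      thus "k = k' \<and> i = i'" using e by (simp add: grp_simps)
    qed
    hence "card (wball S n) * (n + 1) = card ((\<lambda>(k, i). k * t ^ i) ` (wball S n \<times> {..n}))"
      by (simp add: card_image card_cartesian_product)
    also have "\<dots> \<le> card (wball (insert t S) (n + n))"
    proof (rule card_mono[OF finite_wball[OF S'(1)]], rule image_subsetI)
      fix q assume "q \<in> wball S n \<times> {..n}"
      then obtain k i where q: "q = (k, i)" and k: "k \<in> wball S n" and i: "i \<le> n" by auto
      have "wball S n \<subseteq> wball (insert t S) n" unfolding wball_def by (intro image_mono) (auto simp: in_lists_conv_set)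
      moreover have "t ^ i \<in> wball (insert t S) n"
        using wball_power[OF wball_gen[of t "insert t S" 1], of i] wball_mono[of i n "insert t S"] i by auto
      ultimately have "k * t ^ i \<in> wball (insert t S) (n + n)" using k wball_mult by blast
      thus "(case q of (k, i) \<Rightarrow> k * t ^ i) \<in> wball (insert t S) (n + n)" by (simp add: q)
    qed
    also have "\<dots> \<le> C * (n + n + 1) ^ Suc e" by (rule C)
    also have "\<dots> \<le> C * (2 * (n + 1)) ^ Suc e" by (intro mult_le_mono2 power_mono) auto
    also have "\<dots> = ((C * 2 ^ Suc e) * (n + 1) ^ e) * (n + 1)" by (simp only: power_mult_distrib power_Suc mult_ac)
    finally show ?thesis by (simp only: mult_le_cancel2)
  qed
  thus "\<exists>C. \<forall>n. card (wball S n) \<le> C * (n + 1) ^ e" by blast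
qed

text \<open>Milnor's trick: if no conjugate \<open>x^m * b * x^-m\<close> lay in the subgroup generated by the previous ones,
  the products of distinct conjugates would give exponential growth.\<close>

lemma conjugate_in_previous:
  fixes x b :: "'a::grp"
  assumes "growth d H" "subgrp H" "x \<in> H" "b \<in> H"
  obtains m where "x ^ m * b * inverse (x ^ m) \<in> gen ((\<lambda>l. x ^ l * b * inverse (x ^ l)) ` {..<m})"
proof -
  define \<beta> where "\<beta> = (\<lambda>l. x ^ l * b * inverse (x ^ l))"
  define P where "P = (\<lambda>(f::nat \<Rightarrow> bool) m. prod_list (map (\<lambda>l. if f l then \<beta> l else 1) [0..<m]))"
  have PS: "P f (Suc m) = P f m * (if f m then \<beta> m else 1)" for f m by (simp add: P_def)
  have mem: "\<beta> l \<in> gen (\<beta> ` {..<m})" if "l < m" for l m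
    using gen_superset[of "\<beta> ` {..<m}"] that by blast
  have Pgen: "P f m \<in> gen (\<beta> ` {..<m})" for f m
    unfolding P_def by (intro subgrp_prod_list[OF subgrp_gen]) (auto simp: mem subgrp_one[OF subgrp_gen])
  have coincidence: "\<exists>l<m. \<beta> l \<in> gen (\<beta> ` {..<l})" if "P f m = P g m" "l < m" "f l \<noteq> g l" for f g m l
    using that
  proof (induction m)
    case (Suc m)
    show ?case
    proof (cases "f m = g m")
      case True
      hence "P f m = P g m" using Suc.prems(1) by (simp add: PS grp_simps split: if_splits)
      moreover have "l < m" using True Suc.prems by (metis less_Suc_eq)
      ultimately show ?thesis using Suc.IH Suc.prems(3) less_SucI by blast
    next
      case False
      hence "P f m * \<beta> m = P g m \<or> P g m * \<beta> m = P f m" using Suc.prems(1) by (auto simp: PS split: if_splits)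
      hence "\<beta> m = inverse (P f m) * P g m \<or> \<beta> m = inverse (P g m) * P f m" by (metis grp_inv_left)
      hence "\<beta> m \<in> gen (\<beta> ` {..<m})"
        using Pgen[of f m] Pgen[of g m] subgrp_mult[OF subgrp_gen] subgrp_inv[OF subgrp_gen] by metis
      thus ?thesis by blast
    qed
  qed simp
  define S where "S = {x, inverse x, b}"
  have S: "finite S" "S \<subseteq> H" using assms(3,4) subgrp_inv[OF assms(2)] by (auto simp: S_def)
  obtain C where C: "\<And>n. card (wball S n) \<le> C * (n + 1) ^ d" using growthE[OF assms(1) S] by blast
  \<comment> \<open>The conjugating powers telescope: the product is a word in which each of the
    \<open>m\<close> letters \<open>x\<close> is preceded by \<open>b\<close> or by nothing. This
    makes the length linear rather than quadratic in \<open>m\<close>.\<close>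
  have len: "P f m * x ^ m \<in> wball S (2 * m)" for f m
  proof (induction m)
    case (Suc m)
    have "P f (Suc m) * x ^ Suc m = (P f m * x ^ m) * ((if f m then b else 1) * x)"
      by (simp add: PS \<beta>_def grp_simps power_Suc2 del: power_Suc)
    moreover have "(if f m then b else 1) * x \<in> wball S (1 + 1)"
      by (intro wball_mult) (auto simp: S_def intro: wball_gen wball_one)
    ultimately show ?case using wball_mult[OF Suc, of "(if f m then b else 1) * x" "1 + 1"] by (simp add: mult.assoc)
  qed (simp add: P_def wball_one)
  have lenP: "P f m \<in> wball S (3 * m)" for f m
  proof -
    have "inverse x ^ m \<in> wball S (m * 1)" by (intro wball_power wball_gen) (auto simp: S_def)
    from wball_mult[OF len[of f m] this]
    have "P f m * x ^ m * inverse x ^ m \<in> wball S (2 * m + m * 1)" .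
    moreover have "y ^ m * inverse y ^ m = 1" for y :: 'a
    proof (induction m)
      case (Suc m)
      have "y ^ Suc m * inverse y ^ Suc m = y ^ m * (y * inverse y) * inverse y ^ m" by (simp only: power_Suc2 power_Suc mult.assoc) (simp add: power_commutes)
      thus ?case using Suc by (simp add: grp_simps)
    qed simp
    ultimately show ?thesis by (simp add: mult.assoc)
  qed
  have "(\<lambda>m::nat. real C * (3 * real m + 1) ^ d / 2 ^ m) \<longlonglongrightarrow> 0" by real_asymp
  hence "\<forall>\<^sub>F m::nat in sequentially. real C * (3 * real m + 1) ^ d / 2 ^ m < 1" by (rule order_tendstoD) simp
  then obtain m where m: "real C * (3 * real m + 1) ^ d / 2 ^ m < 1" unfolding eventually_sequentially by blast
  hence "real C * (3 * real m + 1) ^ d < 2 ^ m" by (simp add: divide_less_eq)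
  hence "real (C * (3 * m + 1) ^ d) < real (2 ^ m)" by (simp add: add.commute)
  hence m: "C * (3 * m + 1) ^ d < 2 ^ m" by (simp only: of_nat_less_iff)
  define E where "E = PiE {..<m} (\<lambda>_. UNIV :: bool set)"
  have "card E = 2 ^ m" by (simp add: E_def card_PiE card_UNIV_bool)
  moreover have "card ((\<lambda>f. P f m) ` E) \<le> card (wball S (3 * m))"
    using lenP by (intro card_mono finite_wball S(1)) auto
  ultimately have "card ((\<lambda>f. P f m) ` E) < card E" using C[of "3 * m"] m by linarith
  hence "\<not> inj_on (\<lambda>f. P f m) E" using pigeonhole by blast
  then obtain f g where fg: "f \<in> E" "g \<in> E" "P f m = P g m" "f \<noteq> g" by (auto simp: inj_on_def)
  have "\<exists>l<m. f l \<noteq> g l"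
  proof (rule ccontr)
    assume "\<not> ?thesis"
    hence "f = g" using fg by (intro PiE_ext[of f "{..<m}" "\<lambda>_. UNIV" g]) (auto simp: E_def)
    thus False using fg by simp
  qed
  then obtain l where "\<beta> l \<in> gen (\<beta> ` {..<l})" using coincidence[OF fg(3)] by blast
  thus ?thesis using that[of l] by (simp add: \<beta>_def)
qed

text \<open>Conjugating the relation of \<open>conjugate_in_previous\<close> by \<open>x ^ i\<close>
  expresses the conjugate with number \<open>m + i\<close> by its predecessors, and induction
  reduces all of them to the first \<open>m\<close>.\<close>

lemma conjugates_finitely_generated:
  fixes x b :: "'a::grp"
  assumes "growth d H" "subgrp H" "x \<in> H" "b \<in> H"
  obtains m where "\<And>n. x ^ n * b * inverse (x ^ n) \<in> gen ((\<lambda>l. x ^ l * b * inverse (x ^ l)) ` {..<m})"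
proof -
  define \<beta> where "\<beta> = (\<lambda>l. x ^ l * b * inverse (x ^ l))"
  obtain m where m: "\<beta> m \<in> gen (\<beta> ` {..<m})" using conjugate_in_previous[OF assms] by (auto simp: \<beta>_def)
  have shift: "x ^ i * \<beta> l * inverse (x ^ i) = \<beta> (l + i)" for i l
  proof -
    have "x ^ i * \<beta> l * inverse (x ^ i) = (x ^ i * x ^ l) * b * inverse (x ^ i * x ^ l)" by (simp add: \<beta>_def grp_simps)
    also have "x ^ i * x ^ l = x ^ (l + i)" by (simp add: power_add [symmetric] add.commute)
    finally show ?thesis by (simp add: \<beta>_def)
  qed
  have conj: "x ^ i * y * inverse (x ^ i) \<in> gen (\<beta> ` {..<m + i})" if y: "y \<in> gen (\<beta> ` {..<m})" for i y
  proof -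
    have "subgrp {y. x ^ i * y * inverse (x ^ i) \<in> gen (\<beta> ` {..<m + i})}"
    proof (rule subgrpI; clarify?)
      show "x ^ i * 1 * inverse (x ^ i) \<in> gen (\<beta> ` {..<m + i})" using subgrp_one[OF subgrp_gen] by (simp add: grp_simps)
      show "x ^ i * (y * z) * inverse (x ^ i) \<in> gen (\<beta> ` {..<m + i})"
        if "x ^ i * y * inverse (x ^ i) \<in> gen (\<beta> ` {..<m + i})" "x ^ i * z * inverse (x ^ i) \<in> gen (\<beta> ` {..<m + i})" for y z
        using subgrp_mult[OF subgrp_gen that] by (simp add: grp_simps)
      show "x ^ i * inverse y * inverse (x ^ i) \<in> gen (\<beta> ` {..<m + i})"
        if "x ^ i * y * inverse (x ^ i) \<in> gen (\<beta> ` {..<m + i})" for y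
        using subgrp_inv[OF subgrp_gen that] by (simp add: grp_simps)
    qed
    moreover have "\<beta> ` {..<m} \<subseteq> {y. x ^ i * y * inverse (x ^ i) \<in> gen (\<beta> ` {..<m + i})}"
      using gen_superset[of "\<beta> ` {..<m + i}"] by (auto simp: shift)
    ultimately show ?thesis using gen_least y by blast
  qed
  have "gen (\<beta> ` {..<m + i}) \<subseteq> gen (\<beta> ` {..<m})" for i
  proof (induction i)
    case (Suc i)
    have "\<beta> (m + i) \<in> gen (\<beta> ` {..<m})" using conj[OF m, of i] shift[of i m] Suc by auto
    moreover have "\<beta> ` {..<m + Suc i} = insert (\<beta> (m + i)) (\<beta> ` {..<m + i})" by (simp add: lessThan_Suc)
    ultimately show ?case using Suc gen_superset[of "\<beta> ` {..<m + i}"] by (intro gen_least[OF subgrp_gen]) auto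
  qed simp
  moreover have "\<beta> n \<in> gen (\<beta> ` {..<m + Suc n})" for n using gen_superset by fastforce
  ultimately have all: "\<beta> n \<in> gen (\<beta> ` {..<m})" for n by blast
  show ?thesis by (rule that[of m]) (use all in \<open>simp add: \<beta>_def\<close>)
qed

text \<open>The kernel is generated by the conjugates, under all powers of \<open>t\<close>, of the
  generators stripped of their power of \<open>t\<close>. Milnor's argument is applied once to
  \<open>t\<close> and once to its inverse, for the positive and the negative powers.\<close>

lemma (in cyclic_ext) fin_gen_L:
  assumes "growth d H" "fin_gen H"
  shows "fin_gen L"
proof -
  obtain S where S: "finite S" "S \<subseteq> H" "gen S = H" using assms(2) by (auto simp: fin_gen_def)
  define k where "k = (\<lambda>s. s * power_int t (- j s))"
  have kL: "k s \<in> L" if "s \<in> S" for s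
    using that S(2) j_mult[OF _ powi_mem] j_powi subgrp_mult[OF H _ powi_mem] by (auto simp: k_def L_eq)
  have kH: "k s \<in> H" if "s \<in> S" for s using kL[OF that] L_subset by auto
  have it: "inverse t \<in> H" by (rule subgrp_inv[OF H t])
  have "\<exists>m. \<forall>n. t ^ n * k s * inverse (t ^ n) \<in> gen ((\<lambda>l. t ^ l * k s * inverse (t ^ l)) ` {..<m})" if "s \<in> S" for s
    using conjugates_finitely_generated[OF assms(1) H t kH[OF that]] by metis
  then obtain m where m: "\<And>s n. s \<in> S \<Longrightarrow> t ^ n * k s * inverse (t ^ n) \<in> gen ((\<lambda>l. t ^ l * k s * inverse (t ^ l)) ` {..<m s})" by metis
  have "\<exists>m. \<forall>n. inverse t ^ n * k s * inverse (inverse t ^ n) \<in> gen ((\<lambda>l. inverse t ^ l * k s * inverse (inverse t ^ l)) ` {..<m})" if "s \<in> S" for s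
    using conjugates_finitely_generated[OF assms(1) H it kH[OF that]] by metis
  then obtain m' where m': "\<And>s n. s \<in> S \<Longrightarrow> inverse t ^ n * k s * inverse (inverse t ^ n) \<in> gen ((\<lambda>l. inverse t ^ l * k s * inverse (inverse t ^ l)) ` {..<m' s})" by metis
  define Y where "Y = (\<Union>s\<in>S. (\<lambda>l. t ^ l * k s * inverse (t ^ l)) ` {..<m s} \<union> (\<lambda>l. inverse t ^ l * k s * inverse (inverse t ^ l)) ` {..<m' s})"
  define Z where "Z = {power_int t i * k s * power_int t (- i) | i s. s \<in> S}"
  have ZL: "Z \<subseteq> L" using nrmlD[OF nrml_L powi_mem] kL by (auto simp: Z_def powi_minus)
  have pos: "power_int t (int l) * y * power_int t (- int l) = t ^ l * y * inverse (t ^ l)" for l y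
    unfolding powi_minus by (simp add: powi_nat)
  have neg: "power_int t (- int l) * y * power_int t (- (- int l)) = inverse t ^ l * y * inverse (inverse t ^ l)" for l y
  proof -
    have "power_int t (- int l) = inverse t ^ l" by (simp add: power_int_def)
    thus ?thesis unfolding powi_minus[of t "- int l"] by simp
  qed
  have YZ: "Y \<subseteq> Z"
  proof
    fix y assume "y \<in> Y"
    then obtain s l where "s \<in> S" "y = t ^ l * k s * inverse (t ^ l) \<or> y = inverse t ^ l * k s * inverse (inverse t ^ l)"
      by (auto simp: Y_def)
    hence "y = power_int t (int l) * k s * power_int t (- int l) \<or> y = power_int t (- int l) * k s * power_int t (- (- int l))"
      by (simp only: pos neg)
    thus "y \<in> Z" unfolding Z_def using \<open>s \<in> S\<close> by blast
  qed
  have "Z \<subseteq> gen Y"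
  proof
    fix z assume "z \<in> Z"
    then obtain i s where z: "s \<in> S" "z = power_int t i * k s * power_int t (- i)" by (auto simp: Z_def)
    show "z \<in> gen Y"
    proof (cases i rule: int_cases2)
      case (nonneg n)
      have "z \<in> gen ((\<lambda>l. t ^ l * k s * inverse (t ^ l)) ` {..<m s})" using m[OF z(1), of n] z(2) nonneg pos by simp
      moreover have "(\<lambda>l. t ^ l * k s * inverse (t ^ l)) ` {..<m s} \<subseteq> Y" using z(1) by (auto simp: Y_def)
      ultimately show ?thesis using gen_mono by blast
    next
      case (nonpos n)
      have "z \<in> gen ((\<lambda>l. inverse t ^ l * k s * inverse (inverse t ^ l)) ` {..<m' s})"
        using m'[OF z(1), of n] z(2) neg[of n "k s"] unfolding nonpos by simp
      moreover have "(\<lambda>l. inverse t ^ l * k s * inverse (inverse t ^ l)) ` {..<m' s} \<subseteq> Y" using z(1) by (auto simp: Y_def)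
      ultimately show ?thesis using gen_mono by blast
    qed
  qed
  hence genZ: "gen Z = gen Y" using gen_mono[OF YZ] gen_least[OF subgrp_gen] by blast
  have norm: "normalizes t (gen Z)"
  proof -
    have *: "power_int t e * z * power_int t (- e) \<in> gen Z" if z: "z \<in> gen Z" for z e
    proof -
      have "subgrp {y. power_int t e * y * power_int t (- e) \<in> gen Z}"
      proof (rule subgrpI; clarify?)
        show "power_int t e * 1 * power_int t (- e) \<in> gen Z" using subgrp_one[OF subgrp_gen] by (simp add: powi_minus grp_simps)
        show "power_int t e * (y * z) * power_int t (- e) \<in> gen Z"
          if "power_int t e * y * power_int t (- e) \<in> gen Z" "power_int t e * z * power_int t (- e) \<in> gen Z" for y z
          using subgrp_mult[OF subgrp_gen that] by (simp add: powi_minus grp_simps)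
        show "power_int t e * inverse y * power_int t (- e) \<in> gen Z"
          if "power_int t e * y * power_int t (- e) \<in> gen Z" for y
          using subgrp_inv[OF subgrp_gen that] by (simp add: powi_minus grp_simps)
      qed
      moreover have "Z \<subseteq> {y. power_int t e * y * power_int t (- e) \<in> gen Z}"
      proof
        fix y assume "y \<in> Z"
        then obtain i s where "s \<in> S" "y = power_int t i * k s * power_int t (- i)" by (auto simp: Z_def)
        hence "power_int t e * y * power_int t (- e) = power_int t (e + i) * k s * power_int t (- (e + i))"
          unfolding powi_minus by (simp add: powi_add grp_simps)
        hence "power_int t e * y * power_int t (- e) \<in> Z" using \<open>s \<in> S\<close> unfolding Z_def by blast
        thus "y \<in> {y. power_int t e * y * power_int t (- e) \<in> gen Z}" using gen_superset by blast
      qed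
      ultimately show ?thesis using gen_least z by blast
    qed
    show ?thesis unfolding normalizes_def
      using *[of _ 1] *[of _ "-1"] by (simp add: powi_one)
  qed
  have "S \<subseteq> cyc (gen Z) t"
  proof
    fix s assume s: "s \<in> S"
    have "k s = power_int t 0 * k s * power_int t (- 0)" by (simp add: powi_zero)
    hence "k s \<in> Z" using s unfolding Z_def by blast
    moreover have "s = k s * power_int t (j s)" by (simp add: k_def powi_minus grp_simps)
    ultimately show "s \<in> cyc (gen Z) t" unfolding cyc_def using gen_superset by blast
  qed
  hence HC: "H \<subseteq> cyc (gen Z) t" using gen_least[OF subgrp_cyc[OF subgrp_gen norm]] S(3) by blast
  have "L \<subseteq> gen Z"
  proof
    fix y assume y: "y \<in> L"
    then obtain z i where z: "y = z * power_int t i" "z \<in> gen Z" using HC L_subset by (auto simp: cyc_def)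
    have zL: "z \<in> L" using z(2) gen_least[OF subgrp_L ZL] by blast
    have "j y = i" using z(1) zL j_mult[OF _ powi_mem, of z i] j_powi by (simp add: L_eq)
    hence "i = 0" using y L_eq by simp
    thus "y \<in> gen Z" using z by (simp add: powi_zero)
  qed
  hence "gen Y = L" using genZ gen_least[OF subgrp_L ZL] by auto
  moreover have "finite Y" using S(1) by (simp add: Y_def)
  ultimately show ?thesis unfolding fin_gen_def using gen_superset[of Y] by blast
qed

theorem gromov:
  "fin_gen (\<Gamma> :: 'a::grp set) \<Longrightarrow> growth d \<Gamma> \<Longrightarrow> \<exists>N. subgrp N \<and> fin_index N \<Gamma> \<and> nilp N"
proof (induction d arbitrary: \<Gamma>)
  case 0
  have sub: "subgrp \<Gamma>" using 0(1) by (rule fin_gen_subgrp)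
  obtain S where S: "finite S" "S \<subseteq> \<Gamma>" "gen S = \<Gamma>" "sym_set S" "1 \<in> S" using fin_gen_sym[OF 0(1)] .
  interpret cayley \<Gamma> S 0 by standard (use S 0 in auto)
  obtain C where C: "\<And>n. card (wball S n) \<le> C * (n + 1) ^ 0" using growthE[OF 0(2) S(1,2)] by blast
  have "finite \<Gamma>"
  proof (rule ccontr)
    assume "infinite \<Gamma>"
    from infinite_card_B[OF this, of "Suc C"] obtain n where "Suc C \<le> card (B n)" by blast
    thus False using C[of n] by (simp add: B_def)
  qed
  hence "fin_index {1} \<Gamma>" using sub by (rule fin_index_finite)
  moreover have "nilp {1::'a}" unfolding nilp_def by (rule exI[of _ 0]) simp
  moreover have "subgrp {1::'a}" by (auto simp: subgrp_def grp_inv_one)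
  ultimately show ?case by blast
next
  case (Suc d)
  have sub: "subgrp \<Gamma>" using Suc.prems(1) by (rule fin_gen_subgrp)
  obtain S where S: "finite S" "S \<subseteq> \<Gamma>" "gen S = \<Gamma>" "sym_set S" "1 \<in> S" using fin_gen_sym[OF Suc.prems(1)] .
  interpret cayley \<Gamma> S "Suc d" by standard (use S Suc.prems in auto)
  show ?case
  proof (cases "finite \<Gamma>")
    case True
    hence "fin_index {1} \<Gamma>" using sub by (rule fin_index_finite)
    moreover have "nilp {1::'a}" unfolding nilp_def by (rule exI[of _ 0]) simp
    moreover have "subgrp {1::'a}" by (auto simp: subgrp_def grp_inv_one)
    ultimately show ?thesis by blast
  next
    case False
    obtain H A where H: "subgrp H" "fin_index H \<Gamma>" and A: "subgrp A" "A \<subseteq> H" "\<not> fin_index A H"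
      "\<And>x y. x \<in> H \<Longrightarrow> y \<in> H \<Longrightarrow> commu x y \<in> A"
      using infinite_abelianization[OF False] by metis
    have fgH: "fin_gen H" by (rule fin_gen_fin_index[OF Suc.prems(1) H(2,1)])
    obtain K x j where K: "subgrp K" "normalizes x K" "fin_index (cyc K x) H" "cyclic_ext (cyc K x) K x j"
      using infinite_cyclic_quotient[OF fgH A] by metis
    interpret E: cyclic_ext "cyc K x" K x j by (rule K(4))
    have EG: "fin_index (cyc K x) \<Gamma>" by (rule fin_index_trans[OF K(3) H(2) sub])
    have fgE: "fin_gen (cyc K x)" by (rule fin_gen_fin_index[OF Suc.prems(1) EG E.H])
    have gE: "growth (Suc d) (cyc K x)" by (rule growth_subset[OF Suc.prems(2) fin_index_subset[OF EG]])
    have fgK: "fin_gen K" by (rule E.fin_gen_L[OF gE fgE])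
    obtain N where N: "subgrp N" "fin_index N K" "nilp N" using Suc.IH[OF fgK E.growth_L[OF gE]] by blast
    have fgN: "fin_gen N" by (rule fin_gen_fin_index[OF fgK N(2,1)])
    obtain L where L: "subgrp L" "fin_index L N" "separated L" using nilp_fin_index_separated[OF fgN N(3)] .
    have LK: "fin_index L K" by (rule fin_index_trans[OF L(2) N(2) K(1)])
    obtain L' where L': "subgrp L'" "normalizes x L'" "fin_index L' K" "separated L'"
      using invariant_separated_extension[OF fgK K(2) L(1) LK L(3)] .
    interpret F: cyclic_ext "cyc L' x" L' x j
      by (rule cyclic_ext_sub[OF K(4) L'(1) fin_index_subset[OF L'(3)] L'(2)])
    have FE: "fin_index (cyc L' x) (cyc K x)" by (rule fin_index_cyc_mono[OF K(1,2) L'(3,1,2)])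
    have FG: "fin_index (cyc L' x) \<Gamma>" by (rule fin_index_trans[OF FE EG sub])
    have gF: "growth (Suc d) (cyc L' x)" by (rule growth_subset[OF Suc.prems(2) fin_index_subset[OF FG]])
    have fgF: "fin_gen (cyc L' x)" by (rule fin_gen_fin_index[OF Suc.prems(1) FG F.H])
    have fgL': "fin_gen L'" by (rule fin_gen_fin_index[OF fgK L'(3,1)])
    obtain D where D: "subgrp D" "fin_index D (cyc L' x)" "nilp D" using F.fin_index_nilp[OF gF fgF fgL' L'(4)] .
    have "fin_index D \<Gamma>" by (rule fin_index_trans[OF D(2) FG sub])
    thus ?thesis using D by blast
  qed
qed

section \<open>Crossing sequences\<close>

lemma run_0: "run M 0 w = init_config w"
  by (simp add: run_def)

lemma run_Suc: "run M (Suc t) w = tm_step M (run M t w)"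
  by (simp add: run_def)

lemma run_halted:
  assumes "halted M (run M t w)"
  shows "run M (t + k) w = run M t w"
  by (induction k) (use assms in \<open>auto simp: run_Suc tm_step_def split: prod.splits\<close>)

lemma run_halted_le:
  assumes "halted M (run M t w)" "t \<le> t'"
  shows "run M t' w = run M t w"
  using run_halted[OF assms(1), of "t' - t"] assms(2) by simp

lemma halted_unique:
  assumes "halted M (run M t w)" "halted M (run M t' w)"
  shows "run M t w = run M t' w"
  using run_halted_le[OF assms(1), of t'] run_halted_le[OF assms(2), of t] by (metis nat_le_linear)

abbreviation st :: "'a tm \<Rightarrow> 'a list \<Rightarrow> nat \<Rightarrow> nat" where "st M w t \<equiv> fst (run M t w)"
abbreviation tape :: "'a tm \<Rightarrow> 'a list \<Rightarrow> nat \<Rightarrow> int \<Rightarrow> 'a cell" where "tape M w t \<equiv> fst (snd (run M t w))"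
abbreviation hd_pos :: "'a tm \<Rightarrow> 'a list \<Rightarrow> nat \<Rightarrow> int" where "hd_pos M w t \<equiv> snd (snd (run M t w))"

lemma head_step: "\<bar>hd_pos M w (Suc t) - hd_pos M w t\<bar> \<le> 1"
  by (auto simp: run_Suc tm_step_def shift_def split: prod.splits dir.splits)

lemma tape_step: "i \<noteq> hd_pos M w t \<Longrightarrow> tape M w (Suc t) i = tape M w t i"
  by (auto simp: run_Suc tm_step_def split: prod.splits)

text \<open>The boundary \<open>b\<close> lies between the cells \<open>b - 1\<close> and
  \<open>b\<close>. States alone are recorded, since the directions of crossings alternate and the
  first one is known from the starting position.\<close>

fun crossings :: "'a tm \<Rightarrow> 'a list \<Rightarrow> int \<Rightarrow> nat \<Rightarrow> nat list" where
  "crossings M w b 0 = []"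
| "crossings M w b (Suc t) = crossings M w b t @
     (if (hd_pos M w t < b) \<noteq> (hd_pos M w (Suc t) < b) then [st M w (Suc t)] else [])"

lemma crossings_mono: "s \<le> t \<Longrightarrow> \<exists>ys. crossings M w b t = crossings M w b s @ ys"
  by (induction t rule: dec_induct) auto

lemma crossings_take: "s \<le> t \<Longrightarrow> crossings M w b s = take (length (crossings M w b s)) (crossings M w b t)"
  using crossings_mono[of s t M w b] by auto

lemma next_crossing:
  assumes "t \<le> T" "length (crossings M w b t) < length (crossings M w b T)"
  obtains t' where "t < t'" "t' \<le> T" "(hd_pos M w t' < b) \<noteq> (hd_pos M w t < b)"
    "hd_pos M w t' = (if hd_pos M w t < b then b else b - 1)"
    "crossings M w b t' = crossings M w b t @ [st M w t']"
    "\<And>i. (i < b) \<noteq> (hd_pos M w t < b) \<Longrightarrow> tape M w t' i = tape M w t i"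
proof -
  define P where "P = (\<lambda>k. t < k \<and> (hd_pos M w k < b) \<noteq> (hd_pos M w t < b))"
  have "\<exists>k\<le>T. P k"
  proof (rule ccontr)
    assume c: "\<not> ?thesis"
    hence side: "(hd_pos M w k < b) = (hd_pos M w t < b)" if "t \<le> k" "k \<le> T" for k
      using that unfolding P_def by (cases "k = t") auto
    have "crossings M w b k = crossings M w b t" if "t \<le> k" "k \<le> T" for k
      using that
    proof (induction k rule: dec_induct)
      case (step k)
      thus ?case using side[of k] side[of "Suc k"] by simp
    qed simp
    from this[of T] show False using assms by simp
  qed
  hence PL: "P (LEAST k. P k)" "(LEAST k. P k) \<le> T" by (meson LeastI, meson Least_le order_trans)
  define t' where "t' = (LEAST k. P k)"
  have t': "t < t'" "t' \<le> T" "(hd_pos M w t' < b) \<noteq> (hd_pos M w t < b)" using PL by (auto simp: P_def t'_def)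
  have before: "(hd_pos M w k < b) = (hd_pos M w t < b)" if "t \<le> k" "k < t'" for k
    using not_less_Least[of k P] that unfolding P_def t'_def by (cases "k = t") auto
  obtain s where s: "t' = Suc s" "t \<le> s" using t'(1) by (cases t') auto
  have same: "crossings M w b k = crossings M w b t" if "t \<le> k" "k < t'" for k
    using that
  proof (induction k rule: dec_induct)
    case (step k)
    thus ?case using before[of k] before[of "Suc k"] by simp
  qed simp
  have tp: "tape M w k i = tape M w t i" if i: "(i < b) \<noteq> (hd_pos M w t < b)" and "t \<le> k" "k \<le> t'" for k i
    using that(2,3)
  proof (induction k rule: dec_induct)
    case (step k)
    have "i \<noteq> hd_pos M w k" using before[of k] step i by auto
    thus ?case using step tape_step[where i = i and M = M and w = w and t = k] by simp
  qed simp
  show ?thesis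
  proof (rule that[of t'])
    show "hd_pos M w t' = (if hd_pos M w t < b then b else b - 1)"
      using before[of s] t'(3) head_step[where M = M and w = w and t = s] s by (auto split: if_splits)
    show "crossings M w b t' = crossings M w b t @ [st M w t']"
      using same[of s] before[of s] t'(3) s by auto
    show "tape M w t' i = tape M w t i" if "(i < b) \<noteq> (hd_pos M w t < b)" for i
      by (rule tp[OF that]) (use t'(1) in simp_all)
  qed (rule t')+
qed

section \<open>Splicing two accepting runs\<close>

locale splice =
  fixes M :: "'a tm" and u1 v1 u2 v2 :: "'a list" and T1 T2 :: nat
  assumes ne: "u1 \<noteq> []" "u2 \<noteq> []"
    and acc: "st M (u1 @ v1) T1 = q_acc M" "st M (u2 @ v2) T2 = q_acc M"
    and cs: "crossings M (u1 @ v1) (int (length u1)) T1 = crossings M (u2 @ v2) (int (length u2)) T2"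
begin

abbreviation "w1 \<equiv> u1 @ v1"
abbreviation "w2 \<equiv> u2 @ v2"
abbreviation "w3 \<equiv> u1 @ v2"
abbreviation "b1 \<equiv> int (length u1)"
abbreviation "b2 \<equiv> int (length u2)"

text \<open>The spliced run looks like the first run to the left of the boundary and like the second run to the
  right of it; the run on the side away from the head waits just after its last crossing.\<close>

definition follows :: "'a config \<Rightarrow> nat \<Rightarrow> nat \<Rightarrow> bool" where
  "follows c t1 t2 \<longleftrightarrow> t1 \<le> T1 \<and> t2 \<le> T2
    \<and> (\<forall>i<b1. fst (snd c) i = tape M w1 t1 i) \<and> (\<forall>i\<ge>b1. fst (snd c) i = tape M w2 t2 (i - b1 + b2))
    \<and> length (crossings M w1 b1 t1) = length (crossings M w2 b2 t2)
    \<and> (if snd (snd c) < b1 then hd_pos M w1 t1 = snd (snd c) \<and> st M w1 t1 = fst c \<and> hd_pos M w2 t2 < b2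
       else hd_pos M w2 t2 = snd (snd c) - b1 + b2 \<and> st M w2 t2 = fst c \<and> hd_pos M w1 t1 \<ge> b1)"

lemma follows_init: "follows (run M 0 w3) 0 0"
proof -
  have "nat (i - b1 + b2) - length u2 = nat i - length u1" if "b1 \<le> i" for i using that by arith
  thus ?thesis using ne by (auto simp: follows_def run_0 init_config_def nth_append nat_less_iff)
qed

text \<open>As long as the head stays on its side, the run on that side advances by one step. When
  the boundary is crossed, the other run is forwarded to its own next crossing: it has one because
  both crossing sequences have equal length, and it arrives in the same state because they are
  equal. The sum \<open>t1 + t2\<close> grows in every case.\<close>

lemma follows_step:
  assumes F: "follows c t1 t2" and nh: "\<not> halted M c"
  shows "\<exists>t1' t2'. follows (tm_step M c) t1' t2' \<and> t1 + t2 < t1' + t2'"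
proof -
  obtain q tp h where c: "c = (q, tp, h)" by (cases c)
  obtain q' x dd where D: "delta M q (tp h) = (q', x, dd)" by (cases "delta M q (tp h)")
  have stepc: "tm_step M c = (q', tp(h := x), h + shift dd)" using nh by (simp add: c tm_step_def D)
  have sh: "\<bar>shift dd\<bar> \<le> 1" by (simp add: shift_def split: dir.splits)
  have len: "length (crossings M w1 b1 t1) = length (crossings M w2 b2 t2)" and tT: "t1 \<le> T1" "t2 \<le> T2"
    and tpl: "\<And>i. i < b1 \<Longrightarrow> tp i = tape M w1 t1 i" and tpr: "\<And>i. i \<ge> b1 \<Longrightarrow> tp i = tape M w2 t2 (i - b1 + b2)"
    using F by (auto simp: follows_def c)
  have lenT: "length (crossings M w1 b1 T1) = length (crossings M w2 b2 T2)" using cs by simp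
  show ?thesis
  proof (cases "h < b1")
    case True
    have r1: "hd_pos M w1 t1 = h" "st M w1 t1 = q" "hd_pos M w2 t2 < b2" using F True by (auto simp: follows_def c)
    have "t1 \<noteq> T1" using nh acc(1) r1(2) by (auto simp: halted_def c)
    hence t1: "Suc t1 \<le> T1" using tT by simp
    have run1: "run M (Suc t1) w1 = (q', (tape M w1 t1)(h := x), h + shift dd)"
    proof -
      have e: "run M t1 w1 = (q, tape M w1 t1, h)" using r1 by (metis prod.collapse)
      show ?thesis unfolding run_Suc using nh D tpl[OF True] by (subst e) (simp add: tm_step_def halted_def c)
    qed
    show ?thesis
    proof (cases "h + shift dd < b1")
      case False
      have cr: "crossings M w1 b1 (Suc t1) = crossings M w1 b1 t1 @ [q']" using r1 run1 True False by simp
      have "length (crossings M w1 b1 (Suc t1)) \<le> length (crossings M w1 b1 T1)"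
        using crossings_mono[OF t1, of M w1 b1] by auto
      hence "length (crossings M w2 b2 t2) < length (crossings M w2 b2 T2)" using cr len lenT by simp
      then obtain t2' where t2': "t2 < t2'" "t2' \<le> T2" "(hd_pos M w2 t2' < b2) \<noteq> (hd_pos M w2 t2 < b2)"
        "hd_pos M w2 t2' = (if hd_pos M w2 t2 < b2 then b2 else b2 - 1)"
        "crossings M w2 b2 t2' = crossings M w2 b2 t2 @ [st M w2 t2']"
        "\<And>i. (i < b2) \<noteq> (hd_pos M w2 t2 < b2) \<Longrightarrow> tape M w2 t2' i = tape M w2 t2 i"
        by (rule next_crossing[OF tT(2)]) (rule that)
      have l: "length (crossings M w1 b1 (Suc t1)) = length (crossings M w2 b2 t2')" using cr t2'(5) len by simp
      have "crossings M w1 b1 (Suc t1) = take (length (crossings M w1 b1 (Suc t1))) (crossings M w1 b1 T1)"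
        by (rule crossings_take[OF t1])
      also have "\<dots> = crossings M w2 b2 t2'" unfolding l cs by (rule crossings_take[OF t2'(2), symmetric])
      finally have "crossings M w1 b1 (Suc t1) = crossings M w2 b2 t2'" .
      hence "st M w2 t2' = q'" using cr t2'(5) by simp
      hence "follows (tm_step M c) (Suc t1) t2'"
        unfolding follows_def stepc using t1 t2' r1 run1 True False sh tpl tpr cr len by auto
      thus ?thesis using t2'(1) by (intro exI[of _ "Suc t1"] exI[of _ t2']) simp
    next
      case inside: True
      have "crossings M w1 b1 (Suc t1) = crossings M w1 b1 t1" using r1 run1 True inside by simp
      hence "follows (tm_step M c) (Suc t1) t2"
        unfolding follows_def stepc using t1 tT r1 run1 True inside tpl tpr len by auto
      thus ?thesis by (intro exI[of _ "Suc t1"] exI[of _ t2]) simp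
    qed
  next
    case right: False
    have r2: "hd_pos M w2 t2 = h - b1 + b2" "st M w2 t2 = q" "hd_pos M w1 t1 \<ge> b1" using F right by (auto simp: follows_def c)
    have "t2 \<noteq> T2" using nh acc(2) r2(2) by (auto simp: halted_def c)
    hence t2: "Suc t2 \<le> T2" using tT by simp
    have run2: "run M (Suc t2) w2 = (q', (tape M w2 t2)(h - b1 + b2 := x), h - b1 + b2 + shift dd)"
    proof -
      have e: "run M t2 w2 = (q, tape M w2 t2, h - b1 + b2)" using r2 by (metis prod.collapse)
      show ?thesis unfolding run_Suc using nh D tpr[of h] right by (subst e) (simp add: tm_step_def halted_def c)
    qed
    show ?thesis
    proof (cases "h + shift dd < b1")
      case True
      have cr: "crossings M w2 b2 (Suc t2) = crossings M w2 b2 t2 @ [q']" using r2 run2 True right by simp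
      have "length (crossings M w2 b2 (Suc t2)) \<le> length (crossings M w2 b2 T2)"
        using crossings_mono[OF t2, of M w2 b2] by auto
      hence "length (crossings M w1 b1 t1) < length (crossings M w1 b1 T1)" using cr len lenT by simp
      then obtain t1' where t1': "t1 < t1'" "t1' \<le> T1" "(hd_pos M w1 t1' < b1) \<noteq> (hd_pos M w1 t1 < b1)"
        "hd_pos M w1 t1' = (if hd_pos M w1 t1 < b1 then b1 else b1 - 1)"
        "crossings M w1 b1 t1' = crossings M w1 b1 t1 @ [st M w1 t1']"
        "\<And>i. (i < b1) \<noteq> (hd_pos M w1 t1 < b1) \<Longrightarrow> tape M w1 t1' i = tape M w1 t1 i"
        by (rule next_crossing[OF tT(1)]) (rule that)
      have l: "length (crossings M w2 b2 (Suc t2)) = length (crossings M w1 b1 t1')" using cr t1'(5) len by simp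
      have "crossings M w2 b2 (Suc t2) = take (length (crossings M w2 b2 (Suc t2))) (crossings M w2 b2 T2)"
        by (rule crossings_take[OF t2])
      also have "\<dots> = crossings M w1 b1 t1'" unfolding l cs [symmetric] by (rule crossings_take[OF t1'(2), symmetric])
      finally have "crossings M w2 b2 (Suc t2) = crossings M w1 b1 t1'" .
      hence "st M w1 t1' = q'" using cr t1'(5) by simp
      hence "follows (tm_step M c) t1' (Suc t2)"
        unfolding follows_def stepc using t2 t1' r2 run2 True right sh tpl tpr cr len by auto
      thus ?thesis using t1'(1) by (intro exI[of _ t1'] exI[of _ "Suc t2"]) simp
    next
      case False
      have "crossings M w2 b2 (Suc t2) = crossings M w2 b2 t2" using r2 run2 False right by simp
      hence "follows (tm_step M c) t1 (Suc t2)"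
        unfolding follows_def stepc using t2 tT r2 run2 False right tpl tpr len by auto
      thus ?thesis by (intro exI[of _ t1] exI[of _ "Suc t2"]) simp
    qed
  qed
qed

text \<open>Since \<open>t1 + t2\<close> cannot exceed \<open>T1 + T2\<close>, the spliced run
  halts. It then is in the state of the run on the side of the head, and the only halting state of
  that run is the accepting one.\<close>

lemma follows_accepts: "follows (run M t w3) t1 t2 \<Longrightarrow> \<exists>t. st M w3 t = q_acc M"
proof (induction "T1 + T2 - (t1 + t2)" arbitrary: t t1 t2 rule: less_induct)
  case less
  show ?case
  proof (cases "halted M (run M t w3)")
    case True
    have tT: "t1 \<le> T1" "t2 \<le> T2" using less.prems by (auto simp: follows_def)
    have "st M w3 t = q_acc M"
    proof (cases "hd_pos M w3 t < b1")
      case left: True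
      hence e: "st M w1 t1 = st M w3 t" using less.prems by (simp add: follows_def)
      hence "halted M (run M t1 w1)" using True by (simp add: halted_def)
      from run_halted_le[OF this tT(1)] show ?thesis using acc(1) e by simp
    next
      case False
      hence e: "st M w2 t2 = st M w3 t" using less.prems by (simp add: follows_def)
      hence "halted M (run M t2 w2)" using True by (simp add: halted_def)
      from run_halted_le[OF this tT(2)] show ?thesis using acc(2) e by simp
    qed
    thus ?thesis by blast
  next
    case False
    obtain t1' t2' where F: "follows (run M (Suc t) w3) t1' t2'" "t1 + t2 < t1' + t2'"
      using follows_step[OF less.prems False] by (auto simp: run_Suc)
    hence "t1' + t2' \<le> T1 + T2" by (simp add: follows_def)
    thus ?thesis using less.hyps[OF _ F(1)] F(2) by simp
  qed
qed

lemma accepts: "\<exists>t. st M w3 t = q_acc M"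
  using follows_accepts[OF follows_init] .

end

section \<open>Counting by short crossing sequences\<close>

lemma sum_crossings_le:
  assumes "finite A"
  shows "(\<Sum>b\<in>A. length (crossings M w b t)) \<le> t"
proof (induction t)
  case (Suc t)
  define P where "P = (\<lambda>b. (hd_pos M w t < b) \<noteq> (hd_pos M w (Suc t) < b))"
  have "card {b \<in> A. P b} \<le> 1"
  proof (rule card_le_Suc0_iff_eq[THEN iffD2, unfolded One_nat_def[symmetric]])
    show "finite {b \<in> A. P b}" using assms by simp
    show "\<forall>a\<in>{b \<in> A. P b}. \<forall>b\<in>{b \<in> A. P b}. a = b"
      using head_step[where M = M and w = w and t = t] by (auto simp: P_def)
  qed
  moreover have "(\<Sum>b\<in>A. if P b then 1 else 0) = card {b \<in> A. P b}"
    using assms by (simp add: sum.If_cases Int_def)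
  moreover have "(\<Sum>b\<in>A. length (crossings M w b (Suc t))) = (\<Sum>b\<in>A. length (crossings M w b t)) + (\<Sum>b\<in>A. if P b then 1 else 0)"
    unfolding sum.distrib [symmetric] by (rule sum.cong) (auto simp: P_def)
  ultimately show ?case using Suc by linarith
qed simp

lemma run_valid:
  assumes wf: "wf_tm \<Sigma> M" and w: "w \<in> lists \<Sigma>"
  shows "st M w t < nstates M \<and> (\<forall>i. valid_cell \<Sigma> M (tape M w t i))"
proof (induction t)
  case 0
  have "0 < nstates M" using wf by (auto simp: wf_tm_def)
  thus ?case using w by (auto simp: run_0 init_config_def valid_cell_def in_lists_conv_set)
next
  case (Suc t)
  obtain q tp h where c: "run M t w = (q, tp, h)" by (cases "run M t w")
  obtain q' x dd where D: "delta M q (tp h) = (q', x, dd)" by (cases "delta M q (tp h)")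
  have v: "q < nstates M" "\<And>i. valid_cell \<Sigma> M (tp i)" using Suc c by auto
  have all: "\<forall>q<nstates M. \<forall>c. valid_cell \<Sigma> M c \<longrightarrow>
      (case delta M q c of (q', c', d) \<Rightarrow> q' < nstates M \<and> valid_cell \<Sigma> M c')"
    using wf by (simp add: wf_tm_def)
  have "q' < nstates M \<and> valid_cell \<Sigma> M x"
    using mp[OF spec[OF mp[OF spec[OF all, of q] v(1)], of "tp h"] v(2)] by (simp add: D)
  thus ?case using v by (auto simp: run_Suc c tm_step_def D)
qed

lemma crossings_states: "wf_tm \<Sigma> M \<Longrightarrow> w \<in> lists \<Sigma> \<Longrightarrow> set (crossings M w b t) \<subseteq> {..<nstates M}"
proof (induction t)
  case (Suc t)
  thus ?case using run_valid[where M = M and w = w and t = "Suc t"] by auto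
qed simp

text \<open>A fooling set argument. Among the \<open>n\<close> boundaries after the letters of
  \<open>p\<close> one is crossed at most time divided by \<open>n\<close>, thus O(log n) times, and
  splicing makes the pair of its offset and crossing sequence injective on \<open>I\<close>. There
  are only polynomially many such pairs. Offsets start at 1, which keeps the left parts
  nonempty.\<close>

theorem crossing_count:
  assumes wf: "wf_tm \<Sigma> M" and dec: "decides_in_time \<Sigma> M L (\<lambda>n. c * nlogn n + c)"
  shows "\<exists>C e :: nat. \<forall>n p (I :: 'i set) x y. 0 < n \<longrightarrow> p \<in> lists \<Sigma> \<longrightarrow> length p = n \<longrightarrow> finite I \<longrightarrow>
      (\<forall>g\<in>I. x g \<in> lists \<Sigma> \<and> y g \<in> lists \<Sigma> \<and> length (x g) \<le> n \<and> length (y g) \<le> n \<and> x g @ p @ y g \<in> L) \<longrightarrow>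
      (\<forall>g\<in>I. \<forall>h\<in>I. x g @ p @ y h \<in> L \<longrightarrow> g = h) \<longrightarrow> card I \<le> C * n ^ e"
proof -
  define a where "a = \<bar>c\<bar>"
  define q where "q = nstates M"
  have q: "1 \<le> q" using wf by (auto simp: wf_tm_def q_def)
  define e0 where "e0 = nat \<lceil>3 * a * log 2 (2 * real q)\<rceil>"
  define C0 where "C0 = (2 * real q) powr a * 3 ^ e0"
  have key: "real (card I) \<le> real n * (C0 * real n ^ e0)"
    if n: "0 < n" and p: "p \<in> lists \<Sigma>" "length p = n" and I: "finite I"
      and xy: "\<And>g. g \<in> I \<Longrightarrow> x g \<in> lists \<Sigma> \<and> y g \<in> lists \<Sigma> \<and> length (x g) \<le> n \<and> length (y g) \<le> n \<and> x g @ p @ y g \<in> L"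
      and inj: "\<And>g h. g \<in> I \<Longrightarrow> h \<in> I \<Longrightarrow> x g @ p @ y h \<in> L \<Longrightarrow> g = h"
    for n p and I :: "'i set" and x y
  proof -
    \<comment> \<open>The inputs have length at most \<open>3 * n\<close>; this is the resulting
      time bound divided by the \<open>n\<close> boundaries.\<close>
    define ell where "ell = 3 * a * log 2 (3 * real n) + a"
    have l0: "0 \<le> ell" using n by (simp add: ell_def a_def)
    define m where "m = nat \<lfloor>ell\<rfloor>"
    define w where "w = (\<lambda>g. x g @ p @ y g)"
    have wL: "w g \<in> lists \<Sigma>" if "g \<in> I" for g using xy[OF that] p by (simp add: w_def)
    have "\<exists>t i. i \<in> {1..n} \<and> st M (w g) t = q_acc M \<and> length (crossings M (w g) (int (length (x g) + i)) t) \<le> m" if g: "g \<in> I" for g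
    proof -
      obtain t where t: "real t \<le> c * nlogn (length (w g)) + c" "halted M (run M t (w g))" "st M (w g) t = q_acc M"
        using dec wL[OF g] xy[OF g] unfolding decides_in_time_def w_def by blast
      have len: "n \<le> length (w g)" "length (w g) \<le> 3 * n" using xy[OF g] p by (auto simp: w_def)
      have l0: "0 \<le> log 2 (real (length (w g)))" using len n by (subst zero_le_log_cancel_iff) auto
      have l1: "log 2 (real (length (w g))) \<le> log 2 (3 * real n)" using len n by (subst log_le_cancel_iff) auto
      from l0 have "c * nlogn (length (w g)) + c \<le> a * nlogn (length (w g)) + a"
        using len n unfolding a_def nlogn_def by (intro add_mono mult_right_mono) auto
      also have "nlogn (length (w g)) \<le> real (3 * n) * log 2 (3 * real n)"
        unfolding nlogn_def using len n l0 l1 by (intro mult_mono) auto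
      finally have tl: "real t \<le> a * (real (3 * n) * log 2 (3 * real n)) + a"
        using t(1) by (simp add: a_def mult_left_mono)
      have "real t \<le> real n * ell"
      proof -
        have "a * 1 \<le> a * real n" using n by (intro mult_left_mono) (auto simp: a_def)
        thus ?thesis using tl by (simp add: ell_def algebra_simps)
      qed
      have "\<exists>i\<in>{1..n}. length (crossings M (w g) (int (length (x g) + i)) t) \<le> m"
      proof (rule ccontr)
        assume "\<not> ?thesis"
        hence big: "Suc m \<le> length (crossings M (w g) (int (length (x g) + i)) t)" if "i \<in> {1..n}" for i
          using that by (auto simp: not_le Suc_le_eq)
        have "n * Suc m = (\<Sum>i\<in>{1..n}. Suc m)" by simp
        also have "\<dots> \<le> (\<Sum>i\<in>{1..n}. length (crossings M (w g) (int (length (x g) + i)) t))" by (intro sum_mono big)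
        also have "\<dots> = (\<Sum>b\<in>(\<lambda>i. int (length (x g) + i)) ` {1..n}. length (crossings M (w g) b t))"
          by (subst sum.reindex) (auto simp: inj_on_def)
        also have "\<dots> \<le> t" by (rule sum_crossings_le) simp
        finally have "real (n * Suc m) \<le> real t" by (simp only: of_nat_le_iff)
        hence "real n * real (Suc m) \<le> real n * ell" using \<open>real t \<le> real n * ell\<close> by (simp add: algebra_simps)
        hence "real (Suc m) \<le> ell" using n by simp
        thus False using l0 unfolding m_def by linarith
      qed
      thus ?thesis using t(3) by blast
    qed
    then obtain t i where ti: "\<And>g. g \<in> I \<Longrightarrow> i g \<in> {1..n} \<and> st M (w g) (t g) = q_acc M \<and>
        length (crossings M (w g) (int (length (x g) + i g)) (t g)) \<le> m" by metis
    define f where "f = (\<lambda>g. (i g, crossings M (w g) (int (length (x g) + i g)) (t g)))"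
    have "inj_on f I"
    proof (rule inj_onI)
      fix g h assume g: "g \<in> I" and h: "h \<in> I" and fe: "f g = f h"
      define k where "k = i g"
      have k: "i g = k" "i h = k" "1 \<le> k" "k \<le> n" using fe ti[OF g] by (auto simp: f_def k_def)
      define u1 v1 u2 v2 where uv: "u1 = x g @ take k p" "v1 = drop k p @ y g" "u2 = x h @ take k p" "v2 = drop k p @ y h"
      have w1: "w g = u1 @ v1" and w2: "w h = u2 @ v2" and w3: "u1 @ v2 = x g @ p @ y h"
        by (simp_all add: w_def uv)
      have lens: "length u1 = length (x g) + k" "length u2 = length (x h) + k" using k p by (simp_all add: uv)
      interpret splice M u1 v1 u2 v2 "t g" "t h"
      proof
        show "u1 \<noteq> []" "u2 \<noteq> []" using lens k by auto
        show "st M (u1 @ v1) (t g) = q_acc M" "st M (u2 @ v2) (t h) = q_acc M" using ti[OF g] ti[OF h] w1 w2 by auto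
        show "crossings M (u1 @ v1) (int (length u1)) (t g) = crossings M (u2 @ v2) (int (length u2)) (t h)"
          using fe k by (simp add: f_def lens w1 w2)
      qed
      obtain s where s: "st M (x g @ p @ y h) s = q_acc M" using accepts w3 by auto
      have "x g @ p @ y h \<in> lists \<Sigma>" using xy[OF g] xy[OF h] p by simp
      then obtain s' where "halted M (run M s' (x g @ p @ y h))" "(st M (x g @ p @ y h) s' = q_acc M) = (x g @ p @ y h \<in> L)"
        using dec unfolding decides_in_time_def by blast
      moreover have "halted M (run M s (x g @ p @ y h))" using s by (simp add: halted_def)
      ultimately have "x g @ p @ y h \<in> L" using halted_unique s by metis
      thus "g = h" by (rule inj[OF g h])
    qed
    moreover have "f ` I \<subseteq> {1..n} \<times> {xs. set xs \<subseteq> {..<q} \<and> length xs \<le> m}"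
    proof
      fix z assume "z \<in> f ` I"
      then obtain g where g: "g \<in> I" "z = f g" by blast
      show "z \<in> {1..n} \<times> {xs. set xs \<subseteq> {..<q} \<and> length xs \<le> m}"
        using ti[OF g(1)] crossings_states[OF wf wL[OF g(1)]] unfolding g(2) f_def q_def by simp
    qed
    ultimately have "card I \<le> card ({1..n} \<times> {xs. set xs \<subseteq> {..<q} \<and> length xs \<le> m})"
      by (intro card_inj_on_le) (auto simp: finite_lists_length_le)
    also have "\<dots> = n * (\<Sum>j\<le>m. q ^ j)" by (simp add: card_cartesian_product card_lists_length_le)
    also have "\<dots> \<le> n * (\<Sum>j\<le>m. q ^ m)" using q by (intro mult_le_mono2 sum_mono power_increasing) auto
    also have "\<dots> = n * (Suc m * q ^ m)" by simp
    also have "\<dots> \<le> n * (2 ^ m * q ^ m)" by (intro mult_le_mono2 mult_le_mono1 Suc_leI less_exp)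
    also have "\<dots> = n * (2 * q) ^ m" by (simp add: power_mult_distrib)
    finally have "real (card I) \<le> real (n * (2 * q) ^ m)" by (simp only: of_nat_le_iff)
    also have "\<dots> = real n * (2 * real q) ^ m" by simp
    also have "\<dots> \<le> real n * (C0 * real n ^ e0)"
    proof (rule mult_left_mono)
      have "(2 * real q) ^ m = (2 * real q) powr real m" using q by (simp add: powr_realpow)
      also have "\<dots> \<le> (2 * real q) powr ell" using q l0 by (intro powr_mono) (auto simp: m_def)
      also have "\<dots> = (2 * real q) powr a * (2 * real q) powr (3 * a * log 2 (3 * real n))"
        by (simp add: ell_def powr_add)
      \<comment> \<open>Exchanging base and argument of the logarithm turns an exponential in the
        logarithm of \<open>n\<close> into a power of \<open>n\<close>.\<close>
      also have "(2 * real q) powr (3 * a * log 2 (3 * real n)) = (3 * real n) powr (3 * a * log 2 (2 * real q))"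
        using q n by (simp add: powr_def log_def)
      also have "\<dots> \<le> (3 * real n) powr real e0"
        using n by (intro powr_mono) (auto simp: e0_def real_nat_ceiling_ge)
      also have "\<dots> = (3 * real n) ^ e0" using n by (simp add: powr_realpow)
      finally show "(2 * real q) ^ m \<le> C0 * real n ^ e0"
        by (simp add: C0_def power_mult_distrib mult_left_mono)
    qed simp
    finally show ?thesis .
  qed
  show ?thesis
  proof (rule exI[of _ "nat \<lceil>C0\<rceil>"], rule exI[of _ "Suc e0"], intro allI impI)
    fix n p and I :: "'i set" and x y
    assume a: "0 < n" "p \<in> lists \<Sigma>" "length p = n" "finite I"
      and xy: "\<forall>g\<in>I. x g \<in> lists \<Sigma> \<and> y g \<in> lists \<Sigma> \<and> length (x g) \<le> n \<and> length (y g) \<le> n \<and> x g @ p @ y g \<in> L"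
      and inj: "\<forall>g\<in>I. \<forall>h\<in>I. x g @ p @ y h \<in> L \<longrightarrow> g = h"
    have "real (card I) \<le> real n * (C0 * real n ^ e0)"
      using xy inj by (intro key[OF a, of x y]) blast+
    also have "\<dots> \<le> real n * (real (nat \<lceil>C0\<rceil>) * real n ^ e0)"
      by (intro mult_left_mono mult_right_mono real_nat_ceiling_ge) auto
    also have "\<dots> = real (nat \<lceil>C0\<rceil> * n ^ Suc e0)" by simp
    finally show "card I \<le> nat \<lceil>C0\<rceil> * n ^ Suc e0" by (simp only: of_nat_le_iff)
  qed
qed

section \<open>Additive register machines on one-tape Turing machines\<close>

datatype ('a, 'v) sym = SB | SI 'a | SV 'v

definition astep :: "('q \<Rightarrow> ('a, 'v) sym \<Rightarrow> 'q \<times> ('a, 'v) sym \<times> dir) \<Rightarrow> 'q set \<Rightarrow>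
    'q \<times> (int \<Rightarrow> ('a, 'v) sym) \<times> int \<Rightarrow> 'q \<times> (int \<Rightarrow> ('a, 'v) sym) \<times> int" where
  "astep \<delta> F c = (case c of (q, tp, h) \<Rightarrow> if q \<in> F then c
     else (case \<delta> q (tp h) of (q', x, d) \<Rightarrow> (q', tp(h := x), h + shift d)))"

definition atape :: "'a list \<Rightarrow> int \<Rightarrow> ('a, 'v) sym" where
  "atape w = (\<lambda>i. if 0 \<le> i \<and> i < int (length w) then SI (w ! nat i) else SB)"

text \<open>Machines are programmed over arbitrary types of states and symbols and transported to
  numbered ones by injections of the finite sets that the transitions stay in.\<close>

lemma encode_machine:
  fixes \<delta> :: "'q \<Rightarrow> ('a, 'v) sym \<Rightarrow> 'q \<times> ('a, 'v) sym \<times> dir" and Q :: "'q set" and V :: "'v set"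
  assumes fin: "finite \<Sigma>" "finite Q" "finite V" and q: "q0 \<in> Q" "qa \<in> Q" "qr \<in> Q" "qa \<noteq> qr"
    and closed: "\<And>p x p' y d. p \<in> Q \<Longrightarrow> x \<in> insert SB (SI ` \<Sigma> \<union> SV ` V) \<Longrightarrow> \<delta> p x = (p', y, d) \<Longrightarrow>
      p' \<in> Q \<and> y \<in> insert SB (SI ` \<Sigma> \<union> SV ` V)"
  obtains M where "wf_tm \<Sigma> M" "\<forall>w\<in>lists \<Sigma>. \<forall>t.
    (halted M (run M t w) \<longleftrightarrow> fst ((astep \<delta> {qa, qr} ^^ t) (q0, atape w, 0)) \<in> {qa, qr}) \<and>
    (fst (run M t w) = q_acc M \<longleftrightarrow> fst ((astep \<delta> {qa, qr} ^^ t) (q0, atape w, 0)) = qa)"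
proof -
  define C where "C = insert SB (SI ` \<Sigma> \<union> SV ` V)"
  obtain f0 :: "'q \<Rightarrow> nat" and n where f0: "f0 ` Q = {i. i < n}" "inj_on f0 Q"
    using finite_imp_inj_to_nat_seg[OF fin(2)] by auto
  \<comment> \<open>The start state has to be number 0, so all others are shifted by one. The number
    \<open>Suc (f0 q0)\<close> then belongs to no state and receives the default transition in
    \<open>D\<close>.\<close>
  define f where "f = (\<lambda>p. if p = q0 then 0 else Suc (f0 p))"
  have f: "inj_on f Q" "f q0 = 0" "\<And>p. p \<in> Q \<Longrightarrow> f p < Suc n"
    using f0 by (auto simp: f_def inj_on_def)
  obtain g :: "'v \<Rightarrow> nat" and m where g: "g ` V = {i. i < m}" "inj_on g V"
    using finite_imp_inj_to_nat_seg[OF fin(3)] by auto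
  define enc :: "('a, 'v) sym \<Rightarrow> 'a cell" where
    "enc = (\<lambda>x. case x of SB \<Rightarrow> Blank | SI a \<Rightarrow> Inp a | SV v \<Rightarrow> Aux (g v))"
  have enc_inj: "inj_on enc C"
    using g(2) by (auto simp: inj_on_def C_def enc_def)
  define D where "D = (\<lambda>k c. if k \<in> f ` Q \<and> c \<in> enc ` C
     then (case \<delta> (inv_into Q f k) (inv_into C enc c) of (p, y, d) \<Rightarrow> (f p, enc y, d)) else (0, Blank, Stay))"
  define M where "M = \<lparr>nstates = Suc n, naux = m, delta = D, q_acc = f qa, q_rej = f qr\<rparr>"
  have valid: "valid_cell \<Sigma> M (enc y)" if "y \<in> C" for y
    using that g(1) by (auto simp: valid_cell_def C_def enc_def M_def)
  have wf: "wf_tm \<Sigma> M"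
  proof -
    have "case D k c of (q', c', d) \<Rightarrow> q' < Suc n \<and> valid_cell \<Sigma> M c'" for k c
    proof (cases "k \<in> f ` Q \<and> c \<in> enc ` C")
      case True
      obtain p y d where d: "\<delta> (inv_into Q f k) (inv_into C enc c) = (p, y, d)" by (metis prod_cases3)
      have "p \<in> Q" "y \<in> C" using closed[OF _ _ d] True inv_into_into[of k f Q] inv_into_into[of c enc C] by (auto simp: C_def)
      thus ?thesis using True d f(3) valid by (simp add: D_def)
    next
      case False
      thus ?thesis unfolding D_def by (subst if_not_P) (auto simp: valid_cell_def)
    qed
    moreover have "f qa \<noteq> f qr" using f(1) q by (auto simp: inj_on_def)
    ultimately show ?thesis using f(3) q fin(1) by (auto simp: wf_tm_def M_def)
  qed
  have fM: "q_acc M = f qa" "q_rej M = f qr" by (simp_all add: M_def)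
  have sim: "\<exists>p tp h. (astep \<delta> {qa, qr} ^^ t) (q0, atape w, 0) = (p, tp, h) \<and> p \<in> Q \<and> (\<forall>i. tp i \<in> C)
      \<and> run M t w = (f p, \<lambda>i. enc (tp i), h)" if w: "w \<in> lists \<Sigma>" for w t
  proof (induction t)
    case 0
    have "atape w i \<in> C" for i using w by (auto simp: atape_def C_def in_lists_conv_set)
    moreover have "run M 0 w = (f q0, \<lambda>i. enc (atape w i), 0)"
      by (auto simp: run_def init_config_def f(2) atape_def enc_def)
    ultimately show ?case using q(1) by auto
  next
    case (Suc t)
    then obtain p tp h where IH: "(astep \<delta> {qa, qr} ^^ t) (q0, atape w, 0) = (p, tp, h)" "p \<in> Q" "\<And>i. tp i \<in> C"
      "run M t w = (f p, \<lambda>i. enc (tp i), h)" by blast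
    obtain p' y d where d: "\<delta> p (tp h) = (p', y, d)" by (metis prod_cases3)
    have cl: "p' \<in> Q" "y \<in> C" using closed[OF IH(2) _ d] IH(3)[of h] by (auto simp: C_def)
    have halt: "halted M (run M t w) \<longleftrightarrow> p \<in> {qa, qr}"
      unfolding halted_def fM using IH(2,4) q f(1) by (auto simp: inj_on_def)
    have "D (f p) (enc (tp h)) = (f p', enc y, d)"
      using IH(2,3) d f(1) enc_inj by (simp add: D_def inv_into_f_f)
    hence "run M (Suc t) w = (if p \<in> {qa, qr} then (f p, \<lambda>i. enc (tp i), h) else (f p', (\<lambda>i. enc (tp i))(h := enc y), h + shift d))"
      using halt IH(4) by (simp add: run_def tm_step_def M_def)
    moreover have "(astep \<delta> {qa, qr} ^^ Suc t) (q0, atape w, 0) = (if p \<in> {qa, qr} then (p, tp, h) else (p', tp(h := y), h + shift d))"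
      by (simp add: IH(1) astep_def d)
    moreover have "(\<lambda>i. enc ((tp(h := y)) i)) = (\<lambda>i. enc (tp i))(h := enc y)" by auto
    ultimately show ?case using IH cl by (cases "p \<in> {qa, qr}") auto
  qed
  show ?thesis
  proof (rule that[OF wf], intro ballI allI)
    fix w t assume "w \<in> lists \<Sigma>"
    then obtain p tp h where s: "(astep \<delta> {qa, qr} ^^ t) (q0, atape w, 0) = (p, tp, h)" "p \<in> Q"
      "run M t w = (f p, \<lambda>i. enc (tp i), h)" using sim by blast
    show "(halted M (run M t w) \<longleftrightarrow> fst ((astep \<delta> {qa, qr} ^^ t) (q0, atape w, 0)) \<in> {qa, qr}) \<and>
      (fst (run M t w) = q_acc M \<longleftrightarrow> fst ((astep \<delta> {qa, qr} ^^ t) (q0, atape w, 0)) = qa)"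
      unfolding halted_def fM using s q f(1) by (auto simp: inj_on_def)
  qed
qed

text \<open>Balanced ternary: \<open>x = dig x + 3 * car x\<close> with \<open>dig x\<close> in \<open>{-1, 0, 1}\<close>; a number vanishes
  iff all its digits do.\<close>

definition dig :: "int \<Rightarrow> int" where "dig x = (x + 1) mod 3 - 1"
definition car :: "int \<Rightarrow> int" where "car x = (x + 1) div 3"

lemma dig_car: "dig x + 3 * car x = x"
  unfolding dig_def car_def using mult_div_mod_eq[of 3 "x + 1"] by linarith

lemma dig_range: "dig x \<in> {-1, 0, 1}"
proof -
  have "0 \<le> (x + 1) mod 3" "(x + 1) mod 3 < 3" by simp_all
  thus ?thesis by (auto simp: dig_def)
qed

lemma dig_0: "dig 0 = 0" and car_0: "car 0 = 0"
  by (simp_all add: dig_def car_def)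

lemma car_bound: "3 * \<bar>car x\<bar> \<le> \<bar>x\<bar> + 1"
  using dig_car[of x] dig_range[of x] by auto

lemma car_less: "x \<noteq> 0 \<Longrightarrow> \<bar>car x\<bar> < \<bar>x\<bar>"
  using car_bound[of x] by linarith

lemma dig_nonzero: "car x = 0 \<Longrightarrow> x \<noteq> 0 \<Longrightarrow> dig x \<noteq> 0"
  using dig_car[of x] by auto

text \<open>The digit vectors form a block directly to the left of the input letter being read, least significant
  digit first when going left. \<open>Add\<close> sweeps left with a carry \<open>c\<close>; \<open>Sh\<close> sweeps back right and moves the block
  one cell to the right, over the letter; \<open>Check\<close> tests that all digits are zero.\<close>

datatype ('k, 'a, 'r) mstate = Read 'k | Add 'k 'a "'r \<Rightarrow> int" | Sh 'k "('r \<Rightarrow> int) option" | Check | QAcc | QRej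

text \<open>Each letter applies an affine map, chosen by the control state, to an integer vector.
  The registers share one block of cells, a cell holding one digit of every register, so a single
  sweep updates all of them.\<close>

locale register_machine =
  fixes \<Sigma> :: "'a set" and I :: "'k set" and R :: "'r set" and nx :: "'k \<Rightarrow> 'a \<Rightarrow> 'k"
    and A :: "'k \<Rightarrow> 'a \<Rightarrow> 'r \<Rightarrow> 'r \<Rightarrow> int" and b :: "'k \<Rightarrow> 'a \<Rightarrow> 'r \<Rightarrow> int"
    and i0 :: 'k and Acc :: "'k set" and R0 :: "'r set"
  assumes fin: "finite \<Sigma>" "finite I" "finite R" and i0: "i0 \<in> I"
    and nx: "\<And>i s. i \<in> I \<Longrightarrow> s \<in> \<Sigma> \<Longrightarrow> nx i s \<in> I" and R0: "R0 \<subseteq> R"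
begin

definition upd :: "'k \<Rightarrow> 'a \<Rightarrow> ('r \<Rightarrow> int) \<Rightarrow> ('r \<Rightarrow> int) \<Rightarrow> 'r \<Rightarrow> int" where
  "upd i s d c = (\<lambda>r. if r \<in> R then (\<Sum>r'\<in>R. A i s r r' * d r') + c r else 0)"

definition rstep :: "'k \<times> ('r \<Rightarrow> int) \<Rightarrow> 'a \<Rightarrow> 'k \<times> ('r \<Rightarrow> int)" where
  "rstep = (\<lambda>(i, u) s. (nx i s, upd i s u (b i s)))"

definition regs :: "'a list \<Rightarrow> 'k \<times> ('r \<Rightarrow> int)" where
  "regs w = foldl rstep (i0, \<lambda>_. 0) w"

definition accepted :: "'a list set" where
  "accepted = {w \<in> lists \<Sigma>. fst (regs w) \<in> Acc \<and> (\<forall>r\<in>R0. snd (regs w) r = 0)}"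

definition DV :: "('r \<Rightarrow> int) set" where
  "DV = {d. \<forall>r. (r \<in> R \<longrightarrow> d r \<in> {-1, 0, 1}) \<and> (r \<notin> R \<longrightarrow> d r = 0)}"

text \<open>A bound for the carries, needed for finitely many states. The digits contribute at most
  \<open>bnd - 1\<close> to a column and the carry at most \<open>bnd\<close>; the new carry is
  about a third of the sum and again at most \<open>bnd\<close>.\<close>

definition bnd :: int where
  "bnd = 1 + (\<Sum>i\<in>I. \<Sum>s\<in>\<Sigma>. \<Sum>r\<in>R. \<bar>b i s r\<bar> + (\<Sum>r'\<in>R. \<bar>A i s r r'\<bar>))"

definition CV :: "('r \<Rightarrow> int) set" where
  "CV = {c. \<forall>r. (r \<in> R \<longrightarrow> c r \<in> {-bnd..bnd}) \<and> (r \<notin> R \<longrightarrow> c r = 0)}"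

definition bvec :: "'k \<Rightarrow> 'a \<Rightarrow> 'r \<Rightarrow> int" where
  "bvec i s = (\<lambda>r. if r \<in> R then b i s r else 0)"

fun tr :: "('k, 'a, 'r) mstate \<Rightarrow> ('a, 'r \<Rightarrow> int) sym \<Rightarrow> ('k, 'a, 'r) mstate \<times> ('a, 'r \<Rightarrow> int) sym \<times> dir" where
  "tr (Read i) (SI s) = (Add i s (bvec i s), SI s, MoveL)"
| "tr (Read i) y = (if i \<in> Acc then Check else QRej, y, MoveL)"
| "tr (Add i s c) (SV d) = (Add i s (\<lambda>r. car (upd i s d c r)), SV (\<lambda>r. dig (upd i s d c r)), MoveL)"
| "tr (Add i s c) y = (if \<forall>r\<in>R. c r = 0 then (Sh (nx i s) None, SB, MoveR)
     else (Add i s (\<lambda>r. car (c r)), SV (\<lambda>r. dig (c r)), MoveL))"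
| "tr (Sh i None) (SV d) = (Sh i (Some d), SB, MoveR)"
| "tr (Sh i None) y = (Read i, SB, MoveR)"
| "tr (Sh i (Some d)) (SV d') = (Sh i (Some d'), SV d, MoveR)"
| "tr (Sh i (Some d)) y = (Read i, SV d, MoveR)"
| "tr Check (SV d) = (if \<forall>r\<in>R0. d r = 0 then Check else QRej, SV d, MoveL)"
| "tr Check y = (QAcc, y, Stay)"
| "tr QAcc y = (QAcc, y, Stay)"
| "tr QRej y = (QRej, y, Stay)"

abbreviation mstep where "mstep \<equiv> astep tr {QAcc, QRej}"

text \<open>The block left by an \<open>Add\<close> sweep. Beyond the end of the old block the carry
  alone is written out until it vanishes, which happens because \<open>car\<close> shrinks nonzero
  numbers. Leading zeros are never removed.\<close>

function addl :: "'k \<Rightarrow> 'a \<Rightarrow> ('r \<Rightarrow> int) \<Rightarrow> ('r \<Rightarrow> int) list \<Rightarrow> ('r \<Rightarrow> int) list" where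
  "addl i s c (d # ds) = (\<lambda>r. dig (upd i s d c r)) # addl i s (\<lambda>r. car (upd i s d c r)) ds"
| "addl i s c [] = (if \<forall>r\<in>R. c r = 0 then [] else (\<lambda>r. dig (c r)) # addl i s (\<lambda>r. car (c r)) [])"
  by pat_completeness auto
termination
proof (relation "measures [\<lambda>(i, s, c, ds). length ds, \<lambda>(i, s, c, ds). \<Sum>r\<in>R. nat \<bar>c r\<bar>]")
  fix c :: "'r \<Rightarrow> int" and i s assume "\<not> (\<forall>r\<in>R. c r = 0)"
  then obtain r where r: "r \<in> R" "c r \<noteq> 0" by blast
  have "(\<Sum>r\<in>R. nat \<bar>car (c r)\<bar>) < (\<Sum>r\<in>R. nat \<bar>c r\<bar>)"
  proof (rule sum_strict_mono_ex1[OF fin(3)])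
    have "nat \<bar>car (c r)\<bar> \<le> nat \<bar>c r\<bar>" for r
      using car_less[of "c r"] by (cases "c r = 0") (auto simp: car_0)
    thus "\<forall>r\<in>R. nat \<bar>car (c r)\<bar> \<le> nat \<bar>c r\<bar>" by blast
    show "\<exists>r\<in>R. nat \<bar>car (c r)\<bar> < nat \<bar>c r\<bar>" using r car_less[OF r(2)] by (intro bexI[of _ r]) auto
  qed
  thus "((i, s, \<lambda>r. car (c r), []), (i, s, c, [])) \<in> measures [\<lambda>(i, s, c, ds). length ds, \<lambda>(i, s, c, ds). \<Sum>r\<in>R. nat \<bar>c r\<bar>]"
    by simp
qed auto

declare addl.simps(2) [simp del]

fun val :: "('r \<Rightarrow> int) list \<Rightarrow> 'r \<Rightarrow> int" where
  "val [] r = 0"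
| "val (d # ds) r = d r + 3 * val ds r"

lemma val_addl: "r \<in> R \<Longrightarrow> val (addl i s c ds) r = (\<Sum>r'\<in>R. A i s r r' * val ds r') + c r"
proof (induction i s c ds rule: addl.induct)
  case (1 i s c d ds)
  have "(\<Sum>r'\<in>R. A i s r r' * val (d # ds) r') = (\<Sum>r'\<in>R. A i s r r' * d r') + 3 * (\<Sum>r'\<in>R. A i s r r' * val ds r')"
    by (simp add: distrib_left sum.distrib sum_distrib_left mult_ac)
  thus ?case using 1 dig_car[of "upd i s d c r"] by (simp add: upd_def[of i s d c])
next
  case (2 i s c)
  show ?case
  proof (cases "\<forall>r\<in>R. c r = 0")
    case False
    thus ?thesis using 2 dig_car[of "c r"] by (simp add: addl.simps(2)[of i s c])
  qed (use 2 in \<open>simp add: addl.simps(2)\<close>)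
qed

lemma dig_vec_DV: "(\<And>r. r \<notin> R \<Longrightarrow> c r = 0) \<Longrightarrow> (\<lambda>r. dig (c r)) \<in> DV"
  using dig_range by (auto simp: DV_def dig_0)

lemma addl_DV: "(\<And>r. r \<notin> R \<Longrightarrow> c r = 0) \<Longrightarrow> set (addl i s c ds) \<subseteq> DV"
proof (induction i s c ds rule: addl.induct)
  case (1 i s c d ds)
  have "(\<lambda>r. dig (upd i s d c r)) \<in> DV" by (rule dig_vec_DV) (simp add: upd_def)
  thus ?case using 1(1) by (simp add: upd_def car_0)
next
  case (2 i s c)
  thus ?case using dig_vec_DV[of c] by (auto simp: addl.simps(2)[of i s c] car_0)
qed

text \<open>The block is extended only while the carry is nonzero, and the last cell so written has
  a nonzero digit by \<open>dig_nonzero\<close>. Together with \<open>val_lower\<close> every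
  extension certifies a large register value.\<close>

lemma addl_length:
  "length ds \<le> length (addl i s c ds) \<and> (length (addl i s c ds) = length ds \<or> (\<exists>r\<in>R. last (addl i s c ds) r \<noteq> 0))"
proof (induction i s c ds rule: addl.induct)
  case (1 i s c d ds)
  thus ?case by auto
next
  case (2 i s c)
  show ?case
  proof (cases "\<forall>r\<in>R. c r = 0")
    case True
    thus ?thesis by (simp add: addl.simps(2))
  next
    case False
    show ?thesis
    proof (cases "addl i s (\<lambda>r. car (c r)) [] = []")
      case True
      hence z: "\<forall>r\<in>R. car (c r) = 0" by (simp add: addl.simps(2) split: if_splits)
      obtain r where r: "r \<in> R" "c r \<noteq> 0" using False by blast
      have "dig (c r) \<noteq> 0" using z r dig_nonzero by blast
      thus ?thesis using False True r(1) by (auto simp: addl.simps(2)[of i s c])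
    next
      case ne: False
      hence "\<exists>r\<in>R. last (addl i s (\<lambda>r. car (c r)) []) r \<noteq> 0" using 2[OF False] by auto
      thus ?thesis using False ne by (simp add: addl.simps(2)[of i s c])
    qed
  qed
qed

lemma val_zero_iff: "set ds \<subseteq> DV \<Longrightarrow> r \<in> R \<Longrightarrow> val ds r = 0 \<longleftrightarrow> (\<forall>d\<in>set ds. d r = 0)"
proof (induction ds)
  case (Cons d ds)
  have "d r \<in> {-1, 0, 1}" using Cons.prems by (auto simp: DV_def)
  hence "d r = -1 \<or> d r = 0 \<or> d r = 1" by auto
  hence "d r + 3 * val ds r = 0 \<longleftrightarrow> d r = 0 \<and> val ds r = 0" by presburger
  thus ?case using Cons by simp
qed simp

text \<open>In balanced ternary the digits below a leading one at position \<open>m\<close> sum to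
  at most \<open>(3 ^ m - 1) / 2\<close> in absolute value, so they cannot cancel it.\<close>

lemma val_lower: "set ds \<subseteq> DV \<Longrightarrow> r \<in> R \<Longrightarrow> ds \<noteq> [] \<Longrightarrow> last ds r \<noteq> 0 \<Longrightarrow> 3 ^ (length ds - 1) + 1 \<le> 2 * \<bar>val ds r\<bar>"
proof (induction ds)
  case (Cons d ds)
  have d: "d r \<in> {-1, 0, 1}" using Cons.prems by (auto simp: DV_def)
  show ?case
  proof (cases "ds = []")
    case True
    thus ?thesis using Cons.prems d by auto
  next
    case False
    hence IH: "3 ^ (length ds - 1) + 1 \<le> 2 * \<bar>val ds r\<bar>" using Cons by simp
    have "(3::int) ^ length ds = 3 * 3 ^ (length ds - 1)" using False by (cases ds) auto
    moreover have "3 * \<bar>val ds r\<bar> - 1 \<le> \<bar>d r + 3 * val ds r\<bar>" using d by auto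
    ultimately have "3 ^ length ds + 1 \<le> 2 * \<bar>d r + 3 * val ds r\<bar>" using IH by (smt (verit))
    thus ?thesis by simp
  qed
qed simp

section \<open>Sweeps of the head over the digit block\<close>

definition spells :: "(int \<Rightarrow> ('a, 'r \<Rightarrow> int) sym) \<Rightarrow> int \<Rightarrow> ('r \<Rightarrow> int) list \<Rightarrow> bool" where
  "spells tp h ds \<longleftrightarrow> (\<forall>j. tp (h - int j) = (if j < length ds then SV (ds ! j) else SB))"

lemma spells_Cons: "spells tp h (d # ds) \<longleftrightarrow> tp h = SV d \<and> spells tp (h - 1) ds"
proof
  assume s: "spells tp h (d # ds)"
  have "tp (h - 1 - int j) = (if j < length ds then SV (ds ! j) else SB)" for j
    using s[unfolded spells_def, rule_format, of "Suc j"] by (simp add: algebra_simps)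
  moreover have "tp h = SV d" using s[unfolded spells_def, rule_format, of 0] by simp
  ultimately show "tp h = SV d \<and> spells tp (h - 1) ds" by (simp add: spells_def)
next
  assume s: "tp h = SV d \<and> spells tp (h - 1) ds"
  have "tp (h - int j) = (if j < length (d # ds) then SV ((d # ds) ! j) else SB)" for j
  proof (cases j)
    case (Suc k)
    have e: "h - int j = h - 1 - int k" using Suc by simp
    show ?thesis unfolding e using s Suc by (simp add: spells_def)
  qed (use s in simp)
  thus "spells tp h (d # ds)" by (simp add: spells_def)
qed

lemma spells_Nil: "spells tp h [] \<longleftrightarrow> tp h = SB \<and> spells tp (h - 1) []"
proof
  assume s: "spells tp h []"
  have "tp (h - 1 - int j) = SB" for j
    using s[unfolded spells_def, rule_format, of "Suc j"] by (simp add: algebra_simps)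
  thus "tp h = SB \<and> spells tp (h - 1) []" using s[unfolded spells_def, rule_format, of 0] by (simp add: spells_def)
next
  assume s: "tp h = SB \<and> spells tp (h - 1) []"
  have "tp (h - int j) = SB" for j
  proof (cases j)
    case (Suc k)
    have e: "h - int j = h - 1 - int k" using Suc by simp
    show ?thesis unfolding e using s Suc by (simp add: spells_def)
  qed (use s in simp)
  thus "spells tp h []" by (simp add: spells_def)
qed

lemma spells_cong: "spells tp h ds \<Longrightarrow> (\<And>x. x \<le> h \<Longrightarrow> tp' x = tp x) \<Longrightarrow> spells tp' h ds"
  by (simp add: spells_def)

lemma add_sweep:
  "spells tp h ds \<Longrightarrow> \<exists>tp'. (mstep ^^ (length (addl i s c ds) + 1)) (Add i s c, tp, h)
      = (Sh (nx i s) None, tp', h - int (length (addl i s c ds)) + 1)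
    \<and> spells tp' h (addl i s c ds) \<and> (\<forall>x>h. tp' x = tp x)"
proof (induction i s c ds arbitrary: tp h rule: addl.induct)
  case (1 i s c d ds)
  let ?x = "upd i s d c"
  have tp: "tp h = SV d" "spells tp (h - 1) ds" using 1(2) by (auto simp: spells_Cons)
  define tp1 where "tp1 = tp(h := SV (\<lambda>r. dig (?x r)))"
  have "spells tp1 (h - 1) ds" using tp(2) by (rule spells_cong) (simp add: tp1_def)
  from 1(1)[OF this] obtain tp' where tp':
    "(mstep ^^ (length (addl i s (\<lambda>r. car (?x r)) ds) + 1)) (Add i s (\<lambda>r. car (?x r)), tp1, h - 1)
      = (Sh (nx i s) None, tp', h - 1 - int (length (addl i s (\<lambda>r. car (?x r)) ds)) + 1)"
    "spells tp' (h - 1) (addl i s (\<lambda>r. car (?x r)) ds)" "\<forall>x>h - 1. tp' x = tp1 x" by blast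
  have "mstep (Add i s c, tp, h) = (Add i s (\<lambda>r. car (?x r)), tp1, h - 1)"
    by (simp add: astep_def tp tp1_def shift_def)
  hence "(mstep ^^ (length (addl i s c (d # ds)) + 1)) (Add i s c, tp, h)
      = (Sh (nx i s) None, tp', h - int (length (addl i s c (d # ds))) + 1)"
    using tp'(1) by (simp add: funpow_swap1 algebra_simps)
  moreover have "tp' h = SV (\<lambda>r. dig (?x r))" using tp'(3) by (simp add: tp1_def)
  hence "spells tp' h (addl i s c (d # ds))" using tp'(2) by (simp add: spells_Cons)
  moreover have "\<forall>x>h. tp' x = tp x" using tp'(3) by (simp add: tp1_def)
  ultimately show ?case by blast
next
  case (2 i s c)
  have tp: "tp h = SB" "spells tp (h - 1) []" using 2(2) spells_Nil by blast+
  show ?case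
  proof (cases "\<forall>r\<in>R. c r = 0")
    case True
    have e: "addl i s c [] = []" using True by (simp add: addl.simps(2))
    have "mstep (Add i s c, tp, h) = (Sh (nx i s) None, tp, h + 1)"
      using True tp(1) by (auto simp: astep_def shift_def)
    thus ?thesis using 2(2) unfolding e by (intro exI[of _ tp]) simp
  next
    case False
    define tp1 where "tp1 = tp(h := SV (\<lambda>r. dig (c r)))"
    have e: "addl i s c [] = (\<lambda>r. dig (c r)) # addl i s (\<lambda>r. car (c r)) []" unfolding addl.simps(2)[of i s c] using False by (rule if_not_P)
    have "spells tp1 (h - 1) []" using tp(2) by (rule spells_cong) (simp add: tp1_def)
    from 2(1)[OF False this] obtain tp' where tp':
      "(mstep ^^ (length (addl i s (\<lambda>r. car (c r)) []) + 1)) (Add i s (\<lambda>r. car (c r)), tp1, h - 1)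
        = (Sh (nx i s) None, tp', h - 1 - int (length (addl i s (\<lambda>r. car (c r)) [])) + 1)"
      "spells tp' (h - 1) (addl i s (\<lambda>r. car (c r)) [])" "\<forall>x>h - 1. tp' x = tp1 x" by blast
    have "tr (Add i s c) SB = (Add i s (\<lambda>r. car (c r)), SV (\<lambda>r. dig (c r)), MoveL)"
      unfolding tr.simps using False by (rule if_not_P)
    hence "mstep (Add i s c, tp, h) = (Add i s (\<lambda>r. car (c r)), tp1, h - 1)"
      by (simp add: astep_def tp tp1_def shift_def del: tr.simps)
    hence "(mstep ^^ (length (addl i s c []) + 1)) (Add i s c, tp, h)
        = (Sh (nx i s) None, tp', h - int (length (addl i s c [])) + 1)"
      using tp'(1) unfolding e by (simp add: funpow_swap1 algebra_simps)
    moreover have "tp' h = SV (\<lambda>r. dig (c r))" using tp'(3) by (simp add: tp1_def)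
    hence "spells tp' h (addl i s c [])" using tp'(2) unfolding e by (simp add: spells_Cons)
    moreover have "\<forall>x>h. tp' x = tp x" using tp'(3) by (simp add: tp1_def)
    ultimately show ?thesis by blast
  qed
qed

lemma shift_sweep:
  "(\<forall>j<length rs. tp (h + int j) = SV (rs ! j)) \<Longrightarrow> tp (h + int (length rs)) = SI a \<Longrightarrow>
    \<exists>tp'. (mstep ^^ (length rs + 1)) (Sh i (Some d), tp, h) = (Read i, tp', h + int (length rs) + 1)
      \<and> (\<forall>j\<le>length rs. tp' (h + int j) = SV ((d # rs) ! j))
      \<and> (\<forall>x. x < h \<or> x > h + int (length rs) \<longrightarrow> tp' x = tp x)"
proof (induction rs arbitrary: tp h d)
  case Nil
  hence "mstep (Sh i (Some d), tp, h) = (Read i, tp(h := SV d), h + 1)"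
    by (simp add: astep_def shift_def)
  thus ?case by (intro exI[of _ "tp(h := SV d)"]) (simp add: fun_upd_def)
next
  case (Cons r rs)
  define tp1 where "tp1 = tp(h := SV d)"
  have "tp h = SV r" using Cons.prems(1)[rule_format, of 0] by simp
  hence step: "mstep (Sh i (Some d), tp, h) = (Sh i (Some r), tp1, h + 1)"
    by (simp add: astep_def shift_def tp1_def)
  have "tp1 (h + 1 + int j) = SV (rs ! j)" if "j < length rs" for j
    using Cons.prems(1)[rule_format, of "Suc j"] that by (simp add: tp1_def add_ac)
  moreover have "tp1 (h + 1 + int (length rs)) = SI a" using Cons.prems(2) by (simp add: tp1_def add_ac)
  ultimately obtain tp' where tp':
    "(mstep ^^ (length rs + 1)) (Sh i (Some r), tp1, h + 1) = (Read i, tp', h + 1 + int (length rs) + 1)"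
    "\<forall>j\<le>length rs. tp' (h + 1 + int j) = SV ((r # rs) ! j)"
    "\<forall>x. x < h + 1 \<or> x > h + 1 + int (length rs) \<longrightarrow> tp' x = tp1 x"
    using Cons.IH[of tp1 "h + 1" r] by blast
  have "(mstep ^^ (length (r # rs) + 1)) (Sh i (Some d), tp, h) = (Read i, tp', h + int (length (r # rs)) + 1)"
    using tp'(1) step by (simp add: funpow_swap1 add_ac)
  moreover have "tp' (h + int j) = SV ((d # r # rs) ! j)" if "j \<le> length (r # rs)" for j
  proof (cases j)
    case 0
    thus ?thesis using tp'(3)[rule_format, of h] by (simp add: tp1_def)
  next
    case (Suc m)
    thus ?thesis using tp'(2)[rule_format, of m] that by (simp add: add_ac)
  qed
  moreover have "tp' x = tp x" if "x < h \<or> x > h + int (length (r # rs))" for x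
    using tp'(3)[rule_format, of x] that by (auto simp: tp1_def)
  ultimately show ?case by (intro exI[of _ tp']) blast
qed

lemma funpow_trans: "(f ^^ m) x = y \<Longrightarrow> (f ^^ n) y = z \<Longrightarrow> (f ^^ (m + n)) x = z"
  by (subst add.commute) (simp add: funpow_add)

text \<open>One step reads the letter, one more than the new block length goes into the additive
  sweep including the turn, and as many into the sweep back, whose last step overwrites the letter.
  This makes \<open>2 * l + 3\<close> for the new length \<open>l\<close>.\<close>

lemma letter_steps:
  assumes sp: "spells tp (k - 1) ds" and cell: "tp k = SI s"
  shows "\<exists>tp'. (mstep ^^ (2 * length (addl i s (bvec i s) ds) + 3)) (Read i, tp, k) = (Read (nx i s), tp', k + 1)
    \<and> spells tp' k (addl i s (bvec i s) ds) \<and> (\<forall>x>k. tp' x = tp x)"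
proof -
  define es where "es = addl i s (bvec i s) ds"
  define h where "h = k - int (length es)"
  have "tp(k := SI s) = tp" using cell by (metis fun_upd_triv)
  hence s1: "(mstep ^^ 1) (Read i, tp, k) = (Add i s (bvec i s), tp, k - 1)"
    using cell by (simp add: astep_def shift_def)
  obtain tp1 where tp1: "(mstep ^^ (length es + 1)) (Add i s (bvec i s), tp, k - 1) = (Sh (nx i s) None, tp1, h)"
    "spells tp1 (k - 1) es" "\<forall>x>k - 1. tp1 x = tp x"
    using add_sweep[OF sp, of i s "bvec i s"] unfolding es_def[symmetric] h_def by (auto simp: algebra_simps)
  have s2: "(mstep ^^ (length es + 2)) (Read i, tp, k) = (Sh (nx i s) None, tp1, h)"
    using funpow_trans[OF s1 tp1(1)] by simp
  have cell1: "tp1 k = SI s" using tp1(3) cell by simp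
  have "\<exists>tp'. (mstep ^^ (length es + 1)) (Sh (nx i s) None, tp1, h) = (Read (nx i s), tp', k + 1)
    \<and> spells tp' k es \<and> (\<forall>x>k. tp' x = tp1 x)"
  proof (cases "es = []")
    case True
    have "mstep (Sh (nx i s) None, tp1, k) = (Read (nx i s), tp1(k := SB), k + 1)"
      using cell1 by (simp add: astep_def shift_def)
    moreover have "spells (tp1(k := SB)) (k - 1) []"
      using tp1(2) unfolding True by (rule spells_cong) simp
    hence "spells (tp1(k := SB)) k []" by (subst spells_Nil) simp
    ultimately show ?thesis using True by (intro exI[of _ "tp1(k := SB)"]) (simp add: h_def)
  next
    case False
    then obtain d rs where rev: "rev es = d # rs" by (cases "rev es") auto
    have len: "length es = Suc (length rs)" using arg_cong[OF rev, of length] by simp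
    have nth: "es ! j = (d # rs) ! (length rs - j)" if "j < length es" for j
    proof -
      have "es ! j = rev (rev es) ! j" by simp
      also have "\<dots> = rev es ! (length es - Suc j)" using that by (subst rev_nth) auto
      finally show ?thesis by (simp add: rev len)
    qed
    have c1: "tp1 (h + int m) = SV ((d # rs) ! m)" if m: "m \<le> length rs" for m
    proof -
      have c0: "tp1 (k - 1 - int (length rs - m)) = SV (es ! (length rs - m))"
        using tp1(2)[unfolded spells_def, rule_format, of "length rs - m"] m by (simp add: len)
      have e: "k - 1 - int (length rs - m) = h + int m" using m by (simp add: h_def len)
      show ?thesis using c0[unfolded e] m nth[of "length rs - m"] len by simp
    qed
    define tp2 where "tp2 = tp1(h := SB)"
    have a1: "(mstep ^^ 1) (Sh (nx i s) None, tp1, h) = (Sh (nx i s) (Some d), tp2, h + 1)"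
      using c1[of 0] by (simp add: astep_def shift_def tp2_def)
    have "tp2 (h + 1 + int j) = SV (rs ! j)" if "j < length rs" for j
      using c1[of "Suc j"] that by (simp add: tp2_def add_ac)
    moreover have kh: "h + 1 + int (length rs) = k" by (simp add: h_def len)
    moreover have "tp2 k = SI s" using cell1 by (simp add: tp2_def h_def len)
    ultimately obtain tp3 where tp3: "(mstep ^^ (length rs + 1)) (Sh (nx i s) (Some d), tp2, h + 1) = (Read (nx i s), tp3, k + 1)"
      "\<forall>j\<le>length rs. tp3 (h + 1 + int j) = SV ((d # rs) ! j)" "\<forall>x. x < h + 1 \<or> x > k \<longrightarrow> tp3 x = tp2 x"
      using shift_sweep[of rs tp2 "h + 1" s "nx i s" d] by auto
    have "(mstep ^^ (length es + 1)) (Sh (nx i s) None, tp1, h) = (Read (nx i s), tp3, k + 1)"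
      using funpow_trans[OF a1 tp3(1)] by (simp add: len)
    moreover have "spells tp3 k es"
      unfolding spells_def
    proof
      fix j
      show "tp3 (k - int j) = (if j < length es then SV (es ! j) else SB)"
      proof (cases "j < length es")
        case True
        hence "k - int j = h + 1 + int (length rs - j)" by (simp add: h_def len)
        thus ?thesis using True tp3(2)[rule_format, of "length rs - j"] nth[OF True] by simp
      next
        case False
        have le: "k - int j \<le> h" using False by (simp add: h_def)
        hence e: "tp3 (k - int j) = tp2 (k - int j)" using tp3(3) by simp
        show ?thesis
        proof (cases "k - int j = h")
          case True
          thus ?thesis using False e by (simp add: tp2_def)
        next
          case ne: False
          hence j: "\<not> j - 1 < length es" "1 \<le> j" using le False len by (auto simp: h_def)
          hence "tp1 (k - 1 - int (j - 1)) = SB"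
            using tp1(2)[unfolded spells_def, rule_format, of "j - 1"] by (simp only: if_False)
          moreover have "k - 1 - int (j - 1) = k - int j" using j(2) by simp
          ultimately show ?thesis using e ne False by (simp add: tp2_def)
        qed
      qed
    qed
    moreover have "\<forall>x>k. tp3 x = tp1 x" using tp3(3) by (simp add: tp2_def h_def)
    ultimately show ?thesis by blast
  qed
  then obtain tp' where tp': "(mstep ^^ (length es + 1)) (Sh (nx i s) None, tp1, h) = (Read (nx i s), tp', k + 1)"
    "spells tp' k es" "\<forall>x>k. tp' x = tp1 x" by blast
  have "(mstep ^^ (2 * length es + 3)) (Read i, tp, k) = (Read (nx i s), tp', k + 1)"
    using funpow_trans[OF s2 tp'(1)] by (simp add: mult_2 numeral_3_eq_3)
  moreover have "\<forall>x>k. tp' x = tp x" using tp'(3) tp1(3) by simp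
  ultimately show ?thesis using tp'(2) unfolding es_def by blast
qed

definition digits :: "'a list \<Rightarrow> 'k \<times> ('r \<Rightarrow> int) list" where
  "digits w = foldl (\<lambda>(i, ds) s. (nx i s, addl i s (bvec i s) ds)) (i0, []) w"

lemma digits_snoc: "digits (w @ [s]) =
    (nx (fst (digits w)) s, addl (fst (digits w)) s (bvec (fst (digits w)) s) (snd (digits w)))"
  by (simp add: digits_def split_beta)

lemma regs_snoc: "regs (w @ [s]) =
    (nx (fst (regs w)) s, upd (fst (regs w)) s (snd (regs w)) (b (fst (regs w)) s))"
  by (simp add: regs_def rstep_def split_beta)

lemma regs_Nil: "regs [] = (i0, \<lambda>_. 0)"
  by (simp add: regs_def)

lemma digits_regs:
  "fst (digits w) = fst (regs w) \<and> set (snd (digits w)) \<subseteq> DV \<and> (\<forall>r\<in>R. val (snd (digits w)) r = snd (regs w) r)"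
proof (induction w rule: rev_induct)
  case Nil
  show ?case by (simp add: digits_def regs_Nil)
next
  case (snoc s w)
  have "val (snd (digits (w @ [s]))) r = snd (regs (w @ [s])) r" if r: "r \<in> R" for r
    using snoc r by (auto simp: digits_snoc regs_snoc val_addl upd_def bvec_def intro!: sum.cong)
  moreover have "set (snd (digits (w @ [s]))) \<subseteq> DV" by (simp add: digits_snoc addl_DV bvec_def)
  ultimately show ?case using snoc by (simp add: digits_snoc regs_snoc)
qed

text \<open>The block never shrinks, so its length was reached by an extension at some prefix, where
  a register had a nonzero leading digit. Hence a bound for the registers is required at all
  prefixes, not only at the end.\<close>

lemma digits_length:
  assumes "\<And>u v r. w = u @ v \<Longrightarrow> r \<in> R \<Longrightarrow> \<bar>snd (regs u) r\<bar> \<le> U"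
  shows "snd (digits w) = [] \<or> 3 ^ (length (snd (digits w)) - 1) \<le> 2 * U"
  using assms
proof (induction w rule: rev_induct)
  case Nil
  show ?case by (simp add: digits_def)
next
  case (snoc s w)
  let ?ds = "snd (digits (w @ [s]))"
  have IH: "snd (digits w) = [] \<or> 3 ^ (length (snd (digits w)) - 1) \<le> 2 * U"
    using snoc.prems by (intro snoc.IH) (metis append_assoc)
  show ?case
  proof (cases "?ds = []")
    case False
    have "length ?ds = length (snd (digits w)) \<or> (\<exists>r\<in>R. last ?ds r \<noteq> 0)"
      using addl_length by (auto simp: digits_snoc)
    thus ?thesis
    proof
      assume "length ?ds = length (snd (digits w))"
      thus ?thesis using IH False by (metis length_0_conv)
    next
      assume "\<exists>r\<in>R. last ?ds r \<noteq> 0"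
      then obtain r where r: "r \<in> R" "last ?ds r \<noteq> 0" by blast
      have "3 ^ (length ?ds - 1) + 1 \<le> 2 * \<bar>val ?ds r\<bar>"
        using val_lower[OF _ r(1) False r(2)] digits_regs[of "w @ [s]"] by blast
      moreover have "val ?ds r = snd (regs (w @ [s])) r" using digits_regs[of "w @ [s]"] r(1) by blast
      moreover have "\<bar>snd (regs (w @ [s])) r\<bar> \<le> U" using snoc.prems[of "w @ [s]" "[]"] r(1) by simp
      ultimately show ?thesis by linarith
    qed
  qed simp
qed

lemma word_steps:
  assumes "w = u @ v" and "\<forall>u' v'. u = u' @ v' \<longrightarrow> length (snd (digits u')) \<le> N"
  shows "\<exists>t tp. t \<le> length u * (2 * N + 3) \<and>
    (mstep ^^ t) (Read i0, atape w, 0) = (Read (fst (digits u)), tp, int (length u)) \<and>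
    spells tp (int (length u) - 1) (snd (digits u)) \<and> (\<forall>x\<ge>int (length u). tp x = atape w x)"
  using assms
proof (induction u arbitrary: v rule: rev_induct)
  case Nil
  have "spells (atape w) (- 1) []" by (simp add: spells_def atape_def)
  thus ?case by (intro exI[of _ 0] exI[of _ "atape w"]) (simp add: digits_def)
next
  case (snoc s u)
  have a: "w = u @ (s # v)" using snoc.prems(1) by simp
  have bd: "\<forall>u' v'. u = u' @ v' \<longrightarrow> length (snd (digits u')) \<le> N"
    using snoc.prems(2) by simp
  obtain t tp where t: "t \<le> length u * (2 * N + 3)"
    "(mstep ^^ t) (Read i0, atape w, 0) = (Read (fst (digits u)), tp, int (length u))"
    "spells tp (int (length u) - 1) (snd (digits u))" "\<forall>x\<ge>int (length u). tp x = atape w x"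
    using snoc.IH[OF a bd] by blast
  have "tp (int (length u)) = SI s" using t(4) snoc.prems(1) by (simp add: atape_def nth_append)
  from letter_steps[OF t(3) this, of "fst (digits u)"] obtain tp' where tp':
    "(mstep ^^ (2 * length (snd (digits (u @ [s]))) + 3)) (Read (fst (digits u)), tp, int (length u))
      = (Read (fst (digits (u @ [s]))), tp', int (length u) + 1)"
    "spells tp' (int (length u)) (snd (digits (u @ [s])))" "\<forall>x>int (length u). tp' x = tp x"
    by (auto simp: digits_snoc)
  have "length (snd (digits (u @ [s]))) \<le> N" using snoc.prems(2) by simp
  hence "t + (2 * length (snd (digits (u @ [s]))) + 3) \<le> length (u @ [s]) * (2 * N + 3)" using t(1) by simp
  moreover have "(mstep ^^ (t + (2 * length (snd (digits (u @ [s]))) + 3))) (Read i0, atape w, 0)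
      = (Read (fst (digits (u @ [s]))), tp', int (length (u @ [s])))"
    using funpow_trans[OF t(2) tp'(1)] by (simp add: add_ac)
  moreover have "\<forall>x\<ge>int (length (u @ [s])). tp' x = atape w x" using tp'(3) t(4) by simp
  moreover have "spells tp' (int (length (u @ [s])) - 1) (snd (digits (u @ [s])))" using tp'(2) by simp
  ultimately show ?case by blast
qed

lemma check_sweep:
  "spells tp h ds \<Longrightarrow> \<exists>t\<le>length ds + 1. fst ((mstep ^^ t) (Check, tp, h)) = (if \<forall>d\<in>set ds. \<forall>r\<in>R0. d r = 0 then QAcc else QRej)"
proof (induction ds arbitrary: h)
  case Nil
  hence "tp h = SB" using spells_Nil by blast
  hence "fst ((mstep ^^ 1) (Check, tp, h)) = QAcc" by (simp add: astep_def)
  thus ?case by (intro exI[of _ 1]) simp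
next
  case (Cons d ds)
  have c: "tp h = SV d" "spells tp (h - 1) ds" using Cons.prems by (auto simp: spells_Cons)
  have tp: "tp(h := SV d) = tp" using c(1) by (metis fun_upd_triv)
  show ?case
  proof (cases "\<forall>r\<in>R0. d r = 0")
    case True
    obtain t where t: "t \<le> length ds + 1"
      "fst ((mstep ^^ t) (Check, tp, h - 1)) = (if \<forall>d\<in>set ds. \<forall>r\<in>R0. d r = 0 then QAcc else QRej)"
      using Cons.IH[OF c(2)] by blast
    have "mstep (Check, tp, h) = (Check, tp, h - 1)" using True c(1) tp by (simp add: astep_def shift_def)
    thus ?thesis using t True by (intro exI[of _ "Suc t"]) (simp add: funpow_swap1)
  next
    case False
    have "tr Check (SV d) = (QRej, SV d, MoveL)" unfolding tr.simps using False by simp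
    hence "fst ((mstep ^^ 1) (Check, tp, h)) = QRej" using c(1) by (simp add: astep_def del: tr.simps)
    thus ?thesis using False by (intro exI[of _ 1]) auto
  qed
qed

lemma machine_run:
  assumes "w \<in> lists \<Sigma>" and N: "\<forall>u v. w = u @ v \<longrightarrow> length (snd (digits u)) \<le> N"
  shows "\<exists>t \<le> length w * (2 * N + 3) + N + 2.
    fst ((mstep ^^ t) (Read i0, atape w, 0)) = (if w \<in> accepted then QAcc else QRej)"
proof -
  obtain t tp where t: "t \<le> length w * (2 * N + 3)"
    "(mstep ^^ t) (Read i0, atape w, 0) = (Read (fst (digits w)), tp, int (length w))"
    "spells tp (int (length w) - 1) (snd (digits w))" "\<forall>x\<ge>int (length w). tp x = atape w x"
    using word_steps[of w w "[]" N] N by auto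
  have b: "tp (int (length w)) = SB" using t(4) by (simp add: atape_def)
  show ?thesis
  proof (cases "fst (digits w) \<in> Acc")
    case True
    have "tp(int (length w) := SB) = tp" using b by (metis fun_upd_triv)
    hence s1: "(mstep ^^ 1) (Read (fst (digits w)), tp, int (length w)) = (Check, tp, int (length w) - 1)"
      using b True by (simp add: astep_def shift_def)
    obtain t' where t': "t' \<le> length (snd (digits w)) + 1"
      "fst ((mstep ^^ t') (Check, tp, int (length w) - 1)) = (if \<forall>d\<in>set (snd (digits w)). \<forall>r\<in>R0. d r = 0 then QAcc else QRej)"
      using check_sweep[OF t(3)] by blast
    have "(\<forall>d\<in>set (snd (digits w)). \<forall>r\<in>R0. d r = 0) \<longleftrightarrow> (\<forall>r\<in>R0. snd (regs w) r = 0)"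
    proof -
      have "(\<forall>d\<in>set (snd (digits w)). d r = 0) \<longleftrightarrow> snd (regs w) r = 0" if "r \<in> R0" for r
      proof -
        have r: "r \<in> R" using that R0 by blast
        have "val (snd (digits w)) r = snd (regs w) r" using digits_regs[of w] r by blast
        moreover have "set (snd (digits w)) \<subseteq> DV" using digits_regs[of w] by blast
        ultimately show ?thesis using val_zero_iff[OF _ r] by metis
      qed
      thus ?thesis by blast
    qed
    hence acc: "(\<forall>d\<in>set (snd (digits w)). \<forall>r\<in>R0. d r = 0) \<longleftrightarrow> w \<in> accepted"
      using True digits_regs[of w] assms(1) by (simp add: accepted_def)
    have "(mstep ^^ (t + 1 + t')) (Read i0, atape w, 0) = (mstep ^^ t') (Check, tp, int (length w) - 1)"
      by (rule funpow_trans[OF funpow_trans[OF t(2) s1] refl])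
    hence "fst ((mstep ^^ (t + 1 + t')) (Read i0, atape w, 0)) = (if w \<in> accepted then QAcc else QRej)"
      using t'(2) by (simp only: acc)
    moreover have "t + 1 + t' \<le> length w * (2 * N + 3) + N + 2" using t(1) t'(1) N[rule_format, of w "[]"] by simp
    ultimately show ?thesis by blast
  next
    case False
    have "fst ((mstep ^^ 1) (Read (fst (digits w)), tp, int (length w))) = QRej"
      using b False by (simp add: astep_def)
    hence "fst ((mstep ^^ (t + 1)) (Read i0, atape w, 0)) = QRej" using funpow_trans[OF t(2) refl] by metis
    moreover have "w \<notin> accepted" using False digits_regs[of w] by (simp add: accepted_def)
    ultimately show ?thesis using t(1) by (intro exI[of _ "t + 1"]) auto
  qed
qed

section \<open>Finiteness of the control and the time bound\<close>

definition states :: "('k, 'a, 'r) mstate set" where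
  "states = Read ` I \<union> (\<lambda>(i, s, c). Add i s c) ` (I \<times> \<Sigma> \<times> CV) \<union>
     (\<lambda>(i, x). Sh i x) ` (I \<times> insert None (Some ` DV)) \<union> {Check, QAcc, QRej}"

lemma states_iff:
  "Read i \<in> states \<longleftrightarrow> i \<in> I" "Add i s c \<in> states \<longleftrightarrow> i \<in> I \<and> s \<in> \<Sigma> \<and> c \<in> CV"
  "Sh i x \<in> states \<longleftrightarrow> i \<in> I \<and> (x = None \<or> x \<in> Some ` DV)" "Check \<in> states" "QAcc \<in> states" "QRej \<in> states"
  by (auto simp: states_def image_iff)

lemma finite_DV: "finite DV"
  unfolding DV_def by (rule finite_set_of_finite_funs[OF fin(3)]) simp

lemma finite_states: "finite states"
proof -
  have "finite CV" unfolding CV_def by (rule finite_set_of_finite_funs[OF fin(3)]) simp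
  thus ?thesis using fin finite_DV by (auto simp: states_def)
qed

lemma coeff_bound:
  assumes "i \<in> I" "s \<in> \<Sigma>" "r \<in> R"
  shows "\<bar>b i s r\<bar> + (\<Sum>r'\<in>R. \<bar>A i s r r'\<bar>) \<le> bnd - 1"
proof -
  let ?f = "\<lambda>i s r. \<bar>b i s r\<bar> + (\<Sum>r'\<in>R. \<bar>A i s r r'\<bar>)"
  have f: "0 \<le> ?f i s r" for i s r by (intro add_nonneg_nonneg sum_nonneg) auto
  have "?f i s r \<le> (\<Sum>r\<in>R. ?f i s r)"
    by (rule member_le_sum[OF assms(3) f fin(3)])
  moreover have "(\<Sum>r\<in>R. ?f i s r) \<le> (\<Sum>s\<in>\<Sigma>. \<Sum>r\<in>R. ?f i s r)"
    by (rule member_le_sum[OF assms(2) _ fin(1)]) (intro sum_nonneg f)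
  moreover have "(\<Sum>s\<in>\<Sigma>. \<Sum>r\<in>R. ?f i s r) \<le> (\<Sum>i\<in>I. \<Sum>s\<in>\<Sigma>. \<Sum>r\<in>R. ?f i s r)"
    by (rule member_le_sum[OF assms(1) _ fin(2)]) (intro sum_nonneg f)
  ultimately show ?thesis unfolding bnd_def by linarith
qed

lemma bnd_pos: "1 \<le> bnd"
  unfolding bnd_def by (auto intro!: add_nonneg_nonneg sum_nonneg)

lemma bvec_CV: "i \<in> I \<Longrightarrow> s \<in> \<Sigma> \<Longrightarrow> bvec i s \<in> CV"
proof -
  assume i: "i \<in> I" "s \<in> \<Sigma>"
  have "\<bar>b i s r\<bar> \<le> bnd" if "r \<in> R" for r
  proof -
    have "0 \<le> (\<Sum>r'\<in>R. \<bar>A i s r r'\<bar>)" by (simp add: sum_nonneg)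
    thus ?thesis using coeff_bound[OF i that] by linarith
  qed
  hence "- bnd \<le> b i s r \<and> b i s r \<le> bnd" if "r \<in> R" for r using that by (simp add: abs_le_iff) (metis minus_le_iff)
  thus ?thesis by (simp add: CV_def bvec_def)
qed

lemma CV_iff: "c \<in> CV \<longleftrightarrow> (\<forall>r\<in>R. \<bar>c r\<bar> \<le> bnd) \<and> (\<forall>r. r \<notin> R \<longrightarrow> c r = 0)"
  by (auto simp: CV_def abs_le_iff)

lemma car_CV: "c \<in> CV \<Longrightarrow> (\<lambda>r. car (c r)) \<in> CV"
proof -
  assume c: "c \<in> CV"
  have "\<bar>car (c r)\<bar> \<le> bnd" if "r \<in> R" for r
  proof -
    have "\<bar>c r\<bar> \<le> bnd" using c that unfolding CV_iff by blast
    thus ?thesis using car_bound[of "c r"] bnd_pos by linarith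
  qed
  thus ?thesis using c by (simp add: CV_iff car_0)
qed

lemma car_upd_CV:
  assumes i: "i \<in> I" "s \<in> \<Sigma>" and c: "c \<in> CV" and d: "d \<in> DV"
  shows "(\<lambda>r. car (upd i s d c r)) \<in> CV"
proof -
  have "\<bar>car (upd i s d c r)\<bar> \<le> bnd" if r: "r \<in> R" for r
  proof -
    have dr: "\<bar>d r'\<bar> \<le> 1" if "r' \<in> R" for r'
    proof -
      have "d r' \<in> {-1, 0, 1}" using d that by (auto simp: DV_def)
      thus ?thesis by auto
    qed
    have "\<bar>\<Sum>r'\<in>R. A i s r r' * d r'\<bar> \<le> (\<Sum>r'\<in>R. \<bar>A i s r r' * d r'\<bar>)" by (rule sum_abs)
    moreover have "(\<Sum>r'\<in>R. \<bar>A i s r r' * d r'\<bar>) \<le> (\<Sum>r'\<in>R. \<bar>A i s r r'\<bar>)"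
      using dr by (intro sum_mono) (simp add: abs_mult mult_left_le)
    moreover have "(\<Sum>r'\<in>R. \<bar>A i s r r'\<bar>) \<le> bnd - 1" using coeff_bound[OF i r] by linarith
    moreover have "\<bar>c r\<bar> \<le> bnd" using c r unfolding CV_iff by blast
    moreover have "upd i s d c r = (\<Sum>r'\<in>R. A i s r r' * d r') + c r" using r by (simp add: upd_def)
    ultimately have "\<bar>upd i s d c r\<bar> \<le> 2 * bnd - 1" by linarith
    thus ?thesis using car_bound[of "upd i s d c r"] bnd_pos by linarith
  qed
  thus ?thesis by (simp add: CV_iff upd_def car_0)
qed

lemma tr_closed:
  assumes "p \<in> states" "x \<in> insert SB (SI ` \<Sigma> \<union> SV ` DV)" "tr p x = (p', y, m)"
  shows "p' \<in> states \<and> y \<in> insert SB (SI ` \<Sigma> \<union> SV ` DV)"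
proof -
  have dv: "c \<in> CV \<Longrightarrow> (\<lambda>r. dig (c r)) \<in> DV" "(\<lambda>r. dig (upd i s d c r)) \<in> DV" for c i s d
    by (rule dig_vec_DV; simp add: CV_def upd_def)+
  consider "x = SB" | s where "x = SI s" "s \<in> \<Sigma>" | d where "x = SV d" "d \<in> DV" using assms(2) by blast
  thus ?thesis
  proof cases
    case 1
    thus ?thesis using assms(1,3) dv car_CV nx
      by (cases p) (auto simp: states_iff split: if_splits option.splits)
  next
    case 2
    thus ?thesis using assms(1,3) dv car_CV nx bvec_CV
      by (cases p) (auto simp: states_iff split: if_splits option.splits)
  next
    case 3
    thus ?thesis using assms(1,3) dv car_upd_CV nx
      by (cases p) (auto simp: states_iff split: if_splits option.splits)
  qed
qed

text \<open>Polynomially bounded registers have O(log n) digits, and each letter costs two sweeps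
  over the block.\<close>

theorem accepted_DTIME1:
  assumes bound: "\<And>w r. w \<in> lists \<Sigma> \<Longrightarrow> r \<in> R \<Longrightarrow> \<bar>snd (regs w) r\<bar> \<le> int (C * (length w + 1) ^ D)"
  shows "accepted \<in> DTIME1 \<Sigma> nlogn"
proof -
  have q: "Read i0 \<in> states" "QAcc \<in> states" "QRej \<in> states" "(QAcc :: ('k, 'a, 'r) mstate) \<noteq> QRej"
    using i0 by (simp_all add: states_iff)
  obtain M where M: "wf_tm \<Sigma> M" "\<forall>w\<in>lists \<Sigma>. \<forall>t.
    (halted M (run M t w) \<longleftrightarrow> fst ((mstep ^^ t) (Read i0, atape w, 0)) \<in> {QAcc, QRej}) \<and>
    (fst (run M t w) = q_acc M \<longleftrightarrow> fst ((mstep ^^ t) (Read i0, atape w, 0)) = QAcc)"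
    by (rule encode_machine[OF fin(1) finite_states finite_DV q tr_closed])
  \<comment> \<open>One unit pays for the factor 2 in \<open>digits_length\<close>, the other for
    the difference between the block length and the exponent of its leading digit.
    \<open>C + 1\<close> makes the argument of the logarithm positive.\<close>
  define K0 where "K0 = 2 + log 2 (real (C + 1))"
  define K where "K = K0 + 2 * real D"
  have K0: "0 \<le> K0" by (simp add: K0_def)
  have "\<exists>t. real t \<le> (3 * K + 5) * nlogn (length w) + (3 * K + 5) \<and> halted M (run M t w) \<and>
    (fst (run M t w) = q_acc M \<longleftrightarrow> w \<in> accepted)" if w: "w \<in> lists \<Sigma>" for w
  proof -
    define n where "n = length w"
    define B where "B = K0 + real D * log 2 (real (n + 1))"
    have B0: "0 \<le> B" using K0 by (simp add: B_def)
    define N where "N = nat \<lfloor>B\<rfloor>"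
    have len: "\<forall>u v. w = u @ v \<longrightarrow> length (snd (digits u)) \<le> N"
    proof (intro allI impI)
      fix u v assume u: "w = u @ v"
      show "length (snd (digits u)) \<le> N"
      proof (cases "snd (digits u) = []")
        case False
        define l where "l = length (snd (digits u)) - 1"
        have "\<bar>snd (regs u') r\<bar> \<le> int ((C + 1) * (n + 1) ^ D)" if "u = u' @ v'" "r \<in> R" for u' v' r
        proof -
          have "u' \<in> lists \<Sigma>" "length u' \<le> n" using w u that by (auto simp: n_def)
          hence "\<bar>snd (regs u') r\<bar> \<le> int (C * (length u' + 1) ^ D)" by (intro bound that(2))
          moreover have "int (C * (length u' + 1) ^ D) \<le> int ((C + 1) * (n + 1) ^ D)"
            unfolding of_nat_le_iff using \<open>length u' \<le> n\<close> by (intro mult_mono power_mono) auto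
          ultimately show ?thesis by linarith
        qed
        hence "3 ^ l \<le> 2 * int ((C + 1) * (n + 1) ^ D)" using digits_length[of u] False unfolding l_def by blast
        moreover have "(2::int) ^ l \<le> 3 ^ l" by (rule power_mono) auto
        ultimately have "(2::int) ^ l \<le> 2 * int ((C + 1) * (n + 1) ^ D)" by linarith
        hence "real_of_int (2 ^ l) \<le> real_of_int (2 * int ((C + 1) * (n + 1) ^ D))" by (simp only: of_int_le_iff)
        hence "2 ^ l \<le> 2 * (real (C + 1) * real (n + 1) ^ D)" by (simp add: algebra_simps)
        hence "log 2 (2 ^ l) \<le> log 2 (2 * (real (C + 1) * real (n + 1) ^ D))"
          by (subst log_le_cancel_iff) (auto intro!: mult_pos_pos zero_less_power)
        also have "\<dots> = 1 + (log 2 (real (C + 1)) + real D * log 2 (real (n + 1)))"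
        proof -
          have "0 < real (C + 1)" "0 < real (n + 1)" by simp_all
          thus ?thesis by (simp add: log_mult log_nat_power del: of_nat_add of_nat_Suc Num.add_2_eq_Suc' add_Suc_right Suc_eq_plus1[symmetric])
        qed
        finally have "real l + 1 \<le> B" by (simp add: B_def K0_def log_nat_power)
        moreover have "length (snd (digits u)) = l + 1" using False by (cases "snd (digits u)") (auto simp: l_def)
        ultimately show ?thesis unfolding N_def by (simp add: le_nat_iff le_floor_iff)
      qed simp
    qed
    obtain t where t: "t \<le> n * (2 * N + 3) + N + 2"
      "fst ((mstep ^^ t) (Read i0, atape w, 0)) = (if w \<in> accepted then QAcc else QRej)"
      using machine_run[OF w len] unfolding n_def by blast
    have NB: "real N \<le> B" using B0 by (simp add: N_def)
    have "real t \<le> real (n * (2 * N + 3) + N + 2)" using t(1) by (simp only: of_nat_le_iff)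
    also have "\<dots> = real n * (2 * real N + 3) + real N + 2" by simp
    also have "\<dots> \<le> real n * (2 * B + 3) + B + 2"
      using NB by (intro add_mono mult_left_mono) auto
    also have "\<dots> \<le> (3 * K + 5) * nlogn n + (3 * K + 5)"
    \<comment> \<open>For these lengths \<open>nlogn\<close> vanishes and the additive constant has
      to cover the running time.\<close>
    proof (cases "n \<le> 1")
      case True
      hence n: "n = 0 \<or> n = 1" by auto
      have "B \<le> K0 + real D" using n by (auto simp: B_def)
      hence "B \<le> K" by (simp add: K_def)
      thus ?thesis using n B0 by (auto simp: nlogn_def)
    next
      case False
      define l where "l = log 2 (real n)"
      have l1: "1 \<le> l" using False by (simp add: l_def one_le_log_cancel_iff)
      have "log 2 (real (n + 1)) \<le> log 2 (real n ^ 2)"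
      proof -
        have "n + 1 \<le> n * 2" "n * 2 \<le> n * n" using False by auto
        hence "n + 1 \<le> n ^ 2" unfolding power2_eq_square by linarith
        hence "real (n + 1) \<le> real n ^ 2" by (metis of_nat_le_iff of_nat_power)
        thus ?thesis using False by (subst log_le_cancel_iff) auto
      qed
      also have "\<dots> = 2 * l" using False by (simp add: log_nat_power l_def)
      finally have "real D * log 2 (real (n + 1)) \<le> real D * (2 * l)" by (intro mult_left_mono) auto
      hence "B \<le> K0 * l + 2 * real D * l" using mult_left_mono[OF l1 K0] by (simp add: B_def)
      hence B: "B \<le> K * l" by (simp add: K_def algebra_simps)
      have K: "0 \<le> K" using K0 by (simp add: K_def)
      have n1: "1 \<le> real n" using False by simp
      have nl: "real n * 1 \<le> real n * l" by (rule mult_left_mono[OF l1]) simp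
      have "B \<le> real n * B" using mult_right_mono[OF n1 B0] by simp
      moreover have "real n * B \<le> real n * (K * l)" using B by (intro mult_left_mono) auto
      moreover have "real n * (2 * B + 3) = 2 * (real n * B) + 3 * real n" by (simp add: algebra_simps)
      ultimately have "real n * (2 * B + 3) + B + 2 \<le> 3 * (real n * (K * l)) + 5 * (real n * l)"
        using nl n1 by linarith
      also have "\<dots> = (3 * K + 5) * nlogn n" by (simp add: nlogn_def l_def algebra_simps)
      finally show ?thesis using K by linarith
    qed
    finally have "real t \<le> (3 * K + 5) * nlogn (length w) + (3 * K + 5)" by (simp add: n_def)
    moreover have "halted M (run M t w)" "fst (run M t w) = q_acc M \<longleftrightarrow> w \<in> accepted"
      using M(2)[rule_format, OF w, of t] t(2) by auto
    ultimately show ?thesis by blast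
  qed
  hence "decides_in_time \<Sigma> M accepted (\<lambda>n. (3 * K + 5) * nlogn n + (3 * K + 5))"
    unfolding decides_in_time_def by blast
  moreover have "accepted \<subseteq> lists \<Sigma>" by (auto simp: accepted_def)
  ultimately show ?thesis using M(1) unfolding DTIME1_def by blast
qed

end

section \<open>Word problems of groups separated by polynomials\<close>

text \<open>Read as a rule for \<open>x * g\<close>, the recursion says that the value for
  \<open>u\<close> grows by the value for \<open>g # u\<close>: a linear update among differences,
  with no polynomial ever evaluated by the machine.\<close>

fun iterated_diff :: "('a::grp \<Rightarrow> int) \<Rightarrow> 'a list \<Rightarrow> 'a \<Rightarrow> int" where
  "iterated_diff f [] = f"
| "iterated_diff f (g # u) = (\<lambda>x. iterated_diff f u (x * g) - iterated_diff f u x)"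

lemma pol_iterated_diff: "pol k H f \<Longrightarrow> u \<in> lists H \<Longrightarrow> length u \<le> k \<Longrightarrow> pol (k - length u) H (iterated_diff f u)"
proof (induction u)
  case (Cons g u)
  have "k - length u = Suc (k - length (g # u))" using Cons.prems by simp
  hence "pol (Suc (k - length (g # u))) H (iterated_diff f u)" using Cons by simp
  thus ?case using Cons.prems by simp
qed simp

text \<open>\<open>\<rho>\<close> selects representatives for the cosets of \<open>L\<close>. The
  value of a word is factored as \<open>h * r\<close> with \<open>h\<close> in \<open>L\<close>; the
  representative \<open>r\<close> is the control state of the machine, and the registers hold
  iterated differences at \<open>h\<close>.\<close>

locale separated_words =
  fixes S :: "'s set" and \<phi> :: "'s \<Rightarrow> 'a::grp" and \<Gamma> L :: "'a set" and \<rho> :: "'a \<Rightarrow> 'a"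
    and F :: "('a \<Rightarrow> int) set" and k :: nat
  assumes fin_S: "finite S" and \<phi>: "\<And>s. s \<in> S \<Longrightarrow> \<phi> s \<in> \<Gamma>" and sub: "subgrp \<Gamma>" "subgrp L" "L \<subseteq> \<Gamma>"
    and \<rho>: "\<And>x. x \<in> \<Gamma> \<Longrightarrow> \<rho> x \<in> \<Gamma>" "\<And>x. x \<in> \<Gamma> \<Longrightarrow> x * inverse (\<rho> x) \<in> L"
      "\<And>x. x \<in> \<Gamma> \<Longrightarrow> \<rho> x \<in> L \<Longrightarrow> \<rho> x = 1"
    and fin_\<rho>: "finite (\<rho> ` \<Gamma>)" and fin_F: "finite F" and pol_F: "\<And>f. f \<in> F \<Longrightarrow> pol k L f" and k: "0 < k"
    and sep: "\<And>x. x \<in> L \<Longrightarrow> (\<And>f. f \<in> F \<Longrightarrow> f x = f 1) \<Longrightarrow> x = 1"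
begin

definition inc :: "'a \<Rightarrow> 's \<Rightarrow> 'a" where
  "inc r s = r * \<phi> s * inverse (\<rho> (r * \<phi> s))"

definition Hs :: "'a set" where
  "Hs = (\<lambda>(r, s). inc r s) ` (\<rho> ` \<Gamma> \<times> S)"

definition coords :: "(('a \<Rightarrow> int) \<times> 'a list) set" where
  "coords = F \<times> {u. set u \<subseteq> Hs \<and> length u < k}"

definition coef :: "'a \<Rightarrow> 's \<Rightarrow> ('a \<Rightarrow> int) \<times> 'a list \<Rightarrow> ('a \<Rightarrow> int) \<times> 'a list \<Rightarrow> int" where
  "coef r s p q = (if q = p then 1 else 0) + (if q = (fst p, inc r s # snd p) then 1 else 0)"

text \<open>Registers store differences minus their values at 1, so that they start at zero. The
  update by the register for \<open>inc r s # snd p\<close> then lacks its value at 1, which is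
  supplied here.\<close>

definition const :: "'a \<Rightarrow> 's \<Rightarrow> ('a \<Rightarrow> int) \<times> 'a list \<Rightarrow> int" where
  "const r s p = iterated_diff (fst p) (inc r s # snd p) 1"

definition factor :: "'s list \<Rightarrow> 'a \<times> 'a" where
  "factor w = foldl (\<lambda>(h, r) s. (h * inc r s, \<rho> (r * \<phi> s))) (1, 1) w"

lemma factor_snoc:
  "factor (w @ [s]) = (fst (factor w) * inc (snd (factor w)) s, \<rho> (snd (factor w) * \<phi> s))"
  by (simp add: factor_def split_beta)

lemma factor_Nil: "factor [] = (1, 1)"
  by (simp add: factor_def)

lemma rho_one: "\<rho> 1 = 1"
proof -
  have "inverse (\<rho> 1) \<in> L" using \<rho>(2)[of 1] sub by (simp add: subgrp_mem)
  hence "\<rho> 1 \<in> L" using subgrp_inv[OF sub(2)] by (metis grp_inv_inv)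
  thus ?thesis using \<rho>(3)[of 1] sub by (simp add: subgrp_mem)
qed

lemma one_reps: "1 \<in> \<rho> ` \<Gamma>"
  by (rule image_eqI[of _ _ 1]) (simp_all add: rho_one subgrp_one sub)

lemma reps_mult: "r \<in> \<rho> ` \<Gamma> \<Longrightarrow> s \<in> S \<Longrightarrow> r * \<phi> s \<in> \<Gamma>"
  using \<rho>(1) \<phi> sub by (auto simp: subgrp_mult)

lemma inc_L: "r \<in> \<rho> ` \<Gamma> \<Longrightarrow> s \<in> S \<Longrightarrow> inc r s \<in> L"
  unfolding inc_def by (rule \<rho>(2)[OF reps_mult])

lemma inc_Hs: "r \<in> \<rho> ` \<Gamma> \<Longrightarrow> s \<in> S \<Longrightarrow> inc r s \<in> Hs"
  unfolding Hs_def by (rule image_eqI[of _ _ "(r, s)"]) auto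

lemma Hs: "finite Hs" "Hs \<subseteq> L"
  using fin_S fin_\<rho> inc_L by (auto simp: Hs_def)

lemma factor:
  "w \<in> lists S \<Longrightarrow> fst (factor w) \<in> L \<and> snd (factor w) \<in> \<rho> ` \<Gamma> \<and> fst (factor w) * snd (factor w) = prod_list (map \<phi> w)"
proof (induction w rule: rev_induct)
  case Nil
  show ?case using one_reps sub by (simp add: factor_Nil subgrp_one)
next
  case (snoc s w)
  hence w: "w \<in> lists S" "s \<in> S" by auto
  note IH = snoc.IH[OF w(1)]
  have "fst (factor (w @ [s])) \<in> L" using IH inc_L[of "snd (factor w)" s] w sub by (simp add: factor_snoc subgrp_mult)
  moreover have "snd (factor (w @ [s])) \<in> \<rho> ` \<Gamma>" using IH reps_mult[of "snd (factor w)" s] w by (simp add: factor_snoc)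
  moreover have "fst (factor (w @ [s])) * snd (factor (w @ [s])) = fst (factor w) * snd (factor w) * \<phi> s"
    by (simp add: factor_snoc inc_def grp_simps)
  ultimately show ?case using IH by simp
qed

lemma finite_coords: "finite coords"
proof -
  have "finite {u. set u \<subseteq> Hs \<and> length u \<le> k}" by (rule finite_lists_length_le[OF Hs(1)])
  hence "finite {u. set u \<subseteq> Hs \<and> length u < k}" by (rule finite_subset[rotated]) auto
  thus ?thesis using fin_F by (simp add: coords_def)
qed

sublocale rm: register_machine S "\<rho> ` \<Gamma>" coords "\<lambda>r s. \<rho> (r * \<phi> s)" coef const 1 "{1}" "F \<times> {[]}"
proof
  show "F \<times> {[]} \<subseteq> coords" using k by (auto simp: coords_def)
qed (use fin_S fin_\<rho> finite_coords one_reps reps_mult in auto)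

lemma top_diff_zero:
  assumes "f \<in> F" "set u \<subseteq> Hs" "length u = k" "x \<in> L"
  shows "iterated_diff f u x = 0"
proof -
  have "u \<in> lists L" using assms(2) Hs by auto
  from pol_iterated_diff[OF pol_F[OF assms(1)] this] show ?thesis using assms by simp
qed

lemma regs_eq: "w \<in> lists S \<Longrightarrow> fst (rm.regs w) = snd (factor w) \<and>
    (\<forall>f u. (f, u) \<in> coords \<longrightarrow> snd (rm.regs w) (f, u) = iterated_diff f u (fst (factor w)) - iterated_diff f u 1)"
proof (induction w rule: rev_induct)
  case Nil
  show ?case by (simp add: rm.regs_Nil factor_Nil)
next
  case (snoc s w)
  hence w: "w \<in> lists S" "s \<in> S" by auto
  define h r g where "h = fst (factor w)" and "r = snd (factor w)" and "g = inc r s"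
  define d where "d = snd (rm.regs w)"
  note IH = snoc.IH[OF w(1)]
  have h: "h \<in> L" and r: "r \<in> \<rho> ` \<Gamma>" using factor[OF w(1)] by (simp_all add: h_def r_def)
  have g: "g \<in> Hs" "g \<in> L" using inc_Hs[OF r w(2)] inc_L[OF r w(2)] by (simp_all add: g_def)
  have "snd (rm.regs (w @ [s])) (f, u) = iterated_diff f u (h * g) - iterated_diff f u 1" if fu: "(f, u) \<in> coords" for f u
  proof -
    have f: "f \<in> F" "set u \<subseteq> Hs" "length u < k" using fu by (auto simp: coords_def)
    have "(\<Sum>q\<in>coords. coef r s (f, u) q * d q) = (\<Sum>q\<in>coords. (if q = (f, u) then d q else 0) + (if q = (f, g # u) then d q else 0))"
      by (intro sum.cong refl) (simp add: coef_def g_def distrib_right)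
    also have "\<dots> = d (f, u) + (if (f, g # u) \<in> coords then d (f, g # u) else 0)"
      using fu by (simp add: sum.distrib finite_coords)
    also have "(if (f, g # u) \<in> coords then d (f, g # u) else 0) = iterated_diff f (g # u) h - iterated_diff f (g # u) 1"
    proof (cases "Suc (length u) < k")
      case True
      hence "(f, g # u) \<in> coords" using f g by (simp add: coords_def)
      moreover from this have "d (f, g # u) = iterated_diff f (g # u) h - iterated_diff f (g # u) 1"
        using IH unfolding d_def h_def by blast
      ultimately show ?thesis by simp
    next
      case False
      \<comment> \<open>A difference along \<open>k\<close> elements has no register, but it
        vanishes on \<open>L\<close> because the degree is less than \<open>k\<close>.\<close>
      hence len: "length (g # u) = k" using f by simp
      hence "(f, g # u) \<notin> coords" by (simp add: coords_def)
      moreover have "iterated_diff f (g # u) x = 0" if "x \<in> L" for x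
        using f g by (intro top_diff_zero[OF f(1) _ len that]) simp
      hence "iterated_diff f (g # u) h = 0" "iterated_diff f (g # u) 1 = 0" using h subgrp_one[OF sub(2)] by blast+
      ultimately show ?thesis by (simp only: if_False diff_self)
    qed
    also have "d (f, u) = iterated_diff f u h - iterated_diff f u 1" using IH fu unfolding d_def h_def by blast
    finally have "(\<Sum>q\<in>coords. coef r s (f, u) q * d q) + const r s (f, u) = iterated_diff f u (h * g) - iterated_diff f u 1"
      by (simp add: const_def g_def)
    moreover have "fst (rm.regs w) = r" using IH by (simp add: r_def)
    ultimately show ?thesis using fu by (simp add: rm.regs_snoc rm.upd_def d_def)
  qed
  moreover have "factor (w @ [s]) = (h * g, \<rho> (r * \<phi> s))" by (simp add: factor_snoc h_def r_def g_def)
  moreover have "fst (rm.regs (w @ [s])) = \<rho> (r * \<phi> s)" using IH by (simp add: rm.regs_snoc r_def)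
  ultimately show ?case by simp
qed

text \<open>Downward induction on the order of the difference: differences of order \<open>k\<close>
  vanish, and the value for \<open>u\<close> along a word is the sum of the values for
  \<open>g # u\<close> at its prefixes, which raises the exponent of the bound by one.\<close>

lemma diff_growth:
  "f \<in> F \<Longrightarrow> set u \<subseteq> Hs \<Longrightarrow> length u + j = k \<Longrightarrow>
    \<exists>C\<ge>0. \<forall>w\<in>lists S. \<bar>iterated_diff f u (fst (factor w))\<bar> \<le> C * int (length w + 1) ^ j"
proof (induction j arbitrary: u)
  case 0
  hence "iterated_diff f u (fst (factor w)) = 0" if "w \<in> lists S" for w
    using top_diff_zero[of f u] factor[OF that] by simp
  thus ?case by (intro exI[of _ 0]) simp
next
  case (Suc j)
  have "\<exists>C\<ge>0. \<forall>w\<in>lists S. \<bar>iterated_diff f (g # u) (fst (factor w))\<bar> \<le> C * int (length w + 1) ^ j" if "g \<in> Hs" for g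
    using Suc.prems that by (intro Suc.IH) auto
  then obtain Cg where Cg: "\<And>g. g \<in> Hs \<Longrightarrow> 0 \<le> Cg g"
    "\<And>g w. g \<in> Hs \<Longrightarrow> w \<in> lists S \<Longrightarrow> \<bar>iterated_diff f (g # u) (fst (factor w))\<bar> \<le> Cg g * int (length w + 1) ^ j"
    by metis
  define C where "C = (\<Sum>g\<in>Hs. Cg g)"
  have C0: "0 \<le> C" unfolding C_def by (intro sum_nonneg Cg)
  define c0 where "c0 = \<bar>iterated_diff f u 1\<bar>"
  have "\<bar>iterated_diff f u (fst (factor w))\<bar> \<le> c0 + C * int (length w) * int (length w + 1) ^ j" if "w \<in> lists S" for w
    using that
  proof (induction w rule: rev_induct)
    case Nil
    show ?case by (simp add: factor_Nil c0_def)
  next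
    case (snoc s w)
    hence w: "w \<in> lists S" "s \<in> S" by auto
    define h g n where "h = fst (factor w)" and "g = inc (snd (factor w)) s" and "n = int (length w)"
    have n0: "0 \<le> n" by (simp add: n_def)
    have g: "g \<in> Hs" unfolding g_def using factor[OF w(1)] w(2) by (intro inc_Hs) auto
    have 1: "\<bar>iterated_diff f (g # u) h\<bar> \<le> Cg g * (n + 1) ^ j" using Cg(2)[OF g w(1)] by (simp add: h_def n_def add_ac)
    have "Cg g \<le> C" unfolding C_def by (rule member_le_sum[OF g _ Hs(1)]) (use Cg(1) in auto)
    hence 2: "Cg g * (n + 1) ^ j \<le> C * (n + 1) ^ j" using n0 by (intro mult_right_mono) auto
    have 3: "\<bar>iterated_diff f u h\<bar> \<le> c0 + C * n * (n + 1) ^ j"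
      using snoc.IH[OF w(1)] by (simp add: h_def n_def add_ac)
    have "C * (n + 1) * (n + 1) ^ j \<le> C * (n + 1) * (n + 2) ^ j"
      using C0 n0 by (intro mult_left_mono power_mono) auto
    hence 4: "C * n * (n + 1) ^ j + C * (n + 1) ^ j \<le> C * (n + 1) * (n + 2) ^ j"
      by (simp add: algebra_simps)
    have "iterated_diff f u (h * g) = iterated_diff f u h + iterated_diff f (g # u) h" by simp
    hence "\<bar>iterated_diff f u (h * g)\<bar> \<le> c0 + C * (n + 1) * (n + 2) ^ j" using 1 2 3 4 by linarith
    moreover have "fst (factor (w @ [s])) = h * g" by (simp add: factor_snoc h_def g_def)
    ultimately show ?case by (simp add: n_def add_ac)
  qed
  moreover have "c0 + C * int n * int (n + 1) ^ j \<le> (c0 + C) * int (n + 1) ^ Suc j" for n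
  proof -
    have "1 \<le> int (n + 1) ^ Suc j" by (rule one_le_power) simp
    hence "c0 * 1 \<le> c0 * int (n + 1) ^ Suc j" by (intro mult_left_mono) (auto simp: c0_def)
    moreover have "C * int n * int (n + 1) ^ j \<le> C * int (n + 1) * int (n + 1) ^ j"
      using C0 by (intro mult_right_mono mult_left_mono) auto
    ultimately show ?thesis by (simp add: distrib_right mult.assoc)
  qed
  ultimately have "\<forall>w\<in>lists S. \<bar>iterated_diff f u (fst (factor w))\<bar> \<le> (c0 + C) * int (length w + 1) ^ Suc j"
    by (meson order.trans)
  moreover have "0 \<le> c0 + C" using C0 by (simp add: c0_def)
  ultimately show ?case by blast
qed

lemma regs_bound:
  "\<exists>C. \<forall>w\<in>lists S. \<forall>p\<in>coords. \<bar>snd (rm.regs w) p\<bar> \<le> int (C * (length w + 1) ^ k)"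
proof -
  have "\<exists>C\<ge>0. \<forall>w\<in>lists S. \<bar>snd (rm.regs w) p\<bar> \<le> C * int (length w + 1) ^ k" if p: "p \<in> coords" for p
  proof -
    obtain f u where fu: "p = (f, u)" "f \<in> F" "set u \<subseteq> Hs" "length u < k" using p by (auto simp: coords_def)
    obtain C where C: "0 \<le> C" "\<forall>w\<in>lists S. \<bar>iterated_diff f u (fst (factor w))\<bar> \<le> C * int (length w + 1) ^ (k - length u)"
      using diff_growth[OF fu(2,3), of "k - length u"] fu(4) by auto
    have "\<bar>snd (rm.regs w) p\<bar> \<le> (2 * C) * int (length w + 1) ^ k" if w: "w \<in> lists S" for w
    proof -
      have m: "int (length w + 1) ^ (k - length u) \<le> int (length w + 1) ^ k" by (rule power_increasing) auto
      have m1: "1 \<le> int (length w + 1) ^ k" by (rule one_le_power) simp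
      have "\<bar>iterated_diff f u (fst (factor w))\<bar> \<le> C * int (length w + 1) ^ k"
        by (rule order.trans[OF C(2)[rule_format, OF w] mult_left_mono[OF m C(1)]])
      moreover have "\<bar>iterated_diff f u 1\<bar> \<le> C * int (length w + 1) ^ k"
      proof -
        have "\<bar>iterated_diff f u 1\<bar> \<le> C" using C(2)[rule_format, of "[]"] by (simp add: factor_Nil)
        thus ?thesis using mult_left_mono[OF m1 C(1)] by linarith
      qed
      moreover have "snd (rm.regs w) p = iterated_diff f u (fst (factor w)) - iterated_diff f u 1"
        using regs_eq[OF w] p unfolding fu(1) by blast
      ultimately have "\<bar>snd (rm.regs w) p\<bar> \<le> 2 * (C * int (length w + 1) ^ k)" by linarith
      thus ?thesis by (simp add: mult.assoc)
    qed
    thus ?thesis using C(1) by (intro exI[of _ "2 * C"]) auto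
  qed
  then obtain Cp where Cp: "\<And>p. p \<in> coords \<Longrightarrow> 0 \<le> Cp p"
    "\<And>p w. p \<in> coords \<Longrightarrow> w \<in> lists S \<Longrightarrow> \<bar>snd (rm.regs w) p\<bar> \<le> Cp p * int (length w + 1) ^ k"
    by metis
  show ?thesis
  proof (intro exI[of _ "nat (\<Sum>p\<in>coords. Cp p)"] ballI)
    fix w p assume w: "w \<in> lists S" and p: "p \<in> coords"
    have "Cp p \<le> (\<Sum>p\<in>coords. Cp p)" by (rule member_le_sum[OF p _ finite_coords]) (use Cp in auto)
    hence "Cp p * int (length w + 1) ^ k \<le> (\<Sum>p\<in>coords. Cp p) * int (length w + 1) ^ k"
      by (intro mult_right_mono) auto
    hence "\<bar>snd (rm.regs w) p\<bar> \<le> (\<Sum>p\<in>coords. Cp p) * int (length w + 1) ^ k"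
      using Cp(2)[OF p w] by linarith
    moreover have "0 \<le> (\<Sum>p\<in>coords. Cp p)" by (intro sum_nonneg Cp)
    ultimately show "\<bar>snd (rm.regs w) p\<bar> \<le> int (nat (\<Sum>p\<in>coords. Cp p) * (length w + 1) ^ k)" by simp
  qed
qed

lemma words_DTIME1: "{w \<in> lists S. prod_list (map \<phi> w) = 1} \<in> DTIME1 S nlogn"
proof -
  have "w \<in> rm.accepted \<longleftrightarrow> prod_list (map \<phi> w) = 1" if w: "w \<in> lists S" for w
  proof -
    define h r where "h = fst (factor w)" and "r = snd (factor w)"
    have hr: "h \<in> L" "r \<in> \<rho> ` \<Gamma>" "h * r = prod_list (map \<phi> w)" using factor[OF w] by (auto simp: h_def r_def)
    have "(\<forall>f\<in>F. snd (rm.regs w) (f, []) = 0) \<longleftrightarrow> (\<forall>f\<in>F. f h = f 1)"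
      using regs_eq[OF w] k by (auto simp: coords_def h_def)
    also have "\<dots> \<longleftrightarrow> h = 1" using sep[OF hr(1)] by blast
    finally have "w \<in> rm.accepted \<longleftrightarrow> r = 1 \<and> h = 1" using w regs_eq[OF w] by (auto simp: rm.accepted_def r_def)
    \<comment> \<open>If the word has value 1, its representative is the inverse of an element of
      \<open>L\<close>, and the only representative in \<open>L\<close> is 1. So the control state
      may be tested separately from \<open>h\<close>.\<close>
    moreover have "r = 1" if "h * r = 1"
    proof -
      have "r = inverse h" using grp_inv_unique[OF that] by simp
      hence "r \<in> L" using hr(1) sub by (simp add: subgrp_inv)
      thus ?thesis using hr(2) \<rho>(3) by auto
    qed
    ultimately show ?thesis using hr(3) by auto
  qed
  hence "{w \<in> lists S. prod_list (map \<phi> w) = 1} = rm.accepted" by (auto simp: rm.accepted_def)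
  moreover obtain C where "\<forall>w\<in>lists S. \<forall>p\<in>coords. \<bar>snd (rm.regs w) p\<bar> \<le> int (C * (length w + 1) ^ k)"
    using regs_bound by blast
  hence "rm.accepted \<in> DTIME1 S nlogn" by (intro rm.accepted_DTIME1) auto
  ultimately show ?thesis by simp
qed

end

theorem virtually_nilp_DTIME1:
  assumes "finite S" "\<phi> ` S \<subseteq> \<Gamma>" "fin_gen (\<Gamma> :: 'a::grp set)" "subgrp N" "fin_index N \<Gamma>" "nilp N"
  shows "{w \<in> lists S. prod_list (map \<phi> w) = 1} \<in> DTIME1 S nlogn"
proof -
  have sub: "subgrp \<Gamma>" using assms(3) by (rule fin_gen_subgrp)
  have "fin_gen N" using fin_gen_fin_index assms by blast
  then obtain L where L: "subgrp L" "fin_index L N" "separated L"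
    using nilp_fin_index_separated assms(6) by blast
  have LG: "fin_index L \<Gamma>" using fin_index_trans[OF L(2) assms(5) sub] .
  obtain k F where F: "finite F" "\<forall>f\<in>F. pol k L f" "\<forall>x\<in>L. x \<noteq> 1 \<longrightarrow> (\<exists>f\<in>F. f x \<noteq> f 1)"
    using L(3) unfolding separated_def by blast
  obtain c :: "'a \<Rightarrow> 'a" where c: "finite (c ` \<Gamma>)" "\<forall>x\<in>\<Gamma>. \<forall>y\<in>\<Gamma>. c x = c y \<longrightarrow> x * inverse y \<in> L"
    using fin_index_obtain_colouring[OF LG L(1)] by blast
  define r where "r = (\<lambda>v. SOME y. y \<in> \<Gamma> \<and> c y = v)"
  \<comment> \<open>The coset \<open>L\<close> itself gets the representative 1, so that its
    elements are recognized by the control state 1.\<close>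
  define \<rho> where "\<rho> = (\<lambda>x. if x \<in> L then 1 else r (c x))"
  have r: "r (c x) \<in> \<Gamma>" "c (r (c x)) = c x" if "x \<in> \<Gamma>" for x
    using someI[of "\<lambda>y. y \<in> \<Gamma> \<and> c y = c x" x] that by (simp_all add: r_def)
  have \<rho>L: "x * inverse (\<rho> x) \<in> L" if "x \<in> \<Gamma>" for x
    using c(2)[rule_format, of x "r (c x)"] r[OF that] that by (auto simp: \<rho>_def grp_inv_one)
  \<comment> \<open>\<open>Suc k\<close> is positive, which makes the undifferentiated polynomials
    themselves registers.\<close>
  interpret separated_words S \<phi> \<Gamma> L \<rho> F "Suc k"
  proof
    show "\<rho> x \<in> \<Gamma>" if "x \<in> \<Gamma>" for x using r(1)[OF that] sub by (simp add: \<rho>_def subgrp_one)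
    show "\<rho> x = 1" if "x \<in> \<Gamma>" "\<rho> x \<in> L" for x
    proof -
      have "x * inverse (\<rho> x) * \<rho> x \<in> L" by (rule subgrp_mult[OF L(1) \<rho>L[OF that(1)] that(2)])
      hence "x \<in> L" by (simp add: grp_simps)
      thus ?thesis by (simp add: \<rho>_def)
    qed
    have "\<rho> ` \<Gamma> \<subseteq> insert 1 (r ` c ` \<Gamma>)" by (auto simp: \<rho>_def)
    thus "finite (\<rho> ` \<Gamma>)" by (rule finite_subset) (use c in auto)
    show "pol (Suc k) L f" if "f \<in> F" for f using F(2) that by (intro pol_Suc[OF L(1)]) auto
    show "x = 1" if "x \<in> L" "\<And>f. f \<in> F \<Longrightarrow> f x = f 1" for x using F(3) that by blast
  qed (use assms sub L F \<rho>L fin_index_subset[OF LG] in auto)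
  show ?thesis by (rule words_DTIME1)
qed

section \<open>Permutations and the Cayley embedding\<close>

typedef 'a perm = "{f :: 'a \<Rightarrow> 'a. bij f}"
  by (rule exI[of _ id]) simp

instantiation perm :: (type) grp
begin

definition one_perm :: "'a perm" where
  "one_perm = Abs_perm id"

definition times_perm :: "'a perm \<Rightarrow> 'a perm \<Rightarrow> 'a perm" where
  "times_perm f g = Abs_perm (Rep_perm f \<circ> Rep_perm g)"

definition inverse_perm :: "'a perm \<Rightarrow> 'a perm" where
  "inverse_perm f = Abs_perm (inv_into UNIV (Rep_perm f))"

definition divide_perm :: "'a perm \<Rightarrow> 'a perm \<Rightarrow> 'a perm" where
  "divide_perm f g = Abs_perm (Rep_perm f \<circ> inv_into UNIV (Rep_perm g))"

instance
proof
  fix f g h :: "'a perm"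
  have bij: "bij (Rep_perm u)" for u :: "'a perm" using Rep_perm by auto
  have rep: "Rep_perm (u * v) = Rep_perm u \<circ> Rep_perm v" for u v :: "'a perm"
    unfolding times_perm_def by (rule Abs_perm_inverse) (simp add: bij bij_comp)
  have one: "Rep_perm (1 :: 'a perm) = id"
    unfolding one_perm_def by (rule Abs_perm_inverse) simp
  have inv: "Rep_perm (inverse f) = inv_into UNIV (Rep_perm f)"
    unfolding inverse_perm_def by (rule Abs_perm_inverse) (simp add: bij bij_imp_bij_inv)
  show "f * g * h = f * (g * h)" by (simp add: Rep_perm_inject[symmetric] rep comp_assoc)
  show "1 * f = f" "f * 1 = f" by (simp_all add: Rep_perm_inject[symmetric] rep one)
  show "inverse f * f = 1" by (simp add: Rep_perm_inject[symmetric] rep one inv bij bij_is_inj)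
qed (auto simp: divide_perm_def times_perm_def inverse_perm_def Abs_perm_inverse bij_imp_bij_inv Rep_perm[simplified])

end

lemma Rep_perm_mult: "Rep_perm (u * v) = Rep_perm u \<circ> Rep_perm v"
  unfolding times_perm_def using Rep_perm[of u] Rep_perm[of v] by (intro Abs_perm_inverse) (simp add: bij_comp)

text \<open>Points outside the carrier are fixed, which makes left multiplication a permutation of
  the whole type.\<close>

definition cayley_perm :: "('g, 'b) monoid_scheme \<Rightarrow> 'g \<Rightarrow> 'g perm" where
  "cayley_perm G g = Abs_perm (\<lambda>x. if x \<in> carrier G then g \<otimes>\<^bsub>G\<^esub> x else x)"

section \<open>Transfer along a faithful embedding\<close>

locale faithful = group G for G (structure) +
  fixes emb :: "'a \<Rightarrow> 'p::grp"
  assumes emb_mult: "x \<in> carrier G \<Longrightarrow> y \<in> carrier G \<Longrightarrow> emb (x \<otimes> y) = emb x * emb y"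
    and emb_inj: "inj_on emb (carrier G)"
begin

lemma emb_one: "emb \<one> = 1"
proof -
  have "emb \<one> * emb \<one> = emb \<one> * 1" using emb_mult[of \<one> \<one>] by simp
  thus ?thesis by (simp only: grp_left_cancel)
qed

lemma emb_inv: "x \<in> carrier G \<Longrightarrow> emb (inv x) = inverse (emb x)"
  using grp_inv_unique[of "emb x" "emb (inv x)"] emb_mult[of x "inv x"] by (simp add: emb_one)

lemma emb_eq_one: "x \<in> carrier G \<Longrightarrow> emb x = 1 \<longleftrightarrow> x = \<one>"
  using emb_inj emb_one by (metis inj_onD one_closed)

lemma emb_word: "w \<in> lists (carrier G) \<Longrightarrow> eval_word G w \<in> carrier G \<and> emb (eval_word G w) = prod_list (map emb w)"
  by (induction w) (auto simp: eval_word_def emb_one emb_mult)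

lemma word_problem_eq: "S \<subseteq> carrier G \<Longrightarrow> word_problem G S = {w \<in> lists S. prod_list (map emb w) = 1}"
proof -
  assume S: "S \<subseteq> carrier G"
  have "eval_word G w = \<one> \<longleftrightarrow> prod_list (map emb w) = 1" if "w \<in> lists S" for w
  proof -
    have "w \<in> lists (carrier G)" using that lists_mono[OF S] by blast
    thus ?thesis using emb_word emb_eq_one by metis
  qed
  thus ?thesis by (auto simp: word_problem_def)
qed

lemma subgrp_image: "subgroup H G \<Longrightarrow> subgrp (emb ` H)"
proof (rule subgrpI)
  assume H: "subgroup H G"
  note m = subgroup.mem_carrier[OF H]
  show "1 \<in> emb ` H" using subgroup.one_closed[OF H] emb_one by force
  fix x assume "x \<in> emb ` H"
  then obtain a where a: "a \<in> H" "x = emb a" by blast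
  have "inverse x = emb (inv a)" using a m by (simp add: emb_inv)
  thus "inverse x \<in> emb ` H" using subgroup.m_inv_closed[OF H a(1)] by blast
  fix y assume "y \<in> emb ` H"
  then obtain b where b: "b \<in> H" "y = emb b" by blast
  have "x * y = emb (a \<otimes> b)" using a b m by (simp add: emb_mult)
  thus "x * y \<in> emb ` H" using subgroup.m_closed[OF H a(1) b(1)] by blast
qed

lemma subgroup_preimage: "subgrp N \<Longrightarrow> subgroup {g \<in> carrier G. emb g \<in> N} G"
  by (rule subgroupI) (auto simp: subgrp_mem emb_inv emb_mult emb_one intro!: exI[of _ \<one>])

lemma subgrp_range: "subgrp (emb ` carrier G)"
  by (rule subgrp_image[OF subgroup_self])

lemma emb_generate: "T \<subseteq> carrier G \<Longrightarrow> emb ` generate G T = gen (emb ` T)"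
proof
  assume T: "T \<subseteq> carrier G"
  have "generate G T \<subseteq> {g \<in> carrier G. emb g \<in> gen (emb ` T)}"
    using T gen_superset[of "emb ` T"] by (intro generate_subgroup_incl subgroup_preimage subgrp_gen) auto
  thus "emb ` generate G T \<subseteq> gen (emb ` T)" by auto
  show "gen (emb ` T) \<subseteq> emb ` generate G T"
    using generate.incl[of _ T G] by (intro gen_least subgrp_image generate_is_subgroup T) auto
qed

lemma fin_index_image:
  assumes H: "subgroup H G"
  shows "fin_index (emb ` H) (emb ` carrier G) \<longleftrightarrow> finite (rcosets H)"
proof
  define pre where "pre = inv_into (carrier G) emb"
  have pre: "pre (emb g) = g" if "g \<in> carrier G" for g using that emb_inj by (simp add: pre_def)
  note m = subgroup.mem_carrier[OF H]
  {
    assume fin: "finite (rcosets H)"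
    show "fin_index (emb ` H) (emb ` carrier G)"
    proof (rule fin_index_colouring[of "\<lambda>p. H #> pre p"])
      have "(\<lambda>p. H #> pre p) ` emb ` carrier G \<subseteq> rcosets H" by (auto simp: pre RCOSETS_def)
      thus "finite ((\<lambda>p. H #> pre p) ` emb ` carrier G)" using fin by (rule finite_subset)
      show "emb ` H \<subseteq> emb ` carrier G" using m by auto
      fix x y assume "x \<in> emb ` carrier G" "y \<in> emb ` carrier G" and eq: "H #> pre x = H #> pre y"
      then obtain g h where gh: "g \<in> carrier G" "h \<in> carrier G" "x = emb g" "y = emb h" by auto
      have "g \<in> H #> h" using rcos_self[OF gh(1) H] eq pre gh by simp
      then obtain k where k: "k \<in> H" "g = k \<otimes> h" by (auto simp: r_coset_def)
      have "x * inverse y = emb k" using k m gh by (simp add: emb_mult grp_simps)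
      thus "x * inverse y \<in> emb ` H" using k by simp
    qed
  }
  {
    assume "fin_index (emb ` H) (emb ` carrier G)"
    then obtain F where F: "finite F" "F \<subseteq> emb ` carrier G" "\<forall>h\<in>emb ` carrier G. \<exists>a\<in>emb ` H. \<exists>x\<in>F. h = a * x"
      unfolding fin_index_def by blast
    have "rcosets H \<subseteq> (\<lambda>p. H #> pre p) ` F"
    proof
      fix K assume "K \<in> rcosets H"
      then obtain g where g: "g \<in> carrier G" "K = H #> g" by (auto simp: RCOSETS_def)
      then obtain a x where ax: "a \<in> H" "x \<in> F" "emb g = emb a * x" using F(3) by blast
      then obtain y where y: "y \<in> carrier G" "x = emb y" using F(2) by blast
      have "emb g = emb (a \<otimes> y)" using ax y m by (simp add: emb_mult)
      hence "g = a \<otimes> y" using emb_inj g y ax m by (auto dest!: inj_onD)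
      hence "g \<in> H #> y" using ax by (auto simp: r_coset_def)
      hence "H #> y = H #> g" by (rule repr_independence[OF _ y(1) H])
      thus "K \<in> (\<lambda>p. H #> pre p) ` F" using g y ax pre by (intro image_eqI[of _ _ x]) simp_all
    qed
    thus "finite (rcosets H)" using F(1) finite_subset by blast
  }
qed

lemma lower_central_carrier: "lower_central G k \<subseteq> carrier G"
proof (induction k)
  case (Suc k)
  thus ?case unfolding lower_central.simps comm_subgroup_def by (intro generate_incl) auto
qed simp

text \<open>The lower central series generates a subgroup at each stage, \<open>left_normed\<close>
  does not. One direction is therefore a plain inclusion; in the other the lower central series is
  bounded by the upper central series, whose terms are subgroups.\<close>

lemma nilpotent_iff: "nilpotent_group G \<longleftrightarrow> nilp (emb ` carrier G)"
proof
  have comm: "emb (a \<otimes> b \<otimes> inv a \<otimes> inv b) = commu (emb a) (emb b)" if "a \<in> carrier G" "b \<in> carrier G" for a b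
    using that by (simp add: emb_mult emb_inv commu_def)
  {
    assume "nilpotent_group G"
    then obtain k where k: "lower_central G k = {\<one>}" by (auto simp: nilpotent_group_def)
    have "left_normed (emb ` carrier G) k \<subseteq> emb ` lower_central G k" for k
    proof (induction k)
      case (Suc k)
      show ?case
      proof
        fix x assume "x \<in> left_normed (emb ` carrier G) (Suc k)"
        then obtain a b where ab: "a \<in> lower_central G k" "b \<in> carrier G" "x = commu (emb a) (emb b)" using Suc by auto
        have "x = emb (a \<otimes> b \<otimes> inv a \<otimes> inv b)" using ab lower_central_carrier by (subst comm) auto
        moreover have "a \<otimes> b \<otimes> inv a \<otimes> inv b \<in> lower_central G (Suc k)"
          unfolding lower_central.simps comm_subgroup_def using ab by (intro generate.incl) blast
        ultimately show "x \<in> emb ` lower_central G (Suc k)" by blast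
      qed
    qed simp
    from this[of k] show "nilp (emb ` carrier G)" unfolding nilp_def k by (auto simp: emb_one)
  }
  {
    assume "nilp (emb ` carrier G)"
    then obtain k where k: "left_normed (emb ` carrier G) k \<subseteq> {1}" by (auto simp: nilp_def)
    let ?U = "upper_chain {1} (emb ` carrier G)"
    note nr = nrml_trivial[OF subgrp_range]
    have top: "?U k = emb ` carrier G" by (rule upper_chain_eq[OF nr gen_subgrp[OF subgrp_range] k])
    have "i \<le> k \<Longrightarrow> emb ` lower_central G i \<subseteq> ?U (k - i)" for i
    proof (induction i)
      case (Suc i)
      let ?T = "{a \<otimes> b \<otimes> inv a \<otimes> inv b | a b. a \<in> lower_central G i \<and> b \<in> carrier G}"
      have kk: "k - i = Suc (k - Suc i)" using Suc.prems by simp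
      have T: "?T \<subseteq> carrier G" using lower_central_carrier[of i] by (auto intro!: m_closed inv_closed)
      have "emb ` ?T \<subseteq> ?U (k - Suc i)"
      proof
        fix x assume "x \<in> emb ` ?T"
        then obtain a b where ab: "a \<in> lower_central G i" "b \<in> carrier G" "x = emb (a \<otimes> b \<otimes> inv a \<otimes> inv b)" by blast
        have "x = commu (emb a) (emb b)" unfolding ab(3) using ab lower_central_carrier by (intro comm) auto
        moreover have "emb a \<in> ?U (Suc (k - Suc i))" using Suc ab(1) unfolding kk by auto
        ultimately show "x \<in> ?U (k - Suc i)" using ab(2) by simp
      qed
      hence "gen (emb ` ?T) \<subseteq> ?U (k - Suc i)"
        using nrml_upper_chain[OF nr subgrp_range] by (intro gen_least) (auto simp: nrml_def)
      thus ?case using emb_generate[OF T] by (simp add: comm_subgroup_def)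
    qed (use top in simp)
    from this[of k] have "emb ` lower_central G k \<subseteq> {1}" by simp
    hence "lower_central G k \<subseteq> {\<one>}" using lower_central_carrier emb_eq_one by blast
    moreover have "\<one> \<in> lower_central G k"
      by (cases k) (auto simp: comm_subgroup_def intro: generate.one)
    ultimately show "nilpotent_group G" unfolding nilpotent_group_def using is_group by blast
  }
qed

lemma faithful_subgroup: "subgroup H G \<Longrightarrow> faithful (G\<lparr>carrier := H\<rparr>) emb"
proof -
  assume H: "subgroup H G"
  interpret H: group "G\<lparr>carrier := H\<rparr>" by (rule subgroup_imp_group[OF H])
  show ?thesis
    by unfold_locales (use subgroup.mem_carrier[OF H] emb_mult emb_inj in \<open>auto simp: inj_on_def\<close>)
qed

lemma virtually_nilpotent_iff:
  "virtually_nilpotent G \<longleftrightarrow> (\<exists>N. subgrp N \<and> fin_index N (emb ` carrier G) \<and> nilp N)"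
proof
  have nil: "nilpotent_group (G\<lparr>carrier := H\<rparr>) \<longleftrightarrow> nilp (emb ` H)" if "subgroup H G" for H
    using faithful.nilpotent_iff[OF faithful_subgroup[OF that]] by simp
  {
    assume "virtually_nilpotent G"
    then obtain H where "subgroup H G" "finite (rcosets H)" "nilpotent_group (G\<lparr>carrier := H\<rparr>)"
      by (auto simp: virtually_nilpotent_def)
    thus "\<exists>N. subgrp N \<and> fin_index N (emb ` carrier G) \<and> nilp N"
      using subgrp_image fin_index_image nil by (intro exI[of _ "emb ` H"]) simp
  }
  {
    assume "\<exists>N. subgrp N \<and> fin_index N (emb ` carrier G) \<and> nilp N"
    then obtain N where N: "subgrp N" "fin_index N (emb ` carrier G)" "nilp N" by blast
    define H where "H = {g \<in> carrier G. emb g \<in> N}"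
    have H: "subgroup H G" unfolding H_def by (rule subgroup_preimage[OF N(1)])
    have "emb ` H = N" using fin_index_subset[OF N(2)] by (auto simp: H_def)
    hence "finite (rcosets H)" "nilpotent_group (G\<lparr>carrier := H\<rparr>)" using fin_index_image[OF H] nil[OF H] N by simp_all
    thus "virtually_nilpotent G" unfolding virtually_nilpotent_def using H is_group by blast
  }
qed

lemma sym_gen_set_image:
  assumes "sym_gen_set G S"
  shows "sym_set (emb ` S)" "gen (emb ` S) = emb ` carrier G" "finite S" "S \<subseteq> carrier G" "\<And>s. s \<in> S \<Longrightarrow> inv s \<in> S"
proof -
  show S: "finite S" "S \<subseteq> carrier G" "\<And>s. s \<in> S \<Longrightarrow> inv s \<in> S" using assms by (auto simp: sym_gen_set_def)
  show "sym_set (emb ` S)" unfolding sym_set_def using S emb_inv by (metis (no_types, lifting) image_iff subsetD)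
  show "gen (emb ` S) = emb ` carrier G" using emb_generate[OF S(2)] assms by (simp add: sym_gen_set_def)
qed

lemma wball_growth:
  assumes S: "sym_gen_set G S" and wp: "word_problem G S \<in> DTIME1 S nlogn"
  shows "\<exists>C e. \<forall>n. card (wball (emb ` S) n) \<le> C * (n + 1) ^ e"
proof (cases "S = {}")
  \<comment> \<open>Without a letter no padding word can be formed, but then every ball is
    trivial.\<close>
  case True
  have "card (wball (emb ` S) n) \<le> 1 * (n + 1) ^ 0" for n
  proof -
    have "wball (emb ` S) n \<subseteq> {1}" using True by (auto simp: wball_def)
    from card_mono[OF _ this] show ?thesis by simp
  qed
  thus ?thesis by blast
next
  case False
  then obtain s where s: "s \<in> S" by blast
  note SS = sym_gen_set_image[OF S]
  obtain M c where M: "wf_tm S M" "decides_in_time S M (word_problem G S) (\<lambda>n. c * nlogn n + c)"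
    using wp by (auto simp: DTIME1_def)
  obtain C e where C: "\<forall>n p (I :: 'p set) x y. 0 < n \<longrightarrow> p \<in> lists S \<longrightarrow> length p = n \<longrightarrow> finite I \<longrightarrow>
      (\<forall>g\<in>I. x g \<in> lists S \<and> y g \<in> lists S \<and> length (x g) \<le> n \<and> length (y g) \<le> n \<and> x g @ p @ y g \<in> word_problem G S) \<longrightarrow>
      (\<forall>g\<in>I. \<forall>h\<in>I. x g @ p @ y h \<in> word_problem G S \<longrightarrow> g = h) \<longrightarrow> card I \<le> C * n ^ e"
    using crossing_count[OF M] by blast
  \<comment> \<open>\<open>n\<close> copies of \<open>s\<close> and its inverse have
    \<open>2 * n\<close> letters, so the count is applied with \<open>2 * n\<close> in place of
    \<open>n\<close>; this also bounds the two outer words of length at most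
    \<open>n\<close>.\<close>
  have main: "card (wball (emb ` S) n) \<le> C * (2 * n) ^ e" if n: "0 < n" for n
  proof -
    let ?I = "wball (emb ` S) n"
    have "\<exists>w. w \<in> lists S \<and> length w \<le> n \<and> prod_list (map emb w) = g" if g: "g \<in> ?I" for g
    proof -
      obtain v where v: "v \<in> lists (emb ` S)" "length v \<le> n" "g = prod_list v" using g by (rule wballE)
      then obtain w where "w \<in> lists S" "v = map emb w" by (metis imageE lists_image)
      thus ?thesis using v by (intro exI[of _ w]) simp
    qed
    then obtain x where x: "\<And>g. g \<in> ?I \<Longrightarrow> x g \<in> lists S \<and> length (x g) \<le> n \<and> prod_list (map emb (x g)) = g" by metis
    define y where "y = (\<lambda>g. rev (map (\<lambda>a. inv a) (x g)))"
    define p where "p = concat (replicate n [s, inv s])"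
    have p: "p \<in> lists S" "length p = 2 * n" "prod_list (map emb p) = 1"
    proof -
      show "p \<in> lists S" using s SS(5) by (auto simp: p_def in_lists_conv_set)
      show "length p = 2 * n" unfolding p_def by (induction n) simp_all
      have "s \<in> carrier G" using s SS(4) by blast
      thus "prod_list (map emb p) = 1" unfolding p_def by (induction n) (simp_all add: emb_inv grp_simps)
    qed
    have y: "y g \<in> lists S \<and> length (y g) \<le> n \<and> prod_list (map emb (y g)) = inverse g" if g: "g \<in> ?I" for g
    proof -
      have "prod_list (map emb (rev (map (\<lambda>a. inv a) w))) = inverse (prod_list (map emb w))" if "w \<in> lists S" for w
        using that SS(4) by (induction w) (auto simp: grp_inv_one grp_inv_mult emb_inv)
      thus ?thesis using x[OF g] SS(5) by (auto simp: y_def)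
    qed
    have wp: "x g @ p @ y h \<in> word_problem G S \<longleftrightarrow> g * inverse h = 1" if "g \<in> ?I" "h \<in> ?I" for g h
      using x[OF that(1)] y[OF that(2)] p by (simp add: word_problem_eq[OF SS(4)])
    have fin: "finite ?I" using SS(3) by (intro finite_wball) simp
    have "0 < 2 * n" using n by simp
    moreover have "\<forall>g\<in>?I. x g \<in> lists S \<and> y g \<in> lists S \<and> length (x g) \<le> 2 * n \<and> length (y g) \<le> 2 * n \<and> x g @ p @ y g \<in> word_problem G S"
    proof
      fix g assume g: "g \<in> ?I"
      show "x g \<in> lists S \<and> y g \<in> lists S \<and> length (x g) \<le> 2 * n \<and> length (y g) \<le> 2 * n \<and> x g @ p @ y g \<in> word_problem G S"
        using x[OF g] y[OF g] wp[OF g g] by (auto simp: grp_simps)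
    qed
    moreover have "\<forall>g\<in>?I. \<forall>h\<in>?I. x g @ p @ y h \<in> word_problem G S \<longrightarrow> g = h"
      using wp grp_eq_iff by blast
    ultimately show ?thesis using C[rule_format, OF _ p(1,2) fin, of x y] by blast
  qed
  have "card (wball (emb ` S) n) \<le> (C * 2 ^ e + 1) * (n + 1) ^ e" for n
  proof (cases "n = 0")
    case True
    have "wball (emb ` S) 0 = {1}" by (auto simp: wball_def)
    thus ?thesis using True by simp
  next
    case False
    have "card (wball (emb ` S) n) \<le> C * (2 * n) ^ e" using main False by simp
    also have "\<dots> = C * 2 ^ e * n ^ e" by (simp add: power_mult_distrib)
    also have "\<dots> \<le> (C * 2 ^ e + 1) * (n + 1) ^ e" by (intro mult_le_mono power_mono) auto
    finally show ?thesis .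
  qed
  thus ?thesis by blast
qed

end

lemma wball_growth_growth:
  assumes S: "sym_set S" "finite S" and C: "\<And>n. card (wball S n) \<le> C * (n + 1) ^ e"
  shows "growth e (gen S)"
  unfolding growth_def
proof (intro allI impI)
  fix T assume T: "finite T" "T \<subseteq> gen S"
  have "\<exists>m. T \<subseteq> wball S m"
    using T
  proof (induction T rule: finite_induct)
    case (insert t T)
    obtain k where k: "t \<in> wball S k" using gen_wball[OF S(1), of t] insert.prems by auto
    obtain m where "T \<subseteq> wball S m" using insert by auto
    hence "insert t T \<subseteq> wball S (max m k)" using k wball_mono[of m "max m k" S] wball_mono[of k "max m k" S] by auto
    thus ?case by blast
  qed simp
  then obtain m where m: "T \<subseteq> wball S m" by blast
  have "card (wball T n) \<le> (C * (m + 1) ^ e) * (n + 1) ^ e" for n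
  proof -
    have w: "w \<in> lists T \<Longrightarrow> prod_list w \<in> wball S (length w * m)" for w
    proof (induction w)
      case (Cons t w)
      thus ?case using m wball_mult[of t S m "prod_list w" "length w * m"] by auto
    qed (simp add: wball_one)
    have "wball T n \<subseteq> wball S (n * m)"
    proof
      fix x assume "x \<in> wball T n"
      then obtain v where "v \<in> lists T" "length v \<le> n" "x = prod_list v" by (rule wballE)
      thus "x \<in> wball S (n * m)" using w[of v] wball_mono[of "length v * m" "n * m" S] by auto
    qed
    hence "card (wball T n) \<le> card (wball S (n * m))" by (intro card_mono finite_wball S)
    also have "\<dots> \<le> C * (n * m + 1) ^ e" by (rule C)
    also have "\<dots> \<le> C * ((m + 1) * (n + 1)) ^ e" by (intro mult_le_mono2 power_mono) auto
    also have "\<dots> = (C * (m + 1) ^ e) * (n + 1) ^ e" by (simp only: power_mult_distrib mult.assoc)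
    finally show ?thesis .
  qed
  thus "\<exists>C. \<forall>n. card (wball T n) \<le> C * (n + 1) ^ e" by blast
qed

lemma (in faithful) WP_nlogn_iff:
  assumes "fin_gen_group G"
  shows "WP_in_DTIME1 G nlogn \<longleftrightarrow> virtually_nilpotent G"
proof
  obtain T where T: "finite T" "T \<subseteq> carrier G" "generate G T = carrier G" using assms by (auto simp: fin_gen_group_def)
  have fg: "fin_gen (emb ` carrier G)"
    unfolding fin_gen_def using T emb_generate[OF T(2)] by (intro exI[of _ "emb ` T"]) auto
  {
    assume "WP_in_DTIME1 G nlogn"
    then obtain S where S: "sym_gen_set G S" "word_problem G S \<in> DTIME1 S nlogn" by (auto simp: WP_in_DTIME1_def)
    note SS = sym_gen_set_image[OF S(1)]
    obtain C e where "\<forall>n. card (wball (emb ` S) n) \<le> C * (n + 1) ^ e" using wball_growth[OF S] by blast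
    hence "growth e (emb ` carrier G)" using wball_growth_growth[of "emb ` S" C e] SS by simp
    thus "virtually_nilpotent G" using gromov[OF fg] virtually_nilpotent_iff by blast
  }
  {
    assume "virtually_nilpotent G"
    then obtain N where N: "subgrp N" "fin_index N (emb ` carrier G)" "nilp N" using virtually_nilpotent_iff by blast
    define S where "S = T \<union> (\<lambda>x. inv x) ` T"
    have S: "finite S" "S \<subseteq> carrier G" "\<forall>s\<in>S. inv s \<in> S" using T by (auto simp: S_def)
    have "generate G T \<subseteq> generate G S" by (rule mono_generate) (simp add: S_def)
    hence "sym_gen_set G S" using S T generate_incl[OF S(2)] by (auto simp: sym_gen_set_def)
    moreover have "word_problem G S \<in> DTIME1 S nlogn"
      unfolding word_problem_eq[OF S(2)] using S by (intro virtually_nilp_DTIME1[OF _ _ fg N]) auto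
    ultimately show "WP_in_DTIME1 G nlogn" unfolding WP_in_DTIME1_def by blast
  }
qed

lemma cayley_faithful:
  fixes G (structure)
  assumes "group G"
  shows "faithful G (cayley_perm G)"
proof -
  interpret group G by fact
  have rep: "Rep_perm (cayley_perm G g) = (\<lambda>x. if x \<in> carrier G then g \<otimes> x else x)" if g: "g \<in> carrier G" for g
  proof -
    have "bij (\<lambda>x. if x \<in> carrier G then g \<otimes> x else x)"
    proof (rule o_bij)
      show "(\<lambda>x. if x \<in> carrier G then inv g \<otimes> x else x) \<circ> (\<lambda>x. if x \<in> carrier G then g \<otimes> x else x) = id"
        using g by (auto simp: fun_eq_iff m_assoc[symmetric])
      show "(\<lambda>x. if x \<in> carrier G then g \<otimes> x else x) \<circ> (\<lambda>x. if x \<in> carrier G then inv g \<otimes> x else x) = id"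
        using g by (auto simp: fun_eq_iff m_assoc[symmetric])
    qed
    thus ?thesis unfolding cayley_perm_def by (intro Abs_perm_inverse) simp
  qed
  show ?thesis
  proof
    show "cayley_perm G (x \<otimes> y) = cayley_perm G x * cayley_perm G y" if "x \<in> carrier G" "y \<in> carrier G" for x y
      using that by (auto simp: Rep_perm_inject[symmetric] Rep_perm_mult rep fun_eq_iff m_assoc)
    show "inj_on (cayley_perm G) (carrier G)"
    proof (rule inj_onI)
      fix x y assume xy: "x \<in> carrier G" "y \<in> carrier G" "cayley_perm G x = cayley_perm G y"
      have "Rep_perm (cayley_perm G z) \<one> = z" if "z \<in> carrier G" for z using that by (simp add: rep)
      thus "x = y" using xy by metis
    qed
  qed
qed

theorem theorem1:
  fixes G :: "('g, 'b) monoid_scheme"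
  assumes "fin_gen_group G"
  shows "WP_in_DTIME1 G nlogn \<longleftrightarrow> virtually_nilpotent G"
  using assms by (intro faithful.WP_nlogn_iff[OF cayley_faithful]) (simp_all add: fin_gen_group_def)

end
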